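(* Let $A^\epsilon(x)=\{a_1\chi_{\omega_{A^\epsilon}}(x)+a_2(1-\chi_{\omega_{A^\epsilon}}(x))\}I$ with $\chi_{\omega_{A^\epsilon}}\rightharpoonup\theta_A$ in $L^\infty(\Omega)$ weak*, and $A^\epsilon\xrightarrow{H}A^{*}$ in $\Omega$. Let $B^\epsilon(x)=b(x)I\in\mathcal{M}(b_1,b_2;\Omega)$, with $b\in L^\infty(\Omega)$ independent of $\epsilon$, converge to $B^{\#}$ relative to $A^\epsilon$. Then for almost every $x\in\Omega$, $$\mathrm{tr}\left\{b(x)\,(A^{*}(x)-a_1I)\,(b(x)A^{*}(x)-a_1B^{\#}(x))^{-1}\,(A^{*}(x)-a_1I)\right\}\le N\,(1-\theta_A(x))\,(a_2-a_1).$$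
   Context: $\Omega\subset\mathbb{R}^N$ is a bounded open set, $0<a_1<a_2<\infty$, $0<b_1\le b_2<\infty$; $\omega_{A^\epsilon}\subset\Omega$ are measurable sets, $\chi_\omega$ denotes a characteristic function, and $0\le\theta_A(x)\le 1$ a.e. in $\Omega$. $\mathcal{M}(\alpha,\beta;\Omega)$ is the set of measurable real symmetric $N\times N$ matrix fields $A(x)$ on $\Omega$ with $(A(x)\xi,\xi)\ge\alpha|\xi|^2$ and $|A(x)\xi|\le\beta|\xi|$ for all $\xi\in\mathbb{R}^N$, a.e. $x$. A test sequence for $A^\epsilon$ is a sequence $u^\epsilon\rightharpoonup u$ weakly in $H^1(\Omega)$ with $-\mathrm{div}(A^\epsilon\nabla u^\epsilon)$ strongly convergent in $H^{-1}(\Omega)$. $A^\epsilon\xrightarrow{H}A^{*}$ means $A^\epsilon\nabla u^\epsilon\rightharpoonup A^{*}\nabla u$ weakly in $L^2(\Omega)$ for all such test sequences. $B^\epsilon$ converges to $B^{\#}$ relative to $A^\epsilon$ (written $B^\epsilon\xrightarrow{A^\epsilon}B^{\#}$) means $B^\epsilon\nabla u^\epsilon\cdot\nabla u^\epsilon\rightharpoonup B^{\#}\nabla u\cdot\nabla u$ in $\mathcal{D}'(\Omega)$ for all such test sequences.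
   Formalization: H-convergence is required with test sequences along every subsequence of A^ε, not only the full sequence; with the full sequence only, interlacing two mixtures with different H-limits can leave only constant limits u, so that any A* and B^# would qualify and the bound fails. *)

theory Defs
  imports "HOL-Analysis.Analysis"
begin

section \<open>Test functions\<close>

definition partial_derivative :: "'n::finite \<Rightarrow> (real^'n \<Rightarrow> real) \<Rightarrow> real^'n \<Rightarrow> real" where
  "partial_derivative i f x = frechet_derivative f (at x) (axis i 1)"

text \<open>All iterated partial derivatives being (totally) differentiable at every point makes them
  continuous, so this is \<open>C\<^sup>\<infinity>\<close> on the whole space.\<close>

definition smooth :: "(real^'n::finite \<Rightarrow> real) \<Rightarrow> bool" where
  "smooth f \<longleftrightarrow> (\<forall>is x. (fold partial_derivative is f) differentiable (at x))"

definition test_functions :: "(real^'n::finite) set \<Rightarrow> (real^'n \<Rightarrow> real) set" where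
  "test_functions \<Omega> = {\<phi>. smooth \<phi> \<and> compact (closure {x. \<phi> x \<noteq> 0}) \<and> closure {x. \<phi> x \<noteq> 0} \<subseteq> \<Omega>}"

section \<open>Function spaces\<close>

text \<open>Elements of the spaces below are represented by functions on the whole of
  \<open>real^'n\<close>; only their values almost everywhere on \<open>\<Omega>\<close> are ever used.\<close>

definition L2 :: "(real^'n::finite) set \<Rightarrow> (real^'n \<Rightarrow> 'b::euclidean_space) set" where
  "L2 \<Omega> = {f \<in> borel_measurable (lebesgue_on \<Omega>). integrable (lebesgue_on \<Omega>) (\<lambda>x. (norm (f x))\<^sup>2)}"

definition Linfty :: "(real^'n::finite) set \<Rightarrow> (real^'n \<Rightarrow> real) set" where
  "Linfty \<Omega> = {f \<in> borel_measurable (lebesgue_on \<Omega>). \<exists>C. AE x in lebesgue_on \<Omega>. \<bar>f x\<bar> \<le> C}"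

definition locally_integrable :: "(real^'n::finite) set \<Rightarrow> (real^'n \<Rightarrow> real) \<Rightarrow> bool" where
  "locally_integrable \<Omega> f \<longleftrightarrow> (\<forall>K. compact K \<and> K \<subseteq> \<Omega> \<longrightarrow> integrable (lebesgue_on K) f)"

definition has_weak_gradient ::
  "(real^'n::finite) set \<Rightarrow> (real^'n \<Rightarrow> real) \<Rightarrow> (real^'n \<Rightarrow> real^'n) \<Rightarrow> bool" where
  "has_weak_gradient \<Omega> u g \<longleftrightarrow> (\<forall>\<phi>\<in>test_functions \<Omega>. \<forall>i.
     (LINT x|lebesgue_on \<Omega>. u x * partial_derivative i \<phi> x) = - (LINT x|lebesgue_on \<Omega>. g x $ i * \<phi> x))"

definition H1 :: "(real^'n::finite) set \<Rightarrow> (real^'n \<Rightarrow> real) set" where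
  "H1 \<Omega> = {u \<in> L2 \<Omega>. \<exists>g\<in>L2 \<Omega>. has_weak_gradient \<Omega> u g}"

text \<open>The weak gradient is unique up to null sets of \<open>\<Omega>\<close>; \<open>wgrad\<close> picks a representative.\<close>

definition wgrad :: "(real^'n::finite) set \<Rightarrow> (real^'n \<Rightarrow> real) \<Rightarrow> real^'n \<Rightarrow> real^'n" where
  "wgrad \<Omega> u = (SOME g. g \<in> L2 \<Omega> \<and> has_weak_gradient \<Omega> u g)"

definition H1_norm :: "(real^'n::finite) set \<Rightarrow> (real^'n \<Rightarrow> real) \<Rightarrow> real" where
  "H1_norm \<Omega> u =
     sqrt ((LINT x|lebesgue_on \<Omega>. (u x)\<^sup>2) + (LINT x|lebesgue_on \<Omega>. (norm (wgrad \<Omega> u x))\<^sup>2))"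

definition H10 :: "(real^'n::finite) set \<Rightarrow> (real^'n \<Rightarrow> real) set" where
  "H10 \<Omega> = {u \<in> H1 \<Omega>. \<exists>\<phi>. (\<forall>k::nat. \<phi> k \<in> test_functions \<Omega>) \<and>
     (\<lambda>k. H1_norm \<Omega> (\<lambda>x. u x - \<phi> k x)) \<longlonglongrightarrow> 0}"

text \<open>Bounded linear functionals on a subspace \<open>V\<close> of \<open>H1 \<Omega>\<close> with the \<open>H1\<close> norm.
  Boundedness forces them to agree on functions that are equal almost everywhere.\<close>

definition dual_of ::
  "(real^'n::finite) set \<Rightarrow> (real^'n \<Rightarrow> real) set \<Rightarrow> ((real^'n \<Rightarrow> real) \<Rightarrow> real) set" where
  "dual_of \<Omega> V = {F.
     (\<forall>u\<in>V. \<forall>v\<in>V. F (\<lambda>x. u x + v x) = F u + F v) \<and>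
     (\<forall>c. \<forall>u\<in>V. F (\<lambda>x. c * u x) = c * F u) \<and>
     (\<exists>C. \<forall>u\<in>V. \<bar>F u\<bar> \<le> C * H1_norm \<Omega> u)}"

definition Hminus1 :: "(real^'n::finite) set \<Rightarrow> ((real^'n \<Rightarrow> real) \<Rightarrow> real) set" where
  "Hminus1 \<Omega> = dual_of \<Omega> (H10 \<Omega>)"

definition Hminus1_norm :: "(real^'n::finite) set \<Rightarrow> ((real^'n \<Rightarrow> real) \<Rightarrow> real) \<Rightarrow> real" where
  "Hminus1_norm \<Omega> F = (SUP v\<in>{v \<in> H10 \<Omega>. H1_norm \<Omega> v \<le> 1}. \<bar>F v\<bar>)"

text \<open>For \<open>\<sigma>\<close> in \<open>L2\<close>, the distribution \<open>- div \<sigma>\<close> as an element of \<open>Hminus1 \<Omega>\<close>.\<close>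

definition minus_div ::
  "(real^'n::finite) set \<Rightarrow> (real^'n \<Rightarrow> real^'n) \<Rightarrow> (real^'n \<Rightarrow> real) \<Rightarrow> real" where
  "minus_div \<Omega> \<sigma> v = (LINT x|lebesgue_on \<Omega>. \<sigma> x \<bullet> wgrad \<Omega> v x)"

section \<open>Modes of convergence\<close>

definition weakly_in_H1 ::
  "(real^'n::finite) set \<Rightarrow> (nat \<Rightarrow> real^'n \<Rightarrow> real) \<Rightarrow> (real^'n \<Rightarrow> real) \<Rightarrow> bool" where
  "weakly_in_H1 \<Omega> u u0 \<longleftrightarrow> (\<forall>k. u k \<in> H1 \<Omega>) \<and> u0 \<in> H1 \<Omega> \<and>
     (\<forall>F\<in>dual_of \<Omega> (H1 \<Omega>). (\<lambda>k. F (u k)) \<longlonglongrightarrow> F u0)"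

definition strongly_convergent_in_Hminus1 ::
  "(real^'n::finite) set \<Rightarrow> (nat \<Rightarrow> (real^'n \<Rightarrow> real) \<Rightarrow> real) \<Rightarrow> bool" where
  "strongly_convergent_in_Hminus1 \<Omega> F \<longleftrightarrow> (\<forall>k. F k \<in> Hminus1 \<Omega>) \<and>
     (\<exists>F0\<in>Hminus1 \<Omega>. (\<lambda>k. Hminus1_norm \<Omega> (\<lambda>v. F k v - F0 v)) \<longlonglongrightarrow> 0)"

definition weakly_in_L2 ::
  "(real^'n::finite) set \<Rightarrow> (nat \<Rightarrow> real^'n \<Rightarrow> real^'n) \<Rightarrow> (real^'n \<Rightarrow> real^'n) \<Rightarrow> bool" where
  "weakly_in_L2 \<Omega> f f0 \<longleftrightarrow> (\<forall>k. f k \<in> L2 \<Omega>) \<and> f0 \<in> L2 \<Omega> \<and>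
     (\<forall>g\<in>L2 \<Omega>. (\<lambda>k. LINT x|lebesgue_on \<Omega>. f k x \<bullet> g x) \<longlonglongrightarrow> (LINT x|lebesgue_on \<Omega>. f0 x \<bullet> g x))"

definition weakly_star_in_Linfty ::
  "(real^'n::finite) set \<Rightarrow> (nat \<Rightarrow> real^'n \<Rightarrow> real) \<Rightarrow> (real^'n \<Rightarrow> real) \<Rightarrow> bool" where
  "weakly_star_in_Linfty \<Omega> f f0 \<longleftrightarrow> (\<forall>k. f k \<in> Linfty \<Omega>) \<and> f0 \<in> Linfty \<Omega> \<and>
     (\<forall>g. integrable (lebesgue_on \<Omega>) g \<longrightarrow>
       (\<lambda>k. LINT x|lebesgue_on \<Omega>. f k x * g x) \<longlonglongrightarrow> (LINT x|lebesgue_on \<Omega>. f0 x * g x))"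

definition in_distributions ::
  "(real^'n::finite) set \<Rightarrow> (nat \<Rightarrow> real^'n \<Rightarrow> real) \<Rightarrow> (real^'n \<Rightarrow> real) \<Rightarrow> bool" where
  "in_distributions \<Omega> f f0 \<longleftrightarrow> (\<forall>k. locally_integrable \<Omega> (f k)) \<and> locally_integrable \<Omega> f0 \<and>
     (\<forall>\<phi>\<in>test_functions \<Omega>.
       (\<lambda>k. LINT x|lebesgue_on \<Omega>. f k x * \<phi> x) \<longlonglongrightarrow> (LINT x|lebesgue_on \<Omega>. f0 x * \<phi> x))"

section \<open>Matrix fields, H-convergence and relative convergence\<close>

definition matrix_class ::
  "real \<Rightarrow> real \<Rightarrow> (real^'n::finite) set \<Rightarrow> (real^'n \<Rightarrow> real^'n^'n) set" where
  "matrix_class \<alpha> \<beta> \<Omega> = {A \<in> borel_measurable (lebesgue_on \<Omega>).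
     AE x in lebesgue_on \<Omega>. transpose (A x) = A x \<and>
       (\<forall>\<xi>. (A x *v \<xi>) \<bullet> \<xi> \<ge> \<alpha> * (norm \<xi>)\<^sup>2 \<and> norm (A x *v \<xi>) \<le> \<beta> * norm \<xi>)}"

text \<open>The parameter \<open>\<epsilon>\<close> runs through a sequence tending to \<open>0\<close>, indexed here by \<open>nat\<close>.\<close>

definition test_sequence ::
  "(real^'n::finite) set \<Rightarrow> (nat \<Rightarrow> real^'n \<Rightarrow> real^'n^'n) \<Rightarrow>
   (nat \<Rightarrow> real^'n \<Rightarrow> real) \<Rightarrow> (real^'n \<Rightarrow> real) \<Rightarrow> bool" where
  "test_sequence \<Omega> A u u0 \<longleftrightarrow> weakly_in_H1 \<Omega> u u0 \<and>
     strongly_convergent_in_Hminus1 \<Omega> (\<lambda>k. minus_div \<Omega> (\<lambda>x. A k x *v wgrad \<Omega> (u k) x))"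

text \<open>Test sequences are taken along every sequence of parameters tending to \<open>0\<close>, that is, for
  every subsequence \<open>A \<circ> r\<close>. With \<open>r = id\<close> only, the notion would degenerate: interlacing two
  sequences whose H-limits are \<open>\<alpha> I\<close> and \<open>(\<alpha> + d(x)) I\<close>, where \<open>d > 0\<close> in a ball \<open>\<Omega>\<close> and \<open>d\<close>
  vanishes linearly on its boundary, leaves only test sequences with constant limits, so that
  every matrix field would be an H-limit.\<close>

definition H_converges ::
  "(real^'n::finite) set \<Rightarrow> (nat \<Rightarrow> real^'n \<Rightarrow> real^'n^'n) \<Rightarrow> (real^'n \<Rightarrow> real^'n^'n) \<Rightarrow> bool" where
  "H_converges \<Omega> A Astar \<longleftrightarrow> (\<forall>r u u0. strict_mono r \<and> test_sequence \<Omega> (A \<circ> r) u u0 \<longrightarrow>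
     weakly_in_L2 \<Omega> (\<lambda>k x. A (r k) x *v wgrad \<Omega> (u k) x) (\<lambda>x. Astar x *v wgrad \<Omega> u0 x))"

text \<open>No subsequences are needed here: when \<open>A\<close> H-converges, a test sequence for a subsequence
  of \<open>A\<close> extends to one for \<open>A\<close> with the same limit.\<close>

definition relatively_converges ::
  "(real^'n::finite) set \<Rightarrow> (nat \<Rightarrow> real^'n \<Rightarrow> real^'n^'n) \<Rightarrow> (nat \<Rightarrow> real^'n \<Rightarrow> real^'n^'n) \<Rightarrow>
   (real^'n \<Rightarrow> real^'n^'n) \<Rightarrow> bool" where
  "relatively_converges \<Omega> A B Bsharp \<longleftrightarrow> (\<forall>u u0. test_sequence \<Omega> A u u0 \<longrightarrow>
     in_distributions \<Omega>
       (\<lambda>k x. (B k x *v wgrad \<Omega> (u k) x) \<bullet> wgrad \<Omega> (u k) x)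
       (\<lambda>x. (Bsharp x *v wgrad \<Omega> u0 x) \<bullet> wgrad \<Omega> u0 x))"

end

theory Submission
  imports Defs
begin

text \<open>Let \<open>u\<^sub>k\<close> solve \<open>- div (a\<^sub>k grad u\<^sub>k) = g\<close>, where \<open>g\<close> is chosen such that the weak limit of
  \<open>u\<^sub>k\<close> has gradient \<open>\<xi>\<close> near a given point. Since \<open>a\<^sub>k - a1 = (a2 - a1) * (1 - \<chi>\<^sub>k)\<close>, letting
  \<open>k\<close> tend to infinity in \<open>0 \<le> \<integral> \<phi> b (a\<^sub>k - a1) \<bar>grad u\<^sub>k - \<eta>\<bar>\<^sup>2\<close> gives, almost everywhere and for
  all \<open>\<xi>\<close> and \<open>\<eta>\<close>,
  \<open>0 \<le> (b A\<^sup>* - a1 B\<^sup>#) \<xi> \<bullet> \<xi> - 2 b (A\<^sup>* - a1) \<xi> \<bullet> \<eta> + b (1 - \<theta>) (a2 - a1) \<bar>\<eta>\<bar>\<^sup>2\<close>.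
  Minimising over \<open>\<xi>\<close> and summing over the basis vectors \<open>\<eta>\<close> bounds the trace.

  The limit of \<open>\<integral> \<phi> b a\<^sub>k \<bar>grad u\<^sub>k\<bar>\<^sup>2\<close> is not covered by the div-curl lemma because \<open>b\<close> is merely bounded
  and measurable. However, the energy densities are locally equi-integrable, by a reverse Hoelder
  inequality and a level set argument, so \<open>b\<close> may be replaced by polynomials.\<close>

section \<open>Semi-inner product spaces of functions\<close>

text \<open>Nothing is known about \<open>Astar\<close> beyond its action on test sequences, neither
  measurability nor ellipticity. Hence correctors cannot be produced by solving the limit equation;
  they come from a cluster point of the solution operators, which is coercive and therefore onto.
  The bounds and the symmetry of \<open>Astar\<close> are then read off from the correctors. Since
  relative convergence speaks of the full sequence, the corrector must moreover converge without
  passage to a subsequence.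

  The right-hand side of the corrector equation is only in \<open>Hminus1\<close>, too rough for
  higher integrability of the gradients. It equals, however, minus the divergence of the limit flux
  \<open>Astar x *v wgrad \<Omega> w x\<close>, and this flux is bounded when \<open>w\<close> has a
  bounded gradient, as cut-off affine functions do. In the reverse Hoelder inequality, Ehrling's
  inequality with a small parameter acts in the role of a Sobolev-Poincare inequality. Weak
  compactness is drawn from Tychonoff's theorem, whose cluster points are then turned into
  subsequences.\<close>

lemma quadratic_nonneg_discriminant:
  fixes a b c :: real
  assumes "\<And>t. 0 \<le> c + 2 * b * t + a * t\<^sup>2"
  shows "b\<^sup>2 \<le> a * c"
proof (cases "a = 0")
  case True
  have "b = 0"
  proof (rule ccontr)
    assume "b \<noteq> 0"
    \<comment> \<open>At this \<open>t\<close> the affine function \<open>c + 2 * b * t\<close>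
      equals \<open>-1\<close>.\<close>
    with assms[of "- (c + 1) / (2 * b)"] True show False by (simp add: field_simps)
  qed
  with True show ?thesis by simp
next
  case False
  have "a > 0"
  proof (rule ccontr)
    assume "\<not> a > 0"
    with False have a: "a < 0" by simp
    \<comment> \<open>Here \<open>\<bar>a\<bar> * t\<close> equals
      \<open>2 * \<bar>b\<bar> + \<bar>c\<bar> + \<bar>a\<bar>\<close>, so with
      \<open>t \<ge> 1\<close> the negative quadratic term outweighs the two others.\<close>
    define t where "t = 2 * \<bar>b\<bar> / \<bar>a\<bar> + \<bar>c\<bar> / \<bar>a\<bar> + 1"
    have t: "t \<ge> 1" by (auto simp: t_def)
    have "2 * \<bar>b\<bar> + \<bar>c\<bar> + \<bar>a\<bar> = \<bar>a\<bar> * t"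
      using False by (simp add: t_def field_simps)
    then have 1: "\<bar>a\<bar> * t\<^sup>2 = (2 * \<bar>b\<bar> + \<bar>c\<bar> + \<bar>a\<bar>) * t" by (simp add: power2_eq_square)
    have 2: "\<bar>c\<bar> * 1 \<le> \<bar>c\<bar> * t" "\<bar>a\<bar> * 1 \<le> \<bar>a\<bar> * t" using t by (intro mult_left_mono; simp)+
    have "b * t \<le> \<bar>b\<bar> * t" using t by (intro mult_right_mono) auto
    moreover have "\<bar>a\<bar> * t\<^sup>2 = 2 * (\<bar>b\<bar> * t) + \<bar>c\<bar> * t + \<bar>a\<bar> * t"
      unfolding 1 by (simp add: algebra_simps)
    moreover have "\<bar>a\<bar> * t\<^sup>2 = - (a * t\<^sup>2)" using a by simp
    ultimately show False using assms[of t] 2 a by linarith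
  qed
  \<comment> \<open>The minimiser of the quadratic polynomial.\<close>
  with assms[of "- b / a"] show ?thesis
    by (simp add: field_simps power2_eq_square)
qed

lemma linear_part_zero:
  fixes a b :: real
  assumes "\<And>t. 0 \<le> 2 * b * t + a * t\<^sup>2"
  shows "b = 0"
  using quadratic_nonneg_discriminant[of 0 b a] assms by simp

text \<open>Functions that agree almost everywhere are not identified, so \<open>ip\<close> is only
  positive semidefinite: \<open>nrm u = 0\<close> need not give \<open>u = 0\<close>, limits are not
  unique, and uniqueness is always expressed by equal pairings \<open>ip u v\<close> with all
  \<open>v\<close>.\<close>

locale semi_inner =
  fixes V :: "('x \<Rightarrow> real) set" and ip :: "('x \<Rightarrow> real) \<Rightarrow> ('x \<Rightarrow> real) \<Rightarrow> real"
  assumes zero_mem: "(\<lambda>x. 0) \<in> V"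
    and add_mem: "u \<in> V \<Longrightarrow> v \<in> V \<Longrightarrow> (\<lambda>x. u x + v x) \<in> V"
    and scale_mem: "u \<in> V \<Longrightarrow> (\<lambda>x. c * u x) \<in> V"
    and ip_add_left: "u \<in> V \<Longrightarrow> v \<in> V \<Longrightarrow> w \<in> V \<Longrightarrow> ip (\<lambda>x. u x + v x) w = ip u w + ip v w"
    and ip_scale_left: "u \<in> V \<Longrightarrow> v \<in> V \<Longrightarrow> ip (\<lambda>x. c * u x) v = c * ip u v"
    and ip_sym: "u \<in> V \<Longrightarrow> v \<in> V \<Longrightarrow> ip u v = ip v u"
    and ip_nonneg: "u \<in> V \<Longrightarrow> 0 \<le> ip u u"
begin

definition nrm where "nrm u = sqrt (ip u u)"

lemma nrm_nonneg [simp]: "u \<in> V \<Longrightarrow> 0 \<le> nrm u"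
  by (simp add: nrm_def ip_nonneg)

lemma nrm_power2: "u \<in> V \<Longrightarrow> (nrm u)\<^sup>2 = ip u u"
  by (simp add: nrm_def ip_nonneg)

lemma diff_mem: "u \<in> V \<Longrightarrow> v \<in> V \<Longrightarrow> (\<lambda>x. u x - v x) \<in> V"
  using add_mem[OF _ scale_mem[of v "-1"], of u] by simp

lemma ip_add_right:
  "u \<in> V \<Longrightarrow> v \<in> V \<Longrightarrow> w \<in> V \<Longrightarrow> ip w (\<lambda>x. u x + v x) = ip w u + ip w v"
  using ip_add_left[of u v w] ip_sym[OF add_mem, of u v w] ip_sym[of w u] ip_sym[of w v] by simp

lemma ip_scale_right: "u \<in> V \<Longrightarrow> v \<in> V \<Longrightarrow> ip v (\<lambda>x. c * u x) = c * ip v u"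
  using ip_scale_left[of u v c] ip_sym[OF scale_mem, of u v c] ip_sym[of v u] by simp

lemma ip_diff_left:
  assumes "u \<in> V" "v \<in> V" "w \<in> V"
  shows "ip (\<lambda>x. u x - v x) w = ip u w - ip v w"
  using ip_add_left[OF assms(1) scale_mem[OF assms(2), of "-1"] assms(3)]
    ip_scale_left[OF assms(2,3), of "-1"] by simp

lemma ip_diff_right:
  assumes "u \<in> V" "v \<in> V" "w \<in> V"
  shows "ip w (\<lambda>x. u x - v x) = ip w u - ip w v"
  using ip_diff_left[OF assms] ip_sym[OF diff_mem[OF assms(1,2)] assms(3)] ip_sym[OF assms(3,1)]
    ip_sym[OF assms(3,2)] by simp

lemma ip_zero_right [simp]: "v \<in> V \<Longrightarrow> ip v (\<lambda>x. 0) = 0"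
  using ip_scale_right[OF zero_mem, of v 0] by simp

lemma ip_add_scale_self:
  assumes "u \<in> V" "v \<in> V"
  shows "ip (\<lambda>x. u x + t * v x) (\<lambda>x. u x + t * v x) = ip u u + 2 * ip u v * t + ip v v * t\<^sup>2"
  using assms scale_mem[OF assms(2), of t] ip_sym[OF assms]
  by (simp add: ip_add_left ip_add_right ip_scale_left ip_scale_right add_mem power2_eq_square
      algebra_simps)

lemma ip_diff_self:
  assumes "u \<in> V" "v \<in> V"
  shows "ip (\<lambda>x. u x - v x) (\<lambda>x. u x - v x) = ip u u - 2 * ip u v + ip v v"
  using ip_add_scale_self[OF assms, of "-1"] by simp

lemma Cauchy_Schwarz_power2:
  assumes "u \<in> V" "v \<in> V"
  shows "(ip u v)\<^sup>2 \<le> ip u u * ip v v"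
proof -
  have "0 \<le> ip u u + 2 * ip u v * t + ip v v * t\<^sup>2" for t
    using ip_nonneg[OF add_mem[OF assms(1) scale_mem[OF assms(2), of t]]]
    by (simp add: ip_add_scale_self assms)
  from quadratic_nonneg_discriminant[OF this] show ?thesis by (simp add: mult.commute)
qed

lemma Cauchy_Schwarz:
  assumes "u \<in> V" "v \<in> V"
  shows "\<bar>ip u v\<bar> \<le> nrm u * nrm v"
proof -
  have "sqrt ((ip u v)\<^sup>2) \<le> sqrt (ip u u * ip v v)"
    using Cauchy_Schwarz_power2[OF assms] by (rule real_sqrt_le_mono)
  then show ?thesis by (simp add: nrm_def real_sqrt_mult)
qed

lemma ip_zero_of_nrm_zero:
  assumes "u \<in> V" "v \<in> V" "nrm u = 0" shows "ip u v = 0"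
  using Cauchy_Schwarz[OF assms(1,2)] assms(3) by simp

lemma ip_tendsto_left:
  assumes "\<And>n. X n \<in> V" "l \<in> V" "(\<lambda>n. nrm (\<lambda>x. X n x - l x)) \<longlonglongrightarrow> 0" "v \<in> V"
  shows "(\<lambda>n. ip (X n) v) \<longlonglongrightarrow> ip l v"
proof -
  have "\<bar>ip (X n) v - ip l v\<bar> \<le> nrm (\<lambda>x. X n x - l x) * nrm v" for n
    using Cauchy_Schwarz[OF diff_mem[OF assms(1,2)] assms(4)] assms by (simp add: ip_diff_left)
  moreover have "(\<lambda>n. nrm (\<lambda>x. X n x - l x) * nrm v) \<longlonglongrightarrow> 0"
    using tendsto_mult_right[OF assms(3), of "nrm v"] by simp
  ultimately have "(\<lambda>n. ip (X n) v - ip l v) \<longlonglongrightarrow> 0"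
    by (intro Lim_null_comparison[of "\<lambda>n. ip (X n) v - ip l v"]) (auto intro: always_eventually)
  then show ?thesis by (rule LIM_zero_cancel)
qed

end

locale complete_semi_inner = semi_inner +
  assumes complete: "\<lbrakk>\<And>n. X n \<in> V; \<And>e. e > 0 \<Longrightarrow> \<exists>N. \<forall>m\<ge>N. \<forall>n\<ge>N. nrm (\<lambda>x. X m x - X n x) < e\<rbrakk>
    \<Longrightarrow> \<exists>l\<in>V. (\<lambda>n. nrm (\<lambda>x. X n x - l x)) \<longlonglongrightarrow> 0"
begin

text \<open>The representing element is the limit of a minimising sequence of \<open>ip v v - 2 * F v\<close>.\<close>

theorem Riesz:
  assumes F_add: "\<And>u v. u \<in> V \<Longrightarrow> v \<in> V \<Longrightarrow> F (\<lambda>x. u x + v x) = F u + F v"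
    and F_scale: "\<And>c u. u \<in> V \<Longrightarrow> F (\<lambda>x. c * u x) = c * F u"
    and F_bound: "\<And>u. u \<in> V \<Longrightarrow> \<bar>F u\<bar> \<le> C * nrm u"
  shows "\<exists>g\<in>V. \<forall>v\<in>V. F v = ip g v"
proof -
  define J where "J v = ip v v - 2 * F v" for v
  have J_lower: "J v \<ge> - C\<^sup>2" if "v \<in> V" for v
  proof -
    have "0 \<le> (nrm v - C)\<^sup>2" by simp
    then have "0 \<le> ip v v - 2 * (C * nrm v) + C\<^sup>2"
      by (simp add: power2_diff nrm_power2 that algebra_simps)
    then show ?thesis using F_bound[OF that] by (simp add: J_def)
  qed
  define m where "m = (INF v\<in>V. J v)"
  have bdd: "bdd_below (J ` V)" using J_lower by (auto intro!: bdd_belowI[of _ "- C\<^sup>2"])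
  have m_le: "m \<le> J v" if "v \<in> V" for v
    unfolding m_def using bdd that by (rule cINF_lower)
  have "\<exists>v\<in>V. J v < m + 1 / (real n + 1)" for n
  proof -
    have "\<not> m + 1 / (real n + 1) \<le> m" by simp
    then show ?thesis unfolding m_def
      by (metis cINF_greatest empty_iff linorder_not_less zero_mem)
  qed
  then obtain X where X: "\<And>n. X n \<in> V" "\<And>n. J (X n) < m + 1 / (real n + 1)" by metis
  \<comment> \<open>Parallelogram identity with the midpoint, at which \<open>J\<close> is at least
    \<open>m\<close>: almost minimisers are close to each other.\<close>
  have par: "ip (\<lambda>x. v x - w x) (\<lambda>x. v x - w x) \<le> 2 * (J v - m) + 2 * (J w - m)"
    if "v \<in> V" "w \<in> V" for v w
  proof -
    have a: "(\<lambda>x. v x + w x) \<in> V" using that by (rule add_mem)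
    have h: "(\<lambda>x. (1/2) * (v x + w x)) \<in> V" using scale_mem[OF a] .
    have "J (\<lambda>x. (1/2) * (v x + w x)) =
        (1/4) * ip (\<lambda>x. v x + w x) (\<lambda>x. v x + w x) - F (\<lambda>x. v x + w x)"
      unfolding J_def F_scale[OF a] ip_scale_left[OF a h] ip_scale_right[OF a a] by simp
    also have "\<dots> = (1/4) * (ip v v + 2 * ip v w + ip w w) - (F v + F w)"
      using ip_add_scale_self[OF that, of 1] F_add[OF that] by simp
    finally have "4 * J (\<lambda>x. (1/2) * (v x + w x)) =
      ip v v + 2 * ip v w + ip w w - 4 * (F v + F w)" by simp
    with m_le[OF h] show ?thesis
      unfolding ip_diff_self[OF that] by (simp add: J_def)
  qed
  have Cauchy: "\<exists>N. \<forall>m\<ge>N. \<forall>n\<ge>N. nrm (\<lambda>x. X m x - X n x) < e" if "e > 0" for e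
  proof -
    obtain N where N: "4 / e\<^sup>2 < real N" using reals_Archimedean2 by blast
    have "nrm (\<lambda>x. X k x - X l x) < e" if kl: "k \<ge> N" "l \<ge> N" for k l
    proof -
      have "ip (\<lambda>x. X k x - X l x) (\<lambda>x. X k x - X l x) \<le> 2 * (1 / (real k + 1)) + 2 * (1 / (real l + 1))"
        using par[OF X(1)[of k] X(1)[of l]] X(2)[of k] X(2)[of l] by simp
      also have "\<dots> \<le> 2 * (1 / (real N + 1)) + 2 * (1 / (real N + 1))"
        using kl by (intro add_mono mult_left_mono divide_left_mono) auto
      also have "\<dots> = 4 / (real N + 1)" by simp
      also have "\<dots> < e\<^sup>2" using N \<open>e > 0\<close> by (simp add: field_simps add_strict_increasing)
      finally have "(nrm (\<lambda>x. X k x - X l x))\<^sup>2 < e\<^sup>2" by (simp add: nrm_power2 diff_mem X)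
      then show ?thesis using \<open>e > 0\<close> by (meson less_imp_le power_less_imp_less_base)
    qed
    then show ?thesis by blast
  qed
  obtain g where g: "g \<in> V" "(\<lambda>n. nrm (\<lambda>x. X n x - g x)) \<longlonglongrightarrow> 0"
    using complete[OF X(1) Cauchy] by auto
  have "F v = ip g v" if v: "v \<in> V" for v
  proof -
    \<comment> \<open>First variation in the direction \<open>v\<close>: the value of
      \<open>J\<close> at \<open>X n + t v\<close> is compared with the infimum \<open>m\<close>,
      and only the pairing of \<open>X n\<close> with \<open>v\<close> has to pass to the
      limit.\<close>
    have "0 \<le> 2 * (ip g v - F v) * t + ip v v * t\<^sup>2" for t
    proof -
      have step: "m \<le> m + 1 / (real n + 1) + 2 * (ip (X n) v - F v) * t + ip v v * t\<^sup>2" for n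
      proof -
        have "m \<le> J (\<lambda>x. X n x + t * v x)" by (rule m_le[OF add_mem[OF X(1) scale_mem[OF v]]])
        also have "\<dots> = J (X n) + 2 * (ip (X n) v - F v) * t + ip v v * t\<^sup>2"
          unfolding J_def ip_add_scale_self[OF X(1) v]
          F_add[OF X(1)[of n] scale_mem[OF v, of t]] F_scale[OF v, of t]
          by (simp add: algebra_simps)
        finally show ?thesis using X(2)[of n] by simp
      qed
      have "0 \<le> 1 / (real n + 1) + 2 * (ip (X n) v - F v) * t + ip v v * t\<^sup>2" for n
        using step[of n] by linarith
      moreover have "(\<lambda>n. 1 / (real n + 1) + 2 * (ip (X n) v - F v) * t + ip v v * t\<^sup>2)
          \<longlonglongrightarrow> 0 + 2 * (ip g v - F v) * t + ip v v * t\<^sup>2"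
        using LIMSEQ_inverse_real_of_nat
        by (intro tendsto_intros ip_tendsto_left X g v) (simp add: inverse_eq_divide add.commute)
      ultimately show ?thesis
        using LIMSEQ_le_const[of _ _ 0] by fastforce
    qed
    from linear_part_zero[OF this] show ?thesis by simp
  qed
  then show ?thesis using g(1) by blast
qed

end

text \<open>Tychonoff's theorem in the product of the intervals \<open>{- c i..c i}\<close>. The
  index type may be uncountable, and then a subsequence converging at all indices need not exist; a
  cluster point is approximated on finitely many indices at a time, which suffices to inherit
  relations between finitely many values.\<close>

lemma bounded_functions_cluster_point:
  fixes a :: "nat \<Rightarrow> 'i \<Rightarrow> real"
  assumes bound: "\<And>k i. \<bar>a k i\<bar> \<le> c i"
  shows "\<exists>t. \<forall>I e m. finite I \<longrightarrow> e > 0 \<longrightarrow> (\<exists>k\<ge>m. \<forall>i\<in>I. \<bar>a k i - t i\<bar> < e)"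
proof -
  define K where "K = PiE UNIV (\<lambda>i. {- c i..c i})"
  have "compactin (product_topology (\<lambda>i::'i. euclidean) UNIV) K"
    unfolding K_def compactin_PiE by simp
  then have "compact K" by (simp add: euclidean_product_topology)
  moreover have "eventually (\<lambda>f. f \<in> K) (filtermap a sequentially)"
    using bound by (auto simp: eventually_filtermap K_def PiE_def abs_le_iff intro!: always_eventually)
      (metis minus_le_iff)
  \<comment> \<open>Compactness in terms of filters: a proper filter concentrated on
    \<open>K\<close> has a cluster point.\<close>
  ultimately obtain t where t: "inf (nhds t) (filtermap a sequentially) \<noteq> bot"
    unfolding compact_filter by (metis filtermap_bot_iff sequentially_bot)
  show ?thesis
  proof (intro exI[of _ t] allI impI, rule ccontr)
    fix I :: "'i set" and e :: real and m :: nat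
    assume I: "finite I" "e > 0" and no: "\<not> (\<exists>k\<ge>m. \<forall>i\<in>I. \<bar>a k i - t i\<bar> < e)"
    \<comment> \<open>A cylinder neighbourhood of \<open>t\<close>, open in the product topology
      because \<open>I\<close> is finite.\<close>
    define U where "U = (\<Inter>i\<in>I. {f::'i \<Rightarrow> real. f i \<in> {t i - e<..<t i + e}})"
    have "open {f::'i \<Rightarrow> real. f i \<in> {t i - e<..<t i + e}}" for i
      using open_vimage[OF open_greaterThanLessThan[of "t i - e" "t i + e"] continuous_on_product_coordinates[of i]]
      by (simp add: vimage_def)
    then have "open U" unfolding U_def by (intro open_INT I ballI)
    then have "eventually (\<lambda>f. f \<in> U) (nhds t)"
      using I by (auto simp: eventually_nhds U_def)
    moreover have "eventually (\<lambda>f. f \<notin> U) (filtermap a sequentially)"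
      unfolding eventually_filtermap eventually_sequentially U_def
      using no by (force simp: abs_less_iff algebra_simps)
    ultimately have "eventually (\<lambda>f. False) (inf (nhds t) (filtermap a sequentially))"
      unfolding eventually_inf by blast
    with t show False by (simp add: trivial_limit_def)
  qed
qed

section \<open>Weak sequential compactness and weak limits of operators\<close>

context complete_semi_inner
begin

text \<open>Replacing \<open>l\<close> by \<open>Y n\<close> changes the two pairings together by at
  most \<open>C + nrm x\<close> times the distance of \<open>Y n\<close> and \<open>l\<close>,
  uniformly in \<open>k\<close>. It yields completeness of the space of admissible test vectors in
  the next proof.\<close>

lemma weak_limits_closed:
  assumes X: "\<And>k. X k \<in> V" "\<And>k. nrm (X k) \<le> C" and x: "x \<in> V"
    and Y: "\<And>n. Y n \<in> V" "l \<in> V" "(\<lambda>n. nrm (\<lambda>z. Y n z - l z)) \<longlonglongrightarrow> 0"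
    and conv: "\<And>n. (\<lambda>k. ip (X k) (Y n)) \<longlonglongrightarrow> ip x (Y n)"
  shows "(\<lambda>k. ip (X k) l) \<longlonglongrightarrow> ip x l"
proof (rule LIMSEQ_I)
  fix e :: real assume "e > 0"
  define D where "D = C + nrm x + 1"
  have "D > 0" using X[of 0] nrm_nonneg[OF X(1)[of 0]] nrm_nonneg[OF x] unfolding D_def by linarith
  have "e / (2 * D) > 0" using \<open>e > 0\<close> \<open>D > 0\<close> by simp
  from LIMSEQ_D[OF Y(3) this] obtain n where n: "nrm (\<lambda>z. Y n z - l z) < e / (2 * D)"
    using diff_mem[OF Y(1) Y(2)] by fastforce
  from LIMSEQ_D[OF conv[of n], of "e/2"] \<open>e > 0\<close>
  obtain N where N: "\<And>k. k \<ge> N \<Longrightarrow> \<bar>ip (X k) (Y n) - ip x (Y n)\<bar> < e / 2" by auto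
  have "\<bar>ip (X k) l - ip x l\<bar> < e" if "k \<ge> N" for k
  proof -
    have dl: "(\<lambda>z. Y n z - l z) \<in> V" by (rule diff_mem[OF Y(1) Y(2)])
    have 1: "\<bar>ip (X k) (\<lambda>z. Y n z - l z)\<bar> \<le> C * nrm (\<lambda>z. Y n z - l z)"
      using Cauchy_Schwarz[OF X(1)[of k] dl] mult_right_mono[OF X(2)[of k] nrm_nonneg[OF dl]] by linarith
    have 2: "\<bar>ip x (\<lambda>z. Y n z - l z)\<bar> \<le> nrm x * nrm (\<lambda>z. Y n z - l z)"
      by (rule Cauchy_Schwarz[OF x dl])
    have "C * nrm (\<lambda>z. Y n z - l z) + nrm x * nrm (\<lambda>z. Y n z - l z) \<le> D * nrm (\<lambda>z. Y n z - l z)"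
      using nrm_nonneg[OF dl] by (simp add: D_def algebra_simps)
    also have "\<dots> < D * (e / (2 * D))" using n \<open>D > 0\<close> by (intro mult_strict_left_mono)
    also have "\<dots> = e / 2" using \<open>D > 0\<close> by simp
    finally show ?thesis using 1 2 N[OF that]
      unfolding ip_diff_right[OF Y(1) Y(2) X(1)] ip_diff_right[OF Y(1) Y(2) x] by linarith
  qed
  then show "\<exists>N. \<forall>k\<ge>N. norm (ip (X k) l - ip x l) < e" by auto
qed

text \<open>Once \<open>X (r k)\<close> converges weakly against every \<open>X m\<close> and against \<open>x\<close>, it does so against
  the closed span of these, and both sides vanish on its orthogonal complement.\<close>

lemma weakly_convergent_subsequence_of_cluster:
  assumes X: "\<And>k. X k \<in> V" "\<And>k. nrm (X k) \<le> C" and x: "x \<in> V"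
    and cluster: "\<And>I e m. finite I \<Longrightarrow> I \<subseteq> V \<Longrightarrow> e > 0 \<Longrightarrow> \<exists>k\<ge>m. \<forall>v\<in>I. \<bar>ip (X k) v - ip x v\<bar> < e"
  obtains r :: "nat \<Rightarrow> nat" where "strict_mono r" "\<And>v. v \<in> V \<Longrightarrow> (\<lambda>k. ip (X (r k)) v) \<longlonglongrightarrow> ip x v"
proof -
  \<comment> \<open>The finite test set grows with \<open>n\<close> while the tolerance shrinks, so
    one diagonal choice serves \<open>x\<close> and every \<open>X m\<close> at once.\<close>
  have step: "\<exists>k\<ge>m. \<forall>v\<in>insert x (X ` {..n}). \<bar>ip (X k) v - ip x v\<bar> < 1 / (real n + 1)" for n m
    by (rule cluster) (use X x in auto)
  have "\<exists>r. \<forall>n. (\<forall>v\<in>insert x (X ` {..n}). \<bar>ip (X (r n)) v - ip x v\<bar> < 1 / (real n + 1)) \<and> r n < r (Suc n)"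
  proof (rule dependent_nat_choice)
    show "\<exists>k. \<forall>v\<in>insert x (X ` {..0}). \<bar>ip (X k) v - ip x v\<bar> < 1 / (real 0 + 1)"
      using step[where n=0 and m=0] by blast
  next
    fix k n
    show "\<exists>y. (\<forall>v\<in>insert x (X ` {..Suc n}). \<bar>ip (X y) v - ip x v\<bar> < 1 / (real (Suc n) + 1)) \<and> k < y"
      using step[where n="Suc n" and m="Suc k"] by (meson Suc_le_lessD)
  qed
  then obtain r where r: "\<And>n v. v \<in> insert x (X ` {..n}) \<Longrightarrow> \<bar>ip (X (r n)) v - ip x v\<bar> < 1 / (real n + 1)"
    "\<And>n. r n < r (Suc n)" by blast
  have mono: "strict_mono r" using r(2) by (simp add: strict_mono_Suc_iff)
  define W where "W = {v \<in> V. (\<lambda>k. ip (X (r k)) v) \<longlonglongrightarrow> ip x v}"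
  have inv0: "(\<lambda>n. 1 / (real n + 1)) \<longlonglongrightarrow> 0"
    using LIMSEQ_inverse_real_of_nat by (simp add: inverse_eq_divide add.commute)
  \<comment> \<open>\<open>v\<close> may be missing from the first \<open>m\<close> test sets;
    convergence only concerns the later ones.\<close>
  have inW: "v \<in> W" if "v \<in> V" "\<And>n. n \<ge> m \<Longrightarrow> v \<in> insert x (X ` {..n})" for v m
  proof -
    have "(\<lambda>k. ip (X (r k)) v - ip x v) \<longlonglongrightarrow> 0"
      by (rule Lim_null_comparison[OF _ inv0])
         (use that(2) r(1) in \<open>auto simp: eventually_sequentially intro!: exI[of _ m] less_imp_le\<close>)
    then show ?thesis using that(1) by (simp add: W_def LIM_zero_cancel)
  qed
  have xW: "x \<in> W" by (rule inW[of _ 0]) (use x in auto)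
  have XW: "X m \<in> W" for m by (rule inW[of _ m]) (use X in auto)
  have WV: "u \<in> V" if "u \<in> W" for u using that by (simp add: W_def)
  interpret W: complete_semi_inner W ip
  proof
    show "(\<lambda>x. 0) \<in> W" by (simp add: W_def zero_mem X x)
    show "(\<lambda>x. u x + v x) \<in> W" if "u \<in> W" "v \<in> W" for u v
      using that unfolding W_def
      by (auto simp: add_mem ip_add_right X x intro!: tendsto_add)
    show "(\<lambda>x. c * u x) \<in> W" if "u \<in> W" for u c
      using that unfolding W_def
      by (auto simp: scale_mem ip_scale_right X x intro!: tendsto_mult_left)
    show "ip (\<lambda>x. u x + v x) w = ip u w + ip v w" if "u \<in> W" "v \<in> W" "w \<in> W" for u v w
      using that by (simp add: WV ip_add_left)
    show "ip (\<lambda>x. c * u x) v = c * ip u v" if "u \<in> W" "v \<in> W" for u v c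
      using that by (simp add: WV ip_scale_left)
    show "ip u v = ip v u" if "u \<in> W" "v \<in> W" for u v using that by (simp add: WV ip_sym)
    show "0 \<le> ip u u" if "u \<in> W" for u using that by (simp add: WV ip_nonneg)
    fix Y :: "nat \<Rightarrow> _" 
    assume Y: "\<And>n. Y n \<in> W"
      and C: "\<And>e. e > 0 \<Longrightarrow> \<exists>N. \<forall>m\<ge>N. \<forall>n\<ge>N. semi_inner.nrm ip (\<lambda>x. Y m x - Y n x) < e"
    obtain l where l: "l \<in> V" "(\<lambda>n. nrm (\<lambda>x. Y n x - l x)) \<longlonglongrightarrow> 0"
      using complete[OF WV[OF Y] C] by auto
    have "(\<lambda>k. ip (X (r k)) l) \<longlonglongrightarrow> ip x l"
      by (rule weak_limits_closed[OF X(1) X(2) x WV[OF Y] l]) (use Y in \<open>simp add: W_def\<close>)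
    then show "\<exists>l\<in>W. (\<lambda>n. semi_inner.nrm ip (\<lambda>x. Y n x - l x)) \<longlonglongrightarrow> 0"
      using l by (auto simp: W_def)
  qed
  have "(\<lambda>k. ip (X (r k)) v) \<longlonglongrightarrow> ip x v" if v: "v \<in> V" for v
  proof -
    \<comment> \<open>\<open>p\<close> is the projection of \<open>v\<close> onto the complete space
      \<open>W\<close>. All \<open>X m\<close> and \<open>x\<close> lie in \<open>W\<close> and so
      do not see the difference between \<open>v\<close> and \<open>p\<close>.\<close>
    obtain p where p: "p \<in> W" "\<And>u. u \<in> W \<Longrightarrow> ip v u = ip p u"
      using W.Riesz[of "\<lambda>u. ip v u" "nrm v"] Cauchy_Schwarz[OF v WV]
      by (auto simp: ip_add_right ip_scale_right v WV)
    have "ip (X m) v = ip (X m) p" for m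
      using p(2)[OF XW[of m]] ip_sym[OF X(1) v] ip_sym[OF X(1) WV[OF p(1)]] by simp
    moreover have "ip x v = ip x p"
      using p(2)[OF xW] ip_sym[OF x v] ip_sym[OF x WV[OF p(1)]] by simp
    ultimately show ?thesis using p(1) by (simp add: W_def)
  qed
  with mono show ?thesis by (rule that)
qed

text \<open>A cluster point \<open>t\<close> of the functionals \<open>ip (X k)\<close> inherits
  linearity and the bound, because each of these relations involves at most three values; Riesz'
  theorem turns \<open>t\<close> into a vector \<open>x\<close>.\<close>

theorem bounded_weakly_convergent_subsequence:
  assumes X: "\<And>k. X k \<in> V" "\<And>k. nrm (X k) \<le> C"
  obtains r :: "nat \<Rightarrow> nat" and x where "strict_mono r" "x \<in> V"
    "\<And>v. v \<in> V \<Longrightarrow> (\<lambda>k. ip (X (r k)) v) \<longlonglongrightarrow> ip x v"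
proof -
  \<comment> \<open>The default value 0 outside \<open>V\<close> makes the family bounded on the
    whole function type.\<close>
  define a where "a k v = (if v \<in> V then ip (X k) v else 0)" for k v
  have a_bound: "\<bar>a k v\<bar> \<le> (if v \<in> V then C * nrm v else 0)" for k v
    using Cauchy_Schwarz[OF X(1)[of k], of v] mult_right_mono[OF X(2)[of k] nrm_nonneg, of v]
    by (auto simp: a_def)
  obtain t where "\<forall>I e m. finite I \<longrightarrow> e > 0 \<longrightarrow> (\<exists>k\<ge>m. \<forall>i\<in>I. \<bar>a k i - t i\<bar> < e)"
    using bounded_functions_cluster_point[of a, OF a_bound] ..
  then have t: "\<exists>k\<ge>m. \<forall>i\<in>I. \<bar>a k i - t i\<bar> < e" if "finite I" "e > 0" for I e m
    using that by simp
  have t_add: "t (\<lambda>x. u x + v x) = t u + t v" if "u \<in> V" "v \<in> V" for u v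
  proof (rule ccontr)
    \<comment> \<open>One third of the defect: three approximations with errors below
      \<open>e\<close> cannot add up to it.\<close>
    define e where "e = \<bar>t (\<lambda>x. u x + v x) - t u - t v\<bar> / 3"
    assume "\<not> ?thesis"
    then have "e > 0" by (simp add: e_def)
    from t[of "{u, v, \<lambda>x. u x + v x}", OF _ this] obtain k where
      "\<bar>a k u - t u\<bar> < e" "\<bar>a k v - t v\<bar> < e" "\<bar>a k (\<lambda>x. u x + v x) - t (\<lambda>x. u x + v x)\<bar> < e" by auto
    moreover have "a k (\<lambda>x. u x + v x) = a k u + a k v"
      using that by (simp add: a_def add_mem ip_add_right X)
    ultimately show False by (simp add: e_def abs_if split: if_splits)
  qed
  have t_scale: "t (\<lambda>x. c * u x) = c * t u" if "u \<in> V" for u c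
  proof (rule ccontr)
    define e where "e = \<bar>t (\<lambda>x. c * u x) - c * t u\<bar> / (1 + \<bar>c\<bar>)"
    have p: "1 + \<bar>c\<bar> > 0" by simp
    assume "\<not> ?thesis"
    then have "e > 0" using p by (simp add: e_def)
    from t[of "{u, \<lambda>x. c * u x}", OF _ this] obtain k where k:
      "\<bar>a k u - t u\<bar> < e" "\<bar>a k (\<lambda>x. c * u x) - t (\<lambda>x. c * u x)\<bar> < e" by auto
    have "a k (\<lambda>x. c * u x) = c * a k u"
      using that by (simp add: a_def scale_mem ip_scale_right X)
    then have "\<bar>t (\<lambda>x. c * u x) - c * t u\<bar> \<le> \<bar>a k (\<lambda>x. c * u x) - t (\<lambda>x. c * u x)\<bar> + \<bar>c * (a k u - t u)\<bar>"
      by (simp add: algebra_simps)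
    also have "\<dots> < e + \<bar>c\<bar> * e"
      using k by (intro add_less_le_mono) (auto simp: abs_mult intro!: mult_left_mono)
    also have "\<dots> = e * (1 + \<bar>c\<bar>)" by (simp add: algebra_simps)
    also have "\<dots> = \<bar>t (\<lambda>x. c * u x) - c * t u\<bar>" using p by (simp add: e_def)
    finally show False by simp
  qed
  have t_bound: "\<bar>t u\<bar> \<le> C * nrm u" if "u \<in> V" for u
  proof (rule field_le_epsilon)
    fix e :: real assume "e > 0"
    from t[of "{u}", OF _ this] obtain k where "\<bar>a k u - t u\<bar> < e" by auto
    moreover have "\<bar>a k u\<bar> \<le> C * nrm u"
      using a_bound[of k u] that by simp
    ultimately show "\<bar>t u\<bar> \<le> C * nrm u + e" by linarith
  qed
  obtain x where x: "x \<in> V" "\<And>v. v \<in> V \<Longrightarrow> t v = ip x v"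
    using Riesz[of t C] t_add t_scale t_bound by auto
  have "\<exists>k\<ge>m. \<forall>v\<in>I. \<bar>ip (X k) v - ip x v\<bar> < e" if I: "finite I" "I \<subseteq> V" "e > 0" for I e m
  proof -
    obtain k where k: "k \<ge> m" "\<forall>i\<in>I. \<bar>a k i - t i\<bar> < e" using t[OF I(1,3), of m] by blast
    have "\<bar>ip (X k) v - ip x v\<bar> < e" if "v \<in> I" for v
    proof -
      have "v \<in> V" using that I(2) by blast
      then show ?thesis using k(2) that x(2) by (auto simp: a_def)
    qed
    with k(1) show ?thesis by blast
  qed
  then show ?thesis
    by (rule weakly_convergent_subsequence_of_cluster[OF X x(1)]) (assumption+, rule that[OF _ x(1)])
qed

text \<open>A cluster point of the bilinear forms \<open>ip (T k g) v\<close> is again symmetric and coercive,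
  so \<open>w\<close> is represented by some \<open>g\<close> with respect to it.\<close>

theorem weak_limit_operators_surjective:
  assumes T_mem: "\<And>k g. g \<in> V \<Longrightarrow> T k g \<in> V"
    and T_add: "\<And>k g h v. g \<in> V \<Longrightarrow> h \<in> V \<Longrightarrow> v \<in> V \<Longrightarrow>
      ip (T k (\<lambda>x. g x + h x)) v = ip (T k g) v + ip (T k h) v"
    and T_scale: "\<And>k g c v. g \<in> V \<Longrightarrow> v \<in> V \<Longrightarrow> ip (T k (\<lambda>x. c * g x)) v = c * ip (T k g) v"
    and T_sym: "\<And>k g h. g \<in> V \<Longrightarrow> h \<in> V \<Longrightarrow> ip (T k g) h = ip (T k h) g"
    and T_bound: "\<And>k g. g \<in> V \<Longrightarrow> nrm (T k g) \<le> C * nrm g"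
    and T_coercive: "\<And>k g. g \<in> V \<Longrightarrow> c0 * ip g g \<le> ip (T k g) g" and "c0 > 0"
    and w: "w \<in> V"
  obtains g and r :: "nat \<Rightarrow> nat" where "g \<in> V" "strict_mono r"
    "\<And>v. v \<in> V \<Longrightarrow> (\<lambda>k. ip (T (r k) g) v) \<longlonglongrightarrow> ip w v"
proof -
  define a where "a k p = (if fst p \<in> V \<and> snd p \<in> V then ip (T k (fst p)) (snd p) else 0)" for k p
  have a_simp: "a k (g, v) = ip (T k g) v" if "g \<in> V" "v \<in> V" for k g v using that by (simp add: a_def)
  have a_bound: "\<bar>a k p\<bar> \<le> (if fst p \<in> V \<and> snd p \<in> V then C * nrm (fst p) * nrm (snd p) else 0)" for k p
    using Cauchy_Schwarz[OF T_mem[of "fst p" k], of "snd p"]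
      mult_right_mono[OF T_bound[of "fst p" k] nrm_nonneg, of "snd p"]
    by (auto simp: a_def)
  obtain t where "\<forall>I e m. finite I \<longrightarrow> e > 0 \<longrightarrow> (\<exists>k\<ge>m. \<forall>i\<in>I. \<bar>a k i - t i\<bar> < e)"
    using bounded_functions_cluster_point[of a, OF a_bound] ..
  then have t: "\<exists>k\<ge>m. \<forall>i\<in>I. \<bar>a k i - t i\<bar> < e" if "finite I" "e > 0" for I e m
    using that by simp
  have t_add: "t (\<lambda>x. u x + v x, z) = t (u, z) + t (v, z)" if "u \<in> V" "v \<in> V" "z \<in> V" for u v z
  proof (rule ccontr)
    define e where "e = \<bar>t (\<lambda>x. u x + v x, z) - t (u, z) - t (v, z)\<bar> / 3"
    assume "\<not> ?thesis"
    then have "e > 0" by (simp add: e_def)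
    from t[of "{(u, z), (v, z), (\<lambda>x. u x + v x, z)}", OF _ this] obtain k where
      "\<bar>a k (u, z) - t (u, z)\<bar> < e" "\<bar>a k (v, z) - t (v, z)\<bar> < e"
      "\<bar>a k (\<lambda>x. u x + v x, z) - t (\<lambda>x. u x + v x, z)\<bar> < e" by auto
    moreover have "a k (\<lambda>x. u x + v x, z) = a k (u, z) + a k (v, z)"
      using that by (simp add: a_simp add_mem T_add)
    ultimately show False by (simp add: e_def abs_if split: if_splits)
  qed
  have t_scale: "t (\<lambda>x. c * u x, z) = c * t (u, z)" if "u \<in> V" "z \<in> V" for u c z
  proof (rule ccontr)
    define e where "e = \<bar>t (\<lambda>x. c * u x, z) - c * t (u, z)\<bar> / (1 + \<bar>c\<bar>)"
    have p: "1 + \<bar>c\<bar> > 0" by simp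
    assume "\<not> ?thesis"
    then have "e > 0" using p by (simp add: e_def)
    from t[of "{(u, z), (\<lambda>x. c * u x, z)}", OF _ this] obtain k where k:
      "\<bar>a k (u, z) - t (u, z)\<bar> < e" "\<bar>a k (\<lambda>x. c * u x, z) - t (\<lambda>x. c * u x, z)\<bar> < e" by auto
    have "a k (\<lambda>x. c * u x, z) = c * a k (u, z)"
      using that by (simp add: a_simp scale_mem T_scale)
    then have "\<bar>t (\<lambda>x. c * u x, z) - c * t (u, z)\<bar>
        \<le> \<bar>a k (\<lambda>x. c * u x, z) - t (\<lambda>x. c * u x, z)\<bar> + \<bar>c * (a k (u, z) - t (u, z))\<bar>"
      by (simp add: algebra_simps)
    also have "\<dots> < e + \<bar>c\<bar> * e"
      using k by (intro add_less_le_mono) (auto simp: abs_mult intro!: mult_left_mono)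
    also have "\<dots> = e * (1 + \<bar>c\<bar>)" by (simp add: algebra_simps)
    also have "\<dots> = \<bar>t (\<lambda>x. c * u x, z) - c * t (u, z)\<bar>" using p by (simp add: e_def)
    finally show False by simp
  qed
  have t_sym: "t (u, v) = t (v, u)" if "u \<in> V" "v \<in> V" for u v
  proof (rule ccontr)
    define e where "e = \<bar>t (u, v) - t (v, u)\<bar> / 2"
    assume "\<not> ?thesis"
    then have "e > 0" by (simp add: e_def)
    from t[of "{(u, v), (v, u)}", OF _ this] obtain k where
      "\<bar>a k (u, v) - t (u, v)\<bar> < e" "\<bar>a k (v, u) - t (v, u)\<bar> < e" by auto
    moreover have "a k (u, v) = a k (v, u)" using that T_sym by (simp add: a_simp)
    ultimately show False by (simp add: e_def abs_if split: if_splits)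
  qed
  have t_coercive: "c0 * ip u u \<le> t (u, u)" if "u \<in> V" for u
  proof (rule field_le_epsilon)
    fix e :: real assume "e > 0"
    from t[of "{(u, u)}", OF _ this] obtain k where "\<bar>a k (u, u) - t (u, u)\<bar> < e" by auto
    moreover have "c0 * ip u u \<le> a k (u, u)" using T_coercive that by (simp add: a_simp)
    ultimately show "c0 * ip u u \<le> t (u, u) + e" by linarith
  qed
  have t_bound: "t (u, u) \<le> C * ip u u" if "u \<in> V" for u
  proof (rule field_le_epsilon)
    fix e :: real assume "e > 0"
    from t[of "{(u, u)}", OF _ this] obtain k where "\<bar>a k (u, u) - t (u, u)\<bar> < e" by auto
    moreover have "\<bar>a k (u, u)\<bar> \<le> C * (nrm u)\<^sup>2"
      using a_bound[of k "(u, u)"] that by (simp add: power2_eq_square)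
    ultimately show "t (u, u) \<le> C * ip u u + e" using that by (simp add: nrm_power2)
  qed
  \<comment> \<open>The limit form is a new inner product, equivalent to \<open>ip\<close> by
    coercivity and boundedness, so that completeness carries over and Riesz' theorem applies to
    it.\<close>
  interpret t: semi_inner V "\<lambda>u v. t (u, v)"
  proof
    show "0 \<le> t (u, u)" if "u \<in> V" for u
      using t_coercive[OF that] ip_nonneg[OF that] \<open>c0 > 0\<close> by (smt (verit) mult_nonneg_nonneg)
  qed (simp_all add: zero_mem add_mem scale_mem t_add t_scale t_sym)
  have lower: "nrm u \<le> t.nrm u / sqrt c0" if "u \<in> V" for u
    using real_sqrt_le_mono[OF t_coercive[OF that]] \<open>c0 > 0\<close>
    by (simp add: nrm_def t.nrm_def real_sqrt_mult field_simps)
  have upper: "t.nrm u \<le> sqrt C * nrm u" if "u \<in> V" for u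
    using real_sqrt_le_mono[OF t_bound[OF that]] by (simp add: nrm_def t.nrm_def real_sqrt_mult)
  interpret t: complete_semi_inner V "\<lambda>u v. t (u, v)"
  proof
    fix X :: "nat \<Rightarrow> _"
    assume X: "\<And>n. X n \<in> V"
      and C: "\<And>e. e > 0 \<Longrightarrow> \<exists>N. \<forall>m\<ge>N. \<forall>n\<ge>N. t.nrm (\<lambda>x. X m x - X n x) < e"
    have "\<exists>N. \<forall>m\<ge>N. \<forall>n\<ge>N. nrm (\<lambda>x. X m x - X n x) < e" if "e > 0" for e
    proof -
      have "e * sqrt c0 > 0" using that \<open>c0 > 0\<close> by simp
      from C[OF this] obtain N where N: "\<And>m n. m \<ge> N \<Longrightarrow> n \<ge> N \<Longrightarrow> t.nrm (\<lambda>x. X m x - X n x) < e * sqrt c0"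
        by auto
      have "nrm (\<lambda>x. X m x - X n x) < e" if "m \<ge> N" "n \<ge> N" for m n
        using lower[OF diff_mem[OF X X], of m n] N[OF that] \<open>c0 > 0\<close>
        by (meson divide_less_eq less_le_trans not_le real_sqrt_gt_zero)
      then show ?thesis by blast
    qed
    from complete[OF X this] obtain l where l: "l \<in> V" "(\<lambda>n. nrm (\<lambda>x. X n x - l x)) \<longlonglongrightarrow> 0" by auto
    have "(\<lambda>n. t.nrm (\<lambda>x. X n x - l x)) \<longlonglongrightarrow> 0"
    proof (rule Lim_null_comparison)
      show "(\<lambda>n. sqrt C * nrm (\<lambda>x. X n x - l x)) \<longlonglongrightarrow> 0"
        using tendsto_mult_left[OF l(2), of "sqrt C"] by simp
      show "\<forall>\<^sub>F n in sequentially. norm (t.nrm (\<lambda>x. X n x - l x)) \<le> sqrt C * nrm (\<lambda>x. X n x - l x)"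
        using upper[OF diff_mem[OF X l(1)]] t.nrm_nonneg[OF diff_mem[OF X l(1)]]
        by (auto intro!: always_eventually)
    qed
    with l(1) show "\<exists>l\<in>V. (\<lambda>n. t.nrm (\<lambda>x. X n x - l x)) \<longlonglongrightarrow> 0" by auto
  qed
  have "\<bar>ip w v\<bar> \<le> nrm w / sqrt c0 * t.nrm v" if "v \<in> V" for v
    using Cauchy_Schwarz[OF w that] mult_left_mono[OF lower[OF that] nrm_nonneg[OF w]] by simp
  then obtain g where g: "g \<in> V" "\<And>v. v \<in> V \<Longrightarrow> ip w v = t (g, v)"
    using t.Riesz[of "ip w" "nrm w / sqrt c0"] by (auto simp: ip_add_right ip_scale_right w)
  have "\<exists>k\<ge>m. \<forall>v\<in>I. \<bar>ip (T k g) v - ip w v\<bar> < e" if I: "finite I" "I \<subseteq> V" "e > 0" for I e m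
  proof -
    \<comment> \<open>Only index pairs with first component \<open>g\<close> occur, and on these the
      cluster point is \<open>ip w\<close>.\<close>
    obtain k where k: "k \<ge> m" "\<forall>i\<in>Pair g ` I. \<bar>a k i - t i\<bar> < e"
      using t[of "Pair g ` I", OF _ I(3), of m] I(1) by blast
    have "\<bar>ip (T k g) v - ip w v\<bar> < e" if "v \<in> I" for v
    proof -
      have "v \<in> V" using that I(2) by blast
      then show ?thesis using k(2) that g by (auto simp: a_simp)
    qed
    with k(1) show ?thesis by blast
  qed
  then show ?thesis
    by (rule weakly_convergent_subsequence_of_cluster[OF T_mem[OF g(1)] T_bound[OF g(1)] w])
      (assumption+, rule that[OF g(1)])
qed

end

section \<open>Square-integrable functions\<close>

definition sq_int :: "'a measure \<Rightarrow> ('a \<Rightarrow> 'b::euclidean_space) set" where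
  "sq_int M = {f \<in> borel_measurable M. integrable M (\<lambda>x. (norm (f x))\<^sup>2)}"

definition l2 :: "'a measure \<Rightarrow> ('a \<Rightarrow> 'b::euclidean_space) \<Rightarrow> real" where
  "l2 M f = sqrt (LINT x|M. (norm (f x))\<^sup>2)"

lemma L2_eq_sq_int: "L2 \<Omega> = sq_int (lebesgue_on \<Omega>)"
  by (simp add: L2_def sq_int_def)

lemma sq_int_measurable: "f \<in> sq_int M \<Longrightarrow> f \<in> borel_measurable M"
  by (simp add: sq_int_def)

lemma sq_int_integrable: "f \<in> sq_int M \<Longrightarrow> integrable M (\<lambda>x. (norm (f x))\<^sup>2)"
  by (simp add: sq_int_def)

lemma l2_nonneg [simp]: "0 \<le> l2 M f"
  by (simp add: l2_def)

lemma l2_power2: "(l2 M f)\<^sup>2 = (LINT x|M. (norm (f x))\<^sup>2)"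
  by (simp add: l2_def)

lemma sq_int_dominated:
  assumes "g \<in> sq_int M" "f \<in> borel_measurable M" "AE x in M. norm (f x) \<le> C * norm (g x)"
  shows "f \<in> sq_int M"
proof -
  have "integrable M (\<lambda>x. C\<^sup>2 * (norm (g x))\<^sup>2)"
    using sq_int_integrable[OF assms(1)] by simp
  then have "integrable M (\<lambda>x. (norm (f x))\<^sup>2)"
  proof (rule Bochner_Integration.integrable_bound)
    show "AE x in M. norm ((norm (f x))\<^sup>2) \<le> norm (C\<^sup>2 * (norm (g x))\<^sup>2)"
      using assms(3) by eventually_elim (auto simp: power_mult_distrib[symmetric] intro!: power_mono)
  qed (use assms(2) in measurable)
  with assms(2) show ?thesis by (simp add: sq_int_def)
qed

lemma sq_int_mult_integrable:
  assumes "f \<in> sq_int M" "g \<in> sq_int M"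
  shows "integrable M (\<lambda>x. norm (f x) * norm (g x))"
proof (rule Bochner_Integration.integrable_bound)
  show "integrable M (\<lambda>x. (norm (f x))\<^sup>2 + (norm (g x))\<^sup>2)"
    using assms by (auto simp: sq_int_def)
  show "(\<lambda>x. norm (f x) * norm (g x)) \<in> borel_measurable M"
    using assms[THEN sq_int_measurable] by measurable
  have "norm (norm (f x) * norm (g x)) \<le> norm ((norm (f x))\<^sup>2 + (norm (g x))\<^sup>2)" for x
    using sum_squares_bound[of "norm (f x)" "norm (g x)"]
      mult_nonneg_nonneg[OF norm_ge_zero[of "f x"] norm_ge_zero[of "g x"]]
    by (simp del: mult_nonneg_nonneg zero_le_mult_iff)
  then show "AE x in M. norm (norm (f x) * norm (g x)) \<le> norm ((norm (f x))\<^sup>2 + (norm (g x))\<^sup>2)"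
    by simp
qed

lemma sq_int_inner_integrable:
  assumes "f \<in> sq_int M" "g \<in> sq_int M"
  shows "integrable M (\<lambda>x. f x \<bullet> g x)"
proof (rule Bochner_Integration.integrable_bound[OF sq_int_mult_integrable[OF assms]])
  show "(\<lambda>x. f x \<bullet> g x) \<in> borel_measurable M" using assms[THEN sq_int_measurable] by measurable
qed (simp add: Cauchy_Schwarz_ineq2)

lemma sq_int_add:
  assumes "f \<in> sq_int M" "g \<in> sq_int M"
  shows "(\<lambda>x. f x + g x) \<in> sq_int M"
proof -
  have [measurable]: "f \<in> borel_measurable M" "g \<in> borel_measurable M"
    using assms by (auto simp: sq_int_def)
  have "integrable M (\<lambda>x. (norm (f x))\<^sup>2 + 2 * (f x \<bullet> g x) + (norm (g x))\<^sup>2)"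
    using assms sq_int_inner_integrable[OF assms] by (auto simp: sq_int_def)
  then have "integrable M (\<lambda>x. (norm (f x + g x))\<^sup>2)"
    by (simp add: power2_norm_eq_inner inner_add inner_commute algebra_simps)
  then show ?thesis by (simp add: sq_int_def)
qed

lemma sq_int_scaleR:
  assumes "f \<in> sq_int M" shows "(\<lambda>x. c *\<^sub>R f x) \<in> sq_int M"
proof (rule sq_int_dominated[OF assms])
  show "(\<lambda>x. c *\<^sub>R f x) \<in> borel_measurable M" using assms[THEN sq_int_measurable] by measurable
  show "AE x in M. norm (c *\<^sub>R f x) \<le> \<bar>c\<bar> * norm (f x)" by simp
qed

lemma sq_int_uminus: "f \<in> sq_int M \<Longrightarrow> (\<lambda>x. - f x) \<in> sq_int M"
  using sq_int_scaleR[of f M "-1"] by simp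

lemma sq_int_diff:
  assumes "f \<in> sq_int M" "g \<in> sq_int M"
  shows "(\<lambda>x. f x - g x) \<in> sq_int M"
  using sq_int_add[OF assms(1) sq_int_uminus[OF assms(2)]] by simp

lemma sq_int_bounded_scaleR:
  assumes "f \<in> sq_int M" "h \<in> borel_measurable M" "AE x in M. \<bar>h x\<bar> \<le> C"
  shows "(\<lambda>x. h x *\<^sub>R f x) \<in> sq_int M"
proof (rule sq_int_dominated[OF assms(1)])
  show "(\<lambda>x. h x *\<^sub>R f x) \<in> borel_measurable M"
    using assms(1)[THEN sq_int_measurable] assms(2) by measurable
  show "AE x in M. norm (h x *\<^sub>R f x) \<le> C * norm (f x)"
    using assms(3) by eventually_elim (auto intro: mult_right_mono)
qed

lemma sq_int_scaleR_bounded: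
  assumes "f \<in> sq_int M" "h \<in> borel_measurable M" "AE x in M. norm (h x) \<le> C"
  shows "(\<lambda>x. f x *\<^sub>R h x) \<in> sq_int M"
proof (rule sq_int_dominated[OF assms(1)])
  show "(\<lambda>x. f x *\<^sub>R h x) \<in> borel_measurable M"
    using assms(1)[THEN sq_int_measurable] assms(2) by measurable
  show "AE x in M. norm (f x *\<^sub>R h x) \<le> C * norm (f x)"
    using assms(3) by eventually_elim (simp add: mult.commute[of C] mult_left_mono)
qed

lemma l2_add_self:
  assumes "f \<in> sq_int M" "g \<in> sq_int M"
  shows "(LINT x|M. (norm (f x + t *\<^sub>R g x))\<^sup>2)
    = (l2 M f)\<^sup>2 + 2 * (LINT x|M. f x \<bullet> g x) * t + (l2 M g)\<^sup>2 * t\<^sup>2"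
proof -
  have "(LINT x|M. (norm (f x + t *\<^sub>R g x))\<^sup>2)
    = (LINT x|M. (norm (f x))\<^sup>2 + 2 * t * (f x \<bullet> g x) + t\<^sup>2 * (norm (g x))\<^sup>2)"
    by (intro Bochner_Integration.integral_cong refl)
      (simp add: power2_norm_eq_inner inner_add inner_commute power2_eq_square[of t] algebra_simps)
  also have "\<dots> = (l2 M f)\<^sup>2 + 2 * t * (LINT x|M. f x \<bullet> g x) + t\<^sup>2 * (l2 M g)\<^sup>2"
    using sq_int_inner_integrable[OF assms] assms[THEN sq_int_integrable] by (simp add: l2_power2)
  finally show ?thesis by (simp add: algebra_simps)
qed

lemma l2_Cauchy_Schwarz:
  assumes "f \<in> sq_int M" "g \<in> sq_int M"
  shows "\<bar>LINT x|M. f x \<bullet> g x\<bar> \<le> l2 M f * l2 M g"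
proof -
  have "(LINT x|M. f x \<bullet> g x)\<^sup>2 \<le> (l2 M g)\<^sup>2 * (l2 M f)\<^sup>2"
    by (rule quadratic_nonneg_discriminant, subst l2_add_self[OF assms, symmetric]) simp
  then have "sqrt ((LINT x|M. f x \<bullet> g x)\<^sup>2) \<le> sqrt ((l2 M f * l2 M g)\<^sup>2)"
    by (intro real_sqrt_le_mono) (simp add: power_mult_distrib mult.commute)
  then show ?thesis by (simp add: abs_mult)
qed

lemma l2_triangle:
  assumes "f \<in> sq_int M" "g \<in> sq_int M"
  shows "l2 M (\<lambda>x. f x + g x) \<le> l2 M f + l2 M g"
proof (rule power2_le_imp_le)
  show "(l2 M (\<lambda>x. f x + g x))\<^sup>2 \<le> (l2 M f + l2 M g)\<^sup>2"
    using l2_add_self[OF assms, of 1] l2_Cauchy_Schwarz[OF assms]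
    by (simp add: l2_power2 power2_sum)
qed simp

lemma l2_scaleR: "l2 M (\<lambda>x. c *\<^sub>R f x) = \<bar>c\<bar> * l2 M f"
  by (simp add: l2_def power_mult_distrib real_sqrt_mult)

lemma l2_diff_commute: "l2 M (\<lambda>x. f x - g x) = l2 M (\<lambda>x. g x - f x)"
  by (simp add: l2_def norm_minus_commute)

lemma l2_triangle_diff:
  assumes "f \<in> sq_int M" "g \<in> sq_int M" "h \<in> sq_int M"
  shows "l2 M (\<lambda>x. f x - h x) \<le> l2 M (\<lambda>x. f x - g x) + l2 M (\<lambda>x. g x - h x)"
  using l2_triangle[OF sq_int_diff[OF assms(1,2)] sq_int_diff[OF assms(2,3)]] by simp

lemma l2_mono:
  assumes "g \<in> sq_int M" "f \<in> borel_measurable M" "AE x in M. norm (f x) \<le> C * norm (g x)" "0 \<le> C"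
  shows "l2 M f \<le> C * l2 M g"
proof (rule power2_le_imp_le)
  have f: "f \<in> sq_int M" by (rule sq_int_dominated[OF assms(1-3)])
  have "(LINT x|M. (norm (f x))\<^sup>2) \<le> (LINT x|M. C\<^sup>2 * (norm (g x))\<^sup>2)"
  proof (rule integral_mono_AE)
    show "AE x in M. (norm (f x))\<^sup>2 \<le> C\<^sup>2 * (norm (g x))\<^sup>2"
      using assms(3) by eventually_elim (simp add: power_mult_distrib[symmetric] power_mono)
  qed (use sq_int_integrable[OF f] sq_int_integrable[OF assms(1)] in auto)
  then show "(l2 M f)\<^sup>2 \<le> (C * l2 M g)\<^sup>2" by (simp add: l2_power2 power_mult_distrib)
qed (use assms(4) in simp)

lemma l2_cong_AE:
  assumes "f \<in> borel_measurable M" "g \<in> borel_measurable M" "AE x in M. f x = g x"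
  shows "l2 M f = l2 M g"
  unfolding l2_def using assms by (intro arg_cong[of _ _ sqrt] integral_cong_AE) auto

lemma l2_zero_iff:
  assumes "f \<in> sq_int M" shows "l2 M f = 0 \<longleftrightarrow> (AE x in M. f x = 0)"
  using integral_nonneg_eq_0_iff_AE[OF sq_int_integrable[OF assms]] by (simp add: l2_def)

text \<open>Strong times weak convergence: the error is at most \<open>C\<close> times the distance
  of \<open>f n\<close> and \<open>f0\<close>, and \<open>g\<close> has to converge only against the
  fixed limit \<open>f0\<close>. In the div-curl lemma the strong factor comes from Rellich's
  theorem.\<close>

lemma l2_tendsto_inner:
  assumes f: "\<And>n. f n \<in> sq_int M" "f0 \<in> sq_int M" "(\<lambda>n. l2 M (\<lambda>x. f n x - f0 x)) \<longlonglongrightarrow> 0"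
    and g: "\<And>n. g n \<in> sq_int M" "\<And>n. l2 M (g n) \<le> C" "(\<lambda>n. LINT x|M. f0 x \<bullet> g n x) \<longlonglongrightarrow> L"
  shows "(\<lambda>n. LINT x|M. f n x \<bullet> g n x) \<longlonglongrightarrow> L"
proof -
  have "(\<lambda>n. LINT x|M. (f n x - f0 x) \<bullet> g n x) \<longlonglongrightarrow> 0"
  proof (rule Lim_null_comparison)
    show "(\<lambda>n. l2 M (\<lambda>x. f n x - f0 x) * C) \<longlonglongrightarrow> 0" using tendsto_mult_right[OF f(3), of C] by simp
    show "\<forall>\<^sub>F n in sequentially. norm (LINT x|M. (f n x - f0 x) \<bullet> g n x) \<le> l2 M (\<lambda>x. f n x - f0 x) * C"
    proof (intro always_eventually allI)
      fix n
      show "norm (LINT x|M. (f n x - f0 x) \<bullet> g n x) \<le> l2 M (\<lambda>x. f n x - f0 x) * C"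
        using l2_Cauchy_Schwarz[OF sq_int_diff[OF f(1,2)] g(1), of n n]
          mult_left_mono[OF g(2)[of n] l2_nonneg[of M "\<lambda>x. f n x - f0 x"]] by simp
    qed
  qed
  from tendsto_add[OF this g(3)] show ?thesis
    using sq_int_inner_integrable[OF f(1) g(1)] sq_int_inner_integrable[OF f(2) g(1)]
    by (simp add: inner_diff_left)
qed

lemma l2_tendsto_inner_fixed:
  assumes f: "\<And>n. f n \<in> sq_int M" "f0 \<in> sq_int M" "(\<lambda>n. l2 M (\<lambda>x. f n x - f0 x)) \<longlonglongrightarrow> 0"
    and g: "g \<in> sq_int M"
  shows "(\<lambda>n. LINT x|M. f n x \<bullet> g x) \<longlonglongrightarrow> (LINT x|M. f0 x \<bullet> g x)"
  using l2_tendsto_inner[OF f, of "\<lambda>n. g" "l2 M g"] g by simp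

lemma l2_tendsto_l2:
  assumes f: "\<And>n. f n \<in> sq_int M" "f0 \<in> sq_int M" "(\<lambda>n. l2 M (\<lambda>x. f n x - f0 x)) \<longlonglongrightarrow> 0"
  shows "(\<lambda>n. l2 M (f n)) \<longlonglongrightarrow> l2 M f0"
proof -
  have "\<bar>l2 M (f n) - l2 M f0\<bar> \<le> l2 M (\<lambda>x. f n x - f0 x)" for n
    using l2_triangle[OF sq_int_diff[OF f(1,2)] f(2), of n]
      l2_triangle[OF sq_int_diff[OF f(2) f(1)[of n]] f(1)[of n]] l2_diff_commute[of M "f n" f0] by simp
  then have "(\<lambda>n. l2 M (f n) - l2 M f0) \<longlonglongrightarrow> 0"
    by (intro Lim_null_comparison[OF _ f(3)]) (auto intro: always_eventually)
  then show ?thesis by (rule LIM_zero_cancel)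
qed

text \<open>Riesz-Fischer: a fast subsequence converges almost everywhere, and Fatou's lemma along
  it transfers the Cauchy estimate to the limit, directly for all late members of the full
  sequence.\<close>

theorem l2_complete:
  fixes f :: "nat \<Rightarrow> 'a \<Rightarrow> 'b::euclidean_space"
  assumes f: "\<And>n. f n \<in> sq_int M"
    and Cauchy: "\<And>e. e > 0 \<Longrightarrow> \<exists>N. \<forall>m\<ge>N. \<forall>n\<ge>N. l2 M (\<lambda>x. f m x - f n x) < e"
  obtains g where "g \<in> sq_int M" "(\<lambda>n. l2 M (\<lambda>x. f n x - g x)) \<longlonglongrightarrow> 0"
proof -
  have [measurable]: "f n \<in> borel_measurable M" for n using f by (simp add: sq_int_def)
  have "\<exists>N. \<forall>m\<ge>N. \<forall>n\<ge>N. l2 M (\<lambda>x. f m x - f n x) < (1/2)^k" for k :: nat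
    by (rule Cauchy) simp
  then obtain N where N: "\<And>k m n. m \<ge> N k \<Longrightarrow> n \<ge> N k \<Longrightarrow> l2 M (\<lambda>x. f m x - f n x) < (1/2)^k"
    by metis
  have "\<exists>r. \<forall>k. N k \<le> r k \<and> r k < r (Suc k)"
  proof (rule dependent_nat_choice)
    fix x k show "\<exists>y\<ge>N (Suc k). x < y" by (rule exI[of _ "max (N (Suc k)) (Suc x)"]) auto
  qed auto
  then obtain r where r: "\<And>k. N k \<le> r k" "\<And>k. r k < r (Suc k)" by auto
  then have mono: "strict_mono r" by (simp add: strict_mono_Suc_iff)
  define d where "d k x = f (r (Suc k)) x - f (r k) x" for k x
  have [measurable]: "d k \<in> borel_measurable M" for k unfolding d_def by measurable
  have d_sq: "d k \<in> sq_int M" for k unfolding d_def by (intro sq_int_diff f)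
  have d_small: "l2 M (d k) < (1/2)^k" for k
    unfolding d_def using r[of k] by (intro N) auto
  \<comment> \<open>The weight \<open>2^k\<close> is affordable since the squared distances are
    below \<open>(1/4)^k\<close>; finiteness of the weighted sum at \<open>x\<close> then forces
    \<open>norm (d k x)\<close> to decay like \<open>(sqrt (1/2))^k\<close>.\<close>
  have term_le: "(\<integral>\<^sup>+x. ennreal (2^k * (norm (d k x))\<^sup>2) \<partial>M) \<le> ennreal ((1/2)^k)" for k
  proof -
    have "(\<integral>\<^sup>+x. ennreal (2^k * (norm (d k x))\<^sup>2) \<partial>M) = ennreal (2^k * (l2 M (d k))\<^sup>2)"
      unfolding l2_power2 using sq_int_integrable[OF d_sq[of k]]
      by (subst nn_integral_eq_integral) auto
    also have "\<dots> \<le> ennreal (2^k * ((1/2)^k)\<^sup>2)"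
      by (intro ennreal_leI mult_left_mono power_mono less_imp_le[OF d_small]) auto
    also have "2^k * ((1/2::real)^k)\<^sup>2 = (1/2)^k"
      by (simp add: power2_eq_square power_one_over field_simps)
    finally show ?thesis .
  qed
  have "(\<integral>\<^sup>+x. (\<Sum>k. ennreal (2^k * (norm (d k x))\<^sup>2)) \<partial>M) \<noteq> \<infinity>"
  proof -
    have "(\<integral>\<^sup>+x. (\<Sum>k. ennreal (2^k * (norm (d k x))\<^sup>2)) \<partial>M)
        = (\<Sum>k. \<integral>\<^sup>+x. ennreal (2^k * (norm (d k x))\<^sup>2) \<partial>M)"
      by (rule nn_integral_suminf) measurable
    also have "\<dots> \<le> (\<Sum>k. ennreal ((1/2)^k))"
      by (intro suminf_le term_le) auto
    also have "\<dots> = ennreal (\<Sum>k. (1/2)^k)"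
      by (rule suminf_ennreal2) (auto intro: summable_geometric)
    finally show ?thesis by (auto simp: top_unique)
  qed
  then have "AE x in M. (\<Sum>k. ennreal (2^k * (norm (d k x))\<^sup>2)) \<noteq> \<infinity>"
    by (intro nn_integral_PInf_AE) measurable
  then have conv: "AE x in M. convergent (\<lambda>k. f (r k) x)"
  proof eventually_elim
    fix x assume fin: "(\<Sum>k. ennreal (2^k * (norm (d k x))\<^sup>2)) \<noteq> \<infinity>"
    define S where "S = enn2real (\<Sum>k. ennreal (2^k * (norm (d k x))\<^sup>2))"
    have S: "ennreal S = (\<Sum>k. ennreal (2^k * (norm (d k x))\<^sup>2))"
      unfolding S_def using fin by (simp add: less_top)
    have "norm (d k x) \<le> sqrt S * (sqrt (1/2))^k" for k
    proof -
      have "(\<Sum>k\<in>{k}. ennreal (2^k * (norm (d k x))\<^sup>2)) \<le> ennreal S"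
        unfolding S by (rule sum_le_suminf) auto
      then have "2^k * (norm (d k x))\<^sup>2 \<le> S" by (simp add: S_def)
      then have "(norm (d k x))\<^sup>2 \<le> S * (1/2)^k" by (simp add: power_one_over field_simps)
      from real_sqrt_le_mono[OF this] show ?thesis by (simp add: real_sqrt_mult real_sqrt_power)
    qed
    moreover have "summable (\<lambda>k. sqrt S * (sqrt (1/2))^k)"
      by (intro summable_mult summable_geometric) simp
    ultimately have "summable (\<lambda>k. d k x)" by (rule summable_comparison_test'[rotated])
    then have "convergent (\<lambda>n. \<Sum>k<n. d k x)" by (simp add: summable_iff_convergent)
    then have "convergent (\<lambda>n. (\<Sum>k<n. d k x) + f (r 0) x)" by (intro convergent_add convergent_const)
    moreover have "(\<Sum>k<n. d k x) + f (r 0) x = f (r n) x" for n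
      by (induction n) (auto simp: d_def algebra_simps)
    ultimately show "convergent (\<lambda>k. f (r k) x)" by simp
  qed
  define g where "g x = lim (\<lambda>k. f (r k) x)" for x
  have [measurable]: "g \<in> borel_measurable M" unfolding g_def by measurable
  have lim: "AE x in M. (\<lambda>k. f (r k) x) \<longlonglongrightarrow> g x"
    using conv by eventually_elim (simp add: g_def convergent_LIMSEQ_iff)
  have bound: "(\<integral>\<^sup>+x. ennreal ((norm (f n x - g x))\<^sup>2) \<partial>M) \<le> ennreal (((1/2)^j)\<^sup>2)" if n: "n \<ge> N j" for n j
  proof -
    have "(\<integral>\<^sup>+x. ennreal ((norm (f n x - g x))\<^sup>2) \<partial>M)
        = (\<integral>\<^sup>+x. liminf (\<lambda>k. ennreal ((norm (f n x - f (r k) x))\<^sup>2)) \<partial>M)"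
    proof (rule nn_integral_cong_AE)
      show "AE x in M. ennreal ((norm (f n x - g x))\<^sup>2)
          = liminf (\<lambda>k. ennreal ((norm (f n x - f (r k) x))\<^sup>2))"
        using lim
      proof eventually_elim
        fix x assume "(\<lambda>k. f (r k) x) \<longlonglongrightarrow> g x"
        then have "(\<lambda>k. ennreal ((norm (f n x - f (r k) x))\<^sup>2)) \<longlonglongrightarrow> ennreal ((norm (f n x - g x))\<^sup>2)"
          by (intro tendsto_intros)
        from lim_imp_Liminf[OF _ this] show "ennreal ((norm (f n x - g x))\<^sup>2)
          = liminf (\<lambda>k. ennreal ((norm (f n x - f (r k) x))\<^sup>2))" by simp
      qed
    qed
    also have "\<dots> \<le> liminf (\<lambda>k. \<integral>\<^sup>+x. ennreal ((norm (f n x - f (r k) x))\<^sup>2) \<partial>M)"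
      by (rule nn_integral_liminf) measurable
    also have "\<dots> \<le> ennreal (((1/2)^j)\<^sup>2)"
    proof (rule order_trans[OF Liminf_le_Limsup Limsup_bounded])
      show "\<forall>\<^sub>F k in sequentially. (\<integral>\<^sup>+x. ennreal ((norm (f n x - f (r k) x))\<^sup>2) \<partial>M) \<le> ennreal (((1/2)^j)\<^sup>2)"
        unfolding eventually_sequentially
      proof (intro exI allI impI)
        fix k assume "N j \<le> k"
        then have k: "r k \<ge> N j" using strict_mono_imp_increasing[OF mono, of k] by simp
        have "(\<integral>\<^sup>+x. ennreal ((norm (f n x - f (r k) x))\<^sup>2) \<partial>M) = ennreal ((l2 M (\<lambda>x. f n x - f (r k) x))\<^sup>2)"
          unfolding l2_power2 using sq_int_integrable[OF sq_int_diff[OF f f]]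
          by (intro nn_integral_eq_integral) auto
        also have "\<dots> \<le> ennreal (((1/2)^j)\<^sup>2)"
          by (intro ennreal_leI power_mono less_imp_le[OF N[OF n k]]) auto
        finally show "(\<integral>\<^sup>+x. ennreal ((norm (f n x - f (r k) x))\<^sup>2) \<partial>M) \<le> ennreal (((1/2)^j)\<^sup>2)" .
      qed
    qed simp
    finally show ?thesis .
  qed
  have sq: "(\<lambda>x. f n x - g x) \<in> sq_int M" if "n \<ge> N j" for n j
    unfolding sq_int_def using bound[OF that]
    by (auto intro!: integrableI_bounded simp: less_top[symmetric] top_unique)
  have "g \<in> sq_int M"
    using sq_int_diff[OF f[of "N 0"] sq[OF order_refl[of "N 0"]]] by simp
  moreover have "(\<lambda>n. l2 M (\<lambda>x. f n x - g x)) \<longlonglongrightarrow> 0"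
  proof (rule LIMSEQ_I)
    fix e :: real assume "e > 0"
    then obtain j where j: "(1/2::real)^j < e" using real_arch_pow_inv[of e "1/2"] by auto
    have "l2 M (\<lambda>x. f n x - g x) < e" if n: "n \<ge> N j" for n
    proof -
      have "ennreal ((l2 M (\<lambda>x. f n x - g x))\<^sup>2) \<le> ennreal (((1/2)^j)\<^sup>2)"
        unfolding l2_power2 using bound[OF n] sq_int_integrable[OF sq[OF n]]
        by (subst nn_integral_eq_integral[symmetric]) auto
      then have "(l2 M (\<lambda>x. f n x - g x))\<^sup>2 \<le> ((1/2)^j)\<^sup>2" by simp
      then have "l2 M (\<lambda>x. f n x - g x) \<le> (1/2)^j" by (rule power2_le_imp_le) simp
      with j show ?thesis by simp
    qed
    then show "\<exists>N. \<forall>n\<ge>N. norm (l2 M (\<lambda>x. f n x - g x) - 0) < e" by auto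
  qed
  ultimately show ?thesis by (rule that)
qed

section \<open>Smooth functions\<close>

lemma smooth_differentiable: "smooth f \<Longrightarrow> f differentiable (at x)"
  unfolding smooth_def by (drule spec[of _ "[]"]) simp

lemma smooth_partial_derivative: "smooth f \<Longrightarrow> smooth (partial_derivative i f)"
  unfolding smooth_def
proof (intro allI)
  fix "is" x assume "\<forall>is x. fold partial_derivative is f differentiable at x"
  from this[THEN spec, of "i # is"] show "fold partial_derivative is (partial_derivative i f) differentiable at x"
    by simp
qed

text \<open>An invariance principle in place of an induction over the order of derivatives:
  smoothness is proved by naming a set of differentiable functions which partial derivatives do not
  leave.\<close>

lemma smooth_coinduct:
  assumes "f \<in> S" and "\<And>g x. g \<in> S \<Longrightarrow> g differentiable (at x)"
    and "\<And>g i. g \<in> S \<Longrightarrow> partial_derivative i g \<in> S"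
  shows "smooth f"
proof -
  have "fold partial_derivative is g \<in> S" if "g \<in> S" for g "is"
    using that by (induction "is" arbitrary: g) (auto intro: assms(3))
  then show ?thesis using assms(1,2) by (auto simp: smooth_def)
qed

lemma partial_derivative_eq:
  assumes "(f has_derivative f') (at x)"
  shows "partial_derivative i f x = f' (axis i 1)"
  unfolding partial_derivative_def frechet_derivative_at[OF assms, symmetric] ..

lemma has_derivative_frechet: "f differentiable (at x) \<Longrightarrow> (f has_derivative frechet_derivative f (at x)) (at x)"
  by (simp add: frechet_derivative_works)

lemma partial_derivative_const [simp]: "partial_derivative i (\<lambda>x. c) = (\<lambda>x. 0)"
  by (rule ext, rule partial_derivative_eq) (rule has_derivative_const)

lemma partial_derivative_add:
  assumes "f differentiable (at x)" "g differentiable (at x)"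
  shows "partial_derivative i (\<lambda>x. f x + g x) x = partial_derivative i f x + partial_derivative i g x"
  using partial_derivative_eq[OF has_derivative_add[OF assms[THEN has_derivative_frechet]]]
  by (simp add: partial_derivative_def)

lemma partial_derivative_mult:
  assumes "f differentiable (at x)" "g differentiable (at x)"
  shows "partial_derivative i (\<lambda>x. f x * g x) x = f x * partial_derivative i g x + partial_derivative i f x * g x"
  using partial_derivative_eq[OF has_derivative_mult[OF assms[THEN has_derivative_frechet]]]
  by (simp add: partial_derivative_def)

lemma partial_derivative_inverse:
  assumes "f differentiable (at x)" "f x \<noteq> 0"
  shows "partial_derivative i (\<lambda>x. inverse (f x)) x = - 1 * (inverse (f x) * (partial_derivative i f x * inverse (f x)))"
  using partial_derivative_eq[OF Deriv.has_derivative_inverse[OF assms(2) has_derivative_frechet[OF assms(1)]]]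
  by (simp add: partial_derivative_def)

text \<open>The product and quotient rules keep partial derivatives inside this algebra as soon as
  those of the generators are inside. Smoothness therefore has to be checked on \<open>B\<close>
  only, for instance on the functions \<open>flat n\<close> composed with an affine
  coordinate.\<close>

inductive smooth_algebra :: "((real^'n::finite) \<Rightarrow> real) set \<Rightarrow> (real^'n \<Rightarrow> real) \<Rightarrow> bool" for B where
  base: "f \<in> B \<Longrightarrow> smooth_algebra B f"
| const: "smooth_algebra B (\<lambda>x. c)"
| add: "smooth_algebra B f \<Longrightarrow> smooth_algebra B g \<Longrightarrow> smooth_algebra B (\<lambda>x. f x + g x)"
| mult: "smooth_algebra B f \<Longrightarrow> smooth_algebra B g \<Longrightarrow> smooth_algebra B (\<lambda>x. f x * g x)"
| inverse: "smooth_algebra B f \<Longrightarrow> (\<And>x. f x \<noteq> 0) \<Longrightarrow> smooth_algebra B (\<lambda>x. inverse (f x))"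

lemma smooth_algebra_smooth:
  fixes f :: "real^'n::finite \<Rightarrow> real"
  assumes diff: "\<And>f x. f \<in> B \<Longrightarrow> f differentiable (at x)"
    and partial: "\<And>f i. f \<in> B \<Longrightarrow> smooth_algebra B (partial_derivative i f)"
    and f: "smooth_algebra B f"
  shows "smooth f"
proof -
  have d: "g differentiable (at x)" if "smooth_algebra B g" for g x
    using that by induction (auto intro!: diff derivative_intros differentiable_inverse)
  have p: "smooth_algebra B (partial_derivative i g)" if "smooth_algebra B g" for g i
    using that
  proof induction
    case (add f g)
    have "partial_derivative i (\<lambda>x. f x + g x) = (\<lambda>x. partial_derivative i f x + partial_derivative i g x)"
      by (rule ext, rule partial_derivative_add) (use add d in auto)
    then show ?case using add by (auto intro: smooth_algebra.add)
  next
    case (mult f g)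
    have "partial_derivative i (\<lambda>x. f x * g x)
        = (\<lambda>x. f x * partial_derivative i g x + partial_derivative i f x * g x)"
      by (rule ext, rule partial_derivative_mult) (use mult d in auto)
    then show ?case using mult by (auto intro: smooth_algebra.add smooth_algebra.mult)
  next
    case (inverse f)
    have "partial_derivative i (\<lambda>x. inverse (f x))
        = (\<lambda>x. - 1 * (inverse (f x) * (partial_derivative i f x * inverse (f x))))"
      by (rule ext, rule partial_derivative_inverse) (use inverse d in auto)
    moreover have "smooth_algebra B \<dots>"
      by (intro smooth_algebra.mult smooth_algebra.inverse smooth_algebra.const inverse)
    ultimately show ?case by simp
  qed (auto intro: partial smooth_algebra.const)
  show ?thesis
    by (rule smooth_coinduct[of _ "Collect (smooth_algebra B)"]) (use f d p in auto)
qed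

lemma smooth_algebra_of_smooth: "smooth_algebra (Collect smooth) f \<Longrightarrow> smooth f"
  by (rule smooth_algebra_smooth[of "Collect smooth"])
    (auto intro: smooth_differentiable smooth_partial_derivative smooth_algebra.base)

lemma smooth_const [simp]: "smooth (\<lambda>x. c)"
  by (rule smooth_algebra_of_smooth) (rule smooth_algebra.const)

lemma smooth_add: "smooth f \<Longrightarrow> smooth g \<Longrightarrow> smooth (\<lambda>x. f x + g x)"
  by (rule smooth_algebra_of_smooth) (auto intro: smooth_algebra.intros)

lemma smooth_mult: "smooth f \<Longrightarrow> smooth g \<Longrightarrow> smooth (\<lambda>x. f x * g x)"
  by (rule smooth_algebra_of_smooth) (auto intro: smooth_algebra.intros)

lemma smooth_inverse: "smooth f \<Longrightarrow> (\<And>x. f x \<noteq> 0) \<Longrightarrow> smooth (\<lambda>x. inverse (f x))"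
  by (rule smooth_algebra_of_smooth) (auto intro: smooth_algebra.intros)

lemma smooth_prod: "(\<And>i. i \<in> I \<Longrightarrow> smooth (f i)) \<Longrightarrow> smooth (\<lambda>x. \<Prod>i\<in>I. f i x)"
  by (induction I rule: infinite_finite_induct) (auto intro: smooth_mult)

lemma smooth_bounded_linear:
  fixes f :: "real^'n::finite \<Rightarrow> real"
  assumes "bounded_linear f" shows "smooth f"
proof (rule smooth_coinduct[of _ "Collect bounded_linear \<union> range (\<lambda>c x. c)"])
  fix g :: "real^'n \<Rightarrow> real" and i
  assume "g \<in> Collect bounded_linear \<union> range (\<lambda>c x. c)"
  then consider "bounded_linear g" | c where "g = (\<lambda>x. c)" by auto
  then show "partial_derivative i g \<in> Collect bounded_linear \<union> range (\<lambda>c x. c)"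
  proof cases
    case 1
    have "partial_derivative i g = (\<lambda>x. g (axis i 1))"
      by (rule ext, rule partial_derivative_eq, rule bounded_linear_imp_has_derivative) (rule 1)
    then show ?thesis by simp
  qed auto
qed (use assms in \<open>auto intro: bounded_linear_imp_differentiable\<close>)

lemma smooth_real_polynomial_function: "real_polynomial_function p \<Longrightarrow> smooth p"
  by (induction rule: real_polynomial_function.induct)
    (auto intro: smooth_bounded_linear smooth_add smooth_mult)

lemma has_derivative_affine:
  fixes f :: "real^'n::finite \<Rightarrow> real"
  assumes "f differentiable (at (a *\<^sub>R x + d))"
  shows "((\<lambda>x. f (a *\<^sub>R x + d)) has_derivative (\<lambda>h. frechet_derivative f (at (a *\<^sub>R x + d)) (a *\<^sub>R h))) (at x)"
proof -
  have "((\<lambda>x. a *\<^sub>R x + d) has_derivative (\<lambda>h. a *\<^sub>R h)) (at x)"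
    by (auto intro!: derivative_eq_intros)
  from diff_chain_at[OF this has_derivative_frechet[OF assms]] show ?thesis by (simp add: o_def)
qed

lemma partial_derivative_affine:
  fixes f :: "real^'n::finite \<Rightarrow> real"
  assumes "f differentiable (at (a *\<^sub>R x + d))"
  shows "partial_derivative i (\<lambda>x. f (a *\<^sub>R x + d)) x = a * partial_derivative i f (a *\<^sub>R x + d)"
  using partial_derivative_eq[OF has_derivative_affine[OF assms]]
    bounded_linear.linear[OF has_derivative_bounded_linear[OF has_derivative_frechet[OF assms]], THEN linear_scale]
  by (simp add: partial_derivative_def)

lemma smooth_affine:
  fixes f :: "real^'n::finite \<Rightarrow> real"
  assumes "smooth f" shows "smooth (\<lambda>x. f (a *\<^sub>R x + d))"
\<comment> \<open>The constant \<open>c\<close> collects the powers of \<open>a\<close> produced by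
  the chain rule.\<close>
proof (rule smooth_coinduct[of _ "{\<lambda>x. c * g (a *\<^sub>R x + d) | c g. smooth g}"])
  show "(\<lambda>x. f (a *\<^sub>R x + d)) \<in> {\<lambda>x. c * g (a *\<^sub>R x + d) | c g. smooth g}"
    using assms by (auto intro!: exI[of _ "1::real"] exI[of _ f])
  fix h :: "real^'n \<Rightarrow> real" and x and i
  assume "h \<in> {\<lambda>x. c * g (a *\<^sub>R x + d) | c g. smooth g}"
  then obtain c g where h: "h = (\<lambda>x. c * g (a *\<^sub>R x + d))" and g: "smooth g" by auto
  have d: "(\<lambda>x. g (a *\<^sub>R x + d)) differentiable (at y)" for y
    using has_derivative_affine[OF smooth_differentiable[OF g]] by (rule differentiableI)
  then show "h differentiable (at x)" unfolding h by (intro derivative_intros)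
  have "partial_derivative i h = (\<lambda>x. (c * a) * partial_derivative i g (a *\<^sub>R x + d))"
    unfolding h
    by (rule ext, subst partial_derivative_mult)
      (auto simp: d partial_derivative_affine smooth_differentiable[OF g])
  then show "partial_derivative i h \<in> {\<lambda>x. c * g (a *\<^sub>R x + d) | c g. smooth g}"
    using smooth_partial_derivative[OF g, of i] by blast
qed

subsection \<open>Cut-off functions\<close>

text \<open>The powers of \<open>1/t\<close> are included because \<open>exp (- (1/t))\<close> alone
  is not closed under differentiation: the derivative of \<open>flat n\<close> is a combination of
  \<open>flat (n + 1)\<close> and \<open>flat (n + 2)\<close>.\<close>

definition flat :: "nat \<Rightarrow> real \<Rightarrow> real" where
  "flat n t = (if t > 0 then (1/t)^n * exp (- (1/t)) else 0)"

lemma flat_has_derivative: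
  "(flat n has_real_derivative flat (n + 2) t - real n * flat (n + 1) t) (at t)"
proof -
  consider "t > 0" | "t < 0" | "t = 0" by linarith
  then show ?thesis
  proof cases
    case 1
    have "((\<lambda>t. (1/t)^n * exp (- (1/t))) has_real_derivative flat (n + 2) t - real n * flat (n + 1) t) (at t)"
    proof -
      have "((\<lambda>t. (1/t)^n * exp (- (1/t))) has_real_derivative
          (1/t)^n * (exp (- (1/t)) * (1/t^2)) + real n * (1/t)^(n - 1) * (- (1/t^2)) * exp (- (1/t))) (at t)"
      proof -
        have d: "((\<lambda>t. 1/t) has_real_derivative - (1/t^2)) (at t)"
          using 1 by (auto intro!: derivative_eq_intros simp: power2_eq_square)
        have e: "((\<lambda>t. exp (- (1/t))) has_real_derivative exp (- (1/t)) * (1/t^2)) (at t)"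
          using DERIV_chain'[OF DERIV_minus[OF d] DERIV_exp] by simp
        show ?thesis
          using DERIV_mult[OF DERIV_power[OF d, of n] e] by (simp add: algebra_simps)
      qed
      moreover have eq1: "real n * (1/t)^(n - 1) * (- (1/t^2)) = - (real n * (1/t)^(n+1))"
        using 1 by (cases n) (auto simp: power2_eq_square field_simps)
      have eq2: "(1/t)^n * (exp (- (1/t)) * (1/t^2)) = (1/t)^(n+2) * exp (- (1/t))"
        by (simp add: power_add power2_eq_square)
      have "(1/t)^n * (exp (- (1/t)) * (1/t^2)) + real n * (1/t)^(n - 1) * (- (1/t^2)) * exp (- (1/t))
          = flat (n + 2) t - real n * flat (n + 1) t"
        unfolding eq1 eq2 using 1 by (simp add: flat_def)
      ultimately show ?thesis by simp
    qed
    then show ?thesis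
      by (rule has_field_derivative_transform_within_open[of _ _ _ "{0<..}"])
        (use 1 in \<open>auto simp: flat_def\<close>)
  next
    case 2
    have "((\<lambda>t. 0) has_real_derivative flat (n + 2) t - real n * flat (n + 1) t) (at t)"
      using 2 by (simp add: flat_def)
    then show ?thesis
      by (rule has_field_derivative_transform_within_open[of _ _ _ "{..<0}"])
        (use 2 in \<open>auto simp: flat_def\<close>)
  next
    case 3
    \<comment> \<open>At the origin the difference quotient is computed directly; from the right,
      the substitution of \<open>inverse h\<close> for \<open>h\<close> reduces it to an exponential
      beating a power.\<close>
    have "((\<lambda>h. flat n h / h) \<longlongrightarrow> 0) (at_left 0)"
      by (rule tendsto_eventually) (auto simp: flat_def eventually_at_filter)
    moreover have "((\<lambda>h. flat n h / h) \<longlongrightarrow> 0) (at_right 0)"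
    proof -
      have "((\<lambda>h::real. (inverse h)^(n+1) / exp (inverse h)) \<longlongrightarrow> 0) (at_right 0)"
        using filterlim_compose[OF tendsto_power_div_exp_0 filterlim_inverse_at_top_right] .
      moreover have "eventually (\<lambda>h. (inverse h)^(n+1) / exp (inverse h) = flat n h / h) (at_right (0::real))"
        unfolding eventually_at_filter
        by (auto simp: flat_def exp_minus inverse_eq_divide field_simps)
      ultimately show ?thesis by (rule Lim_transform_eventually)
    qed
    ultimately have "((\<lambda>h. flat n h / h) \<longlongrightarrow> 0) (at 0)" by (rule filterlim_split_at)
    then show ?thesis using 3 by (simp add: has_field_derivative_iff flat_def)
  qed
qed

lemma smooth_flat: "smooth (\<lambda>x::real^'n::finite. flat n (a * x $ i + b))"
proof -
  define B where "B = {\<lambda>x::real^'n. flat n (a * x $ i + b) | n. True}"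
  have deriv: "((\<lambda>x. flat n (a * x $ i + b)) has_derivative
      (\<lambda>h. (flat (n + 2) (a * x $ i + b) - real n * flat (n + 1) (a * x $ i + b)) * (a * h $ i))) (at x)"
    for n and x :: "real^'n"
  proof -
    have "((\<lambda>x. a * x $ i + b) has_derivative (\<lambda>h. a * h $ i)) (at x)"
      by (auto intro!: derivative_eq_intros bounded_linear_imp_has_derivative bounded_linear_vec_nth)
    from diff_chain_at[OF this flat_has_derivative[unfolded has_field_derivative_def]]
    show ?thesis by (simp add: o_def)
  qed
  have partial: "smooth_algebra B (partial_derivative j (\<lambda>x. flat n (a * x $ i + b)))" for j n
  proof -
    have mem: "(\<lambda>x. flat m (a * x $ i + b)) \<in> B" for m by (auto simp: B_def)
    have "partial_derivative j (\<lambda>x. flat n (a * x $ i + b))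
      = (\<lambda>x. (flat (n + 2) (a * x $ i + b) + - real n * flat (n + 1) (a * x $ i + b)) * (a * axis j 1 $ i))"
      by (rule ext, subst partial_derivative_eq[OF deriv]) simp
    then show ?thesis
      by (simp only:) (intro smooth_algebra.mult smooth_algebra.add smooth_algebra.const smooth_algebra.base mem)
  qed
  show ?thesis
  proof (rule smooth_algebra_smooth[of B])
    show "smooth_algebra B (\<lambda>x. flat n (a * x $ i + b))"
      by (rule smooth_algebra.base) (auto simp: B_def)
    fix f j x assume "f \<in> B"
    then obtain m where f: "f = (\<lambda>x. flat m (a * x $ i + b))" by (auto simp: B_def)
    show "f differentiable (at x)" unfolding f by (rule differentiableI[OF deriv])
    show "smooth_algebra B (partial_derivative j f)" unfolding f by (rule partial)
  qed
qed

text \<open>The usual transition from 0 to 1 on the unit interval; \<open>t\<close> and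
  \<open>1 - t\<close> are never both nonpositive, so the denominator does not vanish.\<close>

definition smooth_step :: "real \<Rightarrow> real" where
  "smooth_step t = flat 0 t * inverse (flat 0 t + flat 0 (1 - t))"

lemma flat_0_pos: "t > 0 \<Longrightarrow> 0 < flat 0 t" and flat_0_nonneg: "0 \<le> flat 0 t"
  by (auto simp: flat_def)

lemma smooth_step_denominator_pos: "0 < flat 0 t + flat 0 (1 - t)"
  using flat_0_pos[of t] flat_0_pos[of "1 - t"] flat_0_nonneg[of t] flat_0_nonneg[of "1 - t"]
  by (cases "t > 0") (auto simp: add_pos_nonneg add_nonneg_pos)

lemma smooth_step_range: "0 \<le> smooth_step t" "smooth_step t \<le> 1"
  using smooth_step_denominator_pos[of t] flat_0_nonneg[of t] flat_0_nonneg[of "1 - t"]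
  by (auto simp: smooth_step_def field_simps)

lemma smooth_step_0: "t \<le> 0 \<Longrightarrow> smooth_step t = 0"
  by (simp add: smooth_step_def flat_def)

lemma smooth_step_1: "t \<ge> 1 \<Longrightarrow> smooth_step t = 1"
  using flat_0_pos[of t] by (auto simp: smooth_step_def flat_def field_simps)

lemma smooth_smooth_step: "smooth (\<lambda>x. smooth_step (a * x $ i + b))"
proof -
  have "smooth (\<lambda>x. flat 0 (- a * x $ i + (1 - b)))" by (rule smooth_flat)
  then have "smooth (\<lambda>x. flat 0 (1 - (a * x $ i + b)))" by (simp add: algebra_simps)
  then show ?thesis unfolding smooth_step_def
    by (intro smooth_mult smooth_inverse smooth_add smooth_flat)
      (use smooth_step_denominator_pos in \<open>auto simp: less_imp_neq[symmetric]\<close>)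
qed

text \<open>A product of one-dimensional profiles, equal to 1 on the cube of half-width 1 and to 0
  outside the cube of half-width 2. Only affine functions of single coordinates are fed into
  \<open>smooth_step\<close>, and the factors \<open>1\<close> and \<open>- 1\<close> fit the shape
  of \<open>smooth_smooth_step\<close>. Measured by balls the support has radius
  \<open>2 * sqrt (real CARD('n))\<close>, the origin of the dimensional factor in
  \<open>ratio\<close>.\<close>

definition unit_cutoff :: "real^'n::finite \<Rightarrow> real" where
  "unit_cutoff x = (\<Prod>i\<in>UNIV. smooth_step (1 * x $ i + 2) * smooth_step (- 1 * x $ i + 2))"

definition cutoff :: "real^'n::finite \<Rightarrow> real \<Rightarrow> real^'n \<Rightarrow> real" where
  "cutoff c r x = unit_cutoff (inverse r *\<^sub>R x + - (inverse r *\<^sub>R c))"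

lemma smooth_unit_cutoff: "smooth unit_cutoff"
  unfolding unit_cutoff_def[abs_def] by (intro smooth_prod smooth_mult smooth_smooth_step)

lemma smooth_cutoff: "smooth (cutoff c r)"
  unfolding cutoff_def[abs_def] by (rule smooth_affine[OF smooth_unit_cutoff])

lemma unit_cutoff_range: "0 \<le> unit_cutoff x" "unit_cutoff x \<le> 1"
  unfolding unit_cutoff_def
  by (auto intro!: prod_nonneg prod_le_1 mult_nonneg_nonneg mult_le_one smooth_step_range)

lemma unit_cutoff_1:
  assumes "\<And>i. \<bar>x $ i\<bar> \<le> 1" shows "unit_cutoff x = 1"
  unfolding unit_cutoff_def
proof (intro prod.neutral ballI)
  fix i
  have "1 * x $ i + 2 \<ge> 1" "- 1 * x $ i + 2 \<ge> 1" using assms[of i] by (auto simp: abs_le_iff)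
  then show "smooth_step (1 * x $ i + 2) * smooth_step (- 1 * x $ i + 2) = 1"
    by (simp only: smooth_step_1)
qed

lemma unit_cutoff_0:
  assumes "\<bar>x $ i\<bar> \<ge> 2" shows "unit_cutoff x = 0"
proof -
  have "1 * x $ i + 2 \<le> 0 \<or> - 1 * x $ i + 2 \<le> 0" using assms by (auto simp: abs_if split: if_splits)
  then have "smooth_step (1 * x $ i + 2) * smooth_step (- 1 * x $ i + 2) = 0"
    by (auto simp only: smooth_step_0 mult_zero_left mult_zero_right)
  then show ?thesis unfolding unit_cutoff_def by (intro prod_zero) auto
qed

lemma cutoff_coordinate: "r > 0 \<Longrightarrow> (inverse r *\<^sub>R x + - (inverse r *\<^sub>R c)) $ i = (x - c) $ i / r"
  by (simp add: divide_inverse algebra_simps)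

lemma cutoff_range: "0 \<le> cutoff c r x" "cutoff c r x \<le> 1"
  unfolding cutoff_def by (rule unit_cutoff_range)+

lemma cutoff_1: "r > 0 \<Longrightarrow> norm (x - c) \<le> r \<Longrightarrow> cutoff c r x = 1"
  unfolding cutoff_def
  by (rule unit_cutoff_1, subst cutoff_coordinate)
    (use component_le_norm_cart[of "x - c"] order_trans in \<open>auto simp: field_simps\<close>)

lemma cutoff_0: "r > 0 \<Longrightarrow> norm (x - c) \<ge> 2 * sqrt (real CARD('n)) * r \<Longrightarrow> cutoff c r x = 0"
  for x c :: "real^'n::finite"
proof (rule ccontr)
  assume r: "r > 0" and n: "norm (x - c) \<ge> 2 * sqrt (real CARD('n)) * r" and no: "cutoff c r x \<noteq> 0"
  have lt: "\<bar>(x - c) $ i\<bar> < 2 * r" for i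
  proof (rule ccontr)
    assume "\<not> ?thesis"
    then have "\<bar>(inverse r *\<^sub>R x + - (inverse r *\<^sub>R c)) $ i\<bar> \<ge> 2"
      unfolding cutoff_coordinate[OF r] using r by (simp add: field_simps not_less)
    from unit_cutoff_0[OF this] no show False by (simp add: cutoff_def)
  qed
  have "(norm (x - c))\<^sup>2 = (\<Sum>i\<in>UNIV. ((x - c) $ i)\<^sup>2)"
    by (simp add: norm_vec_def L2_set_def sum_nonneg)
  also have "\<dots> < (\<Sum>i\<in>(UNIV::'n set). (2 * r)\<^sup>2)"
  proof (rule sum_strict_mono)
    show "((x - c) $ i)\<^sup>2 < (2 * r)\<^sup>2" for i
      using power_strict_mono[OF lt[of i], of 2] by simp
  qed auto
  also have "\<dots> = (2 * sqrt (real CARD('n)) * r)\<^sup>2" by (simp add: power_mult_distrib)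
  also have "\<dots> \<le> (norm (x - c))\<^sup>2" using n r by (intro power_mono) auto
  finally show False by simp
qed

section \<open>Test functions\<close>

definition grad :: "(real^'n::finite \<Rightarrow> real) \<Rightarrow> real^'n \<Rightarrow> real^'n" where
  "grad f x = (\<chi> i. partial_derivative i f x)"

lemma grad_nth [simp]: "grad f x $ i = partial_derivative i f x"
  by (simp add: grad_def)

lemma smooth_has_derivative:
  assumes "smooth f" shows "(f has_derivative (\<lambda>h. grad f x \<bullet> h)) (at x)"
proof -
  let ?D = "frechet_derivative f (at x)"
  have d: "(f has_derivative ?D) (at x)"
    by (rule has_derivative_frechet[OF smooth_differentiable[OF assms]])
  have "?D h = grad f x \<bullet> h" for h
  proof -
    have "?D h = ?D (\<Sum>i\<in>UNIV. h $ i *\<^sub>R axis i 1)"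
      using basis_expansion[of h] by (simp add: scalar_mult_eq_scaleR)
    also have "\<dots> = (\<Sum>i\<in>UNIV. h $ i * ?D (axis i 1))"
      using has_derivative_linear[OF d] by (simp add: linear_sum linear_scale)
    finally show ?thesis
      by (simp add: inner_vec_def partial_derivative_def mult.commute)
  qed
  then have "?D = (\<lambda>h. grad f x \<bullet> h)" by (rule ext)
  with d show ?thesis by simp
qed

lemma smooth_continuous: "smooth f \<Longrightarrow> continuous_on S f"
  by (meson continuous_at_imp_continuous_on differentiable_imp_continuous_within smooth_differentiable)

lemma continuous_grad: "smooth f \<Longrightarrow> continuous_on S (grad f)"
  unfolding grad_def[abs_def] by (intro continuous_intros smooth_continuous smooth_partial_derivative)

lemma smooth_borel [measurable (raw)]: "smooth f \<Longrightarrow> f \<in> borel_measurable borel"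
  by (rule borel_measurable_continuous_onI) (rule smooth_continuous)

lemma grad_borel [measurable (raw)]: "smooth f \<Longrightarrow> grad f \<in> borel_measurable borel"
  by (rule borel_measurable_continuous_onI) (rule continuous_grad)

lemma borel_imp_lebesgue_on: "f \<in> borel_measurable borel \<Longrightarrow> f \<in> borel_measurable (lebesgue_on S)"
  for f :: "'a::euclidean_space \<Rightarrow> 'b::topological_space"
  by (intro measurable_restrict_space1 measurable_completion) simp

lemma grad_add: "smooth f \<Longrightarrow> smooth g \<Longrightarrow> grad (\<lambda>x. f x + g x) x = grad f x + grad g x"
  by (simp add: vec_eq_iff partial_derivative_add smooth_differentiable)

lemma grad_mult: "smooth f \<Longrightarrow> smooth g \<Longrightarrow> grad (\<lambda>x. f x * g x) x = f x *\<^sub>R grad g x + g x *\<^sub>R grad f x"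
  by (simp add: vec_eq_iff partial_derivative_mult smooth_differentiable mult.commute)

lemma grad_const [simp]: "grad (\<lambda>x. c) x = 0"
  by (simp add: vec_eq_iff)

lemma grad_cmult: "smooth f \<Longrightarrow> grad (\<lambda>x. c * f x) x = c *\<^sub>R grad f x"
  by (subst grad_mult) auto

lemma grad_diff: "smooth f \<Longrightarrow> smooth g \<Longrightarrow> grad (\<lambda>x. f x - g x) x = grad f x - grad g x"
  using grad_add[of f "\<lambda>x. - 1 * g x"] grad_cmult[of g "-1"] smooth_mult[of "\<lambda>x. - 1" g] by simp

lemma grad_inner: "grad (\<lambda>x. v \<bullet> x) x = v"
proof -
  have "((\<lambda>x. v \<bullet> x) has_derivative (\<lambda>h. v \<bullet> h)) (at x)" by (auto intro!: derivative_eq_intros)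
  then show ?thesis by (simp add: vec_eq_iff partial_derivative_eq inner_axis)
qed

lemma test_functionI:
  assumes "smooth f" "compact K" "K \<subseteq> \<Omega>" "\<And>x. x \<notin> K \<Longrightarrow> f x = 0"
  shows "f \<in> test_functions \<Omega>"
proof -
  have "closure {x. f x \<noteq> 0} \<subseteq> K"
    using assms(2,4) by (intro closure_minimal) (auto intro: compact_imp_closed)
  moreover have "compact (closure {x. f x \<noteq> 0})"
    using assms(2) calculation by (metis closed_closure compact_Int_closed inf.absorb_iff2)
  ultimately show ?thesis using assms by (auto simp: test_functions_def)
qed

lemma test_functionE:
  assumes "f \<in> test_functions \<Omega>"
  obtains K where "smooth f" "compact K" "K \<subseteq> \<Omega>" "\<forall>x. x \<notin> K \<longrightarrow> f x = 0"
proof (rule that[of "closure {x. f x \<noteq> 0}"])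
  show "\<forall>x. x \<notin> closure {x. f x \<noteq> 0} \<longrightarrow> f x = 0" using closure_subset[of "{x. f x \<noteq> 0}"] by auto
qed (use assms in \<open>auto simp: test_functions_def\<close>)

lemma test_function_smooth: "f \<in> test_functions \<Omega> \<Longrightarrow> smooth f"
  by (simp add: test_functions_def)

lemma test_function_outside: "f \<in> test_functions \<Omega> \<Longrightarrow> x \<notin> \<Omega> \<Longrightarrow> f x = 0"
  by (metis test_functionE subsetD)

lemma partial_derivative_outside:
  assumes "closed K" "\<And>x. x \<notin> K \<Longrightarrow> f x = 0" "x \<notin> K"
  shows "partial_derivative i f x = 0"
proof -
  have "((\<lambda>x. 0) has_derivative (\<lambda>h. 0)) (at x)" by simp
  then have "(f has_derivative (\<lambda>h. 0)) (at x)"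
    by (rule has_derivative_transform_within_open[of _ _ _ _ "- K"]) (use assms in auto)
  then show ?thesis by (rule partial_derivative_eq)
qed

lemma grad_outside:
  assumes "closed K" "\<And>x. x \<notin> K \<Longrightarrow> f x = 0" "x \<notin> K"
  shows "grad f x = 0"
  using partial_derivative_outside[OF assms] by (simp add: vec_eq_iff)

lemma test_function_grad_outside: "f \<in> test_functions \<Omega> \<Longrightarrow> x \<notin> \<Omega> \<Longrightarrow> grad f x = 0"
  by (metis test_functionE compact_imp_closed grad_outside subsetD)

lemma test_function_partial: "f \<in> test_functions \<Omega> \<Longrightarrow> partial_derivative i f \<in> test_functions \<Omega>"
  by (erule test_functionE) (auto intro!: test_functionI partial_derivative_outside
    smooth_partial_derivative compact_imp_closed)

lemma test_function_add:
  assumes "f \<in> test_functions \<Omega>" "g \<in> test_functions \<Omega>"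
  shows "(\<lambda>x. f x + g x) \<in> test_functions \<Omega>"
proof -
  obtain K where K: "smooth f" "compact K" "K \<subseteq> \<Omega>" "\<forall>x. x \<notin> K \<longrightarrow> f x = 0"
    using assms(1) by (rule test_functionE)
  obtain L where L: "smooth g" "compact L" "L \<subseteq> \<Omega>" "\<forall>x. x \<notin> L \<longrightarrow> g x = 0"
    using assms(2) by (rule test_functionE)
  show ?thesis
    by (rule test_functionI[of _ "K \<union> L"]) (use K L in \<open>auto intro: smooth_add compact_Un\<close>)
qed

lemma test_function_mult_smooth:
  assumes "f \<in> test_functions \<Omega>" "smooth g"
  shows "(\<lambda>x. f x * g x) \<in> test_functions \<Omega>"
proof -
  obtain K where K: "smooth f" "compact K" "K \<subseteq> \<Omega>" "\<forall>x. x \<notin> K \<longrightarrow> f x = 0"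
    using assms(1) by (rule test_functionE)
  show ?thesis
    by (rule test_functionI[of _ K]) (use K assms(2) in \<open>auto intro: smooth_mult\<close>)
qed

lemma test_function_smooth_mult:
  "smooth g \<Longrightarrow> f \<in> test_functions \<Omega> \<Longrightarrow> (\<lambda>x. g x * f x) \<in> test_functions \<Omega>"
  using test_function_mult_smooth[of f \<Omega> g] by (simp add: mult.commute)

lemma test_function_zero: "(\<lambda>x. 0) \<in> test_functions \<Omega>"
  by (rule test_functionI[of _ "{}"]) auto

lemma continuous_outside_compact_bounded:
  fixes f :: "'a::topological_space \<Rightarrow> 'b::real_normed_vector"
  assumes "continuous_on UNIV f" "compact K" "\<And>x. x \<notin> K \<Longrightarrow> f x = 0"
  obtains C where "0 \<le> C" "\<And>x. norm (f x) \<le> C"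
proof -
  have "compact (f ` K)" using assms by (intro compact_continuous_image) (auto intro: continuous_on_subset)
  then obtain C where "\<forall>y\<in>f ` K. norm y \<le> C" using compact_imp_bounded bounded_iff by metis
  then have "norm (f x) \<le> max C 0" for x using assms(3)[of x] by (cases "x \<in> K") auto
  then show ?thesis by (intro that[of "max C 0"]) auto
qed

lemma test_function_bounded:
  assumes "f \<in> test_functions \<Omega>"
  obtains C where "0 \<le> C" "\<And>x. \<bar>f x\<bar> \<le> C"
proof -
  obtain K where K: "smooth f" "compact K" "K \<subseteq> \<Omega>" "\<forall>x. x \<notin> K \<longrightarrow> f x = 0"
    using assms by (rule test_functionE)
  show ?thesis
    using continuous_outside_compact_bounded[OF smooth_continuous[OF K(1)] K(2) K(4)[rule_format]] that by auto
qed

lemma test_function_grad_bounded: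
  assumes "f \<in> test_functions \<Omega>"
  obtains C where "0 \<le> C" "\<And>x. norm (grad f x) \<le> C"
proof -
  obtain K where K: "smooth f" "compact K" "K \<subseteq> \<Omega>" "\<forall>x. x \<notin> K \<longrightarrow> f x = 0"
    using assms by (rule test_functionE)
  show ?thesis
    using continuous_outside_compact_bounded[OF continuous_grad[OF K(1)] K(2)]
      grad_outside[OF compact_imp_closed[OF K(2)] K(4)[rule_format]] that by auto
qed

section \<open>Integration by parts for test functions\<close>

lemma continuous_compact_support_integrable:
  fixes f :: "'a::euclidean_space \<Rightarrow> 'b::{banach, second_countable_topology}"
  assumes "continuous_on UNIV f" "compact K" "\<And>x. x \<notin> K \<Longrightarrow> f x = 0"
  shows "integrable lborel f"
proof -
  have "integrable lborel (\<lambda>x. indicator K x *\<^sub>R f x)"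
    using assms by (intro borel_integrable_compact) (auto intro: continuous_on_subset)
  moreover have "(\<lambda>x. indicator K x *\<^sub>R f x) = f"
    using assms(3) by (auto simp: indicator_def fun_eq_iff)
  ultimately show ?thesis by simp
qed

lemma test_function_integrable:
  assumes "f \<in> test_functions \<Omega>" shows "integrable lborel f"
proof -
  obtain K where K: "smooth f" "compact K" "K \<subseteq> \<Omega>" "\<forall>x. x \<notin> K \<longrightarrow> f x = 0"
    using assms by (rule test_functionE)
  show ?thesis
    by (rule continuous_compact_support_integrable[OF smooth_continuous[OF K(1)] K(2) K(4)[rule_format]])
qed

lemma integrable_lebesgue_on_of_lborel:
  fixes f :: "'a::euclidean_space \<Rightarrow> 'b::{banach, second_countable_topology}"
  assumes "integrable lborel f" "S \<in> sets lebesgue"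
  shows "integrable (lebesgue_on S) f"
proof -
  have "integrable lebesgue f" using assms(1) by (simp add: integrable_completion)
  then show ?thesis using assms(2)
    by (simp add: integrable_restrict_space integrable_mult_indicator)
qed

lemma integral_lebesgue_on_eq_lborel:
  fixes f :: "'a::euclidean_space \<Rightarrow> 'b::{banach, second_countable_topology}"
  assumes "f \<in> borel_measurable borel" "S \<in> sets lebesgue" "\<And>x. x \<notin> S \<Longrightarrow> f x = 0"
  shows "(LINT x|lebesgue_on S. f x) = (LINT x|lborel. f x)"
proof -
  have "(LINT x|lebesgue_on S. f x) = (LINT x|lebesgue. indicator S x *\<^sub>R f x)"
    using assms(2) by (simp add: integral_restrict_space)
  also have "(\<lambda>x. indicator S x *\<^sub>R f x) = f" using assms(3) by (auto simp: indicator_def fun_eq_iff)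
  also have "(LINT x|lebesgue. f x) = (LINT x|lborel. f x)"
    using assms(1) by (intro integral_completion) simp
  finally show ?thesis .
qed

lemma lborel_integral_translation:
  fixes f :: "'a::euclidean_space \<Rightarrow> 'b::{banach, second_countable_topology}"
  assumes "f \<in> borel_measurable borel"
  shows "(LINT x|lborel. f (z + x)) = (LINT x|lborel. f x)"
  using integral_distr[of "(+) z" lborel borel f] assms by (simp add: lborel_distr_plus)

lemma integrable_lborel_translation:
  fixes f :: "'a::euclidean_space \<Rightarrow> 'b::{banach, second_countable_topology}"
  assumes "integrable lborel f"
  shows "integrable lborel (\<lambda>x. f (z + x))"
  using integrable_distr[of "(+) z" lborel borel f] assms by (simp add: lborel_distr_plus)

lemma smooth_difference_bound:
  assumes f: "smooth f" and C: "\<And>x. norm (grad f x) \<le> C"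
  shows "\<bar>f (x + h) - f x\<bar> \<le> C * norm h"
proof -
  have "norm (f (x + h) - f x) \<le> C * norm (x + h - x)"
  proof (rule differentiable_bound[OF convex_UNIV smooth_has_derivative[OF f, THEN has_derivative_at_withinI]])
    show "onorm (\<lambda>h. grad f y \<bullet> h) \<le> C" for y
      by (rule onorm_le) (use C[of y] Cauchy_Schwarz_ineq2[of "grad f y"]
        mult_right_mono[OF C[of y] norm_ge_zero] in \<open>auto intro: order_trans\<close>)
  qed auto
  then show ?thesis by simp
qed

text \<open>By translation invariance every difference quotient has integral zero, and dominated
  convergence passes to the derivative. The quotients are bounded by a bound \<open>C\<close> of the
  gradient and, the steps being of length at most 1, vanish outside the ball of radius
  \<open>R + 1\<close>.\<close>

lemma integral_partial_derivative_zero: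
  assumes f: "f \<in> test_functions (\<Omega> :: (real^'n::finite) set)"
  shows "(LINT x|lborel. partial_derivative i f x) = 0"
proof -
  obtain K where K: "smooth f" "compact K" "K \<subseteq> \<Omega>" "\<forall>x. x \<notin> K \<longrightarrow> f x = 0"
    using f by (rule test_functionE)
  obtain C where C: "0 \<le> C" "\<And>x. norm (grad f x) \<le> C" using test_function_grad_bounded[OF f] by auto
  obtain R where R: "\<And>x. x \<in> K \<Longrightarrow> norm x \<le> R"
    using compact_imp_bounded[OF K(2)] unfolding bounded_iff by auto
  define h where "h n = inverse (real (Suc n))" for n
  have h: "h n > 0" "h n \<le> 1" for n by (auto simp: h_def field_simps)
  have h0: "h \<longlonglongrightarrow> 0" unfolding h_def[abs_def] by (rule LIMSEQ_inverse_real_of_nat)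
  define g where "g n x = inverse (h n) * (f (h n *\<^sub>R axis i 1 + x) - f x)" for n x
  have [measurable]: "f \<in> borel_measurable borel" by (rule smooth_borel[OF K(1)])
  have int: "integrable lborel f" by (rule test_function_integrable[OF f])
  have "(LINT x|lborel. g n x) = 0" for n
    unfolding g_def
    using int integrable_lborel_translation[OF int, of "h n *\<^sub>R axis i 1"]
    by (simp add: lborel_integral_translation)
  moreover have "(\<lambda>n. LINT x|lborel. g n x) \<longlonglongrightarrow> (LINT x|lborel. partial_derivative i f x)"
  proof (rule integral_dominated_convergence)
    show "partial_derivative i f \<in> borel_measurable lborel"
      using smooth_borel[OF smooth_partial_derivative[OF K(1)]] by simp
    show "g n \<in> borel_measurable lborel" for n unfolding g_def by measurable
    show "integrable lborel (\<lambda>x::real^'n. C * indicator (cball 0 (R + 1)) x)"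
      by (intro integrable_mult_right integrable_real_indicator) (simp_all add: emeasure_bounded_finite[unfolded infinity_ennreal_def])
    show "AE x in lborel. norm (g n x) \<le> C * indicator (cball 0 (R + 1)) x" for n
    proof (rule AE_I2)
      fix x
      show "norm (g n x) \<le> C * indicator (cball 0 (R + 1)) x"
      proof (cases "x \<in> cball 0 (R + 1)")
        case True
        have "\<bar>f (h n *\<^sub>R axis i 1 + x) - f x\<bar> \<le> C * h n"
          using smooth_difference_bound[OF K(1) C(2), of x "h n *\<^sub>R axis i 1"] h(1)[of n]
          by (simp add: add.commute)
        then show ?thesis using True h(1)[of n] by (simp add: g_def abs_mult field_simps)
      next
        case False
        have "norm x \<le> norm (h n *\<^sub>R axis i 1 + x) + norm (h n *\<^sub>R axis i (1::real) :: real^'n)"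
          using norm_triangle_ineq4[of "h n *\<^sub>R axis i 1 + x" "h n *\<^sub>R axis i 1"] by simp
        then have "norm (h n *\<^sub>R axis i 1 + x) > R" "norm x > R"
          using False h[of n] by auto
        then have "f (h n *\<^sub>R axis i 1 + x) = 0" "f x = 0" using R K(4) by (meson not_le)+
        then show ?thesis using C(1) by (simp add: g_def)
      qed
    qed
    show "AE x in lborel. (\<lambda>n. g n x) \<longlonglongrightarrow> partial_derivative i f x"
    proof (rule AE_I2)
      fix x :: "real^'n"
      have d1: "((\<lambda>t. x + t *\<^sub>R axis i 1) has_derivative (\<lambda>t. t *\<^sub>R axis i 1)) (at (0::real))"
        by (auto intro!: derivative_eq_intros)
      have d2: "(f has_derivative (\<lambda>h. grad f x \<bullet> h)) (at (x + 0 *\<^sub>R axis i (1::real)))"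
        using smooth_has_derivative[OF K(1), of x] by simp
      have "((\<lambda>t. f (x + t *\<^sub>R axis i 1)) has_field_derivative partial_derivative i f x) (at 0)"
        using diff_chain_at[OF d1 d2]
        by (simp add: has_field_derivative_def o_def inner_axis mult_commute_abs)
      then have "(\<lambda>t. (f (x + t *\<^sub>R axis i 1) - f x) / t) \<midarrow>0\<rightarrow> partial_derivative i f x"
        by (simp add: has_field_derivative_iff)
      moreover have "filterlim h (at 0) sequentially"
        unfolding filterlim_at using h0 h(1) by (auto simp: less_imp_neq[symmetric])
      ultimately have "(\<lambda>n. (f (x + h n *\<^sub>R axis i 1) - f x) / h n) \<longlonglongrightarrow> partial_derivative i f x"
        by (rule filterlim_compose)
      then show "(\<lambda>n. g n x) \<longlonglongrightarrow> partial_derivative i f x"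
        by (simp add: g_def divide_inverse mult.commute add.commute)
    qed
  qed
  ultimately show ?thesis by (simp add: LIMSEQ_const_iff)
qed

lemma test_function_integration_by_parts:
  fixes f :: "real^'n::finite \<Rightarrow> real"
  assumes f: "f \<in> test_functions \<Omega>" and g: "smooth g"
  shows "(LINT x|lborel. g x * partial_derivative i f x) = - (LINT x|lborel. partial_derivative i g x * f x)"
proof -
  note sm = smooth_differentiable[OF test_function_smooth[OF f]] smooth_differentiable[OF g]
  have "0 = (LINT x|lborel. g x * partial_derivative i f x + partial_derivative i g x * f x)"
    using integral_partial_derivative_zero[OF test_function_smooth_mult[OF g f], of i]
    by (simp add: partial_derivative_mult sm)
  also have "\<dots> = (LINT x|lborel. g x * partial_derivative i f x) + (LINT x|lborel. partial_derivative i g x * f x)"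
    using test_function_integrable[OF test_function_smooth_mult[OF g test_function_partial[OF f, of i]]]
      test_function_integrable[OF test_function_smooth_mult[OF smooth_partial_derivative[OF g, of i] f]]
    by (rule Bochner_Integration.integral_add)
  finally show ?thesis by simp
qed

section \<open>Localisation, polynomial approximation and the fundamental lemma\<close>

lemma AE_lebesgue_on_iff:
  "S \<in> sets lebesgue \<Longrightarrow> (AE x in lebesgue_on S. P x) \<longleftrightarrow> (AE x in lebesgue. x \<in> S \<longrightarrow> P x)"
  by (subst AE_restrict_space_iff) auto

text \<open>Lindelof's theorem reduces the open sets given at the points of \<open>S\<close> to
  countably many, whose null sets may be united. Pointwise relations can thus be proved near one
  point at a time.\<close>

lemma AE_lebesgue_on_locally:
  fixes S :: "'a::euclidean_space set"
  assumes S: "S \<in> sets lebesgue"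
    and loc: "\<And>x. x \<in> S \<Longrightarrow> \<exists>U. open U \<and> x \<in> U \<and> (AE y in lebesgue_on S. y \<in> U \<longrightarrow> P y)"
  shows "AE y in lebesgue_on S. P y"
proof -
  define F where "F = {U. open U \<and> (AE y in lebesgue_on S. y \<in> U \<longrightarrow> P y)}"
  obtain F' where F': "F' \<subseteq> F" "countable F'" "\<Union>F' = \<Union>F"
    using Lindelof[of F] by (auto simp: F_def)
  have "AE y in lebesgue_on S. \<forall>U\<in>F'. y \<in> U \<longrightarrow> P y"
    using F'(1,2) by (subst AE_ball_countable) (auto simp: F_def)
  moreover have "AE y in lebesgue_on S. y \<in> S"
    using S by (simp add: AE_lebesgue_on_iff)
  ultimately show ?thesis
  proof eventually_elim
    fix y assume y: "\<forall>U\<in>F'. y \<in> U \<longrightarrow> P y" "y \<in> S"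
    then have "y \<in> \<Union>F" using loc[of y] by (auto simp: F_def)
    then show "P y" using y F'(3) by blast
  qed
qed

text \<open>A measurable function is an almost everywhere limit of continuous functions; these are
  truncated at \<open>C\<close> and approximated uniformly on \<open>K\<close> by Stone-Weierstrass.
  Polynomials are chosen because they are smooth: times a test function they give a test function,
  which \<open>b\<close> does not.\<close>

lemma bounded_measurable_polynomial_approximation:
  fixes b :: "'a::euclidean_space \<Rightarrow> real"
  assumes b: "b \<in> borel_measurable lebesgue" "\<And>x. \<bar>b x\<bar> \<le> C" and K: "compact K"
  obtains p where "\<And>j::nat. real_polynomial_function (p j)" "\<And>j x. x \<in> K \<Longrightarrow> \<bar>p j x\<bar> \<le> C + 1"
    "AE x in lebesgue. x \<in> K \<longrightarrow> (\<lambda>j. p j x) \<longlonglongrightarrow> b x"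
proof -
  have "b \<in> borel_measurable (lebesgue_on UNIV)" using b(1) by simp
  then have "b measurable_on UNIV" by (intro lebesgue_measurable_imp_measurable_on) auto
  then obtain N g where g: "negligible N" "\<And>n::nat. continuous_on UNIV (g n)"
    "\<And>x. x \<notin> N \<Longrightarrow> (\<lambda>n. g n x) \<longlonglongrightarrow> b x"
    unfolding measurable_on_def by auto
  define h where "h n x = max (- C) (min C (g n x))" for n x
  have hc: "continuous_on K (h n)" for n
    unfolding h_def[abs_def] by (intro continuous_intros continuous_on_subset[OF g(2)]) auto
  have C0: "0 \<le> C" using b(2)[of undefined] by linarith
  have "\<exists>q. real_polynomial_function q \<and> (\<forall>x\<in>K. \<bar>h n x - q x\<bar> < inverse (real (Suc n)))" for n
    by (rule Stone_Weierstrass_real_polynomial_function[OF K hc]) auto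
  then obtain p where p: "\<And>n. real_polynomial_function (p n)"
    "\<And>n x. x \<in> K \<Longrightarrow> \<bar>h n x - p n x\<bar> < inverse (real (Suc n))" by metis
  show ?thesis
  proof (rule that[of p, OF p(1)])
    fix j x assume "x \<in> K"
    from p(2)[OF this, of j] have "\<bar>h j x - p j x\<bar> < 1" by (smt (verit) inverse_le_1_iff of_nat_Suc of_nat_0_le_iff)
    moreover have "\<bar>h j x\<bar> \<le> C" using C0 by (auto simp: h_def)
    ultimately show "\<bar>p j x\<bar> \<le> C + 1" by linarith
  next
    have "AE x in lebesgue. x \<notin> N"
      using g(1) by (simp add: AE_not_in negligible_iff_null_sets)
    then show "AE x in lebesgue. x \<in> K \<longrightarrow> (\<lambda>j. p j x) \<longlonglongrightarrow> b x"
    proof (eventually_elim, intro impI)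
      fix x assume x: "x \<notin> N" "x \<in> K"
      have "(\<lambda>n. h n x) \<longlonglongrightarrow> max (- C) (min C (b x))"
        unfolding h_def by (intro tendsto_intros g(3) x)
      also have "max (- C) (min C (b x)) = b x" using b(2)[of x] by (auto simp: abs_le_iff)
      finally have 1: "(\<lambda>n. h n x) \<longlonglongrightarrow> b x" .
      have "(\<lambda>n. h n x - p n x) \<longlonglongrightarrow> 0"
        by (rule Lim_null_comparison[OF _ LIMSEQ_inverse_real_of_nat])
          (use p(2)[OF x(2)] in \<open>auto intro!: always_eventually less_imp_le\<close>)
      from tendsto_diff[OF 1 this] show "(\<lambda>j. p j x) \<longlonglongrightarrow> b x" by simp
    qed
  qed
qed

lemma cutoff_test_function:
  fixes c :: "real^'n::finite"
  assumes "r > 0" "cball c (2 * sqrt (real CARD('n)) * r) \<subseteq> \<Omega>"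
  shows "cutoff c r \<in> test_functions \<Omega>"
proof (rule test_functionI[OF smooth_cutoff compact_cball assms(2)])
  fix x assume "x \<notin> cball c (2 * sqrt (real CARD('n)) * r)"
  then show "cutoff c r x = 0"
    by (intro cutoff_0 assms) (simp add: dist_norm norm_minus_commute)
qed

lemma exists_local_cutoff:
  fixes \<Omega> :: "(real^'n::finite) set"
  assumes "open \<Omega>" "x \<in> \<Omega>"
  obtains r where "r > 0" "cutoff x r \<in> test_functions \<Omega>" "ball x r \<subseteq> \<Omega>" "\<And>y. y \<in> ball x r \<Longrightarrow> cutoff x r y = 1"
proof -
  obtain e where e: "e > 0" "cball x e \<subseteq> \<Omega>" using assms open_contains_cball by blast
  define r where "r = e / (2 * sqrt (real CARD('n)))"
  have n: "sqrt (real CARD('n)) \<ge> 1" by (simp add: Suc_leI)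
  have r: "r > 0" "2 * sqrt (real CARD('n)) * r = e" using e n by (auto simp: r_def)
  have "1 \<le> 2 * sqrt (real CARD('n))" using n by linarith
  then have "r \<le> e" unfolding r_def using e by (simp add: field_simps)
  then have "ball x r \<subseteq> \<Omega>" using e(2) by (auto simp: subset_eq)
  then show ?thesis
    by (intro that[of r] r cutoff_test_function cutoff_1)
      (use e r in \<open>auto simp: dist_norm norm_minus_commute\<close>)
qed

text \<open>Tested with \<open>\<phi> * p\<^sup>2\<close>, where the polynomials \<open>p\<close>
  tend to the indicator of the set \<open>E\<close> on which \<open>h\<close> is negative; the
  squares keep the test functions nonnegative. In the limit the integral of
  \<open>h * \<phi>\<close> over \<open>E\<close> is nonnegative although its integrand is
  nonpositive, so \<open>E\<close> is null where \<open>\<phi> = 1\<close>.\<close>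

theorem fundamental_lemma_nonneg:
  fixes h :: "real^'n::finite \<Rightarrow> real"
  assumes \<Omega>: "open \<Omega>" and h: "h \<in> borel_measurable (lebesgue_on \<Omega>)"
    and int: "\<And>\<phi>. \<phi> \<in> test_functions \<Omega> \<Longrightarrow> integrable (lebesgue_on \<Omega>) (\<lambda>x. h x * \<phi> x)"
    and nonneg: "\<And>\<phi>. \<phi> \<in> test_functions \<Omega> \<Longrightarrow> (\<And>x. 0 \<le> \<phi> x) \<Longrightarrow> 0 \<le> (LINT x|lebesgue_on \<Omega>. h x * \<phi> x)"
  shows "AE x in lebesgue_on \<Omega>. 0 \<le> h x"
proof (rule AE_lebesgue_on_locally)
  show \<Omega>m: "\<Omega> \<in> sets lebesgue" using \<Omega> by auto
  define E where "E = {x \<in> \<Omega>. h x < 0}"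
  have "{x \<in> space (lebesgue_on \<Omega>). h x < 0} \<in> sets (lebesgue_on \<Omega>)" using h by measurable
  then have E: "E \<in> sets lebesgue" using \<Omega>m by (simp add: E_def sets_restrict_space_iff)
  fix x assume "x \<in> \<Omega>"
  then obtain r where r: "r > 0" "cutoff x r \<in> test_functions \<Omega>" "ball x r \<subseteq> \<Omega>"
    "\<And>y. y \<in> ball x r \<Longrightarrow> cutoff x r y = 1" using exists_local_cutoff[OF \<Omega>] by blast
  define \<phi> where "\<phi> = cutoff x r"
  have \<phi>: "\<phi> \<in> test_functions \<Omega>" "\<And>x. 0 \<le> \<phi> x" using r(2) cutoff_range by (auto simp: \<phi>_def)
  obtain K where K: "compact K" "K \<subseteq> \<Omega>" "\<forall>x. x \<notin> K \<longrightarrow> \<phi> x = 0" using \<phi>(1) by (rule test_functionE)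
  obtain p where p: "\<And>j::nat. real_polynomial_function (p j)" "\<And>j x. x \<in> K \<Longrightarrow> \<bar>p j x\<bar> \<le> 1 + 1"
    "AE x in lebesgue. x \<in> K \<longrightarrow> (\<lambda>j. p j x) \<longlonglongrightarrow> indicator E x"
    by (rule bounded_measurable_polynomial_approximation[of "indicator E" 1 K])
      (use E K in \<open>auto simp: indicator_def\<close>)
  have test: "(\<lambda>x. \<phi> x * (p j x * p j x)) \<in> test_functions \<Omega>" for j
    using p(1)[THEN smooth_real_polynomial_function] by (intro test_function_mult_smooth \<phi> smooth_mult)
  have "(\<lambda>j. LINT x|lebesgue_on \<Omega>. h x * (\<phi> x * (p j x * p j x)))
      \<longlonglongrightarrow> (LINT x|lebesgue_on \<Omega>. h x * (\<phi> x * (indicator E x * indicator E x)))"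
  proof (rule integral_dominated_convergence[where w = "\<lambda>x. 4 * \<bar>h x * \<phi> x\<bar>"])
    show "integrable (lebesgue_on \<Omega>) (\<lambda>x. 4 * \<bar>h x * \<phi> x\<bar>)" using int[OF \<phi>(1)] by simp
    show "(\<lambda>x. h x * (\<phi> x * (p j x * p j x))) \<in> borel_measurable (lebesgue_on \<Omega>)" for j
      using int[OF test[of j]] by (rule borel_measurable_integrable)
    have "\<phi> \<in> borel_measurable (lebesgue_on \<Omega>)"
      by (intro borel_imp_lebesgue_on smooth_borel test_function_smooth[OF \<phi>(1)])
    moreover have "indicator E \<in> borel_measurable (lebesgue_on \<Omega>)"
      using E by (intro measurable_restrict_space1) auto
    ultimately show "(\<lambda>x. h x * (\<phi> x * (indicator E x * indicator E x))) \<in> borel_measurable (lebesgue_on \<Omega>)"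
      using h by measurable
    show "AE x in lebesgue_on \<Omega>. (\<lambda>j. h x * (\<phi> x * (p j x * p j x)))
        \<longlonglongrightarrow> h x * (\<phi> x * (indicator E x * indicator E x))"
      unfolding AE_lebesgue_on_iff[OF \<Omega>m] using p(3)
    proof (eventually_elim, intro impI)
      fix x assume "x \<in> K \<longrightarrow> (\<lambda>j. p j x) \<longlonglongrightarrow> indicator E x"
      then show "(\<lambda>j. h x * (\<phi> x * (p j x * p j x))) \<longlonglongrightarrow> h x * (\<phi> x * (indicator E x * indicator E x))"
        using K(3) by (cases "x \<in> K") (auto intro!: tendsto_intros)
    qed
    show "AE x in lebesgue_on \<Omega>. norm (h x * (\<phi> x * (p j x * p j x))) \<le> 4 * \<bar>h x * \<phi> x\<bar>" for j
    proof (rule AE_I2)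
      fix x
      show "norm (h x * (\<phi> x * (p j x * p j x))) \<le> 4 * \<bar>h x * \<phi> x\<bar>"
      proof (cases "x \<in> K")
        case True
        have "\<bar>p j x\<bar> * \<bar>p j x\<bar> \<le> 2 * 2" using p(2)[OF True, of j] by (intro mult_mono) auto
        from mult_left_mono[OF this, of "\<bar>h x * \<phi> x\<bar>"] show ?thesis by (simp add: abs_mult mult_ac)
      qed (use K(3) in auto)
    qed
  qed
  then have ge: "0 \<le> (LINT x|lebesgue_on \<Omega>. h x * (\<phi> x * (indicator E x * indicator E x)))"
    by (rule LIMSEQ_le_const) (use nonneg[OF test] \<phi>(2) in auto)
  define k where "k x = - (h x * (\<phi> x * (indicator E x * indicator E x)))" for x
  have k0: "0 \<le> k x" for x
    using \<phi>(2)[of x] by (auto simp: k_def indicator_def E_def mult_nonpos_nonneg less_imp_le)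
  have "integrable (lebesgue_on \<Omega>) (\<lambda>x. indicator E x *\<^sub>R (h x * \<phi> x))"
  proof (rule integrable_mult_indicator[OF _ int[OF \<phi>(1)]])
    show "E \<in> sets (lebesgue_on \<Omega>)" using E \<Omega>m by (auto simp: sets_restrict_space_iff E_def)
  qed
  then have "integrable (lebesgue_on \<Omega>) k"
    unfolding k_def by (simp add: mult_ac indicator_inter_arith[symmetric])
  moreover have "(LINT x|lebesgue_on \<Omega>. k x) \<le> 0" using ge by (simp add: k_def)
  ultimately have "AE x in lebesgue_on \<Omega>. k x = 0"
    using k0 by (subst integral_nonneg_eq_0_iff_AE[symmetric]) (auto intro: antisym integral_nonneg_AE)
  moreover have "AE x in lebesgue_on \<Omega>. x \<in> \<Omega>" using \<Omega>m by (simp add: AE_lebesgue_on_iff)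
  ultimately have "AE y in lebesgue_on \<Omega>. y \<in> ball x r \<longrightarrow> 0 \<le> h y"
    by eventually_elim (auto simp: k_def \<phi>_def r(4) indicator_def E_def split: if_splits)
  with r(1) show "\<exists>U. open U \<and> x \<in> U \<and> (AE y in lebesgue_on \<Omega>. y \<in> U \<longrightarrow> 0 \<le> h y)"
    by (intro exI[of _ "ball x r"]) auto
qed

theorem fundamental_lemma:
  fixes h :: "real^'n::finite \<Rightarrow> real"
  assumes \<Omega>: "open \<Omega>" and h: "h \<in> borel_measurable (lebesgue_on \<Omega>)"
    and int: "\<And>\<phi>. \<phi> \<in> test_functions \<Omega> \<Longrightarrow> integrable (lebesgue_on \<Omega>) (\<lambda>x. h x * \<phi> x)"
    and zero: "\<And>\<phi>. \<phi> \<in> test_functions \<Omega> \<Longrightarrow> (LINT x|lebesgue_on \<Omega>. h x * \<phi> x) = 0"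
  shows "AE x in lebesgue_on \<Omega>. h x = 0"
proof -
  have "AE x in lebesgue_on \<Omega>. 0 \<le> h x"
    by (rule fundamental_lemma_nonneg[OF \<Omega> h int]) (auto simp: zero)
  moreover have "AE x in lebesgue_on \<Omega>. 0 \<le> - h x"
    by (rule fundamental_lemma_nonneg[OF \<Omega>]) (use h int zero in auto)
  ultimately show ?thesis by eventually_elim auto
qed

section \<open>Weak gradients and the space \<open>H10\<close>\<close>

lemma test_function_sq_int:
  assumes "\<phi> \<in> test_functions \<Omega>'" "\<Omega> \<in> sets lebesgue"
  shows "\<phi> \<in> sq_int (lebesgue_on \<Omega>)"
proof -
  have "(\<lambda>x. \<phi> x * \<phi> x) \<in> test_functions \<Omega>'"
    by (rule test_function_mult_smooth[OF assms(1) test_function_smooth[OF assms(1)]])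
  from integrable_lebesgue_on_of_lborel[OF test_function_integrable[OF this] assms(2)]
  show ?thesis
    by (simp add: sq_int_def power2_eq_square[symmetric] borel_imp_lebesgue_on smooth_borel
        test_function_smooth[OF assms(1)])
qed

lemma test_function_grad_sq_int:
  assumes "\<phi> \<in> test_functions \<Omega>'" "\<Omega> \<in> sets lebesgue"
  shows "grad \<phi> \<in> sq_int (lebesgue_on \<Omega>)"
proof -
  have "integrable (lebesgue_on \<Omega>) (\<lambda>x. \<Sum>i\<in>UNIV. (norm (partial_derivative i \<phi> x))\<^sup>2)"
    by (intro Bochner_Integration.integrable_sum sq_int_integrable
        test_function_sq_int[OF test_function_partial[OF assms(1)] assms(2)])
  moreover have "(\<Sum>i\<in>UNIV. (norm (partial_derivative i \<phi> x))\<^sup>2) = (norm (grad \<phi> x))\<^sup>2" for x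
    by (simp add: norm_vec_def L2_set_def sum_nonneg)
  ultimately show ?thesis
    by (simp add: sq_int_def borel_imp_lebesgue_on grad_borel test_function_smooth[OF assms(1)])
qed

lemma sq_int_component:
  fixes g :: "'a \<Rightarrow> real^'n::finite"
  assumes "g \<in> sq_int M" shows "(\<lambda>x. g x $ i) \<in> sq_int M"
proof (rule sq_int_dominated[OF assms, of _ 1])
  have "(\<lambda>x. g x \<bullet> axis i 1) \<in> borel_measurable M" using sq_int_measurable[OF assms] by measurable
  then show "(\<lambda>x. g x $ i) \<in> borel_measurable M" by (simp add: inner_axis)
qed (simp add: component_le_norm_cart)

lemma weak_gradient_unique:
  assumes \<Omega>: "open \<Omega>" and g: "g \<in> sq_int (lebesgue_on \<Omega>)" "has_weak_gradient \<Omega> u g"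
    and g': "g' \<in> sq_int (lebesgue_on \<Omega>)" "has_weak_gradient \<Omega> u g'"
  shows "AE x in lebesgue_on \<Omega>. g x = g' x"
proof -
  have \<Omega>m: "\<Omega> \<in> sets lebesgue" using \<Omega> by auto
  have "AE x in lebesgue_on \<Omega>. g x $ i - g' x $ i = 0" for i
  proof (rule fundamental_lemma[OF \<Omega>])
    have sq: "(\<lambda>x. g x $ i - g' x $ i) \<in> sq_int (lebesgue_on \<Omega>)"
      by (intro sq_int_diff sq_int_component g g')
    then show "(\<lambda>x. g x $ i - g' x $ i) \<in> borel_measurable (lebesgue_on \<Omega>)" by (rule sq_int_measurable)
    fix \<phi> assume \<phi>: "\<phi> \<in> test_functions \<Omega>"
    show "integrable (lebesgue_on \<Omega>) (\<lambda>x. (g x $ i - g' x $ i) * \<phi> x)"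
      using sq_int_inner_integrable[OF sq test_function_sq_int[OF \<phi> \<Omega>m]] by simp
    show "(LINT x|lebesgue_on \<Omega>. (g x $ i - g' x $ i) * \<phi> x) = 0"
      using g(2)[unfolded has_weak_gradient_def, rule_format, OF \<phi>, of i]
        g'(2)[unfolded has_weak_gradient_def, rule_format, OF \<phi>, of i]
        sq_int_inner_integrable[OF sq_int_component[OF g(1)] test_function_sq_int[OF \<phi> \<Omega>m], of i]
        sq_int_inner_integrable[OF sq_int_component[OF g'(1)] test_function_sq_int[OF \<phi> \<Omega>m], of i]
      by (simp add: left_diff_distrib)
  qed
  then have "AE x in lebesgue_on \<Omega>. \<forall>i. g x $ i - g' x $ i = 0" by (subst AE_all_countable) auto
  then show ?thesis by eventually_elim (simp add: vec_eq_iff)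
qed

lemma wgrad_H1:
  assumes "u \<in> H1 \<Omega>"
  shows "wgrad \<Omega> u \<in> sq_int (lebesgue_on \<Omega>)" "has_weak_gradient \<Omega> u (wgrad \<Omega> u)"
proof -
  have "\<exists>g. g \<in> L2 \<Omega> \<and> has_weak_gradient \<Omega> u g" using assms by (auto simp: H1_def)
  from someI_ex[OF this] show "wgrad \<Omega> u \<in> sq_int (lebesgue_on \<Omega>)" "has_weak_gradient \<Omega> u (wgrad \<Omega> u)"
    by (auto simp: wgrad_def L2_eq_sq_int)
qed

lemma wgrad_AE_eq:
  assumes "open \<Omega>" "u \<in> sq_int (lebesgue_on \<Omega>)" "g \<in> sq_int (lebesgue_on \<Omega>)" "has_weak_gradient \<Omega> u g"
  shows "u \<in> H1 \<Omega>" "AE x in lebesgue_on \<Omega>. wgrad \<Omega> u x = g x"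
proof -
  show u: "u \<in> H1 \<Omega>" using assms by (auto simp: H1_def L2_eq_sq_int)
  show "AE x in lebesgue_on \<Omega>. wgrad \<Omega> u x = g x"
    by (rule weak_gradient_unique[OF assms(1) wgrad_H1[OF u] assms(3,4)])
qed

lemma H1_norm_eq: "H1_norm \<Omega> u = sqrt ((l2 (lebesgue_on \<Omega>) u)\<^sup>2 + (l2 (lebesgue_on \<Omega>) (wgrad \<Omega> u))\<^sup>2)"
  by (simp add: H1_norm_def l2_power2)

lemma smooth_compact_has_weak_gradient:
  assumes \<phi>: "smooth \<phi>" and \<Omega>: "\<Omega> \<in> sets lebesgue"
  shows "has_weak_gradient \<Omega> \<phi> (grad \<phi>)"
  unfolding has_weak_gradient_def
proof (intro ballI allI)
  fix \<psi> i assume \<psi>: "\<psi> \<in> test_functions \<Omega>"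
  have "(LINT x|lebesgue_on \<Omega>. \<phi> x * partial_derivative i \<psi> x) = (LINT x|lborel. \<phi> x * partial_derivative i \<psi> x)"
    using \<phi> test_function_smooth[OF \<psi>] smooth_partial_derivative test_function_outside[OF test_function_partial[OF \<psi>]]
    by (intro integral_lebesgue_on_eq_lborel[OF _ \<Omega>] smooth_borel smooth_mult) auto
  moreover have "(LINT x|lebesgue_on \<Omega>. grad \<phi> x $ i * \<psi> x) = (LINT x|lborel. partial_derivative i \<phi> x * \<psi> x)"
    using \<phi> test_function_smooth[OF \<psi>] smooth_partial_derivative test_function_outside[OF \<psi>]
    by (subst integral_lebesgue_on_eq_lborel[OF _ \<Omega>]) (auto intro!: smooth_borel smooth_mult)
  ultimately show "(LINT x|lebesgue_on \<Omega>. \<phi> x * partial_derivative i \<psi> x)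
      = - (LINT x|lebesgue_on \<Omega>. grad \<phi> x $ i * \<psi> x)"
    using test_function_integration_by_parts[OF \<psi> \<phi>] by simp
qed

text \<open>The pair of \<open>u\<close> and \<open>G\<close> lies in the closure, in the product of
  two \<open>L2\<close> spaces, of the graph of \<open>grad\<close> on test functions. Carrying
  \<open>G\<close> explicitly gives calculus rules free of null sets; the representative
  \<open>wgrad \<Omega> u\<close>, fixed by choice, is compared with \<open>G\<close> only
  afterwards.\<close>

definition has_H10_gradient ::
  "(real^'n::finite) set \<Rightarrow> (real^'n \<Rightarrow> real) \<Rightarrow> (real^'n \<Rightarrow> real^'n) \<Rightarrow> bool" where
  "has_H10_gradient \<Omega> u G \<longleftrightarrow> u \<in> sq_int (lebesgue_on \<Omega>) \<and> G \<in> sq_int (lebesgue_on \<Omega>) \<and>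
    (\<forall>e>0. \<exists>\<phi>\<in>test_functions \<Omega>.
      l2 (lebesgue_on \<Omega>) (\<lambda>x. u x - \<phi> x) < e \<and> l2 (lebesgue_on \<Omega>) (\<lambda>x. G x - grad \<phi> x) < e)"

lemma has_H10_gradient_sequence:
  fixes u :: "real^'n::finite \<Rightarrow> real"
  assumes "has_H10_gradient \<Omega> u G"
  obtains \<phi> where "\<forall>k. \<phi> k \<in> test_functions \<Omega>" "(\<lambda>k. l2 (lebesgue_on \<Omega>) (\<lambda>x. u x - \<phi> k x)) \<longlonglongrightarrow> 0"
    "(\<lambda>k. l2 (lebesgue_on \<Omega>) (\<lambda>x. G x - grad (\<phi> k) x)) \<longlonglongrightarrow> 0"
proof -
  have "\<forall>k. \<exists>\<phi>. \<phi> \<in> test_functions \<Omega> \<and> l2 (lebesgue_on \<Omega>) (\<lambda>x. u x - \<phi> x) < inverse (real (Suc k)) \<and>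
      l2 (lebesgue_on \<Omega>) (\<lambda>x. G x - grad \<phi> x) < inverse (real (Suc k))"
  proof
    fix k show "\<exists>\<phi>. \<phi> \<in> test_functions \<Omega> \<and> l2 (lebesgue_on \<Omega>) (\<lambda>x. u x - \<phi> x) < inverse (real (Suc k)) \<and>
      l2 (lebesgue_on \<Omega>) (\<lambda>x. G x - grad \<phi> x) < inverse (real (Suc k))"
    using assms[unfolded has_H10_gradient_def, THEN conjunct2, THEN conjunct2, rule_format,
      of "inverse (real (Suc k))"] by auto
  qed
  from choice[OF this] obtain \<phi> where \<phi>: "\<And>k. \<phi> k \<in> test_functions \<Omega>"
    "\<And>k. l2 (lebesgue_on \<Omega>) (\<lambda>x. u x - \<phi> k x) < inverse (real (Suc k))"
    "\<And>k. l2 (lebesgue_on \<Omega>) (\<lambda>x. G x - grad (\<phi> k) x) < inverse (real (Suc k))" by blast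
  show ?thesis
  proof (rule that[of \<phi>])
    show "\<forall>k. \<phi> k \<in> test_functions \<Omega>" using \<phi>(1) by simp
    show "(\<lambda>k. l2 (lebesgue_on \<Omega>) (\<lambda>x. u x - \<phi> k x)) \<longlonglongrightarrow> 0"
      by (rule Lim_null_comparison[OF _ LIMSEQ_inverse_real_of_nat])
        (use \<phi>(2) in \<open>auto intro!: always_eventually less_imp_le\<close>)
    show "(\<lambda>k. l2 (lebesgue_on \<Omega>) (\<lambda>x. G x - grad (\<phi> k) x)) \<longlonglongrightarrow> 0"
      by (rule Lim_null_comparison[OF _ LIMSEQ_inverse_real_of_nat])
        (use \<phi>(3) in \<open>auto intro!: always_eventually less_imp_le\<close>)
  qed
qed

text \<open>A diagonal argument: half of \<open>e\<close> is spent on the approximation by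
  \<open>v n\<close>, half on a test function close to \<open>v n\<close>.\<close>

lemma has_H10_gradient_limit:
  assumes u: "u \<in> sq_int (lebesgue_on \<Omega>)" and G: "G \<in> sq_int (lebesgue_on \<Omega>)" and \<Omega>: "\<Omega> \<in> sets lebesgue"
    and n: "\<And>n. has_H10_gradient \<Omega> (v n) (H n)"
    and v: "(\<lambda>n. l2 (lebesgue_on \<Omega>) (\<lambda>x. v n x - u x)) \<longlonglongrightarrow> 0"
    and H: "(\<lambda>n. l2 (lebesgue_on \<Omega>) (\<lambda>x. H n x - G x)) \<longlonglongrightarrow> 0"
  shows "has_H10_gradient \<Omega> u G"
  unfolding has_H10_gradient_def
proof (intro conjI u G allI impI)
  fix e :: real assume "e > 0"
  have "\<forall>\<^sub>F n in sequentially. l2 (lebesgue_on \<Omega>) (\<lambda>x. v n x - u x) < e/2 \<and>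
      l2 (lebesgue_on \<Omega>) (\<lambda>x. H n x - G x) < e/2"
    using order_tendstoD(2)[OF v, of "e/2"] order_tendstoD(2)[OF H, of "e/2"] \<open>e > 0\<close>
    by (auto intro: eventually_conj)
  then obtain n where vn: "l2 (lebesgue_on \<Omega>) (\<lambda>x. v n x - u x) < e/2"
    and Hn: "l2 (lebesgue_on \<Omega>) (\<lambda>x. H n x - G x) < e/2"
    by (auto simp: eventually_sequentially)
  have vs: "v n \<in> sq_int (lebesgue_on \<Omega>)" and Hs: "H n \<in> sq_int (lebesgue_on \<Omega>)"
    using n[of n] by (auto simp: has_H10_gradient_def)
  obtain \<phi> where \<phi>: "\<phi> \<in> test_functions \<Omega>" "l2 (lebesgue_on \<Omega>) (\<lambda>x. v n x - \<phi> x) < e/2"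
    "l2 (lebesgue_on \<Omega>) (\<lambda>x. H n x - grad \<phi> x) < e/2"
    using n[of n, unfolded has_H10_gradient_def, THEN conjunct2, THEN conjunct2, rule_format, of "e/2"]
      \<open>e > 0\<close> by auto
  have "l2 (lebesgue_on \<Omega>) (\<lambda>x. u x - \<phi> x) < e"
    using l2_triangle_diff[OF u vs test_function_sq_int[OF \<phi>(1) \<Omega>]] vn \<phi>(2)
      l2_diff_commute[of "lebesgue_on \<Omega>" u "v n"] by simp
  moreover have "l2 (lebesgue_on \<Omega>) (\<lambda>x. G x - grad \<phi> x) < e"
    using l2_triangle_diff[OF G Hs test_function_grad_sq_int[OF \<phi>(1) \<Omega>]] Hn \<phi>(3)
      l2_diff_commute[of "lebesgue_on \<Omega>" G "H n"] by simp
  ultimately show "\<exists>\<phi>\<in>test_functions \<Omega>.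
      l2 (lebesgue_on \<Omega>) (\<lambda>x. u x - \<phi> x) < e \<and> l2 (lebesgue_on \<Omega>) (\<lambda>x. G x - grad \<phi> x) < e"
    using \<phi>(1) by auto
qed

lemma test_function_has_H10_gradient:
  assumes "\<phi> \<in> test_functions \<Omega>" "\<Omega> \<in> sets lebesgue"
  shows "has_H10_gradient \<Omega> \<phi> (grad \<phi>)"
  unfolding has_H10_gradient_def using test_function_sq_int[OF assms] test_function_grad_sq_int[OF assms] assms(1)
  by (auto intro!: bexI[of _ \<phi>] simp: l2_def)

text \<open>Both sides of the integration by parts formula are continuous under \<open>L2\<close>
  convergence of the approximating test functions and of their gradients.\<close>

lemma has_H10_gradient_has_weak_gradient:
  assumes u: "has_H10_gradient \<Omega> u G" and \<Omega>: "\<Omega> \<in> sets lebesgue"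
  shows "has_weak_gradient \<Omega> u G"
  unfolding has_weak_gradient_def
proof (intro ballI allI)
  fix \<psi> i assume \<psi>: "\<psi> \<in> test_functions \<Omega>"
  obtain \<phi> where \<phi>: "\<forall>k. \<phi> k \<in> test_functions \<Omega>" "(\<lambda>k. l2 (lebesgue_on \<Omega>) (\<lambda>x. u x - \<phi> k x)) \<longlonglongrightarrow> 0"
    "(\<lambda>k. l2 (lebesgue_on \<Omega>) (\<lambda>x. G x - grad (\<phi> k) x)) \<longlonglongrightarrow> 0"
    by (rule has_H10_gradient_sequence[OF u])
  note \<phi>(1)[rule_format]
  note \<phi> = this \<phi>(2,3)
  have us: "u \<in> sq_int (lebesgue_on \<Omega>)" and Gs: "G \<in> sq_int (lebesgue_on \<Omega>)"
    using u by (auto simp: has_H10_gradient_def)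
  have \<psi>s: "\<psi> \<in> sq_int (lebesgue_on \<Omega>)" "partial_derivative i \<psi> \<in> sq_int (lebesgue_on \<Omega>)"
    using test_function_sq_int[OF \<psi> \<Omega>] test_function_sq_int[OF test_function_partial[OF \<psi>] \<Omega>] by auto
  have "(\<lambda>k. LINT x|lebesgue_on \<Omega>. \<phi> k x \<bullet> partial_derivative i \<psi> x)
      \<longlonglongrightarrow> (LINT x|lebesgue_on \<Omega>. u x \<bullet> partial_derivative i \<psi> x)"
    by (rule l2_tendsto_inner_fixed[OF test_function_sq_int[OF \<phi>(1) \<Omega>] us _ \<psi>s(2)])
      (use \<phi>(2) in \<open>simp add: l2_diff_commute[of _ u]\<close>)
  moreover have "(\<lambda>k. LINT x|lebesgue_on \<Omega>. grad (\<phi> k) x \<bullet> axis i (\<psi> x))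
      \<longlonglongrightarrow> (LINT x|lebesgue_on \<Omega>. G x \<bullet> axis i (\<psi> x))"
  proof (rule l2_tendsto_inner_fixed[OF test_function_grad_sq_int[OF \<phi>(1) \<Omega>] Gs])
    show "(\<lambda>k. l2 (lebesgue_on \<Omega>) (\<lambda>x. grad (\<phi> k) x - G x)) \<longlonglongrightarrow> 0"
      using \<phi>(3) by (simp add: l2_diff_commute[of _ G])
    have "(\<lambda>x. \<psi> x *\<^sub>R axis i (1::real)) \<in> sq_int (lebesgue_on \<Omega>)"
      by (rule sq_int_scaleR_bounded[OF \<psi>s(1), of _ 1]) auto
    moreover have "axis i (\<psi> x) = \<psi> x *\<^sub>R axis i (1::real)" for x by (simp add: axis_def vec_eq_iff)
    ultimately show "(\<lambda>x. axis i (\<psi> x)) \<in> sq_int (lebesgue_on \<Omega>)" by simp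
  qed
  moreover have "(LINT x|lebesgue_on \<Omega>. \<phi> k x * partial_derivative i \<psi> x)
      = - (LINT x|lebesgue_on \<Omega>. grad (\<phi> k) x $ i * \<psi> x)" for k
    using smooth_compact_has_weak_gradient[OF test_function_smooth[OF \<phi>(1)] \<Omega>] \<psi>
    unfolding has_weak_gradient_def by blast
  ultimately have "(\<lambda>k. - (LINT x|lebesgue_on \<Omega>. grad (\<phi> k) x $ i * \<psi> x))
      \<longlonglongrightarrow> (LINT x|lebesgue_on \<Omega>. u x * partial_derivative i \<psi> x)"
    "(\<lambda>k. - (LINT x|lebesgue_on \<Omega>. grad (\<phi> k) x $ i * \<psi> x)) \<longlonglongrightarrow> - (LINT x|lebesgue_on \<Omega>. G x $ i * \<psi> x)"
    by (auto simp: inner_axis intro!: tendsto_minus)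
  then show "(LINT x|lebesgue_on \<Omega>. u x * partial_derivative i \<psi> x) = - (LINT x|lebesgue_on \<Omega>. G x $ i * \<psi> x)"
    by (rule LIMSEQ_unique)
qed

lemma has_H10_gradient_sq_int:
  "has_H10_gradient \<Omega> u G \<Longrightarrow> u \<in> sq_int (lebesgue_on \<Omega>)"
  "has_H10_gradient \<Omega> u G \<Longrightarrow> G \<in> sq_int (lebesgue_on \<Omega>)"
  by (auto simp: has_H10_gradient_def)

lemma has_H10_gradientI:
  assumes "u \<in> sq_int (lebesgue_on \<Omega>)" "G \<in> sq_int (lebesgue_on \<Omega>)"
    and "\<Omega> \<in> sets lebesgue" and "\<And>k. \<phi> k \<in> test_functions \<Omega>"
    and "(\<lambda>k. l2 (lebesgue_on \<Omega>) (\<lambda>x. u x - \<phi> k x)) \<longlonglongrightarrow> 0"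
    and "(\<lambda>k. l2 (lebesgue_on \<Omega>) (\<lambda>x. G x - grad (\<phi> k) x)) \<longlonglongrightarrow> 0"
  shows "has_H10_gradient \<Omega> u G"
proof (rule has_H10_gradient_limit[OF assms(1-3) test_function_has_H10_gradient[OF assms(4,3)]])
  show "(\<lambda>n. l2 (lebesgue_on \<Omega>) (\<lambda>x. \<phi> n x - u x)) \<longlonglongrightarrow> 0"
    using assms(5) by (simp add: l2_diff_commute[of _ u])
  show "(\<lambda>n. l2 (lebesgue_on \<Omega>) (\<lambda>x. grad (\<phi> n) x - G x)) \<longlonglongrightarrow> 0"
    using assms(6) by (simp add: l2_diff_commute[of _ G])
qed

lemma has_H10_gradient_obtain:
  fixes u :: "real^'n::finite \<Rightarrow> real"
  assumes "has_H10_gradient \<Omega> u G"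
  shows "\<exists>\<phi>. (\<forall>k. \<phi> k \<in> test_functions \<Omega>) \<and> (\<lambda>k. l2 (lebesgue_on \<Omega>) (\<lambda>x. u x - \<phi> k x)) \<longlonglongrightarrow> 0 \<and>
    (\<lambda>k. l2 (lebesgue_on \<Omega>) (\<lambda>x. G x - grad (\<phi> k) x)) \<longlonglongrightarrow> 0"
  by (rule has_H10_gradient_sequence[OF assms]) auto

lemma tendsto_zero_bound:
  fixes f g :: "nat \<Rightarrow> real"
  assumes "g \<longlonglongrightarrow> 0" "\<And>n. 0 \<le> f n" "\<And>n. f n \<le> g n"
  shows "f \<longlonglongrightarrow> 0"
  by (rule tendsto_sandwich[OF _ _ tendsto_const assms(1)]) (use assms in auto)

lemma has_H10_gradient_add:
  assumes u: "has_H10_gradient \<Omega> u G" and v: "has_H10_gradient \<Omega> v H" and \<Omega>: "\<Omega> \<in> sets lebesgue"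
  shows "has_H10_gradient \<Omega> (\<lambda>x. u x + v x) (\<lambda>x. G x + H x)"
proof -
  note sq = has_H10_gradient_sq_int[OF u] has_H10_gradient_sq_int[OF v]
  obtain \<phi> where \<phi>: "\<And>k. \<phi> k \<in> test_functions \<Omega>" "(\<lambda>k. l2 (lebesgue_on \<Omega>) (\<lambda>x. u x - \<phi> k x)) \<longlonglongrightarrow> 0"
    "(\<lambda>k. l2 (lebesgue_on \<Omega>) (\<lambda>x. G x - grad (\<phi> k) x)) \<longlonglongrightarrow> 0"
    using has_H10_gradient_obtain[OF u] by auto
  obtain \<psi> where \<psi>: "\<And>k. \<psi> k \<in> test_functions \<Omega>" "(\<lambda>k. l2 (lebesgue_on \<Omega>) (\<lambda>x. v x - \<psi> k x)) \<longlonglongrightarrow> 0"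
    "(\<lambda>k. l2 (lebesgue_on \<Omega>) (\<lambda>x. H x - grad (\<psi> k) x)) \<longlonglongrightarrow> 0"
    using has_H10_gradient_obtain[OF v] by auto
  show ?thesis
  proof (rule has_H10_gradientI[OF sq_int_add[OF sq(1,3)] sq_int_add[OF sq(2,4)] \<Omega> test_function_add[OF \<phi>(1) \<psi>(1)]])
    show "(\<lambda>k. l2 (lebesgue_on \<Omega>) (\<lambda>x. u x + v x - (\<phi> k x + \<psi> k x))) \<longlonglongrightarrow> 0"
    proof (rule tendsto_zero_bound)
      show "(\<lambda>k. l2 (lebesgue_on \<Omega>) (\<lambda>x. u x - \<phi> k x) + l2 (lebesgue_on \<Omega>) (\<lambda>x. v x - \<psi> k x)) \<longlonglongrightarrow> 0"
        using tendsto_add[OF \<phi>(2) \<psi>(2)] by simp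
      show "l2 (lebesgue_on \<Omega>) (\<lambda>x. u x + v x - (\<phi> k x + \<psi> k x))
          \<le> l2 (lebesgue_on \<Omega>) (\<lambda>x. u x - \<phi> k x) + l2 (lebesgue_on \<Omega>) (\<lambda>x. v x - \<psi> k x)" for k
        using l2_triangle[OF sq_int_diff[OF sq(1) test_function_sq_int[OF \<phi>(1) \<Omega>]]
          sq_int_diff[OF sq(3) test_function_sq_int[OF \<psi>(1) \<Omega>]], of k k]
        by (simp add: algebra_simps)
    qed simp
    show "(\<lambda>k. l2 (lebesgue_on \<Omega>) (\<lambda>x. G x + H x - grad (\<lambda>x. \<phi> k x + \<psi> k x) x)) \<longlonglongrightarrow> 0"
    proof (rule tendsto_zero_bound)
      show "(\<lambda>k. l2 (lebesgue_on \<Omega>) (\<lambda>x. G x - grad (\<phi> k) x) + l2 (lebesgue_on \<Omega>) (\<lambda>x. H x - grad (\<psi> k) x)) \<longlonglongrightarrow> 0"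
        using tendsto_add[OF \<phi>(3) \<psi>(3)] by simp
      show "l2 (lebesgue_on \<Omega>) (\<lambda>x. G x + H x - grad (\<lambda>x. \<phi> k x + \<psi> k x) x)
          \<le> l2 (lebesgue_on \<Omega>) (\<lambda>x. G x - grad (\<phi> k) x) + l2 (lebesgue_on \<Omega>) (\<lambda>x. H x - grad (\<psi> k) x)" for k
        using l2_triangle[OF sq_int_diff[OF sq(2) test_function_grad_sq_int[OF \<phi>(1) \<Omega>]]
          sq_int_diff[OF sq(4) test_function_grad_sq_int[OF \<psi>(1) \<Omega>]], of k k]
        by (simp add: algebra_simps grad_add[OF test_function_smooth[OF \<phi>(1)] test_function_smooth[OF \<psi>(1)]])
    qed simp
  qed
qed

text \<open>Multiplication by \<open>\<psi>\<close> is continuous in the graph norm, with constants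
  \<open>C\<close> and \<open>D\<close>, so the product rule for test functions passes to the
  closure.\<close>

lemma has_H10_gradient_smooth_mult:
  assumes u: "has_H10_gradient \<Omega> u G" and \<Omega>: "\<Omega> \<in> sets lebesgue"
    and \<psi>: "smooth \<psi>" and C: "\<And>x. \<bar>\<psi> x\<bar> \<le> C" and D: "\<And>x. norm (grad \<psi> x) \<le> D"
  shows "has_H10_gradient \<Omega> (\<lambda>x. \<psi> x * u x) (\<lambda>x. \<psi> x *\<^sub>R G x + u x *\<^sub>R grad \<psi> x)"
proof -
  note sq = has_H10_gradient_sq_int[OF u]
  have \<psi>m: "\<psi> \<in> borel_measurable (lebesgue_on \<Omega>)" "grad \<psi> \<in> borel_measurable (lebesgue_on \<Omega>)"
    by (auto intro: borel_imp_lebesgue_on smooth_borel grad_borel \<psi>)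
  have CD: "C \<ge> 0" "D \<ge> 0" using C[of 0] norm_ge_zero[of "grad \<psi> 0"] D[of 0] by linarith+
  have m1: "(\<lambda>x. \<psi> x *\<^sub>R w x) \<in> sq_int (lebesgue_on \<Omega>)"
    if "w \<in> sq_int (lebesgue_on \<Omega>)" for w :: "_ \<Rightarrow> 'b::euclidean_space"
    using sq_int_bounded_scaleR[OF that \<psi>m(1), of C] C by simp
  have m2: "(\<lambda>x. w x *\<^sub>R grad \<psi> x) \<in> sq_int (lebesgue_on \<Omega>)" if "w \<in> sq_int (lebesgue_on \<Omega>)" for w
    using sq_int_scaleR_bounded[OF that \<psi>m(2), of D] D by simp
  have b1: "l2 (lebesgue_on \<Omega>) (\<lambda>x. \<psi> x *\<^sub>R w x) \<le> C * l2 (lebesgue_on \<Omega>) w"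
    if "w \<in> sq_int (lebesgue_on \<Omega>)" for w :: "_ \<Rightarrow> 'b::euclidean_space"
    by (rule l2_mono[OF that sq_int_measurable[OF m1[OF that]]])
      (use C CD in \<open>auto intro!: AE_I2 mult_right_mono\<close>)
  have b2: "l2 (lebesgue_on \<Omega>) (\<lambda>x. w x *\<^sub>R grad \<psi> x) \<le> D * l2 (lebesgue_on \<Omega>) w"
    if "w \<in> sq_int (lebesgue_on \<Omega>)" for w
    by (rule l2_mono[OF that sq_int_measurable[OF m2[OF that]]])
      (use D CD in \<open>auto simp: mult.commute[of D] intro!: AE_I2 mult_left_mono\<close>)
  obtain \<phi> where \<phi>: "\<And>k. \<phi> k \<in> test_functions \<Omega>" "(\<lambda>k. l2 (lebesgue_on \<Omega>) (\<lambda>x. u x - \<phi> k x)) \<longlonglongrightarrow> 0"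
    "(\<lambda>k. l2 (lebesgue_on \<Omega>) (\<lambda>x. G x - grad (\<phi> k) x)) \<longlonglongrightarrow> 0"
    using has_H10_gradient_obtain[OF u] by auto
  note ds = sq_int_diff[OF sq(1) test_function_sq_int[OF \<phi>(1) \<Omega>]]
    sq_int_diff[OF sq(2) test_function_grad_sq_int[OF \<phi>(1) \<Omega>]]
  show ?thesis
  proof (rule has_H10_gradientI[OF _ _ \<Omega> test_function_smooth_mult[OF \<psi> \<phi>(1)]])
    show "(\<lambda>x. \<psi> x * u x) \<in> sq_int (lebesgue_on \<Omega>)" using m1[OF sq(1)] by simp
    show "(\<lambda>x. \<psi> x *\<^sub>R G x + u x *\<^sub>R grad \<psi> x) \<in> sq_int (lebesgue_on \<Omega>)"
      by (intro sq_int_add m1 m2 sq)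
    show "(\<lambda>k. l2 (lebesgue_on \<Omega>) (\<lambda>x. \<psi> x * u x - \<psi> x * \<phi> k x)) \<longlonglongrightarrow> 0"
    proof (rule tendsto_zero_bound)
      show "(\<lambda>k. C * l2 (lebesgue_on \<Omega>) (\<lambda>x. u x - \<phi> k x)) \<longlonglongrightarrow> 0"
        using tendsto_mult_left[OF \<phi>(2), of C] by simp
      show "l2 (lebesgue_on \<Omega>) (\<lambda>x. \<psi> x * u x - \<psi> x * \<phi> k x) \<le> C * l2 (lebesgue_on \<Omega>) (\<lambda>x. u x - \<phi> k x)" for k
        using b1[OF ds(1), of k] by (simp add: algebra_simps)
    qed simp
    show "(\<lambda>k. l2 (lebesgue_on \<Omega>) (\<lambda>x. \<psi> x *\<^sub>R G x + u x *\<^sub>R grad \<psi> x - grad (\<lambda>x. \<psi> x * \<phi> k x) x)) \<longlonglongrightarrow> 0"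
    proof (rule tendsto_zero_bound)
      show "(\<lambda>k. C * l2 (lebesgue_on \<Omega>) (\<lambda>x. G x - grad (\<phi> k) x) + D * l2 (lebesgue_on \<Omega>) (\<lambda>x. u x - \<phi> k x)) \<longlonglongrightarrow> 0"
        using tendsto_add[OF tendsto_mult_left[OF \<phi>(3), of C] tendsto_mult_left[OF \<phi>(2), of D]] by simp
      fix k
      have "(\<lambda>x. \<psi> x *\<^sub>R G x + u x *\<^sub>R grad \<psi> x - grad (\<lambda>x. \<psi> x * \<phi> k x) x)
          = (\<lambda>x. \<psi> x *\<^sub>R (G x - grad (\<phi> k) x) + (u x - \<phi> k x) *\<^sub>R grad \<psi> x)"
        by (simp add: grad_mult[OF \<psi> test_function_smooth[OF \<phi>(1)]] algebra_simps)
      then show "l2 (lebesgue_on \<Omega>) (\<lambda>x. \<psi> x *\<^sub>R G x + u x *\<^sub>R grad \<psi> x - grad (\<lambda>x. \<psi> x * \<phi> k x) x)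
          \<le> C * l2 (lebesgue_on \<Omega>) (\<lambda>x. G x - grad (\<phi> k) x) + D * l2 (lebesgue_on \<Omega>) (\<lambda>x. u x - \<phi> k x)"
        using l2_triangle[OF m1[OF ds(2)[of k]] m2[OF ds(1)[of k]]] b1[OF ds(2)[of k]] b2[OF ds(1)[of k]]
        by simp
    qed simp
  qed
qed

lemma has_H10_gradient_test_mult:
  assumes u: "has_H10_gradient \<Omega> u G" and \<Omega>: "\<Omega> \<in> sets lebesgue" and \<psi>: "\<psi> \<in> test_functions \<Omega>'"
  shows "has_H10_gradient \<Omega> (\<lambda>x. \<psi> x * u x) (\<lambda>x. \<psi> x *\<^sub>R G x + u x *\<^sub>R grad \<psi> x)"
proof -
  obtain C where "\<And>x. \<bar>\<psi> x\<bar> \<le> C" using test_function_bounded[OF \<psi>] by auto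
  moreover obtain D where "\<And>x. norm (grad \<psi> x) \<le> D" using test_function_grad_bounded[OF \<psi>] by auto
  ultimately show ?thesis by (rule has_H10_gradient_smooth_mult[OF u \<Omega> test_function_smooth[OF \<psi>]])
qed

lemma has_H10_gradient_scale:
  assumes u: "has_H10_gradient \<Omega> u G" and \<Omega>: "\<Omega> \<in> sets lebesgue"
  shows "has_H10_gradient \<Omega> (\<lambda>x. c * u x) (\<lambda>x. c *\<^sub>R G x)"
  using has_H10_gradient_smooth_mult[OF u \<Omega> smooth_const[of c], of "\<bar>c\<bar>" 0] by simp

lemma has_H10_gradient_diff:
  assumes "has_H10_gradient \<Omega> u G" "has_H10_gradient \<Omega> v H" "\<Omega> \<in> sets lebesgue"
  shows "has_H10_gradient \<Omega> (\<lambda>x. u x - v x) (\<lambda>x. G x - H x)"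
  using has_H10_gradient_add[OF assms(1) has_H10_gradient_scale[OF assms(2,3), of "-1"] assms(3)] by simp

lemma has_H10_gradient_cong:
  assumes u: "has_H10_gradient \<Omega> u G" and \<Omega>: "\<Omega> \<in> sets lebesgue"
    and H: "H \<in> sq_int (lebesgue_on \<Omega>)" "AE x in lebesgue_on \<Omega>. H x = G x"
  shows "has_H10_gradient \<Omega> u H"
proof (rule has_H10_gradient_limit[OF has_H10_gradient_sq_int(1)[OF u] H(1) \<Omega>, of "\<lambda>n. u" "\<lambda>n. G"])
  have "(\<lambda>x. G x - H x) \<in> sq_int (lebesgue_on \<Omega>)"
    by (intro sq_int_diff H has_H10_gradient_sq_int(2)[OF u])
  then have "l2 (lebesgue_on \<Omega>) (\<lambda>x. G x - H x) = 0"
    by (subst l2_zero_iff) (use H(2) in \<open>auto elim: eventually_mono\<close>)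
  then show "(\<lambda>n. l2 (lebesgue_on \<Omega>) (\<lambda>x. G x - H x)) \<longlonglongrightarrow> 0" by simp
qed (use u in \<open>auto simp: l2_def\<close>)

lemma has_weak_gradient_diff:
  assumes u: "u \<in> sq_int (lebesgue_on \<Omega>)" "G \<in> sq_int (lebesgue_on \<Omega>)" "has_weak_gradient \<Omega> u G"
    and v: "v \<in> sq_int (lebesgue_on \<Omega>)" "H \<in> sq_int (lebesgue_on \<Omega>)" "has_weak_gradient \<Omega> v H"
    and \<Omega>: "\<Omega> \<in> sets lebesgue"
  shows "has_weak_gradient \<Omega> (\<lambda>x. u x - v x) (\<lambda>x. G x - H x)"
  unfolding has_weak_gradient_def
proof (intro ballI allI)
  fix \<phi> i assume \<phi>: "\<phi> \<in> test_functions \<Omega>"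
  note p = test_function_sq_int[OF test_function_partial[OF \<phi>, of i] \<Omega>] and t = test_function_sq_int[OF \<phi> \<Omega>]
  note ints = sq_int_inner_integrable[OF u(1) p] sq_int_inner_integrable[OF v(1) p]
    sq_int_inner_integrable[OF sq_int_component[OF u(2), of i] t]
    sq_int_inner_integrable[OF sq_int_component[OF v(2), of i] t]
  show "(LINT x|lebesgue_on \<Omega>. (u x - v x) * partial_derivative i \<phi> x)
      = - (LINT x|lebesgue_on \<Omega>. (G x - H x) $ i * \<phi> x)"
    using u(3) v(3) \<phi> ints by (simp add: has_weak_gradient_def left_diff_distrib)
qed

lemma has_H10_gradient_wgrad:
  assumes u: "has_H10_gradient \<Omega> u G" and \<Omega>: "open \<Omega>"
  shows "u \<in> H1 \<Omega>" "AE x in lebesgue_on \<Omega>. wgrad \<Omega> u x = G x"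
proof -
  have "\<Omega> \<in> sets lebesgue" using \<Omega> by auto
  from wgrad_AE_eq[OF \<Omega> has_H10_gradient_sq_int[OF u] has_H10_gradient_has_weak_gradient[OF u this]]
  show "u \<in> H1 \<Omega>" "AE x in lebesgue_on \<Omega>. wgrad \<Omega> u x = G x" by auto
qed

lemma H1_norm_eq_of_gradient:
  assumes u: "has_H10_gradient \<Omega> u G" and \<Omega>: "open \<Omega>"
  shows "H1_norm \<Omega> u = sqrt ((l2 (lebesgue_on \<Omega>) u)\<^sup>2 + (l2 (lebesgue_on \<Omega>) G)\<^sup>2)"
  unfolding H1_norm_eq
  using l2_cong_AE[OF sq_int_measurable[OF wgrad_H1(1)[OF has_H10_gradient_wgrad(1)[OF u \<Omega>]]]
      sq_int_measurable[OF has_H10_gradient_sq_int(2)[OF u]] has_H10_gradient_wgrad(2)[OF u \<Omega>]]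
  by simp

text \<open>Both sides speak of approximation by test functions. What has to be checked is that the
  gradient chosen for \<open>u - \<phi> k\<close> agrees almost everywhere with the difference of
  the gradients.\<close>

lemma H10_iff:
  assumes \<Omega>: "open \<Omega>"
  shows "u \<in> H10 \<Omega> \<longleftrightarrow> has_H10_gradient \<Omega> u (wgrad \<Omega> u)"
proof
  have \<Omega>m: "\<Omega> \<in> sets lebesgue" using \<Omega> by auto
  { assume "u \<in> H10 \<Omega>"
    then obtain \<phi> where u: "u \<in> H1 \<Omega>" and \<phi>: "\<And>k::nat. \<phi> k \<in> test_functions \<Omega>"
      "(\<lambda>k. H1_norm \<Omega> (\<lambda>x. u x - \<phi> k x)) \<longlonglongrightarrow> 0" unfolding H10_def by auto
    have us: "u \<in> sq_int (lebesgue_on \<Omega>)" using u by (simp add: H1_def L2_eq_sq_int)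
    note g = wgrad_H1[OF u]
    have d: "l2 (lebesgue_on \<Omega>) (\<lambda>x. wgrad \<Omega> u x - grad (\<phi> k) x) = l2 (lebesgue_on \<Omega>) (wgrad \<Omega> (\<lambda>x. u x - \<phi> k x))" for k
    proof -
      note t = test_function_sq_int[OF \<phi>(1) \<Omega>m] test_function_grad_sq_int[OF \<phi>(1) \<Omega>m]
      have w: "has_weak_gradient \<Omega> (\<lambda>x. u x - \<phi> k x) (\<lambda>x. wgrad \<Omega> u x - grad (\<phi> k) x)"
        by (rule has_weak_gradient_diff[OF us g t(1,2)
              smooth_compact_has_weak_gradient[OF test_function_smooth[OF \<phi>(1)] \<Omega>m] \<Omega>m])
      note e = wgrad_AE_eq[OF \<Omega> sq_int_diff[OF us t(1)] sq_int_diff[OF g(1) t(2)] w]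
      show ?thesis
        using l2_cong_AE[OF sq_int_measurable[OF wgrad_H1(1)[OF e(1)]]
            sq_int_measurable[OF sq_int_diff[OF g(1) t(2)]] e(2)] by simp
    qed
    show "has_H10_gradient \<Omega> u (wgrad \<Omega> u)"
    proof (rule has_H10_gradientI[OF us g(1) \<Omega>m \<phi>(1)])
      show "(\<lambda>k. l2 (lebesgue_on \<Omega>) (\<lambda>x. u x - \<phi> k x)) \<longlonglongrightarrow> 0"
        by (rule tendsto_zero_bound[OF \<phi>(2)]) (auto simp: H1_norm_eq real_le_rsqrt)
      show "(\<lambda>k. l2 (lebesgue_on \<Omega>) (\<lambda>x. wgrad \<Omega> u x - grad (\<phi> k) x)) \<longlonglongrightarrow> 0"
        unfolding d by (rule tendsto_zero_bound[OF \<phi>(2)]) (auto simp: H1_norm_eq real_le_rsqrt)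
    qed }
  { assume u: "has_H10_gradient \<Omega> u (wgrad \<Omega> u)"
    obtain \<phi> where \<phi>: "\<And>k. \<phi> k \<in> test_functions \<Omega>" "(\<lambda>k. l2 (lebesgue_on \<Omega>) (\<lambda>x. u x - \<phi> k x)) \<longlonglongrightarrow> 0"
      "(\<lambda>k. l2 (lebesgue_on \<Omega>) (\<lambda>x. wgrad \<Omega> u x - grad (\<phi> k) x)) \<longlonglongrightarrow> 0"
      using has_H10_gradient_obtain[OF u] by auto
    have "(\<lambda>k. H1_norm \<Omega> (\<lambda>x. u x - \<phi> k x)) \<longlonglongrightarrow> sqrt (0\<^sup>2 + 0\<^sup>2)"
      unfolding H1_norm_eq_of_gradient[OF has_H10_gradient_diff[OF u test_function_has_H10_gradient[OF \<phi>(1) \<Omega>m] \<Omega>m] \<Omega>]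
      by (intro tendsto_intros \<phi>)
    then show "u \<in> H10 \<Omega>" unfolding H10_def using has_H10_gradient_wgrad(1)[OF u \<Omega>] \<phi>(1) by auto }
qed

lemma has_H10_gradient_H10:
  assumes u: "has_H10_gradient \<Omega> u G" and \<Omega>: "open \<Omega>"
  shows "u \<in> H10 \<Omega>"
proof -
  have "\<Omega> \<in> sets lebesgue" using \<Omega> by auto
  then show ?thesis unfolding H10_iff[OF \<Omega>]
    using has_H10_gradient_cong[OF u _ wgrad_H1(1)] has_H10_gradient_wgrad[OF u \<Omega>] by blast
qed

lemma test_function_H10: "\<phi> \<in> test_functions \<Omega> \<Longrightarrow> open \<Omega> \<Longrightarrow> \<phi> \<in> H10 \<Omega>"
  by (rule has_H10_gradient_H10[OF test_function_has_H10_gradient]) auto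

text \<open>Poincare's inequality comes from integrating the \<open>i\<close>-th derivative of \<open>x $ i * (\<phi> x)\<^sup>2\<close>.\<close>

lemma Poincare_test_function:
  fixes \<phi> :: "real^'n::finite \<Rightarrow> real"
  assumes \<phi>: "\<phi> \<in> test_functions \<Omega>" and \<Omega>: "\<Omega> \<in> sets lebesgue" and R: "\<And>x. x \<in> \<Omega> \<Longrightarrow> norm x \<le> R" "0 \<le> R"
  shows "l2 (lebesgue_on \<Omega>) \<phi> \<le> 2 * R * l2 (lebesgue_on \<Omega>) (grad \<phi>)"
proof -
  \<comment> \<open>One coordinate direction is enough, and index types are nonempty.\<close>
  fix i :: 'n
  let ?M = "lebesgue_on \<Omega>"
  note sm = test_function_smooth[OF \<phi>]
  have lin: "bounded_linear (\<lambda>x::real^'n. x $ i)" by (rule bounded_linear_vec_nth)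
  have pd: "partial_derivative i (\<lambda>x. x $ i) x = 1" for x :: "real^'n"
    using partial_derivative_eq[OF bounded_linear_imp_has_derivative[OF lin]] by simp
  have t2: "(\<lambda>x. \<phi> x * \<phi> x) \<in> test_functions \<Omega>" by (rule test_function_mult_smooth[OF \<phi> sm])
  have t3: "(\<lambda>x. x $ i * (\<phi> x * \<phi> x)) \<in> test_functions \<Omega>"
    by (rule test_function_smooth_mult[OF smooth_bounded_linear[OF lin] t2])
  have "partial_derivative i (\<lambda>x. x $ i * (\<phi> x * \<phi> x)) x = \<phi> x * \<phi> x + 2 * (x $ i * \<phi> x * partial_derivative i \<phi> x)" for x
    by (simp add: partial_derivative_mult smooth_differentiable sm smooth_mult smooth_bounded_linear[OF lin] pd algebra_simps)
  then have "(LINT x|lborel. \<phi> x * \<phi> x + 2 * (x $ i * \<phi> x * partial_derivative i \<phi> x)) = 0"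
    using integral_partial_derivative_zero[OF t3, of i] by simp
  moreover have "(\<lambda>x::real^'n. x $ i) \<in> borel_measurable borel"
    by (rule smooth_borel[OF smooth_bounded_linear[OF lin]])
  ultimately have z: "(LINT x|?M. \<phi> x * \<phi> x + 2 * (x $ i * \<phi> x * partial_derivative i \<phi> x)) = 0"
    using smooth_borel[OF sm] smooth_borel[OF smooth_partial_derivative[OF sm, of i]] test_function_outside[OF \<phi>]
    by (subst integral_lebesgue_on_eq_lborel[OF _ \<Omega>]) auto
  have xi: "AE x in ?M. \<bar>x $ i\<bar> \<le> R"
    unfolding AE_lebesgue_on_iff[OF \<Omega>]
    using R component_le_norm_cart order_trans by (intro AE_I2) blast
  have xm: "(\<lambda>x. x $ i) \<in> borel_measurable ?M"
    by (intro borel_imp_lebesgue_on smooth_borel smooth_bounded_linear lin)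
  note ps = test_function_sq_int[OF \<phi> \<Omega>] test_function_sq_int[OF test_function_partial[OF \<phi>] \<Omega>, of i]
  have xs: "(\<lambda>x. x $ i * \<phi> x) \<in> sq_int ?M" using sq_int_bounded_scaleR[OF ps(1) xm xi] by simp
  have "l2 ?M (\<lambda>x. x $ i * \<phi> x) \<le> R * l2 ?M \<phi>"
    by (rule l2_mono[OF ps(1) sq_int_measurable[OF xs] _ R(2)])
      (use xi in \<open>eventually_elim, auto simp: abs_mult intro: mult_right_mono\<close>)
  moreover have "l2 ?M (partial_derivative i \<phi>) \<le> 1 * l2 ?M (grad \<phi>)"
    by (rule l2_mono[OF test_function_grad_sq_int[OF \<phi> \<Omega>] sq_int_measurable[OF ps(2)]])
      (auto intro!: AE_I2 simp: component_le_norm_cart[of "grad \<phi> _" i, simplified])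
  ultimately have "l2 ?M (\<lambda>x. x $ i * \<phi> x) * l2 ?M (partial_derivative i \<phi>) \<le> (R * l2 ?M \<phi>) * l2 ?M (grad \<phi>)"
    using R(2) by (intro mult_mono) auto
  moreover have "(l2 ?M \<phi>)\<^sup>2 = - 2 * (LINT x|?M. (x $ i * \<phi> x) \<bullet> partial_derivative i \<phi> x)"
    unfolding l2_power2 using z sq_int_inner_integrable[OF ps(1,1)] sq_int_inner_integrable[OF xs ps(2)]
    by (simp add: power2_eq_square)
  ultimately have "(l2 ?M \<phi>)\<^sup>2 \<le> 2 * ((R * l2 ?M \<phi>) * l2 ?M (grad \<phi>))"
    using l2_Cauchy_Schwarz[OF xs ps(2)] by linarith
  then have "l2 ?M \<phi> * l2 ?M \<phi> \<le> (2 * R * l2 ?M (grad \<phi>)) * l2 ?M \<phi>"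
    by (simp add: power2_eq_square mult_ac)
  then show ?thesis
    using R(2) by (cases "l2 ?M \<phi> = 0") (auto simp: less_le)
qed

theorem Poincare:
  fixes u :: "real^'n::finite \<Rightarrow> real"
  assumes u: "has_H10_gradient \<Omega> u G" and \<Omega>: "\<Omega> \<in> sets lebesgue"
    and R: "\<And>x. x \<in> \<Omega> \<Longrightarrow> norm x \<le> R" "0 \<le> R"
  shows "l2 (lebesgue_on \<Omega>) u \<le> 2 * R * l2 (lebesgue_on \<Omega>) G"
proof -
  obtain \<phi> where \<phi>: "\<And>k. \<phi> k \<in> test_functions \<Omega>" "(\<lambda>k. l2 (lebesgue_on \<Omega>) (\<lambda>x. u x - \<phi> k x)) \<longlonglongrightarrow> 0"
    "(\<lambda>k. l2 (lebesgue_on \<Omega>) (\<lambda>x. G x - grad (\<phi> k) x)) \<longlonglongrightarrow> 0"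
    using has_H10_gradient_obtain[OF u] by auto
  note sq = has_H10_gradient_sq_int[OF u]
  have "(\<lambda>k. l2 (lebesgue_on \<Omega>) (\<phi> k)) \<longlonglongrightarrow> l2 (lebesgue_on \<Omega>) u"
    by (rule l2_tendsto_l2[OF test_function_sq_int[OF \<phi>(1) \<Omega>] sq(1)]) (use \<phi>(2) in \<open>simp add: l2_diff_commute[of _ u]\<close>)
  moreover have "(\<lambda>k. l2 (lebesgue_on \<Omega>) (grad (\<phi> k))) \<longlonglongrightarrow> l2 (lebesgue_on \<Omega>) G"
    by (rule l2_tendsto_l2[OF test_function_grad_sq_int[OF \<phi>(1) \<Omega>] sq(2)]) (use \<phi>(3) in \<open>simp add: l2_diff_commute[of _ G]\<close>)
  ultimately show ?thesis
    using Poincare_test_function[OF \<phi>(1) \<Omega> R] by (intro LIMSEQ_le[OF _ tendsto_mult_left]) auto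
qed

section \<open>Weighted Dirichlet forms on \<open>H10\<close>\<close>

text \<open>With weight 1 this is the inner product used on \<open>H10 \<Omega>\<close> throughout;
  with weight \<open>a k\<close> it is the weak form of the equation solved by the
  correctors.\<close>

definition dirichlet ::
  "(real^'n::finite) set \<Rightarrow> (real^'n \<Rightarrow> real) \<Rightarrow> (real^'n \<Rightarrow> real) \<Rightarrow> (real^'n \<Rightarrow> real) \<Rightarrow> real" where
  "dirichlet \<Omega> a u v = (LINT x|lebesgue_on \<Omega>. a x * (wgrad \<Omega> u x \<bullet> wgrad \<Omega> v x))"

locale domain =
  fixes \<Omega> :: "(real^'n::finite) set"
  assumes open_domain: "open \<Omega>" and bounded_domain: "bounded \<Omega>"
begin

abbreviation "M \<equiv> lebesgue_on \<Omega>"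

lemma domain_sets [simp, intro]: "\<Omega> \<in> sets lebesgue"
  using open_domain by auto

lemma finite_measure_domain: "finite_measure M"
  by (rule finite_measure_lebesgue_on) (simp add: bounded_domain lmeasurable_open open_domain)

lemma H10_gradient: "u \<in> H10 \<Omega> \<Longrightarrow> has_H10_gradient \<Omega> u (wgrad \<Omega> u)"
  using H10_iff[OF open_domain] by simp

lemma H10_sq_int: "u \<in> H10 \<Omega> \<Longrightarrow> u \<in> sq_int M" "u \<in> H10 \<Omega> \<Longrightarrow> wgrad \<Omega> u \<in> sq_int M"
  using has_H10_gradient_sq_int[OF H10_gradient] by auto

lemma H10_add: "u \<in> H10 \<Omega> \<Longrightarrow> v \<in> H10 \<Omega> \<Longrightarrow> (\<lambda>x. u x + v x) \<in> H10 \<Omega>"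
  by (rule has_H10_gradient_H10[OF has_H10_gradient_add[OF H10_gradient H10_gradient] open_domain]) auto

lemma H10_scale: "u \<in> H10 \<Omega> \<Longrightarrow> (\<lambda>x. c * u x) \<in> H10 \<Omega>"
  by (rule has_H10_gradient_H10[OF has_H10_gradient_scale[OF H10_gradient] open_domain]) auto

lemma H10_diff: "u \<in> H10 \<Omega> \<Longrightarrow> v \<in> H10 \<Omega> \<Longrightarrow> (\<lambda>x. u x - v x) \<in> H10 \<Omega>"
  by (rule has_H10_gradient_H10[OF has_H10_gradient_diff[OF H10_gradient H10_gradient] open_domain]) auto

lemma H10_test_mult: "u \<in> H10 \<Omega> \<Longrightarrow> \<psi> \<in> test_functions \<Omega>' \<Longrightarrow> (\<lambda>x. \<psi> x * u x) \<in> H10 \<Omega>"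
  by (rule has_H10_gradient_H10[OF has_H10_gradient_test_mult[OF H10_gradient] open_domain]) auto

lemma wgrad_add: "u \<in> H10 \<Omega> \<Longrightarrow> v \<in> H10 \<Omega> \<Longrightarrow> AE x in M. wgrad \<Omega> (\<lambda>x. u x + v x) x = wgrad \<Omega> u x + wgrad \<Omega> v x"
  by (rule has_H10_gradient_wgrad(2)[OF has_H10_gradient_add[OF H10_gradient H10_gradient] open_domain]) auto

lemma wgrad_scale: "u \<in> H10 \<Omega> \<Longrightarrow> AE x in M. wgrad \<Omega> (\<lambda>x. c * u x) x = c *\<^sub>R wgrad \<Omega> u x"
  by (rule has_H10_gradient_wgrad(2)[OF has_H10_gradient_scale[OF H10_gradient] open_domain]) auto

lemma wgrad_diff: "u \<in> H10 \<Omega> \<Longrightarrow> v \<in> H10 \<Omega> \<Longrightarrow> AE x in M. wgrad \<Omega> (\<lambda>x. u x - v x) x = wgrad \<Omega> u x - wgrad \<Omega> v x"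
  by (rule has_H10_gradient_wgrad(2)[OF has_H10_gradient_diff[OF H10_gradient H10_gradient] open_domain]) auto

lemma wgrad_test_mult: "u \<in> H10 \<Omega> \<Longrightarrow> \<psi> \<in> test_functions \<Omega>' \<Longrightarrow>
    AE x in M. wgrad \<Omega> (\<lambda>x. \<psi> x * u x) x = \<psi> x *\<^sub>R wgrad \<Omega> u x + u x *\<^sub>R grad \<psi> x"
  by (rule has_H10_gradient_wgrad(2)[OF has_H10_gradient_test_mult[OF H10_gradient] open_domain]) auto

lemma wgrad_test: "\<phi> \<in> test_functions \<Omega> \<Longrightarrow> AE x in M. wgrad \<Omega> \<phi> x = grad \<phi> x"
  by (rule has_H10_gradient_wgrad(2)[OF test_function_has_H10_gradient open_domain]) auto

lemma Poincare_constant: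
  obtains P where "P \<ge> 0" "\<And>u G. has_H10_gradient \<Omega> u G \<Longrightarrow> l2 M u \<le> P * l2 M G"
proof -
  obtain R where "\<forall>x\<in>\<Omega>. norm x \<le> R" using bounded_domain unfolding bounded_iff by auto
  then have "\<And>x. x \<in> \<Omega> \<Longrightarrow> norm x \<le> max R 0" "0 \<le> max R 0" by fastforce+
  from Poincare[OF _ domain_sets this] show ?thesis by (intro that[of "2 * max R 0"]) auto
qed

lemma dirichlet_integrable:
  assumes "u \<in> sq_int M" "v \<in> sq_int M" "a \<in> borel_measurable M" "AE x in M. \<bar>a x\<bar> \<le> C"
  shows "integrable M (\<lambda>x. a x * (u x \<bullet> v x))"
  using sq_int_inner_integrable[OF sq_int_bounded_scaleR[OF assms(1,3,4)] assms(2)] by simp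

text \<open>By the bounds on \<open>a\<close> the form is equivalent to the squared
  \<open>L2\<close> norm of the gradient, and Poincare's inequality controls the function itself.
  Completeness then follows from that of \<open>L2\<close>, for functions and for gradients, and
  from the closedness of \<open>has_H10_gradient\<close>.\<close>

theorem dirichlet_complete:
  assumes a: "a \<in> borel_measurable M" "0 < a1" "AE x in M. a1 \<le> a x \<and> a x \<le> a2"
  shows "complete_semi_inner (H10 \<Omega>) (dirichlet \<Omega> a)"
    and "u \<in> H10 \<Omega> \<Longrightarrow> a1 * (l2 M (wgrad \<Omega> u))\<^sup>2 \<le> dirichlet \<Omega> a u u"
    and "u \<in> H10 \<Omega> \<Longrightarrow> dirichlet \<Omega> a u u \<le> a2 * (l2 M (wgrad \<Omega> u))\<^sup>2"
proof -
  have ab: "AE x in M. \<bar>a x\<bar> \<le> a2" using a(3) by eventually_elim (use a(2) in auto)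
  have int: "integrable M (\<lambda>x. a x * (wgrad \<Omega> u x \<bullet> wgrad \<Omega> v x))" if "u \<in> H10 \<Omega>" "v \<in> H10 \<Omega>" for u v
    by (rule dirichlet_integrable[OF _ _ a(1) ab]) (use H10_sq_int that in auto)
  have lower: "a1 * (l2 M (wgrad \<Omega> u))\<^sup>2 \<le> dirichlet \<Omega> a u u" if u: "u \<in> H10 \<Omega>" for u
  proof -
    have "(LINT x|M. a1 * (norm (wgrad \<Omega> u x))\<^sup>2) \<le> (LINT x|M. a x * (wgrad \<Omega> u x \<bullet> wgrad \<Omega> u x))"
    proof (rule integral_mono_AE[OF _ int[OF u u]])
      show "integrable M (\<lambda>x. a1 * (norm (wgrad \<Omega> u x))\<^sup>2)"
        using sq_int_integrable[OF H10_sq_int(2)[OF u]] by simp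
      show "AE x in M. a1 * (norm (wgrad \<Omega> u x))\<^sup>2 \<le> a x * (wgrad \<Omega> u x \<bullet> wgrad \<Omega> u x)"
        using a(3) by eventually_elim (auto simp: power2_norm_eq_inner intro: mult_right_mono)
    qed
    then show ?thesis by (simp add: dirichlet_def l2_power2)
  qed
  then show "u \<in> H10 \<Omega> \<Longrightarrow> a1 * (l2 M (wgrad \<Omega> u))\<^sup>2 \<le> dirichlet \<Omega> a u u" .
  have upper: "dirichlet \<Omega> a u u \<le> a2 * (l2 M (wgrad \<Omega> u))\<^sup>2" if u: "u \<in> H10 \<Omega>" for u
  proof -
    have "(LINT x|M. a x * (wgrad \<Omega> u x \<bullet> wgrad \<Omega> u x)) \<le> (LINT x|M. a2 * (norm (wgrad \<Omega> u x))\<^sup>2)"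
    proof (rule integral_mono_AE[OF int[OF u u]])
      show "integrable M (\<lambda>x. a2 * (norm (wgrad \<Omega> u x))\<^sup>2)"
        using sq_int_integrable[OF H10_sq_int(2)[OF u]] by simp
      show "AE x in M. a x * (wgrad \<Omega> u x \<bullet> wgrad \<Omega> u x) \<le> a2 * (norm (wgrad \<Omega> u x))\<^sup>2"
        using a(3) by eventually_elim (auto simp: power2_norm_eq_inner intro: mult_right_mono)
    qed
    then show ?thesis by (simp add: dirichlet_def l2_power2)
  qed
  then show "u \<in> H10 \<Omega> \<Longrightarrow> dirichlet \<Omega> a u u \<le> a2 * (l2 M (wgrad \<Omega> u))\<^sup>2" .
  interpret semi_inner "H10 \<Omega>" "dirichlet \<Omega> a"
  proof
    show "(\<lambda>x. 0) \<in> H10 \<Omega>" by (rule test_function_H10[OF test_function_zero open_domain])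
    show "dirichlet \<Omega> a (\<lambda>x. u x + v x) w = dirichlet \<Omega> a u w + dirichlet \<Omega> a v w"
      if u: "u \<in> H10 \<Omega>" and v: "v \<in> H10 \<Omega>" and w: "w \<in> H10 \<Omega>" for u v w
    proof -
      have "dirichlet \<Omega> a (\<lambda>x. u x + v x) w
          = (LINT x|M. a x * (wgrad \<Omega> u x \<bullet> wgrad \<Omega> w x) + a x * (wgrad \<Omega> v x \<bullet> wgrad \<Omega> w x))"
        unfolding dirichlet_def
      proof (rule integral_cong_AE)
        show "AE x in M. a x * (wgrad \<Omega> (\<lambda>x. u x + v x) x \<bullet> wgrad \<Omega> w x)
            = a x * (wgrad \<Omega> u x \<bullet> wgrad \<Omega> w x) + a x * (wgrad \<Omega> v x \<bullet> wgrad \<Omega> w x)"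
          using wgrad_add[OF u v] by eventually_elim (simp add: inner_add_left algebra_simps)
      qed (use borel_measurable_integrable[OF int[OF H10_add[OF u v] w]]
        borel_measurable_integrable[OF int[OF u w]] borel_measurable_integrable[OF int[OF v w]] in measurable)
      then show ?thesis using int[OF u w] int[OF v w] by (simp add: dirichlet_def)
    qed
    show "dirichlet \<Omega> a (\<lambda>x. c * u x) w = c * dirichlet \<Omega> a u w"
      if u: "u \<in> H10 \<Omega>" and w: "w \<in> H10 \<Omega>" for c u w
    proof -
      have "dirichlet \<Omega> a (\<lambda>x. c * u x) w = (LINT x|M. c * (a x * (wgrad \<Omega> u x \<bullet> wgrad \<Omega> w x)))"
        unfolding dirichlet_def
      proof (rule integral_cong_AE)
        show "AE x in M. a x * (wgrad \<Omega> (\<lambda>x. c * u x) x \<bullet> wgrad \<Omega> w x) = c * (a x * (wgrad \<Omega> u x \<bullet> wgrad \<Omega> w x))"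
          using wgrad_scale[OF u, of c] by eventually_elim simp
      qed (use borel_measurable_integrable[OF int[OF H10_scale[OF u] w]]
        borel_measurable_integrable[OF int[OF u w]] in measurable)
      then show ?thesis by (simp add: dirichlet_def)
    qed
    show "0 \<le> dirichlet \<Omega> a u u" if "u \<in> H10 \<Omega>" for u
      using lower[OF that] a(2) by (smt (verit) mult_nonneg_nonneg zero_le_power2)
  qed (auto simp: H10_add H10_scale dirichlet_def inner_commute)
  have nrm_lower: "sqrt a1 * l2 M (wgrad \<Omega> u) \<le> nrm u" if "u \<in> H10 \<Omega>" for u
    using real_sqrt_le_mono[OF lower[OF that]] by (simp add: nrm_def real_sqrt_mult)
  have nrm_upper: "nrm u \<le> sqrt a2 * l2 M (wgrad \<Omega> u)" if "u \<in> H10 \<Omega>" for u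
    using real_sqrt_le_mono[OF upper[OF that]] by (simp add: nrm_def real_sqrt_mult)
  show "complete_semi_inner (H10 \<Omega>) (dirichlet \<Omega> a)"
  proof
    fix X :: "nat \<Rightarrow> _"
    assume X: "\<And>n. X n \<in> H10 \<Omega>"
      and C: "\<And>e. e > 0 \<Longrightarrow> \<exists>N. \<forall>m\<ge>N. \<forall>n\<ge>N. nrm (\<lambda>x. X m x - X n x) < e"
    obtain P where P: "P \<ge> 0" "\<And>u G. has_H10_gradient \<Omega> u G \<Longrightarrow> l2 M u \<le> P * l2 M G"
      using Poincare_constant by auto
    note dH = has_H10_gradient_diff[OF H10_gradient H10_gradient domain_sets]
    have gd: "l2 M (\<lambda>x. wgrad \<Omega> (X m) x - wgrad \<Omega> (X n) x) = l2 M (wgrad \<Omega> (\<lambda>x. X m x - X n x))" for m n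
      by (rule l2_cong_AE[symmetric, OF _ _ wgrad_diff[OF X X]])
        (intro sq_int_measurable sq_int_diff H10_sq_int H10_diff X)+
    have CG: "\<exists>N. \<forall>m\<ge>N. \<forall>n\<ge>N. l2 M (\<lambda>x. wgrad \<Omega> (X m) x - wgrad \<Omega> (X n) x) < e" if "e > 0" for e
    proof -
      have "sqrt a1 * e > 0" using that a(2) by simp
      from C[OF this] obtain N where N: "\<And>m n. m \<ge> N \<Longrightarrow> n \<ge> N \<Longrightarrow> nrm (\<lambda>x. X m x - X n x) < sqrt a1 * e" by auto
      have "l2 M (\<lambda>x. wgrad \<Omega> (X m) x - wgrad \<Omega> (X n) x) < e" if mn: "m \<ge> N" "n \<ge> N" for m n
      proof -
        have "sqrt a1 * l2 M (wgrad \<Omega> (\<lambda>x. X m x - X n x)) < sqrt a1 * e"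
          using nrm_lower[OF H10_diff[OF X X], of m n] N[OF mn] by linarith
        then show ?thesis unfolding gd using a(2) by simp
      qed
      then show ?thesis by blast
    qed
    \<comment> \<open>Poincare's inequality makes the functions Cauchy once their gradients are;
      dividing by \<open>P + 1\<close> allows for \<open>P = 0\<close>.\<close>
    have Cu: "\<exists>N. \<forall>m\<ge>N. \<forall>n\<ge>N. l2 M (\<lambda>x. X m x - X n x) < e" if "e > 0" for e
    proof -
      have "e / (P + 1) > 0" using that P(1) by simp
      from CG[OF this] obtain N where N: "\<And>m n. m \<ge> N \<Longrightarrow> n \<ge> N \<Longrightarrow>
        l2 M (\<lambda>x. wgrad \<Omega> (X m) x - wgrad \<Omega> (X n) x) < e / (P + 1)" by auto
      have "l2 M (\<lambda>x. X m x - X n x) < e" if mn: "m \<ge> N" "n \<ge> N" for m n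
      proof -
        have "l2 M (\<lambda>x. X m x - X n x) \<le> P * l2 M (\<lambda>x. wgrad \<Omega> (X m) x - wgrad \<Omega> (X n) x)"
          by (rule P(2)[OF dH[OF X X]])
        also have "\<dots> \<le> P * (e / (P + 1))" using N[OF mn] P(1) by (intro mult_left_mono) auto
        also have "\<dots> < e" using P(1) \<open>e > 0\<close> by (simp add: field_simps)
        finally show ?thesis .
      qed
      then show ?thesis by blast
    qed
    obtain u where u: "u \<in> sq_int M" "(\<lambda>n. l2 M (\<lambda>x. X n x - u x)) \<longlonglongrightarrow> 0"
      using l2_complete[OF H10_sq_int(1)[OF X] Cu] by auto
    obtain G where G: "G \<in> sq_int M" "(\<lambda>n. l2 M (\<lambda>x. wgrad \<Omega> (X n) x - G x)) \<longlonglongrightarrow> 0"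
      using l2_complete[OF H10_sq_int(2)[OF X] CG] by auto
    have uG: "has_H10_gradient \<Omega> u G"
      by (rule has_H10_gradient_limit[OF u(1) G(1) domain_sets H10_gradient[OF X] u(2) G(2)])
    have uH: "u \<in> H10 \<Omega>" by (rule has_H10_gradient_H10[OF uG open_domain])
    have gu: "l2 M (wgrad \<Omega> (\<lambda>x. X n x - u x)) = l2 M (\<lambda>x. wgrad \<Omega> (X n) x - G x)" for n
    proof (rule l2_cong_AE)
      show "AE x in M. wgrad \<Omega> (\<lambda>x. X n x - u x) x = wgrad \<Omega> (X n) x - G x"
        by (rule has_H10_gradient_wgrad(2)[OF has_H10_gradient_diff[OF H10_gradient[OF X] uG domain_sets] open_domain])
    qed (intro sq_int_measurable sq_int_diff H10_sq_int H10_diff X uH G)+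
    have "(\<lambda>n. nrm (\<lambda>x. X n x - u x)) \<longlonglongrightarrow> 0"
    proof (rule tendsto_zero_bound)
      show "(\<lambda>n. sqrt a2 * l2 M (\<lambda>x. wgrad \<Omega> (X n) x - G x)) \<longlonglongrightarrow> 0"
        using tendsto_mult_left[OF G(2), of "sqrt a2"] by simp
      show "nrm (\<lambda>x. X n x - u x) \<le> sqrt a2 * l2 M (\<lambda>x. wgrad \<Omega> (X n) x - G x)" for n
        using nrm_upper[OF H10_diff[OF X uH]] by (simp add: gu)
    qed (use H10_diff[OF X uH] in simp)
    with uH show "\<exists>l\<in>H10 \<Omega>. (\<lambda>n. nrm (\<lambda>x. X n x - l x)) \<longlonglongrightarrow> 0" by auto
  qed
qed

end

section \<open>Translation estimates and their consequences\<close>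

text \<open>The fundamental theorem of calculus along the segment from \<open>x\<close> to
  \<open>x + z\<close>. For exponent 2, Jensen's inequality is obtained by expanding the integral of
  \<open>(h t - m)\<^sup>2\<close>. The bound is written in \<open>ennreal\<close> in preparation
  for Tonelli's theorem.\<close>

lemma smooth_increment_bound:
  assumes \<phi>: "smooth \<phi>" and p: "p = 1 \<or> p = (2::nat)"
  shows "ennreal (\<bar>\<phi> (x + z) - \<phi> x\<bar> ^ p)
    \<le> (\<integral>\<^sup>+t\<in>{0..1}. ennreal (norm z ^ p * norm (grad \<phi> (x + t *\<^sub>R z)) ^ p) \<partial>lborel)"
proof -
  define h where "h t = grad \<phi> (x + t *\<^sub>R z) \<bullet> z" for t :: real
  define m where "m = \<phi> (x + z) - \<phi> x"
  have hc: "continuous_on {0..1} h"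
    unfolding h_def by (intro continuous_intros continuous_on_compose2[OF continuous_grad[OF \<phi>, of UNIV]]) auto
  have "(h has_integral (\<phi> (x + 1 *\<^sub>R z) - \<phi> (x + 0 *\<^sub>R z))) {0..1}"
  proof (rule fundamental_theorem_of_calculus)
    fix t :: real
    have "((\<lambda>t. x + t *\<^sub>R z) has_derivative (\<lambda>t. t *\<^sub>R z)) (at t)"
      by (auto intro!: derivative_eq_intros)
    from diff_chain_at[OF this smooth_has_derivative[OF \<phi>]]
    have "((\<lambda>t. \<phi> (x + t *\<^sub>R z)) has_derivative (\<lambda>s. s *\<^sub>R h t)) (at t)"
      by (simp add: o_def h_def)
    then show "((\<lambda>t. \<phi> (x + t *\<^sub>R z)) has_vector_derivative h t) (at t within {0..1})"
      unfolding has_vector_derivative_def by (rule has_derivative_at_withinI)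
  qed simp
  then have h: "(h has_integral m) {0..1}" by (simp add: m_def)
  have hp: "(\<lambda>t. \<bar>h t\<bar> ^ p) integrable_on {0..1}"
    by (intro integrable_continuous_interval continuous_intros hc)
  have "\<bar>m\<bar> ^ p \<le> integral {0..1} (\<lambda>t. \<bar>h t\<bar> ^ p)"
    using p
  proof
    assume "p = 1"
    have "\<bar>integral {0..1} h\<bar> \<le> integral {0..1} (\<lambda>t. \<bar>h t\<bar>)"
      using integral_norm_bound_integral[of h "{0..1}" "\<lambda>t. \<bar>h t\<bar>"] h hp \<open>p = 1\<close>
      by (auto simp: has_integral_integrable)
    with \<open>p = 1\<close> show ?thesis using integral_unique[OF h] by simp
  next
    assume "p = 2"
    have "(\<lambda>t. (h t)\<^sup>2) integrable_on {0..1}" using hp \<open>p = 2\<close> by simp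
    then have "((\<lambda>t. (h t)\<^sup>2 - 2 * m * h t + m\<^sup>2) has_integral (integral {0..1} (\<lambda>t. (h t)\<^sup>2) - 2 * m * m + m\<^sup>2)) {0..1}"
      using has_integral_const_real[of "m\<^sup>2" 0 1]
      by (intro has_integral_add has_integral_diff integrable_integral has_integral_mult_right h) simp_all
    then have "0 \<le> integral {0..1} (\<lambda>t. (h t)\<^sup>2) - 2 * m * m + m\<^sup>2"
    proof (rule has_integral_nonneg)
      fix t
      have "(h t)\<^sup>2 - 2 * m * h t + m\<^sup>2 = (h t - m)\<^sup>2" by (simp add: power2_diff algebra_simps)
      then show "0 \<le> (h t)\<^sup>2 - 2 * m * h t + m\<^sup>2" by simp
    qed
    with \<open>p = 2\<close> show ?thesis by (simp add: power2_eq_square)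
  qed
  then have "ennreal (\<bar>m\<bar> ^ p) \<le> ennreal (integral {0..1} (\<lambda>t. \<bar>h t\<bar> ^ p))" by (rule ennreal_leI)
  also have "\<dots> = (\<integral>\<^sup>+t\<in>{0..1}. ennreal (\<bar>h t\<bar> ^ p) \<partial>lborel)"
    by (rule nn_integral_has_integral_lebesgue'[symmetric]) (use hp in \<open>auto intro: integrable_integral\<close>)
  also have "\<dots> \<le> (\<integral>\<^sup>+t\<in>{0..1}. ennreal (norm z ^ p * norm (grad \<phi> (x + t *\<^sub>R z)) ^ p) \<partial>lborel)"
  proof (intro nn_integral_mono mult_right_mono ennreal_leI)
    fix t :: real
    have "\<bar>h t\<bar> ^ p \<le> (norm (grad \<phi> (x + t *\<^sub>R z)) * norm z) ^ p"
      unfolding h_def by (intro power_mono Cauchy_Schwarz_ineq2) auto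
    then show "\<bar>h t\<bar> ^ p \<le> norm z ^ p * norm (grad \<phi> (x + t *\<^sub>R z)) ^ p"
      by (simp add: power_mult_distrib mult.commute)
  qed simp
  finally show ?thesis by (simp add: m_def)
qed

text \<open>After the exchange of integrals, translation by \<open>t *\<^sub>R z\<close> moves
  \<open>S\<close> into \<open>S'\<close>, so each \<open>t\<close> in the unit interval contributes
  at most the integral over \<open>S'\<close>.\<close>

lemma translation_estimate:
  assumes \<phi>: "smooth \<phi>" and p: "p = 1 \<or> p = (2::nat)"
    and S: "S \<in> sets borel" and S': "S' \<in> sets borel"
    and sub: "\<And>x t. x \<in> S \<Longrightarrow> 0 \<le> t \<Longrightarrow> t \<le> 1 \<Longrightarrow> x + t *\<^sub>R z \<in> S'"
  shows "(\<integral>\<^sup>+x\<in>S. ennreal (\<bar>\<phi> (x + z) - \<phi> x\<bar> ^ p) \<partial>lborel)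
    \<le> ennreal (norm z ^ p) * (\<integral>\<^sup>+x\<in>S'. ennreal (norm (grad \<phi> x) ^ p) \<partial>lborel)"
proof -
  let ?k = "\<lambda>x. ennreal (norm (grad \<phi> x) ^ p)"
  have [measurable]: "\<phi> \<in> borel_measurable borel" "grad \<phi> \<in> borel_measurable borel" "S \<in> sets borel" "S' \<in> sets borel"
    using \<phi> S S' smooth_borel grad_borel by auto
  have "(\<integral>\<^sup>+x\<in>S. ennreal (\<bar>\<phi> (x + z) - \<phi> x\<bar> ^ p) \<partial>lborel)
      \<le> (\<integral>\<^sup>+x\<in>S. (\<integral>\<^sup>+t\<in>{0..1}. ennreal (norm z ^ p * norm (grad \<phi> (x + t *\<^sub>R z)) ^ p) \<partial>lborel) \<partial>lborel)"
    by (intro nn_integral_mono mult_right_mono smooth_increment_bound \<phi> p) simp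
  also have "\<dots> = (\<integral>\<^sup>+x. (\<integral>\<^sup>+t. ennreal (norm z ^ p) * (?k (x + t *\<^sub>R z) * indicator {0..1} t * indicator S x) \<partial>lborel) \<partial>lborel)"
    by (subst nn_integral_multc[symmetric]) (auto simp: ennreal_mult mult_ac intro!: nn_integral_cong)
  also have "\<dots> = (\<integral>\<^sup>+t. (\<integral>\<^sup>+x. ennreal (norm z ^ p) * (?k (x + t *\<^sub>R z) * indicator {0..1} t * indicator S x) \<partial>lborel) \<partial>lborel)"
    by (rule lborel_pair.Fubini'[symmetric]) measurable
  also have "\<dots> \<le> (\<integral>\<^sup>+t. (ennreal (norm z ^ p) * (\<integral>\<^sup>+x\<in>S'. ?k x \<partial>lborel)) * indicator {0..1::real} t \<partial>lborel)"
  proof (rule nn_integral_mono)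
    fix t :: real
    have "(\<integral>\<^sup>+x. ennreal (norm z ^ p) * (?k (x + t *\<^sub>R z) * indicator {0..1} t * indicator S x) \<partial>lborel)
        \<le> (\<integral>\<^sup>+x. (ennreal (norm z ^ p) * indicator {0..1} t) * (?k (t *\<^sub>R z + x) * indicator S' (t *\<^sub>R z + x)) \<partial>lborel)"
      using sub[of _ t] by (intro nn_integral_mono) (auto simp: indicator_def add.commute)
    also have "\<dots> = (ennreal (norm z ^ p) * indicator {0..1} t) * (\<integral>\<^sup>+x. ?k (t *\<^sub>R z + x) * indicator S' (t *\<^sub>R z + x) \<partial>lborel)"
      by (rule nn_integral_cmult) measurable
    also have "(\<integral>\<^sup>+x. ?k (t *\<^sub>R z + x) * indicator S' (t *\<^sub>R z + x) \<partial>lborel)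
        = (\<integral>\<^sup>+x. ?k x * indicator S' x \<partial>distr lborel borel ((+) (t *\<^sub>R z)))"
      by (rule nn_integral_distr[symmetric]) measurable
    also have "\<dots> = (\<integral>\<^sup>+x\<in>S'. ?k x \<partial>lborel)" by (simp add: lborel_distr_plus)
    finally show "(\<integral>\<^sup>+x. ennreal (norm z ^ p) * (?k (x + t *\<^sub>R z) * indicator {0..1} t * indicator S x) \<partial>lborel)
        \<le> (ennreal (norm z ^ p) * (\<integral>\<^sup>+x\<in>S'. ?k x \<partial>lborel)) * indicator {0..1} t"
      by (simp add: mult_ac)
  qed
  also have "\<dots> = ennreal (norm z ^ p) * (\<integral>\<^sup>+x\<in>S'. ?k x \<partial>lborel)"
    by (subst nn_integral_cmult_indicator) auto
  finally show ?thesis .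
qed

text \<open>Exponent 1 serves the Poincare inequality for means, exponent 2 the comparison of a
  function with its means over small balls.\<close>

lemma averaged_translation_estimate:
  fixes \<phi> :: "real^'n::finite \<Rightarrow> real"
  assumes \<phi>: "smooth \<phi>" and p: "p = 1 \<or> p = (2::nat)" and s: "s > 0"
    and S: "S \<in> sets borel" and S': "S' \<in> sets borel"
    and sub: "\<And>x w. x \<in> S \<Longrightarrow> norm w < s \<Longrightarrow> x + w \<in> S'"
  shows "(\<integral>\<^sup>+x\<in>S. (\<integral>\<^sup>+z\<in>ball 0 s. ennreal (\<bar>\<phi> (x + z) - \<phi> x\<bar> ^ p) \<partial>lborel) \<partial>lborel)
    \<le> ennreal (measure lborel (ball (0::real^'n) s) * s ^ p) * (\<integral>\<^sup>+x\<in>S'. ennreal (norm (grad \<phi> x) ^ p) \<partial>lborel)"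
proof -
  let ?I = "\<integral>\<^sup>+x\<in>S'. ennreal (norm (grad \<phi> x) ^ p) \<partial>lborel"
  have [measurable]: "\<phi> \<in> borel_measurable borel" "S \<in> sets borel" "ball (0::real^'n) s \<in> sets borel"
    using \<phi> S smooth_borel by auto
  have "(\<integral>\<^sup>+x\<in>S. (\<integral>\<^sup>+z\<in>ball 0 s. ennreal (\<bar>\<phi> (x + z) - \<phi> x\<bar> ^ p) \<partial>lborel) \<partial>lborel)
    = (\<integral>\<^sup>+x. (\<integral>\<^sup>+z. ennreal (\<bar>\<phi> (x + z) - \<phi> x\<bar> ^ p) * indicator S x * indicator (ball 0 s) z \<partial>lborel) \<partial>lborel)"
    by (subst nn_integral_multc[symmetric]) (auto simp: mult_ac intro!: nn_integral_cong)
  also have "\<dots> = (\<integral>\<^sup>+z. (\<integral>\<^sup>+x. ennreal (\<bar>\<phi> (x + z) - \<phi> x\<bar> ^ p) * indicator S x * indicator (ball 0 s) z \<partial>lborel) \<partial>lborel)"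
    by (rule lborel_pair.Fubini'[symmetric]) measurable
  also have "\<dots> = (\<integral>\<^sup>+z\<in>ball 0 s. (\<integral>\<^sup>+x\<in>S. ennreal (\<bar>\<phi> (x + z) - \<phi> x\<bar> ^ p) \<partial>lborel) \<partial>lborel)"
    by (intro nn_integral_cong nn_integral_multc) measurable
  also have "\<dots> \<le> (\<integral>\<^sup>+z\<in>ball (0::real^'n) s. (ennreal (s ^ p) * ?I) \<partial>lborel)"
  proof (rule nn_integral_mono)
    fix z :: "real^'n"
    show "(\<integral>\<^sup>+x\<in>S. ennreal (\<bar>\<phi> (x + z) - \<phi> x\<bar> ^ p) \<partial>lborel) * indicator (ball 0 s) z
        \<le> (ennreal (s ^ p) * ?I) * indicator (ball 0 s) z"
    proof (cases "z \<in> ball 0 s")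
      case True
      have "(\<integral>\<^sup>+x\<in>S. ennreal (\<bar>\<phi> (x + z) - \<phi> x\<bar> ^ p) \<partial>lborel) \<le> ennreal (norm z ^ p) * ?I"
      proof (rule translation_estimate[OF \<phi> p S S'])
        fix x and t :: real assume "x \<in> S" "0 \<le> t" "t \<le> 1"
        moreover have "t * norm z \<le> 1 * norm z" using \<open>t \<le> 1\<close> by (intro mult_right_mono) auto
        ultimately show "x + t *\<^sub>R z \<in> S'" using True by (intro sub) auto
      qed
      also have "\<dots> \<le> ennreal (s ^ p) * ?I"
        using True by (intro mult_right_mono ennreal_leI power_mono) auto
      finally show ?thesis using True by simp
    qed simp
  qed
  also have "\<dots> = (ennreal (s ^ p) * ?I) * emeasure lborel (ball (0::real^'n) s)"
    by (rule nn_integral_cmult_indicator) simp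
  also have "emeasure lborel (ball (0::real^'n) s) = ennreal (measure lborel (ball (0::real^'n) s))"
    by (rule emeasure_eq_ennreal_measure) (use emeasure_lborel_ball_finite[of "0::real^'n" s] in auto)
  finally show ?thesis using s by (simp add: ennreal_mult mult_ac)
qed

definition ball_avg :: "real \<Rightarrow> (real^'n::finite \<Rightarrow> real) \<Rightarrow> real^'n \<Rightarrow> real" where
  "ball_avg s f x = (LINT z|lborel. indicator (ball 0 s) z * f (x + z)) / measure lborel (ball (0::real^'n) s)"

lemma bounded_borel_integrable_on_bounded:
  fixes f :: "'a::euclidean_space \<Rightarrow> real"
  assumes "f \<in> borel_measurable borel" "\<And>x. \<bar>f x\<bar> \<le> C" "bounded S" "S \<in> sets borel"
  shows "integrable lborel (\<lambda>x. indicator S x * f x)"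
proof (rule Bochner_Integration.integrable_bound)
  show "integrable lborel (\<lambda>x. C * indicator S x)"
    using assms(3,4) emeasure_bounded_finite[OF assms(3)]
    by (intro integrable_mult_right integrable_real_indicator) auto
  show "(\<lambda>x. indicator S x * f x) \<in> borel_measurable lborel" using assms(1,4) by measurable
  have "\<bar>f x\<bar> \<le> \<bar>C\<bar>" for x using assms(2)[of x] by linarith
  then show "AE x in lborel. norm (indicator S x * f x) \<le> norm (C * indicator S x)"
    by (auto simp: indicator_def)
qed

text \<open>The mean of \<open>\<phi>\<close> over the ball around \<open>x\<close> is inserted
  between \<open>\<phi> x\<close> and \<open>c\<close>; the first difference is estimated by
  Jensen's inequality, the second is kept.\<close>

lemma square_le_ball_avg:
  fixes \<phi> :: "real^'n::finite \<Rightarrow> real"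
  assumes \<phi>: "\<phi> \<in> borel_measurable borel" "\<And>x. \<bar>\<phi> x\<bar> \<le> C" and s: "s > 0"
  defines "V \<equiv> measure lborel (ball (0::real^'n) s)"
  shows "ennreal ((\<phi> x - c)\<^sup>2) \<le> ennreal (2 / V) * (\<integral>\<^sup>+z\<in>ball 0 s. ennreal (\<bar>\<phi> (x + z) - \<phi> x\<bar>\<^sup>2) \<partial>lborel)
    + ennreal (2 * (ball_avg s \<phi> x - c)\<^sup>2)"
proof -
  let ?i = "indicator (ball (0::real^'n) s) :: _ \<Rightarrow> real"
  have V: "V > 0" using s by (simp add: V_def)
  have [measurable]: "\<phi> \<in> borel_measurable borel" by fact
  have C: "C \<ge> 0" using \<phi>(2)[of 0] by linarith
  have i0: "integrable lborel ?i"
    using emeasure_lborel_ball_finite[of "0::real^'n" s] by (intro integrable_real_indicator) auto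
  have iV: "(LINT z|lborel. ?i z) = V" by (simp add: V_def)
  have i1: "integrable lborel (\<lambda>z. ?i z * \<phi> (x + z))"
    by (rule bounded_borel_integrable_on_bounded[of _ C]) (use \<phi>(2) in auto)
  have i2: "integrable lborel (\<lambda>z. ?i z * \<bar>\<phi> (x + z) - \<phi> x\<bar>\<^sup>2)"
  proof (rule bounded_borel_integrable_on_bounded[of _ "(2 * C)\<^sup>2"])
    fix z
    have "\<bar>\<phi> (x + z) - \<phi> x\<bar> \<le> 2 * C" using \<phi>(2)[of "x + z"] \<phi>(2)[of x] by linarith
    then show "\<bar>\<bar>\<phi> (x + z) - \<phi> x\<bar>\<^sup>2\<bar> \<le> (2 * C)\<^sup>2" using power_mono[of "\<bar>\<phi> (x + z) - \<phi> x\<bar>" "2 * C" 2] by simp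
  qed auto
  define D where "D = (LINT z|lborel. ?i z * \<bar>\<phi> (x + z) - \<phi> x\<bar>\<^sup>2)"
  define a where "a = ball_avg s \<phi> x - \<phi> x"
  have a: "a * V = (LINT z|lborel. ?i z * (\<phi> (x + z) - \<phi> x))"
    using V i0 i1 iV by (simp add: a_def ball_avg_def V_def[symmetric] right_diff_distrib field_simps)
  \<comment> \<open>Jensen's inequality as nonnegativity of a variance: \<open>a\<close> is the mean
    of \<open>\<phi> (x + z) - \<phi> x\<close> over the ball.\<close>
  have "0 \<le> (LINT z|lborel. ?i z * (\<phi> (x + z) - \<phi> x - a)\<^sup>2)"
    by (rule Bochner_Integration.integral_nonneg) (auto simp: indicator_def)
  also have "\<dots> = (LINT z|lborel. ?i z * \<bar>\<phi> (x + z) - \<phi> x\<bar>\<^sup>2 - 2 * a * (?i z * \<phi> (x + z) - ?i z * \<phi> x) + a\<^sup>2 * ?i z)"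
    by (intro Bochner_Integration.integral_cong refl) (simp add: power2_eq_square algebra_simps)
  also have "\<dots> = D - 2 * a * (a * V) + a\<^sup>2 * V"
    using i0 i1 i2 iV unfolding a by (simp add: D_def right_diff_distrib)
  finally have "a\<^sup>2 \<le> D / V" using V by (simp add: power2_eq_square field_simps)
  moreover have "(\<phi> x - c)\<^sup>2 \<le> 2 * a\<^sup>2 + 2 * (ball_avg s \<phi> x - c)\<^sup>2"
  proof -
    \<comment> \<open>Parallelogram identity for \<open>a\<close> and
      \<open>ball_avg s \<phi> x - c\<close>, whose difference is
      \<open>c - \<phi> x\<close>.\<close>
    have "(\<phi> x - c)\<^sup>2 + (a + (ball_avg s \<phi> x - c))\<^sup>2 = 2 * a\<^sup>2 + 2 * (ball_avg s \<phi> x - c)\<^sup>2"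
      unfolding a_def by (simp add: power2_eq_square algebra_simps)
    then show ?thesis by (smt (verit) zero_le_power2)
  qed
  ultimately have "(\<phi> x - c)\<^sup>2 \<le> 2 / V * D + 2 * (ball_avg s \<phi> x - c)\<^sup>2" by simp
  then have "ennreal ((\<phi> x - c)\<^sup>2) \<le> ennreal (2 / V * D + 2 * (ball_avg s \<phi> x - c)\<^sup>2)" by (rule ennreal_leI)
  also have D0: "0 \<le> D" unfolding D_def by (rule Bochner_Integration.integral_nonneg) simp
  then have "ennreal (2 / V * D + 2 * (ball_avg s \<phi> x - c)\<^sup>2) = ennreal (2 / V) * ennreal D + ennreal (2 * (ball_avg s \<phi> x - c)\<^sup>2)"
    using V by (simp add: ennreal_mult[symmetric] ennreal_plus[symmetric] del: ennreal_plus)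
  also have "ennreal D = (\<integral>\<^sup>+z. ennreal (?i z * \<bar>\<phi> (x + z) - \<phi> x\<bar>\<^sup>2) \<partial>lborel)"
    unfolding D_def by (rule nn_integral_eq_integral[symmetric, OF i2]) auto
  also have "\<dots> = (\<integral>\<^sup>+z\<in>ball 0 s. ennreal (\<bar>\<phi> (x + z) - \<phi> x\<bar>\<^sup>2) \<partial>lborel)"
    by (intro nn_integral_cong) (auto simp: indicator_def)
  finally show ?thesis .
qed

section \<open>Poincare and Ehrling inequalities on balls\<close>

lemma measure_ball_scale:
  "0 \<le> r \<Longrightarrow> 0 \<le> t \<Longrightarrow> measure lborel (ball (c::real^'n::finite) (t * r)) = t ^ CARD('n) * measure lborel (ball (d::real^'n) r)"
  by (simp add: content_ball power_mult_distrib)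

text \<open>For \<open>x\<close> in the ball of radius \<open>2 * r\<close>, the deviation from
  \<open>m\<close> is at most the mean of \<open>\<bar>\<phi> y - \<phi> x\<bar>\<close> over that
  ball. With \<open>y = x + z\<close> the shifts satisfy \<open>norm z < 4 * r\<close>, which
  explains the radius \<open>6 * r\<close> on the right; the quotient of the volumes for the radii
  \<open>4 * r\<close> and \<open>2 * r\<close> gives \<open>2 ^ CARD('n)\<close>.\<close>

lemma nn_Poincare_L1:
  fixes \<phi> :: "real^'n::finite \<Rightarrow> real" and c :: "real^'n"
  assumes \<phi>: "smooth \<phi>" and C: "\<And>x. \<bar>\<phi> x\<bar> \<le> C" and r: "r > 0"
  defines "V \<equiv> measure lborel (ball c (2 * r))"
  defines "m \<equiv> (LINT y|lborel. indicator (ball c (2 * r)) y * \<phi> y) / V"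
  shows "(\<integral>\<^sup>+x\<in>ball c (2 * r). ennreal \<bar>\<phi> x - m\<bar> \<partial>lborel)
    \<le> ennreal (2 ^ CARD('n) * (4 * r)) * (\<integral>\<^sup>+x\<in>ball c (6 * r). ennreal (norm (grad \<phi> x)) \<partial>lborel)"
proof -
  let ?B = "ball c (2 * r)"
  have V: "V > 0" using r by (simp add: V_def)
  have [measurable]: "\<phi> \<in> borel_measurable borel" "ball c (2 * r) \<in> sets borel"
    "ball (0::real^'n) (4 * r) \<in> sets borel"
    using smooth_borel[OF \<phi>] by auto
  have i0: "integrable lborel (indicator ?B :: _ \<Rightarrow> real)"
    using emeasure_lborel_ball_finite[of c "2 * r"] by (intro integrable_real_indicator) auto
  have i1: "integrable lborel (\<lambda>y. indicator ?B y * \<phi> y)"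
    by (rule bounded_borel_integrable_on_bounded[of _ C]) (use C in auto)
  have pw: "ennreal \<bar>\<phi> x - m\<bar> \<le> ennreal (1 / V) * (\<integral>\<^sup>+z\<in>ball 0 (4 * r). ennreal (\<bar>\<phi> (x + z) - \<phi> x\<bar> ^ 1) \<partial>lborel)"
    if x: "x \<in> ?B" for x
  proof -
    have i2: "integrable lborel (\<lambda>y. indicator ?B y * (\<phi> y - \<phi> x))"
      using i0 i1 by (simp add: right_diff_distrib)
    have i3: "integrable lborel (\<lambda>y. indicator ?B y * \<bar>\<phi> y - \<phi> x\<bar>)"
      using integrable_abs[OF i2] by (simp add: abs_mult)
    have "(LINT y|lborel. indicator ?B y * (\<phi> y - \<phi> x)) = (LINT y|lborel. indicator ?B y * \<phi> y) - V * \<phi> x"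
      using i0 i1 by (simp add: right_diff_distrib V_def)
    then have "(m - \<phi> x) * V = (LINT y|lborel. indicator ?B y * (\<phi> y - \<phi> x))"
      using V by (simp add: m_def left_diff_distrib)
    then have "\<bar>m - \<phi> x\<bar> * V \<le> (LINT y|lborel. indicator ?B y * \<bar>\<phi> y - \<phi> x\<bar>)"
      using integral_abs_bound[of lborel "\<lambda>y. indicator ?B y * (\<phi> y - \<phi> x)"] V
      by (simp add: abs_mult)
    then have "\<bar>\<phi> x - m\<bar> \<le> 1 / V * (LINT y|lborel. indicator ?B y * \<bar>\<phi> y - \<phi> x\<bar>)"
      using V by (simp add: field_simps abs_minus_commute)
    then have "ennreal \<bar>\<phi> x - m\<bar> \<le> ennreal (1 / V * (LINT y|lborel. indicator ?B y * \<bar>\<phi> y - \<phi> x\<bar>))"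
      by (rule ennreal_leI)
    also have "\<dots> = ennreal (1 / V) * ennreal (LINT y|lborel. indicator ?B y * \<bar>\<phi> y - \<phi> x\<bar>)"
      using V by (intro ennreal_mult) (auto intro!: Bochner_Integration.integral_nonneg)
    also have "ennreal (LINT y|lborel. indicator ?B y * \<bar>\<phi> y - \<phi> x\<bar>)
        = (\<integral>\<^sup>+y. ennreal (indicator ?B y * \<bar>\<phi> y - \<phi> x\<bar>) \<partial>lborel)"
      by (rule nn_integral_eq_integral[symmetric, OF i3]) auto
    also have "\<dots> = (\<integral>\<^sup>+y. ennreal (indicator ?B y * \<bar>\<phi> y - \<phi> x\<bar>) \<partial>distr lborel borel ((+) x))"
      by (simp add: lborel_distr_plus)
    also have "\<dots> = (\<integral>\<^sup>+z. ennreal (indicator ?B (x + z) * \<bar>\<phi> (x + z) - \<phi> x\<bar>) \<partial>lborel)"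
      by (rule nn_integral_distr) measurable
    also have "\<dots> \<le> (\<integral>\<^sup>+z\<in>ball 0 (4 * r). ennreal (\<bar>\<phi> (x + z) - \<phi> x\<bar> ^ 1) \<partial>lborel)"
    proof (intro nn_integral_mono)
      fix z
      have "z \<in> ball 0 (4 * r)" if "x + z \<in> ?B"
      proof -
        have "norm z \<le> norm (c - x) + norm (c - (x + z))"
          using norm_triangle_ineq4[of "c - x" "c - (x + z)"] by simp
        then show ?thesis using that x by (simp add: dist_norm)
      qed
      then show "ennreal (indicator ?B (x + z) * \<bar>\<phi> (x + z) - \<phi> x\<bar>)
          \<le> ennreal (\<bar>\<phi> (x + z) - \<phi> x\<bar> ^ 1) * indicator (ball 0 (4 * r)) z"
        by (cases "x + z \<in> ?B") auto
    qed
    finally show ?thesis by (simp add: mult_left_mono)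
  qed
  have meas: "(\<lambda>x. (\<integral>\<^sup>+z\<in>ball 0 (4 * r). ennreal (\<bar>\<phi> (x + z) - \<phi> x\<bar> ^ 1) \<partial>lborel)) \<in> borel_measurable lborel"
    by (rule lborel.borel_measurable_nn_integral) measurable
  have "(\<integral>\<^sup>+x\<in>?B. ennreal \<bar>\<phi> x - m\<bar> \<partial>lborel)
      \<le> (\<integral>\<^sup>+x. ennreal (1 / V) * ((\<integral>\<^sup>+z\<in>ball 0 (4 * r). ennreal (\<bar>\<phi> (x + z) - \<phi> x\<bar> ^ 1) \<partial>lborel) * indicator ?B x) \<partial>lborel)"
    using pw by (intro nn_integral_mono) (auto simp: indicator_def)
  also have "\<dots> = ennreal (1 / V) * (\<integral>\<^sup>+x\<in>?B. (\<integral>\<^sup>+z\<in>ball 0 (4 * r). ennreal (\<bar>\<phi> (x + z) - \<phi> x\<bar> ^ 1) \<partial>lborel) \<partial>lborel)"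
    by (rule nn_integral_cmult) (use meas in measurable)
  also have "\<dots> \<le> ennreal (1 / V) * (ennreal (measure lborel (ball (0::real^'n) (4 * r)) * (4 * r) ^ 1)
      * (\<integral>\<^sup>+x\<in>ball c (6 * r). ennreal (norm (grad \<phi> x) ^ 1) \<partial>lborel))"
  proof (intro mult_left_mono averaged_translation_estimate \<phi>)
    fix x w :: "real^'n" assume x: "x \<in> ?B" and w: "norm w < 4 * r"
    have "dist c (x + w) \<le> dist c x + norm w"
      using norm_triangle_ineq4[of "c - x" w] by (simp add: dist_norm algebra_simps)
    then show "x + w \<in> ball c (6 * r)" using x w by simp
  qed (use r in auto)
  also have "\<dots> = ennreal (1 / V * (measure lborel (ball (0::real^'n) (4 * r)) * (4 * r)))
      * (\<integral>\<^sup>+x\<in>ball c (6 * r). ennreal (norm (grad \<phi> x)) \<partial>lborel)"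
    unfolding power_one_right using V r by (subst ennreal_mult) (auto simp: mult.assoc)
  also have "1 / V * (measure lborel (ball (0::real^'n) (4 * r)) * (4 * r)) = 2 ^ CARD('n) * (4 * r)"
    using measure_ball_scale[of "2 * r" 2 "0::real^'n" c] r V by (simp add: V_def)
  finally show ?thesis .
qed

text \<open>\<open>\<phi>\<close> is compared with its averages over balls of radius \<open>d * r\<close>, which is where the small factor
  \<open>d\<^sup>2\<close> comes from; these averages differ from \<open>m\<close> by a multiple of the \<open>L1\<close> norm of the gradient.\<close>

lemma nn_Ehrling:
  fixes \<phi> :: "real^'n::finite \<Rightarrow> real" and c :: "real^'n"
  assumes \<phi>: "smooth \<phi>" and C: "\<And>x. \<bar>\<phi> x\<bar> \<le> C" and r: "r > 0" and d: "0 < d" "d \<le> 1"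
  defines "V \<equiv> measure lborel (ball c r)"
  defines "m \<equiv> (LINT y|lborel. indicator (ball c (2 * r)) y * \<phi> y) / measure lborel (ball c (2 * r))"
  shows "(\<integral>\<^sup>+x\<in>ball c r. ennreal ((\<phi> x - m)\<^sup>2) \<partial>lborel)
    \<le> ennreal (2 * d\<^sup>2 * r\<^sup>2) * (\<integral>\<^sup>+x\<in>ball c (2 * r). ennreal ((norm (grad \<phi> x))\<^sup>2) \<partial>lborel)
      + ennreal (2 * (2 ^ CARD('n) * 4 / d ^ CARD('n))\<^sup>2 * r\<^sup>2 / V)
        * (\<integral>\<^sup>+x\<in>ball c (6 * r). ennreal (norm (grad \<phi> x)) \<partial>lborel)\<^sup>2"
proof -
  let ?s = "d * r" let ?I = "\<integral>\<^sup>+x\<in>ball c (6 * r). ennreal (norm (grad \<phi> x)) \<partial>lborel"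
  define Vs where "Vs = measure lborel (ball (0::real^'n) ?s)"
  have s: "?s > 0" "?s \<le> r" using r d by (auto simp: mult_left_le_one_le)
  have V: "V > 0" "Vs > 0" using r s by (auto simp: V_def Vs_def)
  have Vs: "Vs = d ^ CARD('n) * V" unfolding Vs_def V_def using r d by (intro measure_ball_scale) auto
  have [measurable]: "\<phi> \<in> borel_measurable borel" "ball c (2 * r) \<in> sets borel"
    "ball (0::real^'n) (d * r) \<in> sets borel"
    using smooth_borel[OF \<phi>] by auto
  \<comment> \<open>A ball of radius \<open>?s \<le> r\<close> around a point of
    \<open>ball c r\<close> stays inside \<open>ball c (2 * r)\<close>, so its mean deviates from
    \<open>m\<close> by at most the right-hand side of the Poincare inequality divided by the small
    volume \<open>Vs\<close>.\<close>
  have avg: "ennreal \<bar>ball_avg ?s \<phi> x - m\<bar> \<le> ennreal (1 / Vs) * (ennreal (2 ^ CARD('n) * (4 * r)) * ?I)"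
    if x: "x \<in> ball c r" for x
  proof -
    let ?i = "indicator (ball (0::real^'n) ?s) :: _ \<Rightarrow> real"
    have i0: "integrable lborel ?i"
      using emeasure_lborel_ball_finite[of "0::real^'n" ?s] by (intro integrable_real_indicator) auto
    have i1: "integrable lborel (\<lambda>z. ?i z * \<phi> (x + z))"
      by (rule bounded_borel_integrable_on_bounded[of _ C]) (use C in auto)
    have i2: "integrable lborel (\<lambda>z. ?i z * (\<phi> (x + z) - m))"
      using i0 i1 by (simp add: right_diff_distrib)
    have i3: "integrable lborel (\<lambda>z. ?i z * \<bar>\<phi> (x + z) - m\<bar>)"
      using integrable_abs[OF i2] by (simp add: abs_mult)
    have "(ball_avg ?s \<phi> x - m) * Vs = (LINT z|lborel. ?i z * (\<phi> (x + z) - m))"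
      using V i0 i1 by (simp add: ball_avg_def Vs_def[symmetric] right_diff_distrib field_simps)
    then have "\<bar>ball_avg ?s \<phi> x - m\<bar> * Vs \<le> (LINT z|lborel. ?i z * \<bar>\<phi> (x + z) - m\<bar>)"
      using integral_abs_bound[of lborel "\<lambda>z. ?i z * (\<phi> (x + z) - m)"] V by (simp add: abs_mult)
    then have "\<bar>ball_avg ?s \<phi> x - m\<bar> \<le> 1 / Vs * (LINT z|lborel. ?i z * \<bar>\<phi> (x + z) - m\<bar>)"
      using V by (simp add: field_simps)
    then have "ennreal \<bar>ball_avg ?s \<phi> x - m\<bar> \<le> ennreal (1 / Vs * (LINT z|lborel. ?i z * \<bar>\<phi> (x + z) - m\<bar>))"
      by (rule ennreal_leI)
    also have "\<dots> = ennreal (1 / Vs) * ennreal (LINT z|lborel. ?i z * \<bar>\<phi> (x + z) - m\<bar>)"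
      using V by (intro ennreal_mult) (auto intro!: Bochner_Integration.integral_nonneg)
    also have "ennreal (LINT z|lborel. ?i z * \<bar>\<phi> (x + z) - m\<bar>) = (\<integral>\<^sup>+z. ennreal (?i z * \<bar>\<phi> (x + z) - m\<bar>) \<partial>lborel)"
      by (rule nn_integral_eq_integral[symmetric, OF i3]) auto
    also have "\<dots> \<le> (\<integral>\<^sup>+z. ennreal \<bar>\<phi> (x + z) - m\<bar> * indicator (ball c (2 * r)) (x + z) \<partial>lborel)"
    proof (intro nn_integral_mono)
      fix z
      have "x + z \<in> ball c (2 * r)" if "z \<in> ball 0 ?s"
      proof -
        have "dist c (x + z) \<le> dist c x + norm z"
          using norm_triangle_ineq4[of "c - x" z] by (simp add: dist_norm algebra_simps)
        then show ?thesis using x that s by simp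
      qed
      then show "ennreal (?i z * \<bar>\<phi> (x + z) - m\<bar>)
          \<le> ennreal \<bar>\<phi> (x + z) - m\<bar> * indicator (ball c (2 * r)) (x + z)"
        by (cases "z \<in> ball 0 ?s") auto
    qed
    also have "\<dots> = (\<integral>\<^sup>+y. ennreal \<bar>\<phi> y - m\<bar> * indicator (ball c (2 * r)) y \<partial>distr lborel borel ((+) x))"
      by (rule nn_integral_distr[symmetric]) measurable
    also have "\<dots> = (\<integral>\<^sup>+y\<in>ball c (2 * r). ennreal \<bar>\<phi> y - m\<bar> \<partial>lborel)"
      by (simp add: lborel_distr_plus)
    also have "\<dots> \<le> ennreal (2 ^ CARD('n) * (4 * r)) * ?I"
      unfolding m_def by (rule nn_Poincare_L1[OF \<phi> C r])
    finally show ?thesis by (simp add: mult_left_mono)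
  qed
  define A where "A = ennreal (1 / Vs) * (ennreal (2 ^ CARD('n) * (4 * r)) * ?I)"
  have meas: "(\<lambda>x. (\<integral>\<^sup>+z\<in>ball 0 ?s. ennreal (\<bar>\<phi> (x + z) - \<phi> x\<bar>\<^sup>2) \<partial>lborel)) \<in> borel_measurable lborel"
    by (rule lborel.borel_measurable_nn_integral) measurable
  have meas': "(\<lambda>x. (\<integral>\<^sup>+z\<in>ball 0 ?s. ennreal (\<bar>\<phi> (x + z) - \<phi> x\<bar>\<^sup>2) \<partial>lborel) * indicator (ball c r) x) \<in> borel_measurable lborel"
    by (intro borel_measurable_times_ennreal meas borel_measurable_indicator) simp
  have "(\<integral>\<^sup>+x\<in>ball c r. ennreal ((\<phi> x - m)\<^sup>2) \<partial>lborel)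
      \<le> (\<integral>\<^sup>+x. ennreal (2 / Vs) * ((\<integral>\<^sup>+z\<in>ball 0 ?s. ennreal (\<bar>\<phi> (x + z) - \<phi> x\<bar>\<^sup>2) \<partial>lborel) * indicator (ball c r) x)
          + (2 * A\<^sup>2) * indicator (ball c r) x \<partial>lborel)"
  proof (intro nn_integral_mono)
    fix x
    show "ennreal ((\<phi> x - m)\<^sup>2) * indicator (ball c r) x
        \<le> ennreal (2 / Vs) * ((\<integral>\<^sup>+z\<in>ball 0 ?s. ennreal (\<bar>\<phi> (x + z) - \<phi> x\<bar>\<^sup>2) \<partial>lborel) * indicator (ball c r) x)
          + (2 * A\<^sup>2) * indicator (ball c r) x"
    proof (cases "x \<in> ball c r")
      case True
      have "ennreal (2 * (ball_avg ?s \<phi> x - m)\<^sup>2) = 2 * (ennreal \<bar>ball_avg ?s \<phi> x - m\<bar>)\<^sup>2"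
        by (simp add: ennreal_mult ennreal_power)
      also have "\<dots> \<le> 2 * A\<^sup>2"
        using avg[OF True] by (intro mult_left_mono power_mono) (auto simp: A_def)
      finally show ?thesis
        using square_le_ball_avg[of \<phi> C ?s x m] C s True
        by (auto simp: Vs_def[symmetric] intro: order_trans add_left_mono)
    qed simp
  qed
  also have "\<dots> = ennreal (2 / Vs) * (\<integral>\<^sup>+x\<in>ball c r. (\<integral>\<^sup>+z\<in>ball 0 ?s. ennreal (\<bar>\<phi> (x + z) - \<phi> x\<bar>\<^sup>2) \<partial>lborel) \<partial>lborel)
      + (2 * A\<^sup>2) * emeasure lborel (ball c r)"
  proof -
    have "(\<integral>\<^sup>+x. (2 * A\<^sup>2) * indicator (ball c r) x \<partial>lborel) = (2 * A\<^sup>2) * emeasure lborel (ball c r)"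
      by (rule nn_integral_cmult_indicator) simp
    moreover have "(\<lambda>x. (2 * A\<^sup>2) * indicator (ball c r) x) \<in> borel_measurable lborel"
      by (intro borel_measurable_times_ennreal borel_measurable_const borel_measurable_indicator) simp
    ultimately show ?thesis
      using nn_integral_add[OF borel_measurable_times_ennreal[OF borel_measurable_const meas'], of _ "ennreal (2 / Vs)"]
        nn_integral_cmult[OF meas', of "ennreal (2 / Vs)"] by simp
  qed
  also have "\<dots> \<le> ennreal (2 / Vs) * (ennreal (Vs * ?s ^ 2) * (\<integral>\<^sup>+x\<in>ball c (2 * r). ennreal (norm (grad \<phi> x) ^ 2) \<partial>lborel))
      + (2 * A\<^sup>2) * emeasure lborel (ball c r)"
    unfolding Vs_def
  proof (intro add_right_mono mult_left_mono averaged_translation_estimate \<phi>)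
    fix x w :: "real^'n" assume x: "x \<in> ball c r" and w: "norm w < ?s"
    have "dist c (x + w) \<le> dist c x + norm w"
      using norm_triangle_ineq4[of "c - x" w] by (simp add: dist_norm algebra_simps)
    then show "x + w \<in> ball c (2 * r)" using x w s by simp
  qed (use s in auto)
  also have "emeasure lborel (ball c r) = ennreal V"
    unfolding V_def by (rule emeasure_eq_ennreal_measure) (use emeasure_lborel_ball_finite[of c r] in auto)
  also have "ennreal (2 / Vs) * (ennreal (Vs * ?s ^ 2) * (\<integral>\<^sup>+x\<in>ball c (2 * r). ennreal (norm (grad \<phi> x) ^ 2) \<partial>lborel))
      = ennreal (2 / Vs * (Vs * ?s ^ 2)) * (\<integral>\<^sup>+x\<in>ball c (2 * r). ennreal (norm (grad \<phi> x) ^ 2) \<partial>lborel)"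
    using V s by (subst ennreal_mult) (auto simp: mult.assoc)
  also have "2 / Vs * (Vs * ?s ^ 2) = 2 * d\<^sup>2 * r\<^sup>2" using V by (simp add: power_mult_distrib)
  also have "(2 * A\<^sup>2) * ennreal V = ennreal (2 * (1 / Vs * (2 ^ CARD('n) * (4 * r)))\<^sup>2 * V) * ?I\<^sup>2"
  proof -
    have "A = ennreal (1 / Vs * (2 ^ CARD('n) * (4 * r))) * ?I"
      unfolding A_def using V r by (subst ennreal_mult) (auto simp: mult.assoc)
    then have "A\<^sup>2 = ennreal ((1 / Vs * (2 ^ CARD('n) * (4 * r)))\<^sup>2) * ?I\<^sup>2"
      using V r by (simp add: power_mult_distrib ennreal_power[symmetric])
    moreover have "ennreal (2 * (1 / Vs * (2 ^ CARD('n) * (4 * r)))\<^sup>2 * V)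
        = 2 * ennreal ((1 / Vs * (2 ^ CARD('n) * (4 * r)))\<^sup>2) * ennreal V"
      using V by (simp add: ennreal_mult)
    ultimately show ?thesis by (simp only: mult_ac)
  qed
  \<comment> \<open>Since \<open>Vs = d ^ CARD('n) * V\<close>, the blow-up for small
    \<open>d\<close> is confined to the coefficient of the \<open>L1\<close> norm of the
    gradient.\<close>
  also have "2 * (1 / Vs * (2 ^ CARD('n) * (4 * r)))\<^sup>2 * V = 2 * (2 ^ CARD('n) * 4 / d ^ CARD('n))\<^sup>2 * r\<^sup>2 / V"
    unfolding Vs using V d by (simp add: power2_eq_square field_simps)
  finally show ?thesis .
qed

section \<open>Ehrling's inequality in \<open>H10\<close>\<close>

context domain
begin

lemma indicator_power2: "(indicator S x :: real)\<^sup>2 = indicator S x"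
  by (simp add: indicator_def)

lemma sq_int_const [simp]: "(\<lambda>x. c) \<in> sq_int M"
proof -
  interpret finite_measure M by (rule finite_measure_domain)
  show ?thesis by (simp add: sq_int_def)
qed

lemma sq_int_indicator [simp]: "S \<in> sets borel \<Longrightarrow> (indicator S :: _ \<Rightarrow> real) \<in> sq_int M"
proof (rule sq_int_dominated[OF sq_int_const[of "1::real"], of _ 1])
  show "(indicator S :: _ \<Rightarrow> real) \<in> borel_measurable M" if "S \<in> sets borel"
    using that by (intro borel_imp_lebesgue_on borel_measurable_indicator)
  show "AE x in M. norm (indicator S x :: real) \<le> 1 * norm (1::real)"
    by (intro AE_I2) (simp add: indicator_def)
qed

lemma sq_int_indicator_scaleR:
  assumes "S \<in> sets borel" "f \<in> sq_int M"
  shows "(\<lambda>x. indicator S x *\<^sub>R f x) \<in> sq_int M"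
  by (rule sq_int_bounded_scaleR[OF assms(2) sq_int_measurable[OF sq_int_indicator[OF assms(1)]], of 1])
    (simp add: indicator_def)

lemma sq_int_indicator_mult:
  "S \<in> sets borel \<Longrightarrow> f \<in> sq_int M \<Longrightarrow> (\<lambda>x. indicator S x * f x :: real) \<in> sq_int M"
  using sq_int_indicator_scaleR[of S f] by simp

lemma l2_indicator_scaleR_le:
  assumes "S \<in> sets borel" "f \<in> sq_int M"
  shows "l2 M (\<lambda>x. indicator S x *\<^sub>R f x) \<le> l2 M f"
  using l2_mono[OF assms(2) sq_int_measurable[OF sq_int_indicator_scaleR[OF assms]], of 1]
  by (simp add: indicator_def)

lemma nn_set_integral_eq:
  fixes g :: "real^'n \<Rightarrow> real"
  assumes g: "g \<in> borel_measurable borel" "\<And>x. 0 \<le> g x" "\<And>x. g x \<le> C"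
    and S: "bounded S" "S \<in> sets borel" "S \<subseteq> \<Omega>"
  shows "(\<integral>\<^sup>+x\<in>S. ennreal (g x) \<partial>lborel) = ennreal (LINT x|M. indicator S x * g x)"
proof -
  have i: "integrable lborel (\<lambda>x. indicator S x * g x)"
    by (rule bounded_borel_integrable_on_bounded[of _ C]) (use g S in auto)
  have "(\<integral>\<^sup>+x\<in>S. ennreal (g x) \<partial>lborel) = (\<integral>\<^sup>+x. ennreal (indicator S x * g x) \<partial>lborel)"
    by (intro nn_integral_cong) (auto simp: indicator_def)
  also have "\<dots> = ennreal (LINT x|lborel. indicator S x * g x)"
    by (rule nn_integral_eq_integral[OF i]) (use g in auto)
  also have "(LINT x|lborel. indicator S x * g x) = (LINT x|M. indicator S x * g x)"
    by (rule integral_lebesgue_on_eq_lborel[symmetric])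
      (use S g(1) in \<open>auto intro!: borel_measurable_times borel_measurable_indicator simp: indicator_def\<close>)
  finally show ?thesis .
qed

definition Ehrling_const :: "real \<Rightarrow> real" where
  "Ehrling_const d = 2 * (2 ^ CARD('n) * 4 / d ^ CARD('n))\<^sup>2"

text \<open>The \<open>ennreal\<close> estimate is translated to real integrals over
  \<open>\<Omega>\<close>; boundedness of a test function and of its gradient makes all of them
  finite.\<close>

lemma Ehrling_test_function:
  assumes \<phi>: "\<phi> \<in> test_functions \<Omega>" and r: "r > 0" and d: "0 < d" "d \<le> 1" and sub: "ball c (6 * r) \<subseteq> \<Omega>"
  defines "m \<equiv> (LINT y|M. indicator (ball c (2 * r)) y * \<phi> y) / measure lborel (ball c (2 * r))"
  shows "(LINT x|M. indicator (ball c r) x * (\<phi> x - m)\<^sup>2)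
    \<le> 2 * d\<^sup>2 * r\<^sup>2 * (LINT x|M. indicator (ball c (2 * r)) x * (norm (grad \<phi> x))\<^sup>2)
      + Ehrling_const d * r\<^sup>2 / measure lborel (ball c r) * (LINT x|M. indicator (ball c (6 * r)) x * norm (grad \<phi> x))\<^sup>2"
proof -
  obtain C where C: "0 \<le> C" "\<And>x. \<bar>\<phi> x\<bar> \<le> C" using test_function_bounded[OF \<phi>] by auto
  obtain D where D: "0 \<le> D" "\<And>x. norm (grad \<phi> x) \<le> D" using test_function_grad_bounded[OF \<phi>] by auto
  have [measurable]: "\<phi> \<in> borel_measurable borel" "grad \<phi> \<in> borel_measurable borel"
    using smooth_borel grad_borel test_function_smooth[OF \<phi>] by auto
  have V: "measure lborel (ball c r) > 0" using r by simp
  have sub': "ball c r \<subseteq> \<Omega>" "ball c (2 * r) \<subseteq> \<Omega>"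
    using sub r subset_ball[of r "6 * r" c] subset_ball[of "2 * r" "6 * r" c] by auto
  have m: "(LINT y|lborel. indicator (ball c (2 * r)) y * \<phi> y) / measure lborel (ball c (2 * r)) = m"
    unfolding m_def using sub' by (subst integral_lebesgue_on_eq_lborel) (auto simp: indicator_def)
  have bm: "(\<phi> x - m)\<^sup>2 \<le> (C + \<bar>m\<bar>)\<^sup>2" for x
    using C(2)[of x] C(1) by (intro power2_le_iff_abs_le[THEN iffD2]) auto
  have n0: "(\<integral>\<^sup>+x\<in>ball c r. ennreal ((\<phi> x - m)\<^sup>2) \<partial>lborel) = ennreal (LINT x|M. indicator (ball c r) x * (\<phi> x - m)\<^sup>2)"
    by (rule nn_set_integral_eq[OF _ _ bm]) (use sub' in auto)
  have n1: "(\<integral>\<^sup>+x\<in>ball c (2 * r). ennreal ((norm (grad \<phi> x))\<^sup>2) \<partial>lborel)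
      = ennreal (LINT x|M. indicator (ball c (2 * r)) x * (norm (grad \<phi> x))\<^sup>2)"
    by (rule nn_set_integral_eq[of _ "D\<^sup>2"]) (use sub' D in \<open>auto intro!: power_mono\<close>)
  have n2: "(\<integral>\<^sup>+x\<in>ball c (6 * r). ennreal (norm (grad \<phi> x)) \<partial>lborel)
      = ennreal (LINT x|M. indicator (ball c (6 * r)) x * norm (grad \<phi> x))"
    by (rule nn_set_integral_eq[of _ D]) (use sub D in auto)
  have p: "0 \<le> (LINT x|M. indicator (ball c (2 * r)) x * (norm (grad \<phi> x))\<^sup>2)"
    "0 \<le> (LINT x|M. indicator (ball c (6 * r)) x * norm (grad \<phi> x))"
    by (auto intro!: Bochner_Integration.integral_nonneg)
  have K: "0 \<le> Ehrling_const d" by (simp add: Ehrling_const_def)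
  have "ennreal (LINT x|M. indicator (ball c r) x * (\<phi> x - m)\<^sup>2)
      \<le> ennreal (2 * d\<^sup>2 * r\<^sup>2) * ennreal (LINT x|M. indicator (ball c (2 * r)) x * (norm (grad \<phi> x))\<^sup>2)
      + ennreal (Ehrling_const d * r\<^sup>2 / measure lborel (ball c r)) * (ennreal (LINT x|M. indicator (ball c (6 * r)) x * norm (grad \<phi> x)))\<^sup>2"
    using nn_Ehrling[OF test_function_smooth[OF \<phi>] C(2) r d, of c]
    unfolding m n0 n1 n2 Ehrling_const_def by simp
  also have "\<dots> = ennreal (2 * d\<^sup>2 * r\<^sup>2 * (LINT x|M. indicator (ball c (2 * r)) x * (norm (grad \<phi> x))\<^sup>2)
      + Ehrling_const d * r\<^sup>2 / measure lborel (ball c r) * (LINT x|M. indicator (ball c (6 * r)) x * norm (grad \<phi> x))\<^sup>2)"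
  proof -
    have "ennreal (2 * d\<^sup>2 * r\<^sup>2) * ennreal (LINT x|M. indicator (ball c (2 * r)) x * (norm (grad \<phi> x))\<^sup>2)
        = ennreal (2 * d\<^sup>2 * r\<^sup>2 * (LINT x|M. indicator (ball c (2 * r)) x * (norm (grad \<phi> x))\<^sup>2))"
      using p by (intro ennreal_mult[symmetric]) auto
    moreover have "ennreal (Ehrling_const d * r\<^sup>2 / measure lborel (ball c r)) * (ennreal (LINT x|M. indicator (ball c (6 * r)) x * norm (grad \<phi> x)))\<^sup>2
        = ennreal (Ehrling_const d * r\<^sup>2 / measure lborel (ball c r) * (LINT x|M. indicator (ball c (6 * r)) x * norm (grad \<phi> x))\<^sup>2)"
      unfolding ennreal_power[OF p(2)] using p K V by (intro ennreal_mult[symmetric]) auto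
    ultimately show ?thesis using p K V by (subst ennreal_plus) auto
  qed
  finally show ?thesis
    by (subst (asm) ennreal_le_iff) (use p K V in \<open>auto intro!: add_nonneg_nonneg mult_nonneg_nonneg\<close>)
qed

text \<open>By approximation with test functions: the three integrals and the mean are continuous in
  the graph norm. The constant \<open>m\<close> is left unspecified because Caccioppoli's inequality
  accepts every constant.\<close>

lemma Ehrling_H10:
  assumes u: "has_H10_gradient \<Omega> u G" and r: "r > 0" and d: "0 < d" "d \<le> 1" and sub: "ball c (6 * r) \<subseteq> \<Omega>"
  shows "\<exists>m. (LINT x|M. indicator (ball c r) x * (u x - m)\<^sup>2)
    \<le> 2 * d\<^sup>2 * r\<^sup>2 * (LINT x|M. indicator (ball c (2 * r)) x * (norm (G x))\<^sup>2)
      + Ehrling_const d * r\<^sup>2 / measure lborel (ball c r) * (LINT x|M. indicator (ball c (6 * r)) x * norm (G x))\<^sup>2"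
proof -
  obtain \<phi> where \<phi>: "\<And>k. \<phi> k \<in> test_functions \<Omega>" "(\<lambda>k. l2 M (\<lambda>x. u x - \<phi> k x)) \<longlonglongrightarrow> 0"
    "(\<lambda>k. l2 M (\<lambda>x. G x - grad (\<phi> k) x)) \<longlonglongrightarrow> 0"
    using has_H10_gradient_obtain[OF u] by auto
  note sq = has_H10_gradient_sq_int[OF u]
  note ts = test_function_sq_int[OF \<phi>(1) domain_sets] and tg = test_function_grad_sq_int[OF \<phi>(1) domain_sets]
  have \<phi>2: "(\<lambda>k. l2 M (\<lambda>x. \<phi> k x - u x)) \<longlonglongrightarrow> 0" using \<phi>(2) by (simp add: l2_diff_commute[of _ u])
  have \<phi>3: "(\<lambda>k. l2 M (\<lambda>x. grad (\<phi> k) x - G x)) \<longlonglongrightarrow> 0" using \<phi>(3) by (simp add: l2_diff_commute[of _ G])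
  have bs: "ball c s \<in> sets borel" for s by simp
  define V2 where "V2 = measure lborel (ball c (2 * r))"
  define mk where "mk k = (LINT y|M. indicator (ball c (2 * r)) y * \<phi> k y) / V2" for k
  define m where "m = (LINT y|M. indicator (ball c (2 * r)) y * u y) / V2"
  have mk: "mk \<longlonglongrightarrow> m"
    unfolding mk_def[abs_def] m_def divide_inverse
    using l2_tendsto_inner_fixed[OF ts sq(1) \<phi>2 sq_int_indicator[OF bs, of "2 * r"]]
    by (intro tendsto_mult_right) (simp add: mult.commute)
  have c1: "(\<lambda>k. LINT x|M. indicator (ball c r) x * (\<phi> k x - mk k)\<^sup>2) \<longlonglongrightarrow> (LINT x|M. indicator (ball c r) x * (u x - m)\<^sup>2)"
  proof -
    have s1: "(\<lambda>x. indicator (ball c r) x * (\<phi> k x - mk k)) \<in> sq_int M" for k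
      by (intro sq_int_indicator_mult bs sq_int_diff ts sq_int_const)
    have s2: "(\<lambda>x. indicator (ball c r) x * (u x - m)) \<in> sq_int M"
      by (intro sq_int_indicator_mult bs sq_int_diff sq sq_int_const)
    have "(\<lambda>k. l2 M (\<lambda>x. indicator (ball c r) x * (\<phi> k x - mk k) - indicator (ball c r) x * (u x - m))) \<longlonglongrightarrow> 0"
    proof (rule tendsto_zero_bound)
      show "(\<lambda>k. l2 M (\<lambda>x. \<phi> k x - u x) + \<bar>mk k - m\<bar> * l2 M (\<lambda>x. 1::real)) \<longlonglongrightarrow> 0"
        using tendsto_add[OF \<phi>2 tendsto_mult_right[OF tendsto_rabs_zero[OF LIM_zero[OF mk]], of "l2 M (\<lambda>x. 1::real)"]]
        by simp
      fix k
      have d1: "(\<lambda>x. \<phi> k x - u x) \<in> sq_int M" by (intro sq_int_diff ts sq)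
      have "(\<lambda>x. indicator (ball c r) x * (\<phi> k x - mk k) - indicator (ball c r) x * (u x - m))
          = (\<lambda>x. indicator (ball c r) x *\<^sub>R ((\<phi> k x - u x) + (m - mk k) *\<^sub>R (1::real)))"
        by (simp add: algebra_simps)
      then have "l2 M (\<lambda>x. indicator (ball c r) x * (\<phi> k x - mk k) - indicator (ball c r) x * (u x - m))
          \<le> l2 M (\<lambda>x. (\<phi> k x - u x) + (m - mk k) *\<^sub>R (1::real))"
        using l2_indicator_scaleR_le[OF bs sq_int_add[OF d1 sq_int_const]] by simp
      also have "\<dots> \<le> l2 M (\<lambda>x. \<phi> k x - u x) + l2 M (\<lambda>x. (m - mk k) *\<^sub>R (1::real))"
        by (rule l2_triangle[OF d1 sq_int_const])
      finally show "l2 M (\<lambda>x. indicator (ball c r) x * (\<phi> k x - mk k) - indicator (ball c r) x * (u x - m))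
          \<le> l2 M (\<lambda>x. \<phi> k x - u x) + \<bar>mk k - m\<bar> * l2 M (\<lambda>x. 1::real)"
        unfolding l2_scaleR by (simp add: abs_minus_commute)
    qed simp
    from tendsto_power[OF l2_tendsto_l2[OF s1 s2 this], of 2] show ?thesis
      unfolding l2_power2 by (simp add: power_mult_distrib indicator_power2)
  qed
  have c2: "(\<lambda>k. LINT x|M. indicator (ball c (2 * r)) x * (norm (grad (\<phi> k) x))\<^sup>2)
      \<longlonglongrightarrow> (LINT x|M. indicator (ball c (2 * r)) x * (norm (G x))\<^sup>2)"
  proof -
    have "(\<lambda>k. l2 M (\<lambda>x. indicator (ball c (2 * r)) x *\<^sub>R grad (\<phi> k) x - indicator (ball c (2 * r)) x *\<^sub>R G x)) \<longlonglongrightarrow> 0"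
      by (rule tendsto_zero_bound[OF \<phi>3])
        (auto simp: scaleR_diff_right[symmetric] intro!: l2_indicator_scaleR_le sq_int_diff tg sq)
    from tendsto_power[OF l2_tendsto_l2[OF sq_int_indicator_scaleR[OF bs tg] sq_int_indicator_scaleR[OF bs sq(2)] this], of 2]
    show ?thesis unfolding l2_power2 by (simp add: power_mult_distrib indicator_power2)
  qed
  have c3: "(\<lambda>k. LINT x|M. indicator (ball c (6 * r)) x * norm (grad (\<phi> k) x))
      \<longlonglongrightarrow> (LINT x|M. indicator (ball c (6 * r)) x * norm (G x))"
  proof -
    have "(\<lambda>k. l2 M (\<lambda>x. norm (grad (\<phi> k) x) - norm (G x))) \<longlonglongrightarrow> 0"
    proof (rule tendsto_zero_bound[OF \<phi>3])
      fix k
      have dg: "(\<lambda>x. grad (\<phi> k) x - G x) \<in> sq_int M" by (intro sq_int_diff tg sq)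
      show "l2 M (\<lambda>x. norm (grad (\<phi> k) x) - norm (G x)) \<le> l2 M (\<lambda>x. grad (\<phi> k) x - G x)"
        using l2_mono[OF dg, of "\<lambda>x. norm (grad (\<phi> k) x) - norm (G x)" 1]
          sq_int_measurable[OF tg[of k]] sq_int_measurable[OF sq(2)]
        by (auto simp: norm_triangle_ineq3)
    qed simp
    moreover have "(\<lambda>x. norm (h x)) \<in> sq_int M" if "h \<in> sq_int M" for h :: "_ \<Rightarrow> real^'n"
      using that sq_int_measurable[OF that] by (simp add: sq_int_def)
    ultimately show ?thesis
      using l2_tendsto_inner_fixed[of "\<lambda>k x. norm (grad (\<phi> k) x)" M "\<lambda>x. norm (G x)" "indicator (ball c (6 * r))"]
        tg sq(2) sq_int_indicator[OF bs, of "6 * r"]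
      by (simp add: mult.commute)
  qed
  show ?thesis
  proof (rule exI[of _ m], rule LIMSEQ_le[OF c1])
    show "(\<lambda>k. 2 * d\<^sup>2 * r\<^sup>2 * (LINT x|M. indicator (ball c (2 * r)) x * (norm (grad (\<phi> k) x))\<^sup>2)
        + Ehrling_const d * r\<^sup>2 / measure lborel (ball c r) * (LINT x|M. indicator (ball c (6 * r)) x * norm (grad (\<phi> k) x))\<^sup>2)
      \<longlonglongrightarrow> 2 * d\<^sup>2 * r\<^sup>2 * (LINT x|M. indicator (ball c (2 * r)) x * (norm (G x))\<^sup>2)
        + Ehrling_const d * r\<^sup>2 / measure lborel (ball c r) * (LINT x|M. indicator (ball c (6 * r)) x * norm (G x))\<^sup>2"
      by (intro tendsto_add tendsto_mult_left tendsto_power c2 c3)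
    show "\<exists>N. \<forall>k\<ge>N. (LINT x|M. indicator (ball c r) x * (\<phi> k x - mk k)\<^sup>2)
        \<le> 2 * d\<^sup>2 * r\<^sup>2 * (LINT x|M. indicator (ball c (2 * r)) x * (norm (grad (\<phi> k) x))\<^sup>2)
        + Ehrling_const d * r\<^sup>2 / measure lborel (ball c r) * (LINT x|M. indicator (ball c (6 * r)) x * norm (grad (\<phi> k) x))\<^sup>2"
      using Ehrling_test_function[OF \<phi>(1) r d sub] unfolding mk_def V2_def by blast
  qed
qed

subsection \<open>Rellich's theorem\<close>

lemma ball_avg_eq:
  assumes "\<phi> \<in> test_functions \<Omega>"
  shows "ball_avg s \<phi> x = (LINT y|M. indicator (ball x s) y * \<phi> y) / measure lborel (ball (0::real^'n) s)"
proof -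
  have [measurable]: "\<phi> \<in> borel_measurable borel" by (rule smooth_borel[OF test_function_smooth[OF assms]])
  have "(LINT z|lborel. indicator (ball 0 s) z * \<phi> (x + z)) = (LINT z|lborel. indicator (ball x s) (x + z) * \<phi> (x + z))"
    by (intro Bochner_Integration.integral_cong) (auto simp: indicator_def dist_norm)
  also have "\<dots> = (LINT y|lborel. indicator (ball x s) y * \<phi> y)"
    by (rule lborel_integral_translation) (auto intro!: borel_measurable_times borel_measurable_indicator)
  also have "\<dots> = (LINT y|M. indicator (ball x s) y * \<phi> y)"
    using test_function_outside[OF assms]
    by (intro integral_lebesgue_on_eq_lborel[symmetric]) (auto intro!: borel_measurable_times borel_measurable_indicator)
  finally show ?thesis by (simp add: ball_avg_def)
qed

lemma ball_avg_measurable: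
  assumes "\<phi> \<in> borel_measurable borel"
  shows "ball_avg s \<phi> \<in> borel_measurable (borel :: (real^'n) measure)"
proof -
  have [measurable]: "\<phi> \<in> borel_measurable borel" "ball (0::real^'n) s \<in> sets borel" using assms by auto
  have "(\<lambda>x. LINT z|lborel. indicator (ball 0 s) z * \<phi> (x + z)) \<in> borel_measurable borel"
    by (rule lborel.borel_measurable_lebesgue_integral) measurable
  then show ?thesis unfolding ball_avg_def[abs_def] by measurable
qed

text \<open>The comparison with means, integrated over the domain. A test function and its gradient
  vanish outside \<open>\<Omega>\<close>, so shifted points that leave \<open>\<Omega>\<close> do no
  harm and \<open>UNIV\<close> may be taken as the larger set.\<close>

lemma ball_avg_estimate:
  assumes \<phi>: "\<phi> \<in> test_functions \<Omega>" and s: "s > 0"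
  shows "(l2 M \<phi>)\<^sup>2 \<le> 2 * s\<^sup>2 * (l2 M (grad \<phi>))\<^sup>2 + 2 * (LINT x|M. (ball_avg s \<phi> x)\<^sup>2)"
proof -
  obtain C where C: "0 \<le> C" "\<And>x. \<bar>\<phi> x\<bar> \<le> C" using test_function_bounded[OF \<phi>] by auto
  have [measurable]: "\<phi> \<in> borel_measurable borel" "grad \<phi> \<in> borel_measurable borel"
      "ball (0::real^'n) s \<in> sets borel" "\<Omega> \<in> sets borel"
    using smooth_borel grad_borel test_function_smooth[OF \<phi>] open_domain by auto
  have [measurable]: "ball_avg s \<phi> \<in> borel_measurable borel" by (rule ball_avg_measurable) measurable
  define V where "V = measure lborel (ball (0::real^'n) s)"
  have V: "V > 0" using s by (simp add: V_def)
  have avgC: "\<bar>ball_avg s \<phi> x\<bar> \<le> C" for x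
  proof -
    have i0: "integrable lborel (indicator (ball (0::real^'n) s) :: _ \<Rightarrow> real)"
      using emeasure_lborel_ball_finite[of "0::real^'n" s] by (intro integrable_real_indicator) auto
    have "\<bar>LINT z|lborel. indicator (ball 0 s) z * \<phi> (x + z)\<bar> \<le> (LINT z|lborel. C * indicator (ball (0::real^'n) s) z)"
    proof (rule integral_abs_bound_integral)
      show "integrable lborel (\<lambda>z. indicator (ball 0 s) z * \<phi> (x + z))"
        by (rule bounded_borel_integrable_on_bounded[of _ C]) (use C in auto)
      show "integrable lborel (\<lambda>z. C * indicator (ball (0::real^'n) s) z)" using i0 by simp
      show "\<bar>indicator (ball 0 s) z * \<phi> (x + z)\<bar> \<le> C * indicator (ball 0 s) z" for z
        using C by (simp add: indicator_def)
    qed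
    then show ?thesis using V by (simp add: ball_avg_def V_def[symmetric] field_simps)
  qed
  have e0: "(\<integral>\<^sup>+x\<in>\<Omega>. ennreal ((\<phi> x - 0)\<^sup>2) \<partial>lborel) = ennreal ((l2 M \<phi>)\<^sup>2)"
  proof -
    have "(\<integral>\<^sup>+x\<in>\<Omega>. ennreal ((\<phi> x - 0)\<^sup>2) \<partial>lborel) = ennreal (LINT x|M. indicator \<Omega> x * (\<phi> x - 0)\<^sup>2)"
      by (rule nn_set_integral_eq[of _ "C\<^sup>2"])
        (use C bounded_domain in \<open>auto simp: power2_le_iff_abs_le\<close>)
    also have "(LINT x|M. indicator \<Omega> x * (\<phi> x - 0)\<^sup>2) = (l2 M \<phi>)\<^sup>2"
      unfolding l2_power2 by (intro Bochner_Integration.integral_cong) (auto simp: indicator_def)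
    finally show ?thesis .
  qed
  have e1: "(\<integral>\<^sup>+x\<in>\<Omega>. ennreal (2 * (ball_avg s \<phi> x - 0)\<^sup>2) \<partial>lborel) = ennreal (2 * (LINT x|M. (ball_avg s \<phi> x)\<^sup>2))"
  proof -
    have "(\<integral>\<^sup>+x\<in>\<Omega>. ennreal (2 * (ball_avg s \<phi> x - 0)\<^sup>2) \<partial>lborel) = ennreal (LINT x|M. indicator \<Omega> x * (2 * (ball_avg s \<phi> x - 0)\<^sup>2))"
      by (rule nn_set_integral_eq[of _ "2 * C\<^sup>2"])
        (use C avgC bounded_domain in \<open>auto simp: power2_le_iff_abs_le\<close>)
    also have "(LINT x|M. indicator \<Omega> x * (2 * (ball_avg s \<phi> x - 0)\<^sup>2)) = (LINT x|M. 2 * (ball_avg s \<phi> x)\<^sup>2)"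
      by (intro Bochner_Integration.integral_cong) (auto simp: indicator_def)
    finally show ?thesis by simp
  qed
  have e2: "(\<integral>\<^sup>+x\<in>UNIV. ennreal (norm (grad \<phi> x) ^ 2) \<partial>lborel) = ennreal ((l2 M (grad \<phi>))\<^sup>2)"
  proof -
    have "(\<integral>\<^sup>+x\<in>UNIV. ennreal (norm (grad \<phi> x) ^ 2) \<partial>lborel) = (\<integral>\<^sup>+x\<in>\<Omega>. ennreal ((norm (grad \<phi> x))\<^sup>2) \<partial>lborel)"
      using test_function_grad_outside[OF \<phi>] by (intro nn_integral_cong) (auto simp: indicator_def)
    also obtain D where D: "0 \<le> D" "\<And>x. norm (grad \<phi> x) \<le> D" using test_function_grad_bounded[OF \<phi>] by auto
    have "(\<integral>\<^sup>+x\<in>\<Omega>. ennreal ((norm (grad \<phi> x))\<^sup>2) \<partial>lborel) = ennreal (LINT x|M. indicator \<Omega> x * (norm (grad \<phi> x))\<^sup>2)"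
      by (rule nn_set_integral_eq[of _ "D\<^sup>2"])
        (use D bounded_domain in \<open>auto intro!: power_mono\<close>)
    also have "(LINT x|M. indicator \<Omega> x * (norm (grad \<phi> x))\<^sup>2) = (l2 M (grad \<phi>))\<^sup>2"
      unfolding l2_power2 by (intro Bochner_Integration.integral_cong) (auto simp: indicator_def)
    finally show ?thesis .
  qed
  have meas: "(\<lambda>x. (\<integral>\<^sup>+z\<in>ball 0 s. ennreal (\<bar>\<phi> (x + z) - \<phi> x\<bar>\<^sup>2) \<partial>lborel) * indicator \<Omega> x) \<in> borel_measurable lborel"
    by (intro borel_measurable_times_ennreal borel_measurable_indicator lborel.borel_measurable_nn_integral) measurable
  have "ennreal ((l2 M \<phi>)\<^sup>2) \<le> (\<integral>\<^sup>+x. ennreal (2 / V) * ((\<integral>\<^sup>+z\<in>ball 0 s. ennreal (\<bar>\<phi> (x + z) - \<phi> x\<bar>\<^sup>2) \<partial>lborel) * indicator \<Omega> x)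
      + ennreal (2 * (ball_avg s \<phi> x - 0)\<^sup>2) * indicator \<Omega> x \<partial>lborel)"
    unfolding e0[symmetric]
    using square_le_ball_avg[of \<phi> C s _ 0] C(2) s by (intro nn_integral_mono) (auto simp: indicator_def V_def)
  also have "\<dots> = ennreal (2 / V) * (\<integral>\<^sup>+x\<in>\<Omega>. (\<integral>\<^sup>+z\<in>ball 0 s. ennreal (\<bar>\<phi> (x + z) - \<phi> x\<bar>\<^sup>2) \<partial>lborel) \<partial>lborel)
      + (\<integral>\<^sup>+x\<in>\<Omega>. ennreal (2 * (ball_avg s \<phi> x - 0)\<^sup>2) \<partial>lborel)"
  proof -
    have "(\<lambda>x. ennreal (2 * (ball_avg s \<phi> x - 0)\<^sup>2) * indicator \<Omega> x) \<in> borel_measurable lborel" by measurable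
    then show ?thesis
      using nn_integral_add[OF borel_measurable_times_ennreal[OF borel_measurable_const meas], of _ "ennreal (2 / V)"]
        nn_integral_cmult[OF meas, of "ennreal (2 / V)"] by simp
  qed
  also have "\<dots> \<le> ennreal (2 / V) * (ennreal (V * s ^ 2) * (\<integral>\<^sup>+x\<in>UNIV. ennreal (norm (grad \<phi> x) ^ 2) \<partial>lborel))
      + (\<integral>\<^sup>+x\<in>\<Omega>. ennreal (2 * (ball_avg s \<phi> x - 0)\<^sup>2) \<partial>lborel)"
    unfolding V_def using s
    by (intro add_right_mono mult_left_mono averaged_translation_estimate test_function_smooth[OF \<phi>]) auto
  also have "\<dots> = ennreal (2 / V * (V * s ^ 2) * (l2 M (grad \<phi>))\<^sup>2 + 2 * (LINT x|M. (ball_avg s \<phi> x)\<^sup>2))"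
    unfolding e1 e2 using V
    by (subst ennreal_plus) (auto simp: ennreal_mult[symmetric] mult.assoc intro!: Bochner_Integration.integral_nonneg)
  also have "2 / V * (V * s ^ 2) = 2 * s\<^sup>2" using V by simp
  finally show ?thesis
    by (subst (asm) ennreal_le_iff) (auto intro!: add_nonneg_nonneg Bochner_Integration.integral_nonneg)
qed

text \<open>At fixed radius \<open>s\<close> the means tend to zero pointwise and boundedly, hence
  in \<open>L2\<close>. What is left is of order \<open>s\<close> by the gradient bound, so
  \<open>s\<close> is fixed before \<open>k\<close> tends to infinity.\<close>

lemma Rellich_test_functions:
  assumes \<phi>: "\<And>k. \<phi> k \<in> test_functions \<Omega>" and C: "\<And>k. l2 M (grad (\<phi> k)) \<le> C" "\<And>k. l2 M (\<phi> k) \<le> C"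
    and avg: "\<And>x s. (\<lambda>k. LINT y|M. indicator (ball x s) y * \<phi> k y) \<longlonglongrightarrow> 0"
  shows "(\<lambda>k. l2 M (\<phi> k)) \<longlonglongrightarrow> 0"
proof -
  interpret finite_measure M by (rule finite_measure_domain)
  have C0: "C \<ge> 0" using C(1)[of 0] l2_nonneg[of M "grad (\<phi> 0)"] by linarith
  have lim: "(\<lambda>k. LINT x|M. (ball_avg s (\<phi> k) x)\<^sup>2) \<longlonglongrightarrow> 0" for s
  proof -
    let ?V = "measure lborel (ball (0::real^'n) s)"
    have "(\<lambda>k. LINT x|M. (ball_avg s (\<phi> k) x)\<^sup>2) \<longlonglongrightarrow> (LINT x|M. 0)"
    proof (rule integral_dominated_convergence[where w = "\<lambda>x. (l2 M (\<lambda>x. 1::real) * C / ?V)\<^sup>2"])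
      show "(\<lambda>x. (ball_avg s (\<phi> k) x)\<^sup>2) \<in> borel_measurable M" for k
        by (intro borel_imp_lebesgue_on borel_measurable_power ball_avg_measurable smooth_borel test_function_smooth[OF \<phi>])
      show "AE x in M. (\<lambda>k. (ball_avg s (\<phi> k) x)\<^sup>2) \<longlonglongrightarrow> 0"
        using tendsto_power[OF tendsto_divide_zero[OF avg], of _ s ?V 2] by (auto simp: ball_avg_eq[OF \<phi>])
      show "AE x in M. norm ((ball_avg s (\<phi> k) x)\<^sup>2) \<le> (l2 M (\<lambda>x. 1::real) * C / ?V)\<^sup>2" for k
      proof (rule AE_I2)
        fix x
        have "\<bar>LINT y|M. indicator (ball x s) y * \<phi> k y\<bar> \<le> l2 M (indicator (ball x s) :: _ \<Rightarrow> real) * l2 M (\<phi> k)"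
          using l2_Cauchy_Schwarz[OF sq_int_indicator[of "ball x s"] test_function_sq_int[OF \<phi>[of k] domain_sets]] by simp
        also have "\<dots> \<le> l2 M (\<lambda>x. 1::real) * C"
        proof (intro mult_mono C)
          show "l2 M (indicator (ball x s) :: _ \<Rightarrow> real) \<le> l2 M (\<lambda>x. 1::real)"
            using l2_mono[OF sq_int_const[of "1::real"] sq_int_measurable[OF sq_int_indicator[of "ball x s"]] AE_I2, of 1]
            by (auto simp: indicator_def)
        qed auto
        finally have "\<bar>ball_avg s (\<phi> k) x\<bar> \<le> l2 M (\<lambda>x. 1::real) * C / ?V"
          unfolding ball_avg_eq[OF \<phi>] by (simp add: divide_right_mono)
        from power_mono[OF this, of 2] show "norm ((ball_avg s (\<phi> k) x)\<^sup>2) \<le> (l2 M (\<lambda>x. 1::real) * C / ?V)\<^sup>2" by simp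
      qed
    qed auto
    then show ?thesis by simp
  qed
  have "(\<lambda>k. (l2 M (\<phi> k))\<^sup>2) \<longlonglongrightarrow> 0"
  proof (rule LIMSEQ_I)
    fix e :: real assume e: "e > 0"
    \<comment> \<open>Makes \<open>2 * s\<^sup>2 * C\<^sup>2\<close> smaller than
      \<open>e / 2\<close>; the summand 1 covers \<open>C = 0\<close>.\<close>
    define s where "s = sqrt (e / (8 * (C\<^sup>2 + 1)))"
    have s: "s > 0" using e by (simp add: s_def add_nonneg_pos)
    have s2: "2 * s\<^sup>2 * C\<^sup>2 < e / 2"
    proof -
      have p: "C\<^sup>2 + 1 > 0" by (simp add: add_nonneg_pos)
      have "2 * s\<^sup>2 * C\<^sup>2 = e * C\<^sup>2 / (4 * (C\<^sup>2 + 1))" using e p by (simp add: s_def field_simps)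
      also have "\<dots> < e / 2" using e p by (simp add: field_simps add_pos_nonneg)
      finally show ?thesis .
    qed
    from LIMSEQ_D[OF lim[of s], of "e / 4"] e obtain N where N: "\<And>k. k \<ge> N \<Longrightarrow> \<bar>LINT x|M. (ball_avg s (\<phi> k) x)\<^sup>2\<bar> < e / 4" by auto
    have "(l2 M (\<phi> k))\<^sup>2 < e" if "k \<ge> N" for k
    proof -
      have "2 * s\<^sup>2 * (l2 M (grad (\<phi> k)))\<^sup>2 \<le> 2 * s\<^sup>2 * C\<^sup>2"
        using C(1)[of k] by (intro mult_left_mono power_mono) auto
      then show ?thesis using ball_avg_estimate[OF \<phi>[of k] s] N[OF that] s2 by linarith
    qed
    then show "\<exists>N. \<forall>k\<ge>N. norm ((l2 M (\<phi> k))\<^sup>2 - 0) < e" by auto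
  qed
  from tendsto_real_sqrt[OF this] show ?thesis by simp
qed

text \<open>The bound on the gradients is made part of the notion: it is at hand for all sequences
  of solutions considered, and Rellich's theorem relies on it.\<close>

definition weakly_H10 :: "(nat \<Rightarrow> real^'n \<Rightarrow> real) \<Rightarrow> (real^'n \<Rightarrow> real) \<Rightarrow> bool" where
  "weakly_H10 u u0 \<longleftrightarrow> (\<forall>k. u k \<in> H10 \<Omega>) \<and> u0 \<in> H10 \<Omega> \<and>
    (\<exists>C. \<forall>k. l2 M (wgrad \<Omega> (u k)) \<le> C) \<and>
    (\<forall>v\<in>H10 \<Omega>. (\<lambda>k. dirichlet \<Omega> (\<lambda>x. 1) (u k) v) \<longlonglongrightarrow> dirichlet \<Omega> (\<lambda>x. 1) u0 v)"

sublocale H10: complete_semi_inner "H10 \<Omega>" "dirichlet \<Omega> (\<lambda>x. 1)"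
  by (rule dirichlet_complete[of _ 1 1]) auto

lemma H10_nrm: "H10.nrm u = l2 M (wgrad \<Omega> u)"
  by (simp add: H10.nrm_def dirichlet_def l2_def power2_norm_eq_inner)

text \<open>By Riesz' theorem a linear functional bounded by the gradient norm is the pairing with
  some \<open>g\<close>, and against such pairings convergence holds by definition.\<close>

lemma weakly_H10_functional:
  assumes u: "weakly_H10 u u0"
    and F: "\<And>u v. u \<in> H10 \<Omega> \<Longrightarrow> v \<in> H10 \<Omega> \<Longrightarrow> F (\<lambda>x. u x + v x) = F u + F v"
      "\<And>c u. u \<in> H10 \<Omega> \<Longrightarrow> F (\<lambda>x. c * u x) = c * F u"
      "\<And>u. u \<in> H10 \<Omega> \<Longrightarrow> \<bar>F u\<bar> \<le> C * l2 M (wgrad \<Omega> u)"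
  shows "(\<lambda>k. F (u k)) \<longlonglongrightarrow> F u0"
proof -
  obtain g where g: "g \<in> H10 \<Omega>" "\<And>v. v \<in> H10 \<Omega> \<Longrightarrow> F v = dirichlet \<Omega> (\<lambda>x. 1) g v"
    using H10.Riesz[of F C] F by (auto simp: H10_nrm)
  have "(\<lambda>k. dirichlet \<Omega> (\<lambda>x. 1) (u k) g) \<longlonglongrightarrow> dirichlet \<Omega> (\<lambda>x. 1) u0 g"
    using u g by (simp add: weakly_H10_def)
  then show ?thesis using u g H10.ip_sym by (simp add: weakly_H10_def)
qed

lemma weakly_H10_sq_int_functional:
  assumes u: "weakly_H10 u u0" and h: "h \<in> sq_int M"
  shows "(\<lambda>k. LINT x|M. h x * u k x) \<longlonglongrightarrow> (LINT x|M. h x * u0 x)"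
proof -
  obtain P where P: "P \<ge> 0" "\<And>u G. has_H10_gradient \<Omega> u G \<Longrightarrow> l2 M u \<le> P * l2 M G"
    using Poincare_constant by auto
  have int: "integrable M (\<lambda>x. h x * v x)" if "v \<in> H10 \<Omega>" for v
    using sq_int_inner_integrable[OF h H10_sq_int(1)[OF that]] by simp
  show ?thesis
  proof (rule weakly_H10_functional[OF u, of _ "l2 M h * P"])
    show "(LINT x|M. h x * (c * v x)) = c * (LINT x|M. h x * v x)" for c v by (simp add: mult.left_commute)
    show "\<bar>LINT x|M. h x * v x\<bar> \<le> l2 M h * P * l2 M (wgrad \<Omega> v)" if "v \<in> H10 \<Omega>" for v
      using l2_Cauchy_Schwarz[OF h H10_sq_int(1)[OF that]] mult_left_mono[OF P(2)[OF H10_gradient[OF that]], of "l2 M h"]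
      by simp
  qed (use int in \<open>simp add: distrib_left\<close>)
qed

lemma weakly_H10_gradient_functional:
  assumes u: "weakly_H10 u u0" and h: "h \<in> sq_int M"
  shows "(\<lambda>k. LINT x|M. h x \<bullet> wgrad \<Omega> (u k) x) \<longlonglongrightarrow> (LINT x|M. h x \<bullet> wgrad \<Omega> u0 x)"
proof (rule weakly_H10_functional[OF u, of _ "l2 M h"])
  fix v assume v: "v \<in> H10 \<Omega>"
  show "\<bar>LINT x|M. h x \<bullet> wgrad \<Omega> v x\<bar> \<le> l2 M h * l2 M (wgrad \<Omega> v)"
    by (rule l2_Cauchy_Schwarz[OF h H10_sq_int(2)[OF v]])
  have hm: "h \<in> borel_measurable M" by (rule sq_int_measurable[OF h])
  note int = sq_int_inner_integrable[OF h H10_sq_int(2)]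
  show "(LINT x|M. h x \<bullet> wgrad \<Omega> (\<lambda>x. c * v x) x) = c * (LINT x|M. h x \<bullet> wgrad \<Omega> v x)" for c
  proof -
    have "(LINT x|M. h x \<bullet> wgrad \<Omega> (\<lambda>x. c * v x) x) = (LINT x|M. c * (h x \<bullet> wgrad \<Omega> v x))"
    proof (rule integral_cong_AE)
      show "AE x in M. h x \<bullet> wgrad \<Omega> (\<lambda>x. c * v x) x = c * (h x \<bullet> wgrad \<Omega> v x)"
        using wgrad_scale[OF v, of c] by eventually_elim simp
    qed (use borel_measurable_integrable[OF int[OF v]] borel_measurable_integrable[OF int[OF H10_scale[OF v]]] in measurable)
    then show ?thesis by simp
  qed
  fix w assume w: "w \<in> H10 \<Omega>"
  have "(LINT x|M. h x \<bullet> wgrad \<Omega> (\<lambda>x. v x + w x) x) = (LINT x|M. h x \<bullet> wgrad \<Omega> v x + h x \<bullet> wgrad \<Omega> w x)"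
  proof (rule integral_cong_AE)
    show "AE x in M. h x \<bullet> wgrad \<Omega> (\<lambda>x. v x + w x) x = h x \<bullet> wgrad \<Omega> v x + h x \<bullet> wgrad \<Omega> w x"
      using wgrad_add[OF v w] by eventually_elim (simp add: inner_add_right)
  qed (use borel_measurable_integrable[OF int[OF v]] borel_measurable_integrable[OF int[OF w]]
      borel_measurable_integrable[OF int[OF H10_add[OF v w]]] in measurable)
  then show "(LINT x|M. h x \<bullet> wgrad \<Omega> (\<lambda>x. v x + w x) x)
      = (LINT x|M. h x \<bullet> wgrad \<Omega> v x) + (LINT x|M. h x \<bullet> wgrad \<Omega> w x)"
    using int[OF v] int[OF w] by simp
qed

text \<open>Each difference \<open>u k - u0\<close> is replaced by a test function which is within
  \<open>inverse (real (Suc k))\<close> of it together with its gradient. The integrals of these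
  test functions over fixed balls tend to zero, because indicators of balls are admissible in the
  weak convergence.\<close>

theorem Rellich:
  assumes u: "weakly_H10 u u0"
  shows "(\<lambda>k. l2 M (\<lambda>x. u k x - u0 x)) \<longlonglongrightarrow> 0"
proof -
  have uH: "u k \<in> H10 \<Omega>" "u0 \<in> H10 \<Omega>" for k using u by (auto simp: weakly_H10_def)
  obtain C where C: "\<And>k. l2 M (wgrad \<Omega> (u k)) \<le> C" using u by (auto simp: weakly_H10_def)
  obtain P where P: "P \<ge> 0" "\<And>u G. has_H10_gradient \<Omega> u G \<Longrightarrow> l2 M u \<le> P * l2 M G"
    using Poincare_constant by auto
  define w where "w k x = u k x - u0 x" for k x
  define G where "G k x = wgrad \<Omega> (u k) x - wgrad \<Omega> u0 x" for k x
  have wG: "has_H10_gradient \<Omega> (w k) (G k)" for k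
    unfolding w_def G_def by (intro has_H10_gradient_diff H10_gradient uH domain_sets)
  note sq = has_H10_gradient_sq_int[OF wG]
  have "\<forall>k. \<exists>\<phi>. \<phi> \<in> test_functions \<Omega> \<and> l2 M (\<lambda>x. w k x - \<phi> x) < inverse (real (Suc k)) \<and>
      l2 M (\<lambda>x. G k x - grad \<phi> x) < inverse (real (Suc k))"
  proof
    fix k show "\<exists>\<phi>. \<phi> \<in> test_functions \<Omega> \<and> l2 M (\<lambda>x. w k x - \<phi> x) < inverse (real (Suc k)) \<and>
      l2 M (\<lambda>x. G k x - grad \<phi> x) < inverse (real (Suc k))"
    using wG[of k, unfolded has_H10_gradient_def, THEN conjunct2, THEN conjunct2, rule_format,
      of "inverse (real (Suc k))"] by auto
  qed
  from choice[OF this] obtain \<phi> where \<phi>: "\<And>k. \<phi> k \<in> test_functions \<Omega>"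
    "\<And>k. l2 M (\<lambda>x. w k x - \<phi> k x) < inverse (real (Suc k))"
    "\<And>k. l2 M (\<lambda>x. G k x - grad (\<phi> k) x) < inverse (real (Suc k))" by blast
  note ts = test_function_sq_int[OF \<phi>(1) domain_sets] and tg = test_function_grad_sq_int[OF \<phi>(1) domain_sets]
  have w\<phi>: "(\<lambda>k. l2 M (\<lambda>x. w k x - \<phi> k x)) \<longlonglongrightarrow> 0"
    by (rule tendsto_zero_bound[OF LIMSEQ_inverse_real_of_nat]) (use \<phi>(2) less_imp_le in auto)
  have inv1: "inverse (real (Suc k)) \<le> 1" for k by (simp add: field_simps)
  define D where "D = C + l2 M (wgrad \<Omega> u0) + 1"
  have GD: "l2 M (G k) \<le> D - 1" for k
    using l2_triangle[OF H10_sq_int(2)[OF uH(1)] sq_int_uminus[OF H10_sq_int(2)[OF uH(2)]], of k] C[of k]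
    by (simp add: G_def D_def l2_def)
  have gD: "l2 M (grad (\<phi> k)) \<le> D" for k
    using l2_triangle[OF sq(2) sq_int_uminus[OF sq_int_diff[OF sq(2) tg]], of k k k] GD[of k] \<phi>(3)[of k] inv1[of k]
    by (simp add: l2_def norm_minus_commute)
  have D0: "D \<ge> 0" using gD[of 0] l2_nonneg[of M "grad (\<phi> 0)"] by linarith
  have fD: "l2 M (\<phi> k) \<le> P * D" for k
    using P(2)[OF test_function_has_H10_gradient[OF \<phi>(1) domain_sets], of k] mult_left_mono[OF gD P(1), of k] by linarith
  have "(\<lambda>k. l2 M (\<phi> k)) \<longlonglongrightarrow> 0"
  proof (rule Rellich_test_functions[OF \<phi>(1), where C = "D + P * D"])
    show "l2 M (grad (\<phi> k)) \<le> D + P * D" for k using gD[of k] P(1) D0 by (simp add: add_increasing2)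
    show "l2 M (\<phi> k) \<le> D + P * D" for k using fD[of k] D0 by simp
    fix x :: "real^'n" and s
    let ?i = "indicator (ball x s) :: _ \<Rightarrow> real"
    have isq: "?i \<in> sq_int M" by simp
    have "(\<lambda>k. LINT y|M. ?i y * u k y) \<longlonglongrightarrow> (LINT y|M. ?i y * u0 y)"
      by (rule weakly_H10_sq_int_functional[OF u isq])
    then have "(\<lambda>k. (LINT y|M. ?i y * u k y) - (LINT y|M. ?i y * u0 y)) \<longlonglongrightarrow> 0" by (rule LIM_zero)
    then have 1: "(\<lambda>k. LINT y|M. ?i y * w k y) \<longlonglongrightarrow> 0"
      using sq_int_inner_integrable[OF isq H10_sq_int(1)[OF uH(1)]] sq_int_inner_integrable[OF isq H10_sq_int(1)[OF uH(2)]]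
      by (simp add: w_def right_diff_distrib)
    have 2: "(\<lambda>k. LINT y|M. ?i y * (w k y - \<phi> k y)) \<longlonglongrightarrow> 0"
    proof (rule Lim_null_comparison)
      show "(\<lambda>k. l2 M ?i * l2 M (\<lambda>x. w k x - \<phi> k x)) \<longlonglongrightarrow> 0"
        using tendsto_mult_left[OF w\<phi>, of "l2 M ?i"] by simp
      show "\<forall>\<^sub>F k in sequentially. norm (LINT y|M. ?i y * (w k y - \<phi> k y)) \<le> l2 M ?i * l2 M (\<lambda>x. w k x - \<phi> k x)"
        using l2_Cauchy_Schwarz[OF isq sq_int_diff[OF sq(1) ts]] by (auto intro!: always_eventually)
    qed
    from tendsto_diff[OF 1 2] show "(\<lambda>k. LINT y|M. ?i y * \<phi> k y) \<longlonglongrightarrow> 0"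
      using sq_int_inner_integrable[OF isq sq(1)] sq_int_inner_integrable[OF isq ts]
      by (simp add: right_diff_distrib)
  qed
  from tendsto_add[OF w\<phi> this] have lim: "(\<lambda>k. l2 M (\<lambda>x. w k x - \<phi> k x) + l2 M (\<phi> k)) \<longlonglongrightarrow> 0" by simp
  show ?thesis
  proof (rule tendsto_zero_bound[OF lim])
    show "l2 M (\<lambda>x. u k x - u0 x) \<le> l2 M (\<lambda>x. w k x - \<phi> k x) + l2 M (\<phi> k)" for k
      using l2_triangle[OF sq_int_diff[OF sq(1) ts] ts, of k k k] by (simp add: w_def)
  qed simp
qed

end

section \<open>Correctors\<close>

lemma scaleR_mat_1_mult_vec: "(a *\<^sub>R mat 1) *v (x::real^'n::finite) = a *\<^sub>R x"
  by (simp add: scaleR_matrix_vector_assoc[symmetric])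

lemma not_tendsto_subsequence:
  fixes x :: "nat \<Rightarrow> real"
  assumes "\<not> x \<longlonglongrightarrow> l"
  obtains e and s :: "nat \<Rightarrow> nat" where "e > 0" "strict_mono s" "\<And>k. e \<le> \<bar>x (s k) - l\<bar>"
proof -
  obtain e where e: "e > 0" "\<And>N. \<exists>n\<ge>N. e \<le> \<bar>x n - l\<bar>"
    using assms by (auto simp: LIMSEQ_def dist_real_def not_less)
  then have "infinite {n. e \<le> \<bar>x n - l\<bar>}"
    by (auto simp: infinite_nat_iff_unbounded_le)
  then obtain s :: "nat \<Rightarrow> nat" where "strict_mono s" "\<And>k. s k \<in> {n. e \<le> \<bar>x n - l\<bar>}"
    using infinite_enumerate by blast
  with e(1) show ?thesis by (intro that[of e s]) auto
qed

context domain
begin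

abbreviation "E \<equiv> dirichlet \<Omega> (\<lambda>x. 1)"

lemma E_def: "E u v = (LINT x|M. wgrad \<Omega> u x \<bullet> wgrad \<Omega> v x)"
  by (simp add: dirichlet_def)

lemma E_self: "E u u = (l2 M (wgrad \<Omega> u))\<^sup>2"
  by (simp add: E_def l2_power2 power2_norm_eq_inner)

lemma E_bound: "u \<in> H10 \<Omega> \<Longrightarrow> v \<in> H10 \<Omega> \<Longrightarrow> \<bar>E u v\<bar> \<le> l2 M (wgrad \<Omega> u) * l2 M (wgrad \<Omega> v)"
  using H10.Cauchy_Schwarz by (simp add: H10_nrm)

lemma H1_norm_zero: "H1_norm \<Omega> (\<lambda>x. 0) = 0"
  using H1_norm_eq_of_gradient[OF test_function_has_H10_gradient[OF test_function_zero domain_sets] open_domain]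
  by (simp add: l2_def)

lemma H1_norm_H10_bound:
  "\<exists>Q\<ge>0. \<forall>u\<in>H10 \<Omega>. H1_norm \<Omega> u \<le> Q * l2 M (wgrad \<Omega> u) \<and> l2 M (wgrad \<Omega> u) \<le> H1_norm \<Omega> u"
proof -
  obtain P where P: "P \<ge> 0" "\<And>u G. has_H10_gradient \<Omega> u G \<Longrightarrow> l2 M u \<le> P * l2 M G"
    using Poincare_constant by auto
  show ?thesis
  proof (intro exI[of _ "sqrt (P\<^sup>2 + 1)"] conjI ballI)
    fix u assume u: "u \<in> H10 \<Omega>"
    have "(l2 M u)\<^sup>2 + (l2 M (wgrad \<Omega> u))\<^sup>2 \<le> (P * l2 M (wgrad \<Omega> u))\<^sup>2 + (l2 M (wgrad \<Omega> u))\<^sup>2"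
      using P(2)[OF H10_gradient[OF u]] by (intro add_right_mono power_mono) auto
    also have "\<dots> = (P\<^sup>2 + 1) * (l2 M (wgrad \<Omega> u))\<^sup>2" by (simp add: power_mult_distrib algebra_simps)
    finally show "H1_norm \<Omega> u \<le> sqrt (P\<^sup>2 + 1) * l2 M (wgrad \<Omega> u)"
      unfolding H1_norm_eq using real_sqrt_le_mono by (fastforce simp: real_sqrt_mult)
    show "l2 M (wgrad \<Omega> u) \<le> H1_norm \<Omega> u" by (simp add: H1_norm_eq real_le_rsqrt)
  qed simp
qed

lemma H10_H1: "u \<in> H10 \<Omega> \<Longrightarrow> u \<in> H1 \<Omega>"
  by (simp add: H10_def)

text \<open>Restricted to \<open>H10 \<Omega>\<close>, a bounded functional on
  \<open>H1 \<Omega>\<close> is bounded by the gradient norm alone, by Poincare's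
  inequality.\<close>

lemma weakly_H10_weakly_in_H1:
  assumes u: "weakly_H10 u u0" shows "weakly_in_H1 \<Omega> u u0"
proof -
  obtain Q where Q: "Q \<ge> 0" "\<And>u. u \<in> H10 \<Omega> \<Longrightarrow> H1_norm \<Omega> u \<le> Q * l2 M (wgrad \<Omega> u)"
    using H1_norm_H10_bound by auto
  have "(\<lambda>k. F (u k)) \<longlonglongrightarrow> F u0" if F: "F \<in> dual_of \<Omega> (H1 \<Omega>)" for F
  proof -
    obtain C where C: "\<forall>v\<in>H1 \<Omega>. \<bar>F v\<bar> \<le> C * H1_norm \<Omega> v" using F by (auto simp: dual_of_def)
    show ?thesis
    proof (rule weakly_H10_functional[OF u, of F "\<bar>C\<bar> * Q"])
      fix v assume v: "v \<in> H10 \<Omega>"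
      have "\<bar>F v\<bar> \<le> \<bar>C\<bar> * H1_norm \<Omega> v"
      proof (rule order_trans[OF bspec[OF C H10_H1[OF v]]])
        show "C * H1_norm \<Omega> v \<le> \<bar>C\<bar> * H1_norm \<Omega> v" by (rule mult_right_mono) (auto simp: H1_norm_eq)
      qed
      also have "\<dots> \<le> \<bar>C\<bar> * (Q * l2 M (wgrad \<Omega> v))" by (intro mult_left_mono Q v) simp
      finally show "\<bar>F v\<bar> \<le> \<bar>C\<bar> * Q * l2 M (wgrad \<Omega> v)" by (simp add: mult.assoc)
    qed (use F H10_H1 in \<open>auto simp: dual_of_def\<close>)
  qed
  then show ?thesis using u H10_H1 by (auto simp: weakly_in_H1_def weakly_H10_def)
qed

text \<open>The functionals \<open>F k\<close> agree on \<open>H10 \<Omega>\<close>, though possibly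
  not elsewhere, and the norm of \<open>Hminus1\<close> looks at \<open>H10 \<Omega>\<close> only;
  all distances to the limit are therefore zero.\<close>

lemma constant_strongly_convergent_in_Hminus1:
  assumes g: "g \<in> H10 \<Omega>" and F: "\<And>k v. v \<in> H10 \<Omega> \<Longrightarrow> F k v = E g v"
  shows "strongly_convergent_in_Hminus1 \<Omega> F"
proof -
  obtain Q where Q: "\<And>u. u \<in> H10 \<Omega> \<Longrightarrow> l2 M (wgrad \<Omega> u) \<le> H1_norm \<Omega> u"
    using H1_norm_H10_bound by auto
  have dual: "f \<in> Hminus1 \<Omega>" if f: "\<And>v. v \<in> H10 \<Omega> \<Longrightarrow> f v = E g v" for f
    unfolding Hminus1_def dual_of_def
  proof (intro CollectI conjI ballI allI)
    fix u v assume uv: "u \<in> H10 \<Omega>" "v \<in> H10 \<Omega>"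
    then show "f (\<lambda>x. u x + v x) = f u + f v" using g by (simp add: f H10_add H10.ip_add_right)
  next
    fix c u assume u: "u \<in> H10 \<Omega>"
    then show "f (\<lambda>x. c * u x) = c * f u" using g by (simp add: f H10_scale H10.ip_scale_right)
  next
    show "\<exists>C. \<forall>u\<in>H10 \<Omega>. \<bar>f u\<bar> \<le> C * H1_norm \<Omega> u"
    proof (intro exI ballI)
      fix u assume u: "u \<in> H10 \<Omega>"
      show "\<bar>f u\<bar> \<le> l2 M (wgrad \<Omega> g) * H1_norm \<Omega> u"
        using E_bound[OF g u] mult_left_mono[OF Q[OF u], of "l2 M (wgrad \<Omega> g)"] by (simp add: f u)
    qed
  qed
  have "Hminus1_norm \<Omega> (\<lambda>v. F k v - E g v) = 0" for k
  proof -
    have "(\<lambda>x. 0) \<in> {v \<in> H10 \<Omega>. H1_norm \<Omega> v \<le> 1}" by (simp add: H1_norm_zero H10.zero_mem)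
    then have ne: "{v \<in> H10 \<Omega>. H1_norm \<Omega> v \<le> 1} \<noteq> {}" by auto
    have "Hminus1_norm \<Omega> (\<lambda>v. F k v - E g v) = (SUP v\<in>{v \<in> H10 \<Omega>. H1_norm \<Omega> v \<le> 1}. 0)"
      unfolding Hminus1_norm_def by (rule SUP_cong) (auto simp: F)
    then show ?thesis using cSUP_const[OF ne] by simp
  qed
  then show ?thesis
    unfolding strongly_convergent_in_Hminus1_def using dual[of "F k" for k] dual[of "E g"] F
    by (auto intro!: bexI[of _ "E g"])
qed

end

section \<open>Solution operators and correctors\<close>

locale h_convergent = domain \<Omega> for \<Omega> :: "(real^'n::finite) set" +
  fixes a :: "nat \<Rightarrow> real^'n \<Rightarrow> real" and a1 a2 :: real and Astar :: "real^'n \<Rightarrow> real^'n^'n"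
  assumes a_measurable: "\<And>k. a k \<in> borel_measurable M"
    and a1_pos: "0 < a1"
    and a_bounds: "\<And>k x. a1 \<le> a k x" "\<And>k x. a k x \<le> a2"
    and H: "H_converges \<Omega> (\<lambda>k x. a k x *\<^sub>R mat 1) Astar"
begin

lemma a2_pos: "0 < a2"
  using a1_pos a_bounds(1)[of 0 0] a_bounds(2)[of 0 0] by linarith

lemma a_abs: "\<bar>a k x\<bar> \<le> a2"
  using a_bounds(1)[of k x] a_bounds(2)[of k x] a1_pos by linarith

sublocale Ea: complete_semi_inner "H10 \<Omega>" "dirichlet \<Omega> (a k)" for k
  by (rule dirichlet_complete[OF a_measurable a1_pos, where ?a2.0 = a2]) (simp add: a_bounds)

lemma Ea_lower: "u \<in> H10 \<Omega> \<Longrightarrow> a1 * (l2 M (wgrad \<Omega> u))\<^sup>2 \<le> dirichlet \<Omega> (a k) u u"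
  by (rule dirichlet_complete(2)[OF a_measurable a1_pos, where ?a2.0 = a2]) (simp add: a_bounds)

lemma Ea_upper: "u \<in> H10 \<Omega> \<Longrightarrow> dirichlet \<Omega> (a k) u u \<le> a2 * (l2 M (wgrad \<Omega> u))\<^sup>2"
  by (rule dirichlet_complete(3)[OF a_measurable a1_pos, where ?a2.0 = a2]) (simp add: a_bounds)

text \<open>The solution operator of the Dirichlet problem with coefficient \<open>a k\<close>. A
  right-hand side in \<open>Hminus1\<close> is encoded by its Riesz representative \<open>g\<close>,
  which turns solution operators into operators on \<open>H10 \<Omega>\<close>. Because of
  \<open>SOME\<close> they are linear only up to functions of gradient norm zero.\<close>

definition T :: "nat \<Rightarrow> (real^'n \<Rightarrow> real) \<Rightarrow> real^'n \<Rightarrow> real" where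
  "T k g = (SOME u. u \<in> H10 \<Omega> \<and> (\<forall>v\<in>H10 \<Omega>. E g v = dirichlet \<Omega> (a k) u v))"

lemma T:
  assumes g: "g \<in> H10 \<Omega>"
  shows "T k g \<in> H10 \<Omega>" "\<And>v. v \<in> H10 \<Omega> \<Longrightarrow> dirichlet \<Omega> (a k) (T k g) v = E g v"
proof -
  have "\<bar>E g v\<bar> \<le> (l2 M (wgrad \<Omega> g) / sqrt a1) * Ea.nrm k v" if v: "v \<in> H10 \<Omega>" for v
  proof -
    have "sqrt a1 * l2 M (wgrad \<Omega> v) \<le> Ea.nrm k v"
      using real_sqrt_le_mono[OF Ea_lower[OF v, of k]] by (simp add: Ea.nrm_def real_sqrt_mult)
    then have "l2 M (wgrad \<Omega> v) \<le> Ea.nrm k v / sqrt a1" using a1_pos by (simp add: field_simps)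
    from mult_left_mono[OF this, of "l2 M (wgrad \<Omega> g)"] show ?thesis using E_bound[OF g v] by simp
  qed
  then have "\<exists>u\<in>H10 \<Omega>. \<forall>v\<in>H10 \<Omega>. E g v = dirichlet \<Omega> (a k) u v"
    using g by (intro Ea.Riesz[where C = "l2 M (wgrad \<Omega> g) / sqrt a1"]) (auto simp: H10.ip_add_right H10.ip_scale_right)
  then have "\<exists>u. u \<in> H10 \<Omega> \<and> (\<forall>v\<in>H10 \<Omega>. E g v = dirichlet \<Omega> (a k) u v)" by auto
  from someI_ex[OF this] show "T k g \<in> H10 \<Omega>" "\<And>v. v \<in> H10 \<Omega> \<Longrightarrow> dirichlet \<Omega> (a k) (T k g) v = E g v"
    unfolding T_def[symmetric] by auto
qed

text \<open>Coercivity makes the gradient norm of the difference vanish, and then all its pairings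
  vanish by Cauchy-Schwarz.\<close>

lemma Ea_unique:
  assumes u: "u \<in> H10 \<Omega>" "u' \<in> H10 \<Omega>" and v: "v \<in> H10 \<Omega>"
    and eq: "\<And>v. v \<in> H10 \<Omega> \<Longrightarrow> dirichlet \<Omega> (a k) u v = dirichlet \<Omega> (a k) u' v"
  shows "E u v = E u' v"
proof -
  have w: "(\<lambda>x. u x - u' x) \<in> H10 \<Omega>" by (intro H10_diff u)
  have "dirichlet \<Omega> (a k) (\<lambda>x. u x - u' x) (\<lambda>x. u x - u' x) = 0"
    using eq[OF w] by (simp add: Ea.ip_diff_left u w)
  then have "a1 * (l2 M (wgrad \<Omega> (\<lambda>x. u x - u' x)))\<^sup>2 \<le> 0" using Ea_lower[OF w, of k] by simp
  then have "H10.nrm (\<lambda>x. u x - u' x) = 0"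
    using a1_pos by (auto simp: H10_nrm mult_le_0_iff)
  from H10.ip_zero_of_nrm_zero[OF w v this] show ?thesis by (simp add: H10.ip_diff_left u v)
qed

lemma T_bound:
  assumes g: "g \<in> H10 \<Omega>" shows "l2 M (wgrad \<Omega> (T k g)) \<le> 1 / a1 * l2 M (wgrad \<Omega> g)"
proof -
  let ?t = "l2 M (wgrad \<Omega> (T k g))"
  have "a1 * ?t\<^sup>2 \<le> E g (T k g)" using Ea_lower[OF T(1)[OF g, of k], of k] T(2)[OF g T(1)[OF g, of k], of k] by simp
  also have "\<dots> \<le> l2 M (wgrad \<Omega> g) * ?t" using E_bound[OF g T(1)[OF g, of k]] by simp
  finally have "a1 * ?t * ?t \<le> l2 M (wgrad \<Omega> g) * ?t" by (simp add: power2_eq_square mult.assoc)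
  then have "a1 * ?t \<le> l2 M (wgrad \<Omega> g)" by (cases "?t = 0") (auto simp: less_le)
  then show ?thesis using a1_pos by (simp add: field_simps)
qed

text \<open>Cauchy-Schwarz in the form with weight \<open>a k\<close>, in which \<open>E g g\<close>
  is the product of \<open>T k g\<close> and \<open>g\<close>, combined with the upper bound
  \<open>a2\<close>.\<close>

lemma T_coercive:
  assumes g: "g \<in> H10 \<Omega>" shows "1 / a2 * E g g \<le> E (T k g) g"
proof -
  note t = T(1)[OF g, of k] T(2)[OF g, where k = k]
  have eq: "E (T k g) g = dirichlet \<Omega> (a k) (T k g) (T k g)"
    using t g by (simp add: H10.ip_sym)
  have "(E g g)\<^sup>2 = (dirichlet \<Omega> (a k) (T k g) g)\<^sup>2" using t(2)[OF g] by simp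
  also have "\<dots> \<le> dirichlet \<Omega> (a k) (T k g) (T k g) * dirichlet \<Omega> (a k) g g"
    by (rule Ea.Cauchy_Schwarz_power2[OF t(1) g])
  also have "\<dots> \<le> E (T k g) g * (a2 * E g g)"
    unfolding eq by (intro mult_left_mono) (use Ea_upper[OF g] Ea.ip_nonneg t(1) in \<open>auto simp: E_self\<close>)
  finally have "E g g * E g g \<le> (a2 * E (T k g) g) * E g g" by (simp add: power2_eq_square mult_ac)
  then have "E g g \<le> a2 * E (T k g) g"
    using Ea.ip_nonneg[OF t(1), of k] H10.ip_nonneg[OF g] a2_pos
    by (cases "E g g = 0") (auto simp: eq less_le)
  then show ?thesis using a2_pos by (simp add: field_simps)
qed

text \<open>The solution operators are symmetric, bounded by \<open>1 / a1\<close> and coercive with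
  constant \<open>1 / a2\<close>, uniformly in \<open>k\<close>; so their weak limits are onto. This
  gives solutions with one fixed right-hand side that approach a prescribed
  \<open>w\<close>.\<close>

lemma exists_corrector_subsequence:
  assumes w: "w \<in> H10 \<Omega>"
  obtains g and r :: "nat \<Rightarrow> nat" where "g \<in> H10 \<Omega>" "strict_mono r" "weakly_H10 (\<lambda>k. T (r k) g) w"
proof -
  obtain g and r :: "nat \<Rightarrow> nat" where gr: "g \<in> H10 \<Omega>" "strict_mono r"
    "\<forall>v\<in>H10 \<Omega>. (\<lambda>k. E (T (r k) g) v) \<longlonglongrightarrow> E w v"
  proof (rule H10.weak_limit_operators_surjective[of T "1 / a1" "1 / a2" w])
    fix k g h v assume g: "g \<in> H10 \<Omega>" and h: "h \<in> H10 \<Omega>" and v: "v \<in> H10 \<Omega>"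
    have "E (T k (\<lambda>x. g x + h x)) v = E (\<lambda>x. T k g x + T k h x) v"
      by (rule Ea_unique[OF _ _ v, where k = k])
        (use g h in \<open>auto simp: T H10_add Ea.ip_add_left H10.ip_add_left\<close>)
    then show "E (T k (\<lambda>x. g x + h x)) v = E (T k g) v + E (T k h) v"
      using g h v by (simp add: T H10.ip_add_left)
  next
    fix k g c v assume g: "g \<in> H10 \<Omega>" and v: "v \<in> H10 \<Omega>"
    have "E (T k (\<lambda>x. c * g x)) v = E (\<lambda>x. c * T k g x) v"
      by (rule Ea_unique[OF _ _ v, where k = k])
        (use g in \<open>auto simp: T H10_scale Ea.ip_scale_left H10.ip_scale_left\<close>)
    then show "E (T k (\<lambda>x. c * g x)) v = c * E (T k g) v"
      using g v by (simp add: T H10.ip_scale_left)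
  next
    fix k g h assume g: "g \<in> H10 \<Omega>" and h: "h \<in> H10 \<Omega>"
    have "E (T k g) h = dirichlet \<Omega> (a k) (T k h) (T k g)" using g h by (simp add: T H10.ip_sym)
    also have "\<dots> = dirichlet \<Omega> (a k) (T k g) (T k h)" using g h by (simp add: T Ea.ip_sym)
    also have "\<dots> = E (T k h) g" using g h by (simp add: T H10.ip_sym)
    finally show "E (T k g) h = E (T k h) g" .
  qed (use w a2_pos T_bound T_coercive T(1) in \<open>auto simp: H10_nrm\<close>)
  show ?thesis
  proof (rule that[OF gr(1,2)])
    show "weakly_H10 (\<lambda>k. T (r k) g) w"
      unfolding weakly_H10_def using gr w T(1)[OF gr(1)] T_bound[OF gr(1)] by blast
  qed
qed

text \<open>The divergences of the fluxes do not depend on \<open>k\<close>, hence they converge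
  strongly in a trivial way.\<close>

lemma T_test_sequence:
  assumes g: "g \<in> H10 \<Omega>" and w: "weakly_H10 (\<lambda>k. T (r k) g) w"
  shows "test_sequence \<Omega> ((\<lambda>k x. a k x *\<^sub>R mat 1) \<circ> r) (\<lambda>k. T (r k) g) w"
  unfolding test_sequence_def
proof (intro conjI weakly_H10_weakly_in_H1 w constant_strongly_convergent_in_Hminus1[OF g])
  fix k v assume v: "v \<in> H10 \<Omega>"
  show "minus_div \<Omega> (\<lambda>x. ((\<lambda>k x. a k x *\<^sub>R mat 1) \<circ> r) k x *v wgrad \<Omega> (T (r k) g) x) v = E g v"
    using T(2)[OF g v, of "r k"] by (simp add: minus_div_def scaleR_mat_1_mult_vec dirichlet_def)
qed

text \<open>The convergence of the fluxes is H-convergence applied to the solutions. In the last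
  claim it is used on a constant sequence: every solution satisfies the weak equation with the same
  \<open>g\<close>.\<close>

lemma T_flux:
  assumes g: "g \<in> H10 \<Omega>" and r: "strict_mono r" and w: "weakly_H10 (\<lambda>k. T (r k) g) w"
  shows "(\<lambda>x. Astar x *v wgrad \<Omega> w x) \<in> sq_int M"
    and "h \<in> sq_int M \<Longrightarrow> (\<lambda>k. LINT x|M. (a (r k) x *\<^sub>R wgrad \<Omega> (T (r k) g) x) \<bullet> h x)
        \<longlonglongrightarrow> (LINT x|M. (Astar x *v wgrad \<Omega> w x) \<bullet> h x)"
    and "v \<in> H10 \<Omega> \<Longrightarrow> (LINT x|M. (Astar x *v wgrad \<Omega> w x) \<bullet> wgrad \<Omega> v x) = E g v"
proof -
  have "weakly_in_L2 \<Omega> (\<lambda>k x. (a (r k) x *\<^sub>R mat 1) *v wgrad \<Omega> (T (r k) g) x) (\<lambda>x. Astar x *v wgrad \<Omega> w x)"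
    using H T_test_sequence[OF g w] r unfolding H_converges_def by blast
  then show sq: "(\<lambda>x. Astar x *v wgrad \<Omega> w x) \<in> sq_int M"
    and lim: "h \<in> sq_int M \<Longrightarrow> (\<lambda>k. LINT x|M. (a (r k) x *\<^sub>R wgrad \<Omega> (T (r k) g) x) \<bullet> h x)
        \<longlonglongrightarrow> (LINT x|M. (Astar x *v wgrad \<Omega> w x) \<bullet> h x)" for h
    by (auto simp: weakly_in_L2_def L2_eq_sq_int scaleR_mat_1_mult_vec)
  show "(LINT x|M. (Astar x *v wgrad \<Omega> w x) \<bullet> wgrad \<Omega> v x) = E g v" if v: "v \<in> H10 \<Omega>"
  proof -
    have "(LINT x|M. (a (r k) x *\<^sub>R wgrad \<Omega> (T (r k) g) x) \<bullet> wgrad \<Omega> v x) = E g v" for k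
      using T(2)[OF g v, of "r k"] by (simp add: dirichlet_def)
    with lim[OF H10_sq_int(2)[OF v]] show ?thesis by (simp add: LIMSEQ_const_iff)
  qed
qed

text \<open>Both limit fluxes have the same divergence, represented by \<open>g\<close>. Ellipticity
  of \<open>Astar\<close> is not at hand to compare \<open>w\<close> and \<open>w'\<close>. Instead
  their difference \<open>z\<close> is itself a weak limit of solutions with some right-hand side
  \<open>h\<close>; the flux identity for \<open>z\<close> forces \<open>h\<close>, and with it
  \<open>z\<close>, to have gradient norm zero.\<close>

lemma T_limit_unique:
  assumes g: "g \<in> H10 \<Omega>"
    and r: "strict_mono r" "weakly_H10 (\<lambda>k. T (r k) g) w"
    and r': "strict_mono r'" "weakly_H10 (\<lambda>k. T (r' k) g) w'"
    and v: "v \<in> H10 \<Omega>"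
  shows "E w v = E w' v"
proof -
  have wH: "w \<in> H10 \<Omega>" "w' \<in> H10 \<Omega>" using r r' by (auto simp: weakly_H10_def)
  define z where "z = (\<lambda>x. w x - w' x)"
  have z: "z \<in> H10 \<Omega>" unfolding z_def by (intro H10_diff wH)
  obtain h s where h: "h \<in> H10 \<Omega>" "strict_mono s" "weakly_H10 (\<lambda>k. T (s k) h) z"
    using exists_corrector_subsequence[OF z] by blast
  have "E h v = 0" if v: "v \<in> H10 \<Omega>" for v
  proof -
    note sq = T_flux(1)[OF g r] T_flux(1)[OF g r'] T_flux(1)[OF h]
    note vs = H10_sq_int(2)[OF v]
    have "E h v = (LINT x|M. (Astar x *v wgrad \<Omega> z x) \<bullet> wgrad \<Omega> v x)"
      using T_flux(3)[OF h v] by simp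
    also have "\<dots> = (LINT x|M. (Astar x *v wgrad \<Omega> w x) \<bullet> wgrad \<Omega> v x - (Astar x *v wgrad \<Omega> w' x) \<bullet> wgrad \<Omega> v x)"
    proof (rule integral_cong_AE)
      show "AE x in M. (Astar x *v wgrad \<Omega> z x) \<bullet> wgrad \<Omega> v x
          = (Astar x *v wgrad \<Omega> w x) \<bullet> wgrad \<Omega> v x - (Astar x *v wgrad \<Omega> w' x) \<bullet> wgrad \<Omega> v x"
        using wgrad_diff[OF wH] unfolding z_def
        by eventually_elim (simp add: matrix_vector_mult_diff_distrib inner_diff_left)
    qed (use borel_measurable_integrable[OF sq_int_inner_integrable[OF sq(1) vs]]
        borel_measurable_integrable[OF sq_int_inner_integrable[OF sq(2) vs]]
        borel_measurable_integrable[OF sq_int_inner_integrable[OF sq(3) vs]] in measurable)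
    also have "\<dots> = 0"
      using T_flux(3)[OF g r v] T_flux(3)[OF g r' v]
        sq_int_inner_integrable[OF sq(1) vs] sq_int_inner_integrable[OF sq(2) vs] by simp
    finally show ?thesis .
  qed
  then have "E h h = 0" using h(1) by simp
  then have "l2 M (wgrad \<Omega> h) = 0" by (simp add: E_self)
  then have "H10.nrm (T k h) = 0" for k
    using T_bound[OF h(1), of k] l2_nonneg[of M "wgrad \<Omega> (T k h)"] by (simp add: H10_nrm)
  then have T0: "E (T k h) v = 0" for k by (rule H10.ip_zero_of_nrm_zero[OF T(1)[OF h(1)] v])
  have "(\<lambda>k. E (T (s k) h) v) \<longlonglongrightarrow> E z v" using h(3) v by (simp add: weakly_H10_def)
  then have "E z v = 0" unfolding T0 by (simp add: LIMSEQ_const_iff)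
  then show ?thesis unfolding z_def by (simp add: H10.ip_diff_left wH v)
qed

text \<open>Every subsequence has a weakly convergent further subsequence, and by uniqueness its
  limit has the same pairings as \<open>w\<close>. Convergence of the full sequence matters because
  relative convergence only speaks of test sequences for all of \<open>A\<close>.\<close>

theorem exists_corrector:
  assumes w: "w \<in> H10 \<Omega>"
  obtains g where "g \<in> H10 \<Omega>" "weakly_H10 (\<lambda>k. T k g) w"
proof -
  obtain g r where g: "g \<in> H10 \<Omega>" and r: "strict_mono r" "weakly_H10 (\<lambda>k. T (r k) g) w"
    using exists_corrector_subsequence[OF w] by blast
  have "(\<lambda>k. E (T k g) v) \<longlonglongrightarrow> E w v" if v: "v \<in> H10 \<Omega>" for v
  proof (rule ccontr)
    assume "\<not> ?thesis"
    then obtain e and s :: "nat \<Rightarrow> nat" where e: "e > 0" "strict_mono s" "\<And>k. e \<le> \<bar>E (T (s k) g) v - E w v\<bar>"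
      by (rule not_tendsto_subsequence) blast
    obtain t :: "nat \<Rightarrow> nat" and w' where t: "strict_mono t" "w' \<in> H10 \<Omega>"
      "\<forall>v\<in>H10 \<Omega>. (\<lambda>k. E (T (s (t k)) g) v) \<longlonglongrightarrow> E w' v"
      by (rule H10.bounded_weakly_convergent_subsequence[of "\<lambda>k. T (s k) g" "1 / a1 * l2 M (wgrad \<Omega> g)"])
        (use T(1)[OF g] T_bound[OF g] in \<open>auto simp: H10_nrm\<close>)
    have "weakly_H10 (\<lambda>k. T (s (t k)) g) w'"
      unfolding weakly_H10_def using t T(1)[OF g] T_bound[OF g] by blast
    then have "E w v = E w' v"
      using T_limit_unique[OF g r strict_mono_compose[OF e(2) t(1)] _ v] by (simp add: o_def)
    then have "(\<lambda>k. E (T (s (t k)) g) v - E w v) \<longlonglongrightarrow> 0" using t(3) v by (simp add: LIM_zero)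
    from LIMSEQ_D[OF this e(1)] obtain N where "\<bar>E (T (s (t N)) g) v - E w v\<bar> < e" by auto
    with e(3)[of "t N"] show False by simp
  qed
  then have "weakly_H10 (\<lambda>k. T k g) w"
    unfolding weakly_H10_def using w T(1)[OF g] T_bound[OF g] by blast
  with g show ?thesis by (rule that)
qed

end

section \<open>Div-curl convergence and pointwise bounds\<close>

lemma bounded_mult_integrable:
  fixes q h :: "'a \<Rightarrow> real"
  assumes "integrable N h" "q \<in> borel_measurable N" "AE x in N. \<bar>q x\<bar> \<le> C"
  shows "integrable N (\<lambda>x. q x * h x)"
proof (rule Bochner_Integration.integrable_bound)
  show "integrable N (\<lambda>x. C * h x)" using assms(1) by simp
  show "AE x in N. norm (q x * h x) \<le> norm (C * h x)"
    using assms(3) by eventually_elim (auto simp: abs_mult intro!: mult_right_mono)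
qed (use assms(1,2) in measurable)

lemma bounded_inner_integrable:
  assumes "q \<in> borel_measurable N" "AE x in N. \<bar>q x\<bar> \<le> C" "f \<in> sq_int N" "h \<in> sq_int N"
  shows "integrable N (\<lambda>x. q x * (f x \<bullet> h x))"
  using sq_int_inner_integrable[OF sq_int_bounded_scaleR[OF assms(3,1,2)] assms(4)] by simp

text \<open>By continuity the inequality is needed only on a countable dense set of parameters,
  where the null sets can be united.\<close>

lemma AE_nonneg_all:
  fixes f :: "'a \<Rightarrow> 'b::second_countable_topology \<Rightarrow> real"
  assumes cont: "\<And>x. continuous_on UNIV (f x)" and nonneg: "\<And>t. AE x in N. 0 \<le> f x t"
  shows "AE x in N. \<forall>t. 0 \<le> f x t"
proof -
  obtain D :: "'b set" where D: "countable D" "\<And>X. open X \<Longrightarrow> X \<noteq> {} \<Longrightarrow> \<exists>d\<in>D. d \<in> X"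
    using countable_dense_exists by blast
  have "closure D = UNIV"
    using D(2)[of "- closure D"] closure_subset[of D] by (auto simp: open_Compl)
  have "AE x in N. \<forall>t\<in>D. 0 \<le> f x t"
    using nonneg D(1) by (subst AE_ball_countable) auto
  then show ?thesis
  proof eventually_elim
    fix x assume *: "\<forall>t\<in>D. 0 \<le> f x t"
    have "0 \<le> f x t" for t
      by (rule continuous_ge_on_closure[of D "f x"]) (use cont \<open>closure D = UNIV\<close> * in auto)
    then show "\<forall>t. 0 \<le> f x t" by simp
  qed
qed

lemma continuous_on_matrix_vector_mult [continuous_intros]:
  fixes A :: "real^'n^'m"
  shows "continuous_on S f \<Longrightarrow> continuous_on S (\<lambda>t. A *v f t)"
  by (rule bounded_linear.continuous_on[OF matrix_vector_mul_bounded_linear])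

context domain
begin

lemma test_function_measurable: "\<phi> \<in> test_functions \<Omega>' \<Longrightarrow> \<phi> \<in> borel_measurable M"
  by (intro borel_imp_lebesgue_on smooth_borel test_function_smooth)

lemma test_function_grad_measurable: "\<phi> \<in> test_functions \<Omega>' \<Longrightarrow> grad \<phi> \<in> borel_measurable M"
  by (intro borel_imp_lebesgue_on grad_borel test_function_smooth)

lemma sq_int_test_scaleR: "\<phi> \<in> test_functions \<Omega>' \<Longrightarrow> f \<in> sq_int M \<Longrightarrow> (\<lambda>x. \<phi> x *\<^sub>R f x) \<in> sq_int M"
  by (rule test_function_bounded, assumption)
    (rule sq_int_bounded_scaleR, auto intro: test_function_measurable)

lemma sq_int_scaleR_grad: "\<phi> \<in> test_functions \<Omega>' \<Longrightarrow> f \<in> sq_int M \<Longrightarrow> (\<lambda>x. f x *\<^sub>R grad \<phi> x) \<in> sq_int M"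
  by (rule test_function_grad_bounded, assumption)
    (rule sq_int_scaleR_bounded, auto intro: test_function_grad_measurable)

lemma sq_int_inner_grad:
  assumes \<phi>: "\<phi> \<in> test_functions \<Omega>'" and f: "f \<in> sq_int M"
  shows "(\<lambda>x. f x \<bullet> grad \<phi> x) \<in> sq_int M"
proof -
  obtain D where D: "0 \<le> D" "\<And>x. norm (grad \<phi> x) \<le> D" using test_function_grad_bounded[OF \<phi>] by auto
  show ?thesis
  proof (rule sq_int_dominated[OF f, of _ D])
    show "(\<lambda>x. f x \<bullet> grad \<phi> x) \<in> borel_measurable M"
      using sq_int_measurable[OF f] test_function_grad_measurable[OF \<phi>] by measurable
    show "AE x in M. norm (f x \<bullet> grad \<phi> x) \<le> D * norm (f x)"
    proof (rule AE_I2)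
      fix x show "norm (f x \<bullet> grad \<phi> x) \<le> D * norm (f x)"
        using Cauchy_Schwarz_ineq2[of "f x" "grad \<phi> x"] mult_left_mono[OF D(2)[of x], of "norm (f x)"]
        by (simp add: mult.commute)
    qed
  qed
qed

text \<open>A linear function times a cut-off function. The radius is chosen before
  \<open>\<xi>\<close>, so one ball serves all gradients; on it the cut-off function is 1 and its
  gradient vanishes.\<close>

lemma local_affine_functions:
  assumes "x0 \<in> \<Omega>"
  shows "\<exists>r>0. ball x0 r \<subseteq> \<Omega> \<and> (\<forall>\<xi>. \<exists>w\<in>test_functions \<Omega>. \<forall>x\<in>ball x0 r. grad w x = \<xi>)"
proof -
  obtain r where r: "r > 0" "cutoff x0 r \<in> test_functions \<Omega>" "ball x0 r \<subseteq> \<Omega>"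
    "\<forall>y\<in>ball x0 r. cutoff x0 r y = 1"
    using exists_local_cutoff[OF open_domain assms] by metis
  have "\<exists>w\<in>test_functions \<Omega>. \<forall>x\<in>ball x0 r. grad w x = \<xi>" for \<xi> :: "real^'n"
  proof (intro bexI ballI)
    have sm: "smooth (\<lambda>x. \<xi> \<bullet> x)" by (rule smooth_bounded_linear[OF bounded_linear_inner_right])
    show "(\<lambda>x. cutoff x0 r x * (\<xi> \<bullet> x)) \<in> test_functions \<Omega>"
      by (rule test_function_mult_smooth[OF r(2) sm])
    fix x assume x: "x \<in> ball x0 r"
    have "grad (\<lambda>y. cutoff x0 r y - 1) x = 0"
      by (rule grad_outside[of "- ball x0 r"]) (use r(4) x in auto)
    then have "grad (cutoff x0 r) x = 0" by (simp add: grad_diff smooth_cutoff)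
    then show "grad (\<lambda>x. cutoff x0 r x * (\<xi> \<bullet> x)) x = \<xi>"
      using r(4) x by (simp add: grad_mult[OF smooth_cutoff sm] grad_inner)
  qed
  with r(1,3) show ?thesis by auto
qed

end

section \<open>Div-curl lemma and bounds on the limit flux\<close>

context h_convergent
begin

lemma flux_sq_int: "f \<in> sq_int M \<Longrightarrow> (\<lambda>x. a k x *\<^sub>R f x) \<in> sq_int M"
  by (rule sq_int_bounded_scaleR[OF _ a_measurable, where C = a2]) (auto simp: a_abs)

lemma flux_l2_bound: "f \<in> sq_int M \<Longrightarrow> l2 M (\<lambda>x. a k x *\<^sub>R f x) \<le> a2 * l2 M f"
  by (rule l2_mono[OF _ sq_int_measurable[OF flux_sq_int]])
    (use a2_pos in \<open>auto simp: a_abs intro!: AE_I2 mult_right_mono\<close>)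

lemmas T_flux_id = T_flux[OF _ strict_mono_id, unfolded id_apply]

text \<open>The flux of \<open>T k g\<close> and the limit flux have the same divergence. Testing
  both with \<open>\<phi> * v k\<close> expresses the product of two weakly convergent sequences by
  terms linear in \<open>v k\<close> and its gradient and by one remaining product, which pairs the
  flux with \<open>v k *\<^sub>R grad \<phi>\<close> and is settled by Rellich's theorem.\<close>

theorem div_curl:
  assumes g: "g \<in> H10 \<Omega>" and w: "weakly_H10 (\<lambda>k. T k g) w" and v: "weakly_H10 v w'"
    and \<phi>: "\<phi> \<in> test_functions \<Omega>"
  shows "(\<lambda>k. LINT x|M. \<phi> x * (a k x * (wgrad \<Omega> (T k g) x \<bullet> wgrad \<Omega> (v k) x)))
    \<longlonglongrightarrow> (LINT x|M. \<phi> x * ((Astar x *v wgrad \<Omega> w x) \<bullet> wgrad \<Omega> w' x))"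
proof -
  define s where "s x = Astar x *v wgrad \<Omega> w x" for x
  note flux = T_flux_id[OF g w, folded s_def]
  have vH: "\<And>k. v k \<in> H10 \<Omega>" "w' \<in> H10 \<Omega>" using v by (auto simp: weakly_H10_def)
  let ?du = "\<lambda>k. wgrad \<Omega> (T k g)" and ?dv = "\<lambda>k. wgrad \<Omega> (v k)"
  note du = H10_sq_int(2)[OF T(1)[OF g]] and dv = H10_sq_int(2)[OF vH(1)] and dw = H10_sq_int(2)[OF vH(2)]
  note vs = H10_sq_int(1)[OF vH(1)] and ws = H10_sq_int(1)[OF vH(2)]
  note adu = flux_sq_int[OF du]
  have key: "(LINT x|M. \<phi> x * (a k x * (?du k x \<bullet> ?dv k x)))
      = (LINT x|M. (\<phi> x *\<^sub>R s x) \<bullet> ?dv k x) + (LINT x|M. (s x \<bullet> grad \<phi> x) * v k x)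
        - (LINT x|M. (v k x *\<^sub>R grad \<phi> x) \<bullet> (a k x *\<^sub>R ?du k x))" for k
  proof -
    let ?z = "\<lambda>x. \<phi> x * v k x"
    have z: "?z \<in> H10 \<Omega>" by (rule H10_test_mult[OF vH(1) \<phi>])
    have i1: "integrable M (\<lambda>x. (a k x *\<^sub>R ?du k x) \<bullet> (\<phi> x *\<^sub>R ?dv k x))"
      by (intro sq_int_inner_integrable adu sq_int_test_scaleR[OF \<phi>] dv)
    have i2: "integrable M (\<lambda>x. (a k x *\<^sub>R ?du k x) \<bullet> (v k x *\<^sub>R grad \<phi> x))"
      by (intro sq_int_inner_integrable adu sq_int_scaleR_grad[OF \<phi>] vs)
    have i3: "integrable M (\<lambda>x. s x \<bullet> (\<phi> x *\<^sub>R ?dv k x))"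
      by (intro sq_int_inner_integrable flux(1) sq_int_test_scaleR[OF \<phi>] dv)
    have i4: "integrable M (\<lambda>x. s x \<bullet> (v k x *\<^sub>R grad \<phi> x))"
      by (intro sq_int_inner_integrable flux(1) sq_int_scaleR_grad[OF \<phi>] vs)
    have "(LINT x|M. (a k x *\<^sub>R ?du k x) \<bullet> (\<phi> x *\<^sub>R ?dv k x + v k x *\<^sub>R grad \<phi> x))
        = (LINT x|M. (a k x *\<^sub>R ?du k x) \<bullet> wgrad \<Omega> ?z x)"
    proof (rule integral_cong_AE)
      show "AE x in M. (a k x *\<^sub>R ?du k x) \<bullet> (\<phi> x *\<^sub>R ?dv k x + v k x *\<^sub>R grad \<phi> x)
          = (a k x *\<^sub>R ?du k x) \<bullet> wgrad \<Omega> ?z x"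
        using wgrad_test_mult[OF vH(1) \<phi>, of k] by eventually_elim simp
      show "(\<lambda>x. (a k x *\<^sub>R ?du k x) \<bullet> wgrad \<Omega> ?z x) \<in> borel_measurable M"
        using sq_int_inner_integrable[OF adu H10_sq_int(2)[OF z]] by (rule borel_measurable_integrable)
      show "(\<lambda>x. (a k x *\<^sub>R ?du k x) \<bullet> (\<phi> x *\<^sub>R ?dv k x + v k x *\<^sub>R grad \<phi> x)) \<in> borel_measurable M"
        using Bochner_Integration.integrable_add[OF i1 i2, THEN borel_measurable_integrable]
        by (simp only: inner_add_right)
    qed
    also have "\<dots> = (LINT x|M. s x \<bullet> wgrad \<Omega> ?z x)"
      using T(2)[OF g z, of k] flux(3)[OF z] by (simp add: dirichlet_def)
    also have "\<dots> = (LINT x|M. s x \<bullet> (\<phi> x *\<^sub>R ?dv k x + v k x *\<^sub>R grad \<phi> x))"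
    proof (rule integral_cong_AE)
      show "AE x in M. s x \<bullet> wgrad \<Omega> ?z x = s x \<bullet> (\<phi> x *\<^sub>R ?dv k x + v k x *\<^sub>R grad \<phi> x)"
        using wgrad_test_mult[OF vH(1) \<phi>, of k] by eventually_elim simp
      show "(\<lambda>x. s x \<bullet> wgrad \<Omega> ?z x) \<in> borel_measurable M"
        using sq_int_inner_integrable[OF flux(1) H10_sq_int(2)[OF z]] by (rule borel_measurable_integrable)
      show "(\<lambda>x. s x \<bullet> (\<phi> x *\<^sub>R ?dv k x + v k x *\<^sub>R grad \<phi> x)) \<in> borel_measurable M"
        using Bochner_Integration.integrable_add[OF i3 i4, THEN borel_measurable_integrable]
        by (simp only: inner_add_right)
    qed
    finally have "(LINT x|M. (a k x *\<^sub>R ?du k x) \<bullet> (\<phi> x *\<^sub>R ?dv k x)) + (LINT x|M. (a k x *\<^sub>R ?du k x) \<bullet> (v k x *\<^sub>R grad \<phi> x))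
        = (LINT x|M. s x \<bullet> (\<phi> x *\<^sub>R ?dv k x)) + (LINT x|M. s x \<bullet> (v k x *\<^sub>R grad \<phi> x))"
      by (simp only: inner_add_right Bochner_Integration.integral_add[OF i1 i2] Bochner_Integration.integral_add[OF i3 i4])
    then show ?thesis by (simp add: mult_ac inner_commute)
  qed
  have l1: "(\<lambda>k. LINT x|M. (\<phi> x *\<^sub>R s x) \<bullet> ?dv k x) \<longlonglongrightarrow> (LINT x|M. (\<phi> x *\<^sub>R s x) \<bullet> wgrad \<Omega> w' x)"
    by (rule weakly_H10_gradient_functional[OF v sq_int_test_scaleR[OF \<phi> flux(1)]])
  have l2': "(\<lambda>k. LINT x|M. (s x \<bullet> grad \<phi> x) * v k x) \<longlonglongrightarrow> (LINT x|M. (s x \<bullet> grad \<phi> x) * w' x)"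
    by (rule weakly_H10_sq_int_functional[OF v sq_int_inner_grad[OF \<phi> flux(1)]])
  have l3: "(\<lambda>k. LINT x|M. (v k x *\<^sub>R grad \<phi> x) \<bullet> (a k x *\<^sub>R ?du k x)) \<longlonglongrightarrow> (LINT x|M. (w' x *\<^sub>R grad \<phi> x) \<bullet> s x)"
  proof (rule l2_tendsto_inner[OF sq_int_scaleR_grad[OF \<phi> vs] sq_int_scaleR_grad[OF \<phi> ws] _ adu])
    obtain D where D: "0 \<le> D" "\<And>x. norm (grad \<phi> x) \<le> D" using test_function_grad_bounded[OF \<phi>] by auto
    show "(\<lambda>k. l2 M (\<lambda>x. v k x *\<^sub>R grad \<phi> x - w' x *\<^sub>R grad \<phi> x)) \<longlonglongrightarrow> 0"
    proof (rule tendsto_zero_bound)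
      show "(\<lambda>k. D * l2 M (\<lambda>x. v k x - w' x)) \<longlonglongrightarrow> 0"
        using tendsto_mult_left[OF Rellich[OF v], of D] by simp
      fix k
      have d: "(\<lambda>x. v k x - w' x) \<in> sq_int M" by (intro sq_int_diff vs ws)
      show "l2 M (\<lambda>x. v k x *\<^sub>R grad \<phi> x - w' x *\<^sub>R grad \<phi> x) \<le> D * l2 M (\<lambda>x. v k x - w' x)"
        unfolding scaleR_diff_left[symmetric]
        by (rule l2_mono[OF d sq_int_measurable[OF sq_int_scaleR_grad[OF \<phi> d]] _ D(1)])
          (use D in \<open>auto simp: mult.commute[of D] intro!: AE_I2 mult_left_mono\<close>)
    qed simp
    show "l2 M (\<lambda>x. a k x *\<^sub>R ?du k x) \<le> a2 * (1 / a1 * l2 M (wgrad \<Omega> g))" for k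
      using flux_l2_bound[OF du, of k k] mult_left_mono[OF T_bound[OF g, of k], of a2] a2_pos by linarith
    show "(\<lambda>k. LINT x|M. (w' x *\<^sub>R grad \<phi> x) \<bullet> (a k x *\<^sub>R ?du k x)) \<longlonglongrightarrow> (LINT x|M. (w' x *\<^sub>R grad \<phi> x) \<bullet> s x)"
      using flux(2)[OF sq_int_scaleR_grad[OF \<phi> ws]] by (simp add: inner_commute)
  qed
  have "(\<lambda>k. LINT x|M. \<phi> x * (a k x * (?du k x \<bullet> ?dv k x)))
      \<longlonglongrightarrow> (LINT x|M. (\<phi> x *\<^sub>R s x) \<bullet> wgrad \<Omega> w' x) + (LINT x|M. (s x \<bullet> grad \<phi> x) * w' x)
        - (LINT x|M. (w' x *\<^sub>R grad \<phi> x) \<bullet> s x)"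
    unfolding key by (intro tendsto_diff tendsto_add l1 l2' l3)
  \<comment> \<open>The two terms with \<open>grad \<phi>\<close> cancel in the limit.\<close>
  then show ?thesis by (simp add: s_def inner_commute mult.commute)
qed

text \<open>Each term has its own mode of convergence: the quadratic one by the div-curl lemma, the
  one with \<open>\<eta>\<close> by weak convergence of the flux, the one with \<open>\<tau>\<close>
  by weak convergence of the gradient, and \<open>c\<close> by assumption. Bounds for the limit flux
  follow by expanding suitable squares.\<close>

lemma quadratic_limit_nonneg:
  assumes w: "w \<in> H10 \<Omega>"
    and c: "\<And>k. c k \<in> borel_measurable M" "\<And>k x. \<bar>c k x\<bar> \<le> C" "c0 \<in> borel_measurable M" "AE x in M. \<bar>c0 x\<bar> \<le> C"
    and limit: "\<And>h. integrable M h \<Longrightarrow> (\<lambda>k. LINT x|M. c k x * h x) \<longlonglongrightarrow> (LINT x|M. c0 x * h x)"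
    and nonneg: "\<And>k x \<xi>. 0 \<le> a k x * (\<xi> \<bullet> \<xi>) - 2 * (a k x * (\<xi> \<bullet> \<eta>)) - 2 * (\<xi> \<bullet> \<tau>) + c k x"
  shows "AE x in M. 0 \<le> (Astar x *v wgrad \<Omega> w x) \<bullet> wgrad \<Omega> w x - 2 * ((Astar x *v wgrad \<Omega> w x) \<bullet> \<eta>)
    - 2 * (wgrad \<Omega> w x \<bullet> \<tau>) + c0 x"
proof -
  obtain g where g: "g \<in> H10 \<Omega>" "weakly_H10 (\<lambda>k. T k g) w" by (rule exists_corrector[OF w])
  let ?s = "\<lambda>x. Astar x *v wgrad \<Omega> w x" and ?dw = "wgrad \<Omega> w" and ?du = "\<lambda>k. wgrad \<Omega> (T k g)"
  note flux = T_flux_id[OF g] and du = H10_sq_int(2)[OF T(1)[OF g(1)]] and dw = H10_sq_int(2)[OF w]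
  have [measurable]: "?s \<in> borel_measurable M" "?dw \<in> borel_measurable M" "c0 \<in> borel_measurable M"
    by (rule sq_int_measurable flux dw c)+
  let ?h = "\<lambda>x. ?s x \<bullet> ?dw x - 2 * (?s x \<bullet> \<eta>) - 2 * (?dw x \<bullet> \<tau>) + c0 x"
  show ?thesis
  proof (rule fundamental_lemma_nonneg[OF open_domain])
    show "?h \<in> borel_measurable M" by measurable
  next
    fix \<phi> assume \<phi>: "\<phi> \<in> test_functions \<Omega>"
    have i\<phi>: "integrable M \<phi>"
      using sq_int_inner_integrable[OF test_function_sq_int[OF \<phi> domain_sets] sq_int_const[of "1::real"]] by simp
    have t\<phi>: "(\<lambda>x. \<phi> x *\<^sub>R t) \<in> sq_int M" for t :: "real^'n" by (rule sq_int_test_scaleR[OF \<phi> sq_int_const])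
    \<comment> \<open>One template for the integrands of the sequence and of the limit;
      \<open>\<phi> x *\<^sub>R \<eta>\<close> and \<open>\<phi> x *\<^sub>R \<tau>\<close> are the
      fixed square-integrable functions tested against.\<close>
    let ?j = "\<lambda>s d c x. \<phi> x * (s x \<bullet> d x) - 2 * (s x \<bullet> (\<phi> x *\<^sub>R \<eta>)) - 2 * ((\<phi> x *\<^sub>R \<tau>) \<bullet> d x) + c x * \<phi> x"
    have ji: "integrable M (?j s d c)"
      and je: "(LINT x|M. ?j s d c x) = (LINT x|M. \<phi> x * (s x \<bullet> d x)) - 2 * (LINT x|M. s x \<bullet> (\<phi> x *\<^sub>R \<eta>))
        - 2 * (LINT x|M. (\<phi> x *\<^sub>R \<tau>) \<bullet> d x) + (LINT x|M. c x * \<phi> x)"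
      if "s \<in> sq_int M" "d \<in> sq_int M" "c \<in> borel_measurable M" "AE x in M. \<bar>c x\<bar> \<le> C" for s d c
    proof -
      have i: "integrable M (\<lambda>x. \<phi> x * (s x \<bullet> d x))" "integrable M (\<lambda>x. s x \<bullet> (\<phi> x *\<^sub>R \<eta>))"
        "integrable M (\<lambda>x. (\<phi> x *\<^sub>R \<tau>) \<bullet> d x)" "integrable M (\<lambda>x. c x * \<phi> x)"
        using sq_int_inner_integrable[OF sq_int_test_scaleR[OF \<phi> that(1)] that(2)]
          sq_int_inner_integrable[OF that(1) t\<phi>] sq_int_inner_integrable[OF t\<phi> that(2)] bounded_mult_integrable[OF i\<phi> that(3,4)]
        by simp_all
      then show "integrable M (?j s d c)"
        by (intro Bochner_Integration.integrable_add Bochner_Integration.integrable_diff integrable_mult_right)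
      show "(LINT x|M. ?j s d c x) = (LINT x|M. \<phi> x * (s x \<bullet> d x)) - 2 * (LINT x|M. s x \<bullet> (\<phi> x *\<^sub>R \<eta>))
        - 2 * (LINT x|M. (\<phi> x *\<^sub>R \<tau>) \<bullet> d x) + (LINT x|M. c x * \<phi> x)"
        using i by (simp only: Bochner_Integration.integral_add Bochner_Integration.integral_diff integrable_mult_right
            Bochner_Integration.integrable_diff integral_mult_right_zero)
    qed
    have he: "?h x * \<phi> x = ?j ?s ?dw c0 x" for x by (simp add: inner_commute algebra_simps)
    show "integrable M (\<lambda>x. ?h x * \<phi> x)" unfolding he by (rule ji[OF flux(1) dw c(3,4)])
    assume \<phi>0: "\<And>x. 0 \<le> \<phi> x"
    have jk: "0 \<le> (LINT x|M. ?j (\<lambda>x. a k x *\<^sub>R ?du k x) (?du k) (c k) x)" for k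
    proof (rule Bochner_Integration.integral_nonneg)
      fix x
      have "0 \<le> \<phi> x * (a k x * (?du k x \<bullet> ?du k x) - 2 * (a k x * (?du k x \<bullet> \<eta>)) - 2 * (?du k x \<bullet> \<tau>) + c k x)"
        by (intro mult_nonneg_nonneg \<phi>0 nonneg)
      then show "0 \<le> ?j (\<lambda>x. a k x *\<^sub>R ?du k x) (?du k) (c k) x" by (simp add: inner_commute algebra_simps)
    qed
    have "(\<lambda>k. (LINT x|M. ?j (\<lambda>x. a k x *\<^sub>R ?du k x) (?du k) (c k) x)) \<longlonglongrightarrow> (LINT x|M. ?j ?s ?dw c0 x)"
      unfolding je[OF flux(1) dw c(3,4)] je[OF flux_sq_int[OF du] du c(1) AE_I2[OF c(2)]]
      using div_curl[OF g g(2) \<phi>]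
      by (intro tendsto_add tendsto_diff tendsto_mult_left flux(2) t\<phi> limit i\<phi> weakly_H10_gradient_functional[OF g(2) t\<phi>]) simp
    then show "0 \<le> (LINT x|M. ?h x * \<phi> x)" unfolding he using jk by (intro LIMSEQ_le_const) auto
  qed
qed

text \<open>Limit of the nonnegative expression \<open>a k x * \<bar>\<xi> - t\<bar>\<^sup>2 + (a2 -
  a k x) * \<bar>t\<bar>\<^sup>2\<close>, followed by the optimal \<open>t\<close>, which is the
  limit flux divided by \<open>a2\<close>. As this depends on \<open>x\<close>, the quantifier over
  \<open>t\<close> has to be moved inside first.\<close>

lemma flux_bound:
  assumes w: "w \<in> H10 \<Omega>"
  shows "AE x in M. norm (Astar x *v wgrad \<Omega> w x) \<le> a2 * norm (wgrad \<Omega> w x)"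
proof -
  let ?s = "\<lambda>x. Astar x *v wgrad \<Omega> w x"
  have "AE x in M. \<forall>t. 0 \<le> ?s x \<bullet> wgrad \<Omega> w x - 2 * (?s x \<bullet> t) - 2 * (wgrad \<Omega> w x \<bullet> 0) + a2 * (t \<bullet> t)"
  proof (rule AE_nonneg_all)
    fix t :: "real^'n"
    show "AE x in M. 0 \<le> ?s x \<bullet> wgrad \<Omega> w x - 2 * (?s x \<bullet> t) - 2 * (wgrad \<Omega> w x \<bullet> 0) + a2 * (t \<bullet> t)"
    proof (rule quadratic_limit_nonneg[OF w])
      fix k x and \<xi> :: "real^'n"
      have "0 \<le> a k x * ((\<xi> - t) \<bullet> (\<xi> - t)) + (a2 - a k x) * (t \<bullet> t)"
        using a_bounds[of k x] a1_pos by (intro add_nonneg_nonneg mult_nonneg_nonneg) auto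
      then show "0 \<le> a k x * (\<xi> \<bullet> \<xi>) - 2 * (a k x * (\<xi> \<bullet> t)) - 2 * (\<xi> \<bullet> 0) + a2 * (t \<bullet> t)"
        by (simp add: inner_diff inner_commute algebra_simps)
    qed auto
  qed (intro continuous_intros)
  then show ?thesis
  proof eventually_elim
    fix x assume "\<forall>t. 0 \<le> ?s x \<bullet> wgrad \<Omega> w x - 2 * (?s x \<bullet> t) - 2 * (wgrad \<Omega> w x \<bullet> 0) + a2 * (t \<bullet> t)"
    from this[rule_format, of "(1 / a2) *\<^sub>R ?s x"] have "norm (?s x) * norm (?s x) / a2 \<le> ?s x \<bullet> wgrad \<Omega> w x"
      using a2_pos by (simp add: power2_norm_eq_inner[symmetric] power2_eq_square)
    also have "\<dots> \<le> norm (?s x) * norm (wgrad \<Omega> w x)" by (rule norm_cauchy_schwarz)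
    finally have "norm (?s x) * norm (?s x) \<le> norm (?s x) * (a2 * norm (wgrad \<Omega> w x))"
      using a2_pos by (simp add: field_simps)
    then show "norm (?s x) \<le> a2 * norm (wgrad \<Omega> w x)"
      using a2_pos by (cases "norm (?s x) = 0") (auto simp: mult_le_cancel_left)
  qed
qed

text \<open>The expression under the limit is symmetric in the two correctors, so the div-curl lemma
  in both orders identifies the limits.\<close>

lemma flux_symmetric:
  assumes w: "w \<in> H10 \<Omega>" and w': "w' \<in> H10 \<Omega>"
  shows "AE x in M. (Astar x *v wgrad \<Omega> w x) \<bullet> wgrad \<Omega> w' x = (Astar x *v wgrad \<Omega> w' x) \<bullet> wgrad \<Omega> w x"
proof -
  obtain g where g: "g \<in> H10 \<Omega>" "weakly_H10 (\<lambda>k. T k g) w" by (rule exists_corrector[OF w])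
  obtain g' where g': "g' \<in> H10 \<Omega>" "weakly_H10 (\<lambda>k. T k g') w'" by (rule exists_corrector[OF w'])
  note f = T_flux_id(1)[OF g] and f' = T_flux_id(1)[OF g'] and d = H10_sq_int(2)[OF w] and d' = H10_sq_int(2)[OF w']
  have "AE x in M. (Astar x *v wgrad \<Omega> w x) \<bullet> wgrad \<Omega> w' x - (Astar x *v wgrad \<Omega> w' x) \<bullet> wgrad \<Omega> w x = 0"
  proof (rule fundamental_lemma[OF open_domain])
    show "(\<lambda>x. (Astar x *v wgrad \<Omega> w x) \<bullet> wgrad \<Omega> w' x - (Astar x *v wgrad \<Omega> w' x) \<bullet> wgrad \<Omega> w x) \<in> borel_measurable M"
      using sq_int_inner_integrable[OF f d'] sq_int_inner_integrable[OF f' d]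
      by (intro borel_measurable_diff borel_measurable_integrable)
    fix \<phi> assume \<phi>: "\<phi> \<in> test_functions \<Omega>"
    have i: "integrable M (\<lambda>x. \<phi> x * ((Astar x *v wgrad \<Omega> w x) \<bullet> wgrad \<Omega> w' x))"
      "integrable M (\<lambda>x. \<phi> x * ((Astar x *v wgrad \<Omega> w' x) \<bullet> wgrad \<Omega> w x))"
      using sq_int_inner_integrable[OF sq_int_test_scaleR[OF \<phi> f] d'] sq_int_inner_integrable[OF sq_int_test_scaleR[OF \<phi> f'] d] by auto
    show "integrable M (\<lambda>x. ((Astar x *v wgrad \<Omega> w x) \<bullet> wgrad \<Omega> w' x - (Astar x *v wgrad \<Omega> w' x) \<bullet> wgrad \<Omega> w x) * \<phi> x)"
      using Bochner_Integration.integrable_diff[OF i] by (simp add: algebra_simps)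
    have "(\<lambda>k. LINT x|M. \<phi> x * (a k x * (wgrad \<Omega> (T k g) x \<bullet> wgrad \<Omega> (T k g') x)))
        \<longlonglongrightarrow> (LINT x|M. \<phi> x * ((Astar x *v wgrad \<Omega> w' x) \<bullet> wgrad \<Omega> w x))"
      using div_curl[OF g' g(2) \<phi>] by (simp add: inner_commute)
    with div_curl[OF g g'(2) \<phi>] have "(LINT x|M. \<phi> x * ((Astar x *v wgrad \<Omega> w x) \<bullet> wgrad \<Omega> w' x))
        = (LINT x|M. \<phi> x * ((Astar x *v wgrad \<Omega> w' x) \<bullet> wgrad \<Omega> w x))" by (rule LIMSEQ_unique)
    then show "(LINT x|M. ((Astar x *v wgrad \<Omega> w x) \<bullet> wgrad \<Omega> w' x - (Astar x *v wgrad \<Omega> w' x) \<bullet> wgrad \<Omega> w x) * \<phi> x) = 0"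
      using i by (simp add: algebra_simps)
  qed
  then show ?thesis by eventually_elim simp
qed

end

section \<open>Equi-integrability from a reverse Hoelder inequality\<close>

text \<open>Stopping balls of a level-set decomposition, selected by Vitali's covering lemma, bound the
  mass of \<open>f\<close> above a level by the mass of \<open>sqrt f\<close> above a comparable level. Summing this over
  geometrically growing levels already gives an \<open>L log L\<close> bound; the absorption argument of
  Gehring's lemma is not needed.\<close>

locale integrable_density =
  fixes f :: "real^'n::finite \<Rightarrow> real"
  assumes f_meas [measurable]: "f \<in> borel_measurable lebesgue" and f_nonneg: "\<And>x. 0 \<le> f x"
    and f_finite: "(\<integral>\<^sup>+x. ennreal (f x) \<partial>lebesgue) < top"
begin

definition mass :: "(real^'n) set \<Rightarrow> ennreal" where
  "mass S = (\<integral>\<^sup>+x\<in>S. ennreal (f x) \<partial>lebesgue)"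

lemma mass_emeasure: "S \<in> sets lebesgue \<Longrightarrow> mass S = emeasure (density lebesgue (\<lambda>x. ennreal (f x))) S"
  by (simp add: mass_def emeasure_density)

lemma mass_mono: "S \<subseteq> T \<Longrightarrow> mass S \<le> mass T"
  unfolding mass_def by (intro nn_integral_mono) (auto simp: indicator_def)

lemma mass_finite: "mass S < top"
  using mass_mono[of S UNIV] f_finite by (auto simp: mass_def)

lemma mass_null: "S \<in> null_sets lebesgue \<Longrightarrow> mass S = 0"
  unfolding mass_def by (rule nn_integral_null_set)

lemma mass_Un_le: "S \<in> sets lebesgue \<Longrightarrow> T \<in> sets lebesgue \<Longrightarrow> mass (S \<union> T) \<le> mass S + mass T"
  by (simp add: mass_emeasure emeasure_subadditive)

text \<open>A slightly smaller concentric ball still has mass above \<open>c\<close>, and it is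
  contained in the balls of radius \<open>r\<close> around all nearby centres. This gives
  measurability of the exceptional set in the differentiation argument.\<close>

lemma open_mass_ball_gt: "open {x. c < mass (ball x r)}"
proof (subst open_subopen, intro ballI)
  fix x assume "x \<in> {x. c < mass (ball x r)}"
  then have x: "c < mass (ball x r)" by simp
  let ?B = "\<lambda>n. ball x (r - inverse (real (Suc n)))"
  have "(\<lambda>n. emeasure (density lebesgue (\<lambda>x. ennreal (f x))) (?B n))
      \<longlonglongrightarrow> emeasure (density lebesgue (\<lambda>x. ennreal (f x))) (\<Union>n. ?B n)"
  proof (rule Lim_emeasure_incseq)
    have "inverse (real (Suc n)) \<le> inverse (real (Suc m))" if "m \<le> n" for m n
      using that by (simp add: field_simps)
    then show "incseq ?B" unfolding incseq_def by (intro allI impI subset_ball) simp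
  qed auto
  moreover have "(\<Union>n. ?B n) = ball x r"
  proof (intro equalityI subsetI)
    fix y assume "y \<in> ball x r"
    then have "0 < r - dist x y" by simp
    then obtain n where "inverse (real (Suc n)) < r - dist x y" using reals_Archimedean by blast
    then show "y \<in> (\<Union>n. ?B n)" by (auto intro!: exI[of _ n])
  next
    fix y assume "y \<in> (\<Union>n. ?B n)"
    then obtain n where "dist x y < r - inverse (real (Suc n))" by auto
    moreover have "0 < inverse (real (Suc n))" by simp
    ultimately show "y \<in> ball x r" unfolding mem_ball by linarith
  qed
  ultimately have "(\<lambda>n. mass (?B n)) \<longlonglongrightarrow> mass (ball x r)" by (simp add: mass_emeasure)
  then obtain n where n: "c < mass (?B n)"
    using x order_tendstoD(1) by (fastforce simp: eventually_sequentially)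
  show "\<exists>T. open T \<and> x \<in> T \<and> T \<subseteq> {x. c < mass (ball x r)}"
  proof (intro exI[of _ "ball x (inverse (real (Suc n)))"] conjI subsetI CollectI)
    show "x \<in> ball x (inverse (real (Suc n)))" by simp
    fix y assume "y \<in> ball x (inverse (real (Suc n)))"
    then have y: "dist x y < inverse (real (Suc n))" by simp
    have "?B n \<subseteq> ball y r"
    proof
      fix z assume "z \<in> ?B n"
      then show "z \<in> ball y r" using y dist_triangle3[of y z x] by simp
    qed
    then show "c < mass (ball y r)" using n mass_mono less_le_trans by blast
  qed simp
qed

lemma emeasure_ball_ennreal: "emeasure lebesgue (ball x r) = ennreal (measure lborel (ball x r))"
  using emeasure_lborel_ball_finite[of x r] by (simp add: emeasure_eq_ennreal_measure)

text \<open>Indexing a countable family by \<open>nat\<close> for the countable (sub)additivity lemmas.\<close>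

lemma countable_mass_le:
  fixes A B :: "'i \<Rightarrow> (real^'n) set"
  assumes C: "countable C" and A: "\<And>x. x \<in> C \<Longrightarrow> A x \<in> sets lebesgue" and B: "\<And>x. x \<in> C \<Longrightarrow> B x \<in> sets lebesgue"
    and disj: "disjoint_family_on B C" and h: "h \<in> borel_measurable lebesgue"
    and le: "\<And>x. x \<in> C \<Longrightarrow> mass (A x) \<le> (\<integral>\<^sup>+y\<in>B x. h y \<partial>lebesgue)"
  shows "mass (\<Union>x\<in>C. A x) \<le> (\<integral>\<^sup>+y\<in>(\<Union>x\<in>C. B x). h y \<partial>lebesgue)"
proof -
  define F where "F G n = (\<Union>x\<in>{x\<in>C. to_nat_on C x = n}. G x)" for G :: "_ \<Rightarrow> (real^'n) set" and n
  have F_cases: "F G n = {} \<and> F G' n = {} \<or> (\<exists>x\<in>C. F G n = G x \<and> F G' n = G' x)" for G G' n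
  proof (cases "\<exists>x\<in>C. to_nat_on C x = n")
    case True
    then obtain x where x: "x \<in> C" "to_nat_on C x = n" by auto
    then have "{x\<in>C. to_nat_on C x = n} = {x}" using inj_on_to_nat_on[OF C] by (auto simp: inj_on_def)
    then show ?thesis using x by (auto simp: F_def)
  qed (auto simp: F_def)
  have FU: "(\<Union>n. F G n) = (\<Union>x\<in>C. G x)" for G by (auto simp: F_def)
  have FA: "F A n \<in> sets lebesgue" "F B n \<in> sets lebesgue" for n
    using F_cases[of A n B] A B by auto
  have Fle: "mass (F A n) \<le> (\<integral>\<^sup>+y\<in>F B n. h y \<partial>lebesgue)" for n
    using F_cases[of A n B] le by (auto simp: mass_def)
  have Fd: "disjoint_family (F B)"
    unfolding disjoint_family_on_def
  proof (intro ballI impI)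
    fix m n :: nat assume "m \<noteq> n"
    show "F B m \<inter> F B n = {}"
    proof (rule ccontr)
      assume "F B m \<inter> F B n \<noteq> {}"
      then obtain y x x' where "x \<in> C" "x' \<in> C" "to_nat_on C x = m" "to_nat_on C x' = n" "y \<in> B x" "y \<in> B x'"
        by (auto simp: F_def)
      moreover from this have "x \<noteq> x'" using \<open>m \<noteq> n\<close> by auto
      ultimately show False using disj[unfolded disjoint_family_on_def, rule_format, of x x'] by auto
    qed
  qed
  let ?N = "density lebesgue (\<lambda>x. ennreal (f x))" and ?H = "density lebesgue h"
  have "mass (\<Union>x\<in>C. A x) = emeasure ?N (\<Union>n. F A n)"
    unfolding FU[of A, symmetric] using FA by (intro mass_emeasure) auto
  also have "\<dots> \<le> (\<Sum>n. emeasure ?N (F A n))" by (rule emeasure_subadditive_countably) (use FA in auto)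
  also have "\<dots> = (\<Sum>n. mass (F A n))" using FA by (simp add: mass_emeasure)
  also have "\<dots> \<le> (\<Sum>n. emeasure ?H (F B n))"
    using Fle FA h by (intro suminf_le) (auto simp: emeasure_density)
  also have "\<dots> = emeasure ?H (\<Union>n. F B n)" by (rule suminf_emeasure) (use FA Fd in auto)
  also have "\<dots> = (\<integral>\<^sup>+y\<in>(\<Union>x\<in>C. B x). h y \<partial>lebesgue)"
    unfolding FU[of B, symmetric] using FA h by (intro emeasure_density) auto
  finally show ?thesis .
qed

text \<open>One half of Lebesgue's differentiation theorem, by Vitali's covering theorem: disjoint
  balls centred in \<open>?X\<close>, inside an open set barely larger than \<open>?X\<close>, cover
  almost all of \<open>?X\<close>, and each has mean at most \<open>l\<close>. So the mass of
  \<open>?X\<close> is at most \<open>l\<close> times its measure, although \<open>f\<close> exceeds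
  \<open>l\<close> there.\<close>

lemma AE_exists_ball_above_average:
  assumes S: "S \<in> sets lebesgue" and l: "l > 0" and R: "R > 0"
  shows "{x \<in> S. l < f x \<and> (\<forall>r. 0 < r \<and> r \<le> R \<longrightarrow> mass (ball x r) \<le> ennreal (l * measure lborel (ball x r)))} \<in> null_sets lebesgue"
    (is "?X \<in> _")
proof -
  have X: "?X \<in> sets lebesgue"
  proof -
    \<comment> \<open>The volume of a ball does not depend on its centre; with a constant threshold
      each condition describes a closed set of centres.\<close>
    have m: "(mass (ball x r) \<le> ennreal (l * measure lborel (ball x r)))
        = (mass (ball x r) \<le> ennreal (l * measure lborel (ball (0::real^'n) r)))" if "r > 0" for x :: "real^'n" and r
      using that by (simp add: content_ball)
    have "?X = {x \<in> S. l < f x \<and> (\<forall>r. 0 < r \<and> r \<le> R \<longrightarrow> mass (ball x r) \<le> ennreal (l * measure lborel (ball (0::real^'n) r)))}"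
      using m by blast
    also have "\<dots> = S \<inter> {x. l < f x} \<inter> (\<Inter>r\<in>{0<..R}. - {x. ennreal (l * measure lborel (ball (0::real^'n) r)) < mass (ball x r)})"
      by (auto simp: not_less)
    finally have "?X = S \<inter> {x. l < f x} \<inter> (\<Inter>r\<in>{0<..R}. - {x. ennreal (l * measure lborel (ball (0::real^'n) r)) < mass (ball x r)})" .
    moreover have "closed (\<Inter>r\<in>{0<..R}. - {x. ennreal (l * measure lborel (ball (0::real^'n) r)) < mass (ball x r)})"
      using open_mass_ball_gt by (intro closed_INT) (auto simp: closed_Compl)
    moreover have "{x. l < f x} \<in> sets lebesgue"
      using borel_measurable_less[of "\<lambda>x. l" lebesgue f] by simp
    ultimately show ?thesis using S by auto
  qed
  have lX: "ennreal l * emeasure lebesgue ?X \<le> mass ?X"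
  proof -
    have "ennreal l * emeasure lebesgue ?X = (\<integral>\<^sup>+x\<in>?X. ennreal l \<partial>lebesgue)"
      by (rule nn_integral_cmult_indicator[OF X, symmetric])
    also have "\<dots> \<le> mass ?X"
      unfolding mass_def by (intro nn_integral_mono) (auto simp: indicator_def intro!: ennreal_leI)
    finally show ?thesis .
  qed
  then have finX: "emeasure lebesgue ?X < top"
    using le_less_trans[OF lX mass_finite[of ?X]] l by (auto simp: ennreal_mult_less_top)
  have "mass ?X \<le> ennreal l * emeasure lebesgue ?X"
  proof (rule ennreal_le_epsilon)
    fix e :: real assume e: "e > 0"
    then have "e / l > 0" using l by simp
    from sets_lebesgue_outer_open[OF X this] obtain U where U: "open U" "?X \<subseteq> U" "U - ?X \<in> lmeasurable"
      "emeasure lebesgue (U - ?X) < ennreal (e / l)" by blast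
    define K where "K = {p. fst p \<in> ?X \<and> 0 < snd p \<and> snd p \<le> R \<and> ball (fst p) (snd p) \<subseteq> U}"
    have fine: "\<exists>i. i \<in> K \<and> x \<in> ball (fst i) (snd i) \<and> snd i < d" if x: "x \<in> ?X" and d: "0 < d" for x d
    proof -
      obtain e' where e': "e' > 0" "ball x e' \<subseteq> U" using U(1,2) x open_contains_ball by blast
      define r where "r = min (min e' R) (d / 2)"
      have "r > 0" "r \<le> e'" "r \<le> R" "r < d" using e' R d by (auto simp: r_def)
      then show ?thesis using x e'(2) subset_ball[of r e' x]
        by (intro exI[of _ "(x, r)"]) (auto simp: K_def)
    qed
    obtain C where C: "countable C" "C \<subseteq> K" "pairwise (\<lambda>i j. disjnt (ball (fst i) (snd i)) (ball (fst j) (snd j))) C"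
      "negligible (?X - (\<Union>i\<in>C. ball (fst i) (snd i)))"
      by (rule Vitali_covering_theorem_balls[OF fine])
    have bC: "(\<Union>i\<in>C. ball (fst i) (snd i)) \<in> sets lebesgue" using C(1) by (intro sets.countable_UN'') auto
    have "mass ?X \<le> mass ((?X - (\<Union>i\<in>C. ball (fst i) (snd i))) \<union> (\<Union>i\<in>C. ball (fst i) (snd i)))"
      by (rule mass_mono) auto
    also have "\<dots> \<le> mass (?X - (\<Union>i\<in>C. ball (fst i) (snd i))) + mass (\<Union>i\<in>C. ball (fst i) (snd i))"
      using X bC by (intro mass_Un_le) auto
    also have "mass (?X - (\<Union>i\<in>C. ball (fst i) (snd i))) = 0"
      using C(4) by (intro mass_null) (simp add: negligible_iff_null_sets)
    also have "mass (\<Union>i\<in>C. ball (fst i) (snd i)) \<le> (\<integral>\<^sup>+y\<in>(\<Union>i\<in>C. ball (fst i) (snd i)). ennreal l \<partial>lebesgue)"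
    proof (rule countable_mass_le[OF C(1)])
      show "disjoint_family_on (\<lambda>i. ball (fst i) (snd i)) C"
        using C(3) by (auto simp: disjoint_family_on_def pairwise_def disjnt_def)
      fix i assume "i \<in> C"
      then have i: "fst i \<in> ?X" "0 < snd i" "snd i \<le> R" using C(2) by (auto simp: K_def)
      then have "mass (ball (fst i) (snd i)) \<le> ennreal (l * measure lborel (ball (fst i) (snd i)))" by auto
      also have "\<dots> = (\<integral>\<^sup>+y\<in>ball (fst i) (snd i). ennreal l \<partial>lebesgue)"
        using l by (simp add: nn_integral_cmult_indicator emeasure_ball_ennreal ennreal_mult)
      finally show "mass (ball (fst i) (snd i)) \<le> (\<integral>\<^sup>+y\<in>ball (fst i) (snd i). ennreal l \<partial>lebesgue)" .
    qed auto
    also have "\<dots> \<le> (\<integral>\<^sup>+y\<in>U. ennreal l \<partial>lebesgue)"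
    proof (intro nn_integral_mono mult_left_mono indicator_leI zero_le)
      have "ball (fst i) (snd i) \<subseteq> U" if "i \<in> C" for i using C(2) that by (auto simp: K_def)
      then show "x \<in> U" if "x \<in> (\<Union>i\<in>C. ball (fst i) (snd i))" for x using that by blast
    qed
    also have "\<dots> = ennreal l * emeasure lebesgue U"
      using U(1) by (intro nn_integral_cmult_indicator) auto
    also have "emeasure lebesgue U \<le> emeasure lebesgue ?X + emeasure lebesgue (U - ?X)"
    proof -
      have "?X \<union> (U - ?X) = U" using U(2) by blast
      moreover have "U - ?X \<in> sets lebesgue" using U(1) X by (intro sets.Diff) auto
      ultimately show ?thesis using emeasure_subadditive[OF X, of "U - ?X"] by argo
    qed
    also have "\<dots> \<le> emeasure lebesgue ?X + ennreal (e / l)" using U(4) by (intro add_left_mono) auto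
    also have "ennreal l * (emeasure lebesgue ?X + ennreal (e / l)) = ennreal l * emeasure lebesgue ?X + ennreal e"
      using l e by (simp add: distrib_left ennreal_mult[symmetric])
    finally show "mass ?X \<le> ennreal l * emeasure lebesgue ?X + ennreal e" by (simp add: mult_left_mono)
  qed
  \<comment> \<open>The excess of \<open>f\<close> over \<open>l\<close> is split off. Since the
    measure of \<open>?X\<close> is finite, cancellation against the previous bound leaves nothing
    for it.\<close>
  moreover have "mass ?X = (\<integral>\<^sup>+x\<in>?X. ennreal (f x - l) \<partial>lebesgue) + ennreal l * emeasure lebesgue ?X"
  proof -
    have "mass ?X = (\<integral>\<^sup>+x. ennreal (f x - l) * indicator ?X x + ennreal l * indicator ?X x \<partial>lebesgue)"
      unfolding mass_def using l
      by (intro nn_integral_cong) (auto simp: indicator_def ennreal_plus[symmetric] simp del: ennreal_plus)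
    also have "\<dots> = (\<integral>\<^sup>+x\<in>?X. ennreal (f x - l) \<partial>lebesgue) + (\<integral>\<^sup>+x\<in>?X. ennreal l \<partial>lebesgue)"
      by (rule nn_integral_add) (use X in measurable)
    finally show ?thesis using X by (simp add: nn_integral_cmult_indicator)
  qed
  ultimately have "(\<integral>\<^sup>+x\<in>?X. ennreal (f x - l) \<partial>lebesgue) = 0"
    using finX l by (simp add: ennreal_add_left_cancel_le ennreal_mult_less_top less_top[symmetric])
      (metis (no_types, lifting) add.left_neutral add.commute ennreal_add_left_cancel_le ennreal_mult_less_top ennreal_less_top finX less_irrefl le_zero_eq)
  then have "AE x in lebesgue. ennreal (f x - l) * indicator ?X x = 0"
    by (subst (asm) nn_integral_0_iff_AE) (use X in auto)
  then have "AE x in lebesgue. x \<notin> ?X"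
    by eventually_elim (auto simp: indicator_def)
  then show ?thesis using X by (simp add: AE_iff_null_sets[OF X])
qed

text \<open>Around almost every point with \<open>f x > l\<close> some ball has mean above
  \<open>l\<close>. A radius exceeding half the supremum of such radii is chosen, so that all balls
  of at least twice this radius, up to \<open>R\<close>, have mean at most \<open>l\<close>. The
  factor \<open>(5 * K) ^ CARD('n)\<close> is the volume ratio between an enlarged covering ball and
  its stopping ball.\<close>

lemma level_set_estimate:
  assumes S: "S \<in> sets lebesgue" and l: "l > 0" and R: "R > 0" and K: "K \<ge> 1"
    and h: "h \<in> borel_measurable lebesgue"
    and large: "mass UNIV < ennreal (l * measure lborel (ball (0::real^'n) (R / (5 * K))))"
    and RH: "\<And>x r. x \<in> S \<Longrightarrow> 0 < r \<Longrightarrow> 5 * K * r \<le> R \<Longrightarrow> ennreal (l * measure lborel (ball x r)) \<le> mass (ball x r)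
      \<Longrightarrow> (\<And>s. 2 * r \<le> s \<Longrightarrow> s \<le> R \<Longrightarrow> mass (ball x s) \<le> ennreal (l * measure lborel (ball x s)))
      \<Longrightarrow> ennreal (l * measure lborel (ball x r)) \<le> (\<integral>\<^sup>+y\<in>ball x (K * r). h y \<partial>lebesgue)"
  shows "mass (S \<inter> {x. l < f x}) \<le> ennreal ((5 * K) ^ CARD('n)) * (\<integral>\<^sup>+y. h y \<partial>lebesgue)"
proof -
  define X where "X = {x \<in> S. l < f x \<and> (\<forall>r. 0 < r \<and> r \<le> R \<longrightarrow> mass (ball x r) \<le> ennreal (l * measure lborel (ball x r)))}"
  have X: "X \<in> null_sets lebesgue" unfolding X_def by (rule AE_exists_ball_above_average[OF S l R])
  define G where "G = S \<inter> {x. l < f x} - X"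
  define P where "P x = {r. 0 < r \<and> r \<le> R \<and> ennreal (l * measure lborel (ball x r)) \<le> mass (ball x r)}" for x
  \<comment> \<open>A ball with radius at least \<open>R / (5 * K)\<close> and mean at least
    \<open>l\<close> would have to contain more than the total mass.\<close>
  have small: "r < R / (5 * K)" if r: "r \<in> P x" for r x
  proof (rule ccontr)
    assume "\<not> r < R / (5 * K)"
    then have "measure lborel (ball (0::real^'n) (R / (5 * K))) \<le> measure lborel (ball x r)"
      using R K r by (auto simp: content_ball P_def intro!: mult_left_mono power_mono)
    then have "ennreal (l * measure lborel (ball (0::real^'n) (R / (5 * K)))) \<le> ennreal (l * measure lborel (ball x r))"
      using l by (intro ennreal_leI mult_left_mono) auto
    also have "\<dots> \<le> mass UNIV" using r mass_mono[of "ball x r" UNIV] by (auto simp: P_def intro: order_trans)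
    finally show False using large by simp
  qed
  have "\<exists>r\<in>P x. \<forall>s\<in>P x. s < 2 * r" if x: "x \<in> G" for x
  proof -
    have ne: "P x \<noteq> {}"
    proof -
      obtain r where "0 < r" "r \<le> R" "\<not> mass (ball x r) \<le> ennreal (l * measure lborel (ball x r))"
        using x by (auto simp: G_def X_def)
      then show ?thesis by (auto simp: P_def)
    qed
    have bdd: "bdd_above (P x)" by (rule bdd_aboveI[of _ R]) (auto simp: P_def)
    \<comment> \<open>The chosen radius exceeds half this supremum, which is the origin of the
      factor two in the hypothesis \<open>RH\<close>.\<close>
    define t where "t = Sup (P x)"
    obtain r0 where r0: "r0 \<in> P x" using ne by auto
    have "0 < r0" using r0 by (simp add: P_def)
    also have "r0 \<le> t" unfolding t_def by (rule cSup_upper[OF r0 bdd])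
    finally have "t / 2 < t" by simp
    then obtain r where r: "r \<in> P x" "t / 2 < r" unfolding t_def using less_cSupD[OF ne] by blast
    have "s < 2 * r" if "s \<in> P x" for s using cSup_upper[OF that bdd] r(2) by (simp add: t_def)
    with r(1) show ?thesis by blast
  qed
  then obtain r where r: "\<And>x. x \<in> G \<Longrightarrow> r x \<in> P x" "\<And>x s. x \<in> G \<Longrightarrow> s \<in> P x \<Longrightarrow> s < 2 * r x" by metis
  have rpos: "0 < r x" "5 * K * r x \<le> R" if "x \<in> G" for x
    using r(1)[OF that] small[OF r(1)[OF that]] K by (auto simp: P_def field_simps)
  have above: "mass (ball x s) \<le> ennreal (l * measure lborel (ball x s))" if "x \<in> G" "2 * r x \<le> s" "s \<le> R" for x s
  proof (rule ccontr)
    assume "\<not> ?thesis"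
    then have "s \<in> P x" using that rpos(1)[OF that(1)] by (auto simp: P_def)
    from r(2)[OF that(1) this] that(2) show False by simp
  qed
  \<comment> \<open>The balls enlarged by \<open>K\<close>, over which the reverse Hoelder
    inequality integrates, are made disjoint; their fivefold enlargements cover.\<close>
  obtain C where C: "countable C" "C \<subseteq> G" "pairwise (\<lambda>x y. disjnt (ball x (K * r x)) (ball y (K * r y))) C"
    "G \<subseteq> (\<Union>x\<in>C. ball x (5 * (K * r x)))"
  proof (rule Vitali_covering_lemma_balls[where S = G and K = G and a = "\<lambda>x. x" and r = "\<lambda>x. K * r x" and B = R])
    show "G \<subseteq> (\<Union>x\<in>G. ball x (K * r x))" using rpos(1) K by force
    fix x assume x: "x \<in> G"
    have "0 < K * r x" using rpos(1)[OF x] K by simp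
    then show "0 < K * r x \<and> K * r x \<le> R" using rpos(2)[OF x] by simp
  qed
  have "mass (S \<inter> {x. l < f x}) \<le> mass (X \<union> (\<Union>x\<in>C. ball x (5 * (K * r x))))"
    using C(4) by (intro mass_mono) (auto simp: G_def)
  also have "\<dots> \<le> mass X + mass (\<Union>x\<in>C. ball x (5 * (K * r x)))"
    using X C(1) by (intro mass_Un_le sets.countable_UN'') auto
  also have "mass X = 0" by (rule mass_null[OF X])
  also have "mass (\<Union>x\<in>C. ball x (5 * (K * r x)))
      \<le> (\<integral>\<^sup>+y\<in>(\<Union>x\<in>C. ball x (K * r x)). ennreal ((5 * K) ^ CARD('n)) * h y \<partial>lebesgue)"
  proof (rule countable_mass_le[OF C(1)])
    show "disjoint_family_on (\<lambda>x. ball x (K * r x)) C"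
      using C(3) by (auto simp: disjoint_family_on_def pairwise_def disjnt_def)
    fix x assume "x \<in> C"
    then have x: "x \<in> G" using C(2) by auto
    have xS: "x \<in> S" using x by (auto simp: G_def)
    have K5: "2 * r x \<le> 5 * (K * r x)"
    proof -
      have "2 * r x \<le> 5 * r x" using rpos(1)[OF x] by simp
      also have "\<dots> \<le> 5 * (K * r x)" using K rpos(1)[OF x] by simp
      finally show ?thesis .
    qed
    have "mass (ball x (5 * (K * r x))) \<le> ennreal (l * measure lborel (ball x (5 * (K * r x))))"
      by (rule above[OF x K5]) (use rpos(2)[OF x] in simp)
    also have "measure lborel (ball x (5 * (K * r x))) = (5 * K) ^ CARD('n) * measure lborel (ball x (r x))"
      using measure_ball_scale[of "r x" "5 * K" x x] rpos(1)[OF x] K by (simp add: mult.assoc)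
    also have "ennreal (l * ((5 * K) ^ CARD('n) * measure lborel (ball x (r x))))
        = ennreal ((5 * K) ^ CARD('n)) * ennreal (l * measure lborel (ball x (r x)))"
      using l K by (simp add: ennreal_mult[symmetric] mult_ac)
    also have "\<dots> \<le> ennreal ((5 * K) ^ CARD('n)) * (\<integral>\<^sup>+y\<in>ball x (K * r x). h y \<partial>lebesgue)"
      using r(1)[OF x] by (intro mult_left_mono RH xS rpos x above) (auto simp: P_def)
    also have "\<dots> = (\<integral>\<^sup>+y\<in>ball x (K * r x). ennreal ((5 * K) ^ CARD('n)) * h y \<partial>lebesgue)"
      unfolding mult.assoc using h
      by (intro nn_integral_cmult[symmetric] borel_measurable_times_ennreal borel_measurable_indicator) auto
    finally show "mass (ball x (5 * (K * r x))) \<le> (\<integral>\<^sup>+y\<in>ball x (K * r x). ennreal ((5 * K) ^ CARD('n)) * h y \<partial>lebesgue)" .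
  qed (use h in auto)
  also have "\<dots> \<le> (\<integral>\<^sup>+y. ennreal ((5 * K) ^ CARD('n)) * h y \<partial>lebesgue)"
    by (intro nn_integral_mono) (auto simp: indicator_def)
  also have "\<dots> = ennreal ((5 * K) ^ CARD('n)) * (\<integral>\<^sup>+y. h y \<partial>lebesgue)"
    by (rule nn_integral_cmult[OF h])
  finally show ?thesis by simp
qed

end

text \<open>The square roots of the levels form a geometric progression with ratio 2, so the sum is
  at most twice its last nonzero term, and that term is below \<open>sqrt (y / c)\<close>.\<close>

lemma geometric_levels_sum:
  fixes y l c :: real
  assumes "0 \<le> y" "0 < l" "0 < c"
  shows "(\<Sum>k<m. if c * (l * 4 ^ k) < y then sqrt (l * 4 ^ k) else 0) \<le> 2 * sqrt (y / c)"
proof (induction m)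
  case (Suc m)
  show ?case
  proof (cases "c * (l * 4 ^ m) < y")
    case True
    have s: "sqrt (l * 4 ^ k) = sqrt l * 2 ^ k" for k :: nat
      by (simp add: real_sqrt_mult real_sqrt_power)
    have "(\<Sum>k<Suc m. if c * (l * 4 ^ k) < y then sqrt (l * 4 ^ k) else 0) \<le> (\<Sum>k<Suc m. sqrt l * 2 ^ k)"
      using assms by (intro sum_mono) (auto simp: s)
    also have "\<dots> = sqrt l * (2 ^ Suc m - 1)"
    proof -
      have "(\<Sum>k<n. (2::real) ^ k) = 2 ^ n - 1" for n by (induction n) auto
      then show ?thesis unfolding sum_distrib_left[symmetric] by simp
    qed
    also have "\<dots> \<le> 2 * sqrt (l * 4 ^ m)" using assms by (simp add: s algebra_simps)
    also have "l * 4 ^ m \<le> y / c" using True assms by (simp add: field_simps)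
    finally show ?thesis by simp
  next
    case False
    with Suc.IH show ?thesis by simp
  qed
qed (use assms in simp)

text \<open>The superlevel sets decrease with \<open>k\<close>, so the mass above
  \<open>l * 4 ^ m\<close> is counted \<open>m\<close> times on the left. On the right the sum over
  the levels is taken under the integral and produces just another factor \<open>sqrt (f y)\<close>.
  The high mass thus decays like \<open>1 / m\<close>, at a rate depending only on \<open>D\<close>,
  \<open>c\<close> and the total mass.\<close>

lemma (in integrable_density) high_level_mass_bound:
  assumes l: "0 < l" and c: "0 < c" and D: "0 \<le> D"
    and level: "\<And>k. mass (S \<inter> {x. l * 4 ^ k < f x})
      \<le> (\<integral>\<^sup>+y. ennreal (D * (sqrt (l * 4 ^ k) * (if c * (l * 4 ^ k) < f y then sqrt (f y) else 0))) \<partial>lebesgue)"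
  shows "of_nat m * mass (S \<inter> {x. l * 4 ^ m < f x}) \<le> ennreal (2 * D / sqrt c) * mass UNIV"
proof -
  let ?A = "\<lambda>k. S \<inter> {x. l * 4 ^ k < f x}"
  let ?g = "\<lambda>k y. D * (sqrt (l * 4 ^ k) * (if c * (l * 4 ^ k) < f y then sqrt (f y) else 0))"
  have "mass (?A m) \<le> mass (?A k)" if "k < m" for k
  proof (rule mass_mono)
    have "l * 4 ^ k \<le> l * 4 ^ m" using l that by (intro mult_left_mono power_increasing) auto
    then show "?A m \<subseteq> ?A k" by auto
  qed
  then have "of_nat m * mass (?A m) \<le> (\<Sum>k<m. mass (?A k))"
    using sum_mono[of "{..<m}" "\<lambda>k. mass (?A m)" "\<lambda>k. mass (?A k)"] by simp
  also have "\<dots> \<le> (\<Sum>k<m. \<integral>\<^sup>+y. ennreal (?g k y) \<partial>lebesgue)" by (intro sum_mono level)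
  also have "\<dots> = (\<integral>\<^sup>+y. (\<Sum>k<m. ennreal (?g k y)) \<partial>lebesgue)"
    by (rule nn_integral_sum[symmetric]) measurable
  also have "\<dots> \<le> (\<integral>\<^sup>+y. ennreal (2 * D / sqrt c) * ennreal (f y) \<partial>lebesgue)"
  proof (rule nn_integral_mono)
    fix y
    have g0: "0 \<le> ?g k y" for k using D l f_nonneg[of y] by (auto intro!: mult_nonneg_nonneg)
    have "(\<Sum>k<m. ?g k y) = D * sqrt (f y) * (\<Sum>k<m. if c * (l * 4 ^ k) < f y then sqrt (l * 4 ^ k) else 0)"
      unfolding sum_distrib_left by (intro sum.cong) auto
    also have "\<dots> \<le> D * sqrt (f y) * (2 * sqrt (f y / c))"
      using geometric_levels_sum[OF f_nonneg l c] D f_nonneg[of y] by (intro mult_left_mono) auto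
    also have "\<dots> = 2 * D / sqrt c * f y"
      using f_nonneg[of y] by (simp add: real_sqrt_divide)
    finally have "ennreal (\<Sum>k<m. ?g k y) \<le> ennreal (2 * D / sqrt c * f y)" by (rule ennreal_leI)
    then show "(\<Sum>k<m. ennreal (?g k y)) \<le> ennreal (2 * D / sqrt c) * ennreal (f y)"
      using g0 D c f_nonneg[of y] by (simp add: sum_ennreal ennreal_mult[symmetric])
  qed
  also have "\<dots> = ennreal (2 * D / sqrt c) * mass UNIV"
    unfolding mass_def by (subst nn_integral_cmult) auto
  finally show ?thesis .
qed

section \<open>Caccioppoli and reverse Hoelder inequalities\<close>

lemma cutoff_gradient_bound:
  obtains C where "0 \<le> C" "\<And>c r (x::real^'n::finite). 0 < r \<Longrightarrow> norm (grad (cutoff c r) x) \<le> C / r"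
proof -
  have unit: "unit_cutoff = cutoff 0 1" by (simp add: fun_eq_iff cutoff_def)
  have "unit_cutoff \<in> test_functions (UNIV :: (real^'n) set)"
    unfolding unit by (rule cutoff_test_function) auto
  then obtain C where C: "0 \<le> C" "\<And>x::real^'n. norm (grad unit_cutoff x) \<le> C"
    using test_function_grad_bounded by blast
  have "norm (grad (cutoff c r) x) \<le> C / r" if r: "0 < r" for c x :: "real^'n" and r
  proof -
    have "grad (cutoff c r) x = inverse r *\<^sub>R grad unit_cutoff (inverse r *\<^sub>R x + - (inverse r *\<^sub>R c))"
      unfolding cutoff_def[abs_def] vec_eq_iff
      by (simp add: partial_derivative_affine[of unit_cutoff "inverse r" _ "- (inverse r *\<^sub>R c)", simplified]
          smooth_differentiable[OF smooth_unit_cutoff])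
    then show ?thesis using C(2) r by (simp add: divide_inverse mult.commute)
  qed
  with C(1) show ?thesis by (rule that)
qed

context domain
begin

text \<open>Extension by zero links integrals over \<open>\<Omega>\<close> with integrals over the
  whole space, where the covering arguments take place.\<close>

lemma set_nn_integral_extended:
  assumes p: "integrable M p" "\<And>x. 0 \<le> p x" and S: "S \<in> sets lebesgue"
  shows "(\<integral>\<^sup>+x\<in>S. ennreal (indicator \<Omega> x * p x) \<partial>lebesgue) = ennreal (LINT x|M. indicator S x * p x)"
proof -
  have i: "integrable M (\<lambda>x. indicator S x *\<^sub>R p x)"
  proof (rule Bochner_Integration.integrable_bound[OF p(1)])
    show "(\<lambda>x. indicator S x *\<^sub>R p x) \<in> borel_measurable M"
    proof (intro borel_measurable_scaleR borel_measurable_integrable[OF p(1)])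
      show "(indicator S :: _ \<Rightarrow> real) \<in> borel_measurable M"
        using S by (intro measurable_restrict_space1 borel_measurable_indicator)
    qed
  qed (auto simp: indicator_def)
  have "(\<integral>\<^sup>+x\<in>S. ennreal (indicator \<Omega> x * p x) \<partial>lebesgue) = (\<integral>\<^sup>+x\<in>\<Omega>. ennreal (indicator S x * p x) \<partial>lebesgue)"
    by (intro nn_integral_cong) (auto simp: indicator_def)
  also have "\<dots> = (\<integral>\<^sup>+x. ennreal (indicator S x * p x) \<partial>M)"
    by (rule nn_integral_restrict_space[symmetric]) auto
  also have "\<dots> = ennreal (LINT x|M. indicator S x * p x)"
    using i p(2) by (intro nn_integral_eq_integral) auto
  finally show ?thesis .
qed

lemma indicator_extension_measurable:
  "p \<in> borel_measurable M \<Longrightarrow> (\<lambda>x. indicator \<Omega> x * p x :: real) \<in> borel_measurable lebesgue"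
  using borel_measurable_restrict_space_iff[of \<Omega> lebesgue p] by simp

end

text \<open>Radius of a ball containing the support of \<open>cutoff c r\<close>, in units of
  \<open>r\<close>. The support lies in the closed ball with factor
  \<open>2 * sqrt (real CARD('n))\<close>; doubling leaves room to pass to an open ball. The
  argument of type \<open>itself\<close> records the dependence on the dimension.\<close>

definition ratio :: "'n::finite itself \<Rightarrow> real" where
  "ratio _ = 4 * sqrt (real CARD('n))"

lemma ratio_ge: "4 \<le> ratio TYPE('n::finite)"
  by (simp add: ratio_def Suc_leI)

lemma cutoff_outside:
  fixes c :: "real^'n::finite"
  assumes "0 < r" "x \<notin> ball c (ratio TYPE('n) * r)"
  shows "cutoff c r x = 0" "grad (cutoff c r) x = 0"
proof -
  have n: "0 < sqrt (real CARD('n))" by simp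
  have lt: "2 * sqrt (real CARD('n)) * r < ratio TYPE('n) * r"
    using assms(1) n by (simp add: ratio_def)
  have z: "cutoff c r y = 0" if "y \<notin> cball c (2 * sqrt (real CARD('n)) * r)" for y
    using that by (intro cutoff_0 assms(1)) (simp add: dist_norm norm_minus_commute)
  have x: "x \<notin> cball c (2 * sqrt (real CARD('n)) * r)" using assms(2) lt by auto
  then show "cutoff c r x = 0" by (rule z)
  show "grad (cutoff c r) x = 0" by (rule grad_outside[OF closed_cball z x])
qed

context h_convergent
begin

text \<open>The equation is tested with \<open>cutoff\<^sup>2 * (u - c)\<close>.\<close>

lemma Caccioppoli:
  assumes g: "g \<in> H10 \<Omega>" and w: "weakly_H10 (\<lambda>k. T k g) w"
    and s: "AE x in M. norm (Astar x *v wgrad \<Omega> w x) \<le> s" "0 \<le> s"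
    and r: "0 < r" and sub: "ball x0 (ratio TYPE('n) * r) \<subseteq> \<Omega>"
    and D: "0 \<le> D" "\<And>x. norm (grad (cutoff x0 r) x) \<le> D / r"
  shows "(LINT x|M. indicator (ball x0 r) x * (norm (wgrad \<Omega> (T k g) x))\<^sup>2)
    \<le> 4 / a1 * ((2 * a2 + 1) * (D / r)\<^sup>2 * (LINT x|M. indicator (ball x0 (ratio TYPE('n) * r)) x * (T k g x - c)\<^sup>2)
      + (1 + 1 / a1) * s\<^sup>2 * measure lborel (ball x0 (ratio TYPE('n) * r)))"
proof -
  let ?B = "ball x0 (ratio TYPE('n) * r)"
  define z where "z = cutoff x0 r"
  define u where "u = T k g"
  define du where "du = wgrad \<Omega> u"
  define \<sigma> where "\<sigma> x = Astar x *v wgrad \<Omega> w x" for x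
  have uH: "u \<in> H10 \<Omega>" unfolding u_def by (rule T(1)[OF g])
  have us: "u \<in> sq_int M" and dus: "du \<in> sq_int M" using H10_sq_int[OF uH] by (auto simp: du_def)
  have \<sigma>s: "\<sigma> \<in> sq_int M" unfolding \<sigma>_def by (rule T_flux_id(1)[OF g w])
  have zt: "z \<in> test_functions \<Omega>"
    unfolding z_def
  proof (rule cutoff_test_function[OF r])
    have "0 < sqrt (real CARD('n))" by simp
    then have "2 * sqrt (real CARD('n)) * r < ratio TYPE('n) * r" using r by (simp add: ratio_def)
    then have "cball x0 (2 * sqrt (real CARD('n)) * r) \<subseteq> ?B" by auto
    then show "cball x0 (2 * sqrt (real CARD('n)) * r) \<subseteq> \<Omega>" using sub by blast
  qed
  have zr: "0 \<le> z x" "z x \<le> 1" for x unfolding z_def by (rule cutoff_range)+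
  have z1: "z x = 1" if "x \<in> ball x0 r" for x
    unfolding z_def using that by (intro cutoff_1 r) (simp add: dist_norm norm_minus_commute)
  have z0: "z x = 0" "grad z x = 0" if "x \<notin> ?B" for x
    unfolding z_def using cutoff_outside[OF r that] by auto
  note zm = test_function_measurable[OF zt] test_function_grad_measurable[OF zt]
  define \<psi> where "\<psi> x = z x * z x" for x
  have \<psi>t: "\<psi> \<in> test_functions \<Omega>"
    unfolding \<psi>_def by (rule test_function_mult_smooth[OF zt test_function_smooth[OF zt]])
  have g\<psi>: "grad \<psi> x = 2 *\<^sub>R (z x *\<^sub>R grad z x)" for x
    unfolding \<psi>_def grad_mult[OF test_function_smooth[OF zt] test_function_smooth[OF zt]] by (simp add: scaleR_left_distrib[symmetric])
  \<comment> \<open>The gradient of \<open>\<psi> * (u - c)\<close>. The function itself is treated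
    as \<open>\<psi> * u - c * \<psi>\<close>, since both summands lie in
    \<open>H10 \<Omega>\<close> while \<open>u - c\<close> need not.\<close>
  define G where "G x = \<psi> x *\<^sub>R du x + (u x - c) *\<^sub>R grad \<psi> x" for x
  have vG: "has_H10_gradient \<Omega> (\<lambda>x. \<psi> x * u x - c * \<psi> x) G"
  proof -
    have "has_H10_gradient \<Omega> (\<lambda>x. \<psi> x * u x - c * \<psi> x) (\<lambda>x. \<psi> x *\<^sub>R du x + u x *\<^sub>R grad \<psi> x - c *\<^sub>R grad \<psi> x)"
      unfolding du_def
      by (intro has_H10_gradient_diff has_H10_gradient_test_mult[OF H10_gradient[OF uH] _ \<psi>t]
          has_H10_gradient_scale test_function_has_H10_gradient[OF \<psi>t] domain_sets)
    moreover have "(\<lambda>x. \<psi> x *\<^sub>R du x + u x *\<^sub>R grad \<psi> x - c *\<^sub>R grad \<psi> x) = G"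
      by (simp add: G_def fun_eq_iff scaleR_diff_left)
    ultimately show ?thesis by simp
  qed
  note vH = has_H10_gradient_H10[OF vG open_domain] and Gs = has_H10_gradient_sq_int(2)[OF vG]
    and vgrad = has_H10_gradient_wgrad(2)[OF vG open_domain]
  have adus: "(\<lambda>x. a k x *\<^sub>R du x) \<in> sq_int M" by (rule flux_sq_int[OF dus])
  have i1: "integrable M (\<lambda>x. (a k x *\<^sub>R du x) \<bullet> G x)" by (rule sq_int_inner_integrable[OF adus Gs])
  have i2: "integrable M (\<lambda>x. \<sigma> x \<bullet> G x)" by (rule sq_int_inner_integrable[OF \<sigma>s Gs])
  \<comment> \<open>The right-hand side of the equation, so far only a functional, is expressed by
    the limit flux \<open>\<sigma>\<close>, which is bounded by \<open>s\<close>.\<close>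
  have eq: "(LINT x|M. (a k x *\<^sub>R du x) \<bullet> G x) = (LINT x|M. \<sigma> x \<bullet> G x)"
  proof -
    let ?v = "\<lambda>x. \<psi> x * u x - c * \<psi> x"
    have "(LINT x|M. (a k x *\<^sub>R du x) \<bullet> G x) = (LINT x|M. (a k x *\<^sub>R du x) \<bullet> wgrad \<Omega> ?v x)"
      by (rule integral_cong_AE[OF borel_measurable_integrable[OF i1]
            borel_measurable_integrable[OF sq_int_inner_integrable[OF adus H10_sq_int(2)[OF vH]]]])
        (use vgrad in \<open>eventually_elim, simp\<close>)
    also have "\<dots> = (LINT x|M. \<sigma> x \<bullet> wgrad \<Omega> ?v x)"
      using T(2)[OF g vH, of k] T_flux_id(3)[OF g w vH] by (simp add: dirichlet_def du_def u_def \<sigma>_def)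
    also have "\<dots> = (LINT x|M. \<sigma> x \<bullet> G x)"
      by (rule integral_cong_AE[OF borel_measurable_integrable[OF sq_int_inner_integrable[OF \<sigma>s H10_sq_int(2)[OF vH]]]
            borel_measurable_integrable[OF i2]])
        (use vgrad in \<open>eventually_elim, simp\<close>)
    finally show ?thesis .
  qed
  have ucs: "(\<lambda>x. u x - c) \<in> sq_int M" by (intro sq_int_diff us sq_int_const)
  have j1: "integrable M (\<lambda>x. (norm (z x *\<^sub>R du x))\<^sup>2)"
    by (rule sq_int_integrable[OF sq_int_test_scaleR[OF zt dus]])
  have j2: "integrable M (\<lambda>x. (norm ((u x - c) *\<^sub>R grad z x))\<^sup>2)"
    by (rule sq_int_integrable[OF sq_int_scaleR_grad[OF zt ucs]])
  have j3: "integrable M (\<lambda>x. (z x)\<^sup>2)"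
    using sq_int_integrable[OF test_function_sq_int[OF zt domain_sets]] by simp
  \<comment> \<open>Young's inequality pointwise, for the localised gradient \<open>p\<close> and
    the cut-off term \<open>q\<close>: half of \<open>a k\<close> is spent on the mixed term and
    \<open>a1 / 4\<close> on the flux, which leaves \<open>a1 / 4\<close>.\<close>
  have "(LINT x|M. (a1 / 4) * (norm (z x *\<^sub>R du x))\<^sup>2 - (2 * a2 + 1) * (norm ((u x - c) *\<^sub>R grad z x))\<^sup>2
      - (1 + 1 / a1) * s\<^sup>2 * (z x)\<^sup>2) \<le> (LINT x|M. (a k x *\<^sub>R du x) \<bullet> G x - \<sigma> x \<bullet> G x)"
  proof (rule integral_mono_AE)
    show "integrable M (\<lambda>x. (a1 / 4) * (norm (z x *\<^sub>R du x))\<^sup>2 - (2 * a2 + 1) * (norm ((u x - c) *\<^sub>R grad z x))\<^sup>2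
      - (1 + 1 / a1) * s\<^sup>2 * (z x)\<^sup>2)"
      by (intro Bochner_Integration.integrable_diff integrable_mult_right j1 j2 j3)
    show "integrable M (\<lambda>x. (a k x *\<^sub>R du x) \<bullet> G x - \<sigma> x \<bullet> G x)"
      by (intro Bochner_Integration.integrable_diff i1 i2)
    show "AE x in M. (a1 / 4) * (norm (z x *\<^sub>R du x))\<^sup>2 - (2 * a2 + 1) * (norm ((u x - c) *\<^sub>R grad z x))\<^sup>2
      - (1 + 1 / a1) * s\<^sup>2 * (z x)\<^sup>2 \<le> (a k x *\<^sub>R du x) \<bullet> G x - \<sigma> x \<bullet> G x"
      using s(1)
    proof eventually_elim
      fix x assume sx: "norm (Astar x *v wgrad \<Omega> w x) \<le> s"
      define p where "p = z x *\<^sub>R du x"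
      define q where "q = (u x - c) *\<^sub>R grad z x"
      define A where "A = a k x"
      have A: "a1 \<le> A" "A \<le> a2" using a_bounds by (auto simp: A_def)
      have ap: "0 < A" using A(1) a1_pos by linarith
      have e1: "(a k x *\<^sub>R du x) \<bullet> G x = A * (p \<bullet> p) + 2 * A * (p \<bullet> q)"
        by (simp add: G_def g\<psi> \<psi>_def p_def q_def A_def inner_add_right algebra_simps)
      have e2: "\<sigma> x \<bullet> G x = z x * (\<sigma> x \<bullet> p) + 2 * (z x * (\<sigma> x \<bullet> q))"
        by (simp add: G_def g\<psi> \<psi>_def p_def q_def inner_add_right algebra_simps)
      have b1: "- (A / 2 * (p \<bullet> p) + 2 * A * (q \<bullet> q)) \<le> 2 * A * (p \<bullet> q)"
      proof -
        have "0 \<le> A / 2 * ((p + 2 *\<^sub>R q) \<bullet> (p + 2 *\<^sub>R q))" using ap by (intro mult_nonneg_nonneg) auto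
        then show ?thesis by (simp add: inner_add inner_commute algebra_simps)
      qed
      have sig: "norm (\<sigma> x) \<le> s" using sx by (simp add: \<sigma>_def)
      have zsp: "z x * (\<sigma> x \<bullet> v) \<le> z x * s * norm v" for v
      proof -
        have "\<sigma> x \<bullet> v \<le> norm (\<sigma> x) * norm v" by (rule norm_cauchy_schwarz)
        also have "\<dots> \<le> s * norm v" by (intro mult_right_mono sig) simp
        finally show ?thesis using zr(1)[of x] by (simp add: mult.assoc mult_left_mono)
      qed
      have b2: "z x * (\<sigma> x \<bullet> p) \<le> a1 / 4 * (norm p)\<^sup>2 + 1 / a1 * (s\<^sup>2 * (z x)\<^sup>2)"
      proof -
        have "0 \<le> 1 / a1 * (a1 / 2 * norm p - z x * s)\<^sup>2" using a1_pos by simp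
        also have "\<dots> = a1 / 4 * (norm p)\<^sup>2 - z x * s * norm p + 1 / a1 * (s\<^sup>2 * (z x)\<^sup>2)"
          using a1_pos by (simp add: power2_eq_square field_simps)
        finally show ?thesis using zsp[of p] by linarith
      qed
      have b3: "2 * (z x * (\<sigma> x \<bullet> q)) \<le> (norm q)\<^sup>2 + s\<^sup>2 * (z x)\<^sup>2"
      proof -
        have "0 \<le> (norm q - z x * s)\<^sup>2" by simp
        then have "2 * (z x * s * norm q) \<le> (norm q)\<^sup>2 + s\<^sup>2 * (z x)\<^sup>2"
          by (simp add: power2_diff power_mult_distrib algebra_simps)
        then show ?thesis using zsp[of q] by linarith
      qed
      have b4: "a1 / 2 * (norm p)\<^sup>2 \<le> A / 2 * (p \<bullet> p)"
        using A(1) by (simp add: power2_norm_eq_inner mult_right_mono)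
      have b5: "2 * A * (q \<bullet> q) \<le> 2 * a2 * (norm q)\<^sup>2"
        using A(2) by (simp add: power2_norm_eq_inner mult_right_mono)
      have "(1 + 1 / a1) * s\<^sup>2 * (z x)\<^sup>2 = s\<^sup>2 * (z x)\<^sup>2 + 1 / a1 * (s\<^sup>2 * (z x)\<^sup>2)" by (simp add: algebra_simps)
      moreover have "(2 * a2 + 1) * (norm q)\<^sup>2 = 2 * a2 * (norm q)\<^sup>2 + (norm q)\<^sup>2" by (simp add: algebra_simps)
      ultimately show "(a1 / 4) * (norm (z x *\<^sub>R du x))\<^sup>2 - (2 * a2 + 1) * (norm ((u x - c) *\<^sub>R grad z x))\<^sup>2
        - (1 + 1 / a1) * s\<^sup>2 * (z x)\<^sup>2 \<le> (a k x *\<^sub>R du x) \<bullet> G x - \<sigma> x \<bullet> G x"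
        unfolding e1 e2 p_def[symmetric] q_def[symmetric] using b1 b2 b3 b4 b5 by linarith
    qed
  qed
  also have "\<dots> = 0" using i1 i2 eq by simp
  finally have main: "a1 / 4 * (LINT x|M. (norm (z x *\<^sub>R du x))\<^sup>2)
      \<le> (2 * a2 + 1) * (LINT x|M. (norm ((u x - c) *\<^sub>R grad z x))\<^sup>2) + (1 + 1 / a1) * s\<^sup>2 * (LINT x|M. (z x)\<^sup>2)"
    by (simp only: Bochner_Integration.integral_diff[OF Bochner_Integration.integrable_diff[OF integrable_mult_right[OF j1] integrable_mult_right[OF j2]] integrable_mult_right[OF j3]]
        Bochner_Integration.integral_diff[OF integrable_mult_right[OF j1] integrable_mult_right[OF j2]] integral_mult_right_zero)
  have m1: "(LINT x|M. indicator (ball x0 r) x * (norm (du x))\<^sup>2) \<le> (LINT x|M. (norm (z x *\<^sub>R du x))\<^sup>2)"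
  proof (rule integral_mono[OF _ j1])
    show "integrable M (\<lambda>x. indicator (ball x0 r) x * (norm (du x))\<^sup>2)"
      using sq_int_integrable[OF sq_int_indicator_scaleR[of "ball x0 r", OF _ dus]]
      by (simp add: power_mult_distrib indicator_power2)
    show "indicator (ball x0 r) x * (norm (du x))\<^sup>2 \<le> (norm (z x *\<^sub>R du x))\<^sup>2" for x
      using z1[of x] by (cases "x \<in> ball x0 r") auto
  qed
  have m2: "(LINT x|M. (norm ((u x - c) *\<^sub>R grad z x))\<^sup>2) \<le> (LINT x|M. (D / r)\<^sup>2 * (indicator (?B) x * (u x - c)\<^sup>2))"
  proof (rule integral_mono[OF j2])
    show "integrable M (\<lambda>x. (D / r)\<^sup>2 * (indicator (?B) x * (u x - c)\<^sup>2))"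
      using sq_int_integrable[OF sq_int_indicator_mult[of "?B", OF _ ucs]]
      by (intro integrable_mult_right) (simp add: power_mult_distrib indicator_power2)
    show "(norm ((u x - c) *\<^sub>R grad z x))\<^sup>2 \<le> (D / r)\<^sup>2 * (indicator (?B) x * (u x - c)\<^sup>2)" for x
    proof (cases "x \<in> ?B")
      case True
      have "(norm (grad z x))\<^sup>2 \<le> (D / r)\<^sup>2" using D(2)[of x] by (intro power_mono) (auto simp: z_def)
      from mult_left_mono[OF this, of "(u x - c)\<^sup>2"] show ?thesis
        using True by (simp add: power_mult_distrib mult.commute[of "(D / r)\<^sup>2"] del: power_divide)
    qed (use z0(2) in simp)
  qed
  have m3: "(LINT x|M. (z x)\<^sup>2) \<le> measure lborel (?B)"
  proof -
    have "(LINT x|M. (z x)\<^sup>2) \<le> (LINT x|M. indicator (?B) x)"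
    proof (rule integral_mono[OF j3])
      show "integrable M (indicator (?B) :: _ \<Rightarrow> real)"
        using sq_int_integrable[OF sq_int_indicator[of "?B"]] by (simp add: indicator_power2)
      show "(z x)\<^sup>2 \<le> indicator (?B) x" for x
        using zr[of x] z0(1)[of x] by (cases "x \<in> ?B") (auto simp: power_le_one)
    qed
    also have "\<dots> = (LINT x|lborel. indicator (?B) x)"
      using sub by (intro integral_lebesgue_on_eq_lborel) (auto simp: indicator_def intro!: borel_measurable_indicator)
    finally show ?thesis by simp
  qed
  have "a1 / 4 * (LINT x|M. indicator (ball x0 r) x * (norm (du x))\<^sup>2)
      \<le> (2 * a2 + 1) * ((D / r)\<^sup>2 * (LINT x|M. indicator (?B) x * (u x - c)\<^sup>2))
        + (1 + 1 / a1) * s\<^sup>2 * measure lborel (?B)"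
  proof -
    have "a1 / 4 * (LINT x|M. indicator (ball x0 r) x * (norm (du x))\<^sup>2) \<le> a1 / 4 * (LINT x|M. (norm (z x *\<^sub>R du x))\<^sup>2)"
      using m1 a1_pos by (intro mult_left_mono) auto
    moreover have "(2 * a2 + 1) * (LINT x|M. (norm ((u x - c) *\<^sub>R grad z x))\<^sup>2)
        \<le> (2 * a2 + 1) * ((D / r)\<^sup>2 * (LINT x|M. indicator (?B) x * (u x - c)\<^sup>2))"
      using m2 a2_pos by (intro mult_left_mono) auto
    moreover have "(1 + 1 / a1) * s\<^sup>2 * (LINT x|M. (z x)\<^sup>2) \<le> (1 + 1 / a1) * s\<^sup>2 * measure lborel (?B)"
      using m3 a1_pos by (intro mult_left_mono) auto
    ultimately show ?thesis using main by linarith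
  qed
  then show ?thesis unfolding du_def u_def using a1_pos by (simp add: field_simps)
qed

text \<open>Caccioppoli's inequality is combined with Ehrling's. On a ball where the energy density has
  average \<open>l\<close>, all terms are absorbed on the left except the square of the mean of the gradient norm,
  and in that mean the part below \<open>sqrt (c * l)\<close> is absorbed as well.\<close>

lemma reverse_Hoelder:
  assumes g: "g \<in> H10 \<Omega>" and w: "weakly_H10 (\<lambda>k. T k g) w"
    and s: "AE x in M. norm (Astar x *v wgrad \<Omega> w x) \<le> s" "0 \<le> s"
  obtains l0 c D where "0 < l0" "0 < c" "0 \<le> D" "\<forall>k x r l. 0 < r \<longrightarrow> ball x (6 * (ratio TYPE('n) * r)) \<subseteq> \<Omega> \<longrightarrow> l0 \<le> l
    \<longrightarrow> l * measure lborel (ball x r) \<le> (LINT y|M. indicator (ball x r) y * (norm (wgrad \<Omega> (T k g) y))\<^sup>2)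
    \<longrightarrow> (LINT y|M. indicator (ball x (2 * (ratio TYPE('n) * r))) y * (norm (wgrad \<Omega> (T k g) y))\<^sup>2)
          \<le> l * measure lborel (ball x (2 * (ratio TYPE('n) * r)))
    \<longrightarrow> l * measure lborel (ball x r) \<le> (LINT y|M. indicator (ball x (6 * (ratio TYPE('n) * r))) y *
          (D * (sqrt l * (if c * l < (norm (wgrad \<Omega> (T k g) y))\<^sup>2 then norm (wgrad \<Omega> (T k g) y) else 0))))"
proof -
  let ?N = "CARD('n)"
  define \<kappa> where "\<kappa> = ratio TYPE('n)"
  have \<kappa>: "4 \<le> \<kappa>" unfolding \<kappa>_def by (rule ratio_ge)
  obtain C0 where C0: "0 \<le> C0" "\<And>c r (x::real^'n). 0 < r \<Longrightarrow> norm (grad (cutoff c r) x) \<le> C0 / r"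
    using cutoff_gradient_bound by auto
  define C1 where "C1 = 4 / a1 * ((2 * a2 + 1) * C0\<^sup>2)"
  define C2 where "C2 = 4 / a1 * ((1 + 1 / a1) * s\<^sup>2)"
  have C12: "0 \<le> C1" "0 \<le> C2" using a1_pos a2_pos by (auto simp: C1_def C2_def)
  \<comment> \<open>The coefficient of \<open>d\<^sup>2 * (l * V)\<close> once the energy on the
    ball of radius \<open>2 * (\<kappa> * r)\<close> is bounded by its mean; the following choice of
    \<open>d\<close> makes this term at most a quarter of \<open>l * V\<close>.\<close>
  define q where "q = C1 * (2 * \<kappa>\<^sup>2) * (2 * \<kappa>) ^ ?N"
  have q: "0 \<le> q" using C12 \<kappa> by (simp add: q_def)
  define d where "d = 1 / (1 + 4 * q)"
  have d: "0 < d" "d \<le> 1" using q by (auto simp: d_def)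
  have dq: "q * d\<^sup>2 \<le> 1 / 4"
  proof -
    have "q * d\<^sup>2 \<le> q * d" using d q by (intro mult_left_mono) (auto simp: power2_eq_square mult_left_le)
    also have "\<dots> \<le> 1 / 4" using q by (simp add: d_def field_simps)
    finally show ?thesis .
  qed
  define C3 where "C3 = 2 * C1 * Ehrling_const d * \<kappa>\<^sup>2 / \<kappa> ^ ?N"
  have C3: "0 \<le> C3" using C12 \<kappa> by (simp add: C3_def Ehrling_const_def)
  \<comment> \<open>Chosen such that the part of the gradient norm below
    \<open>sqrt (c * l)\<close>, integrated over the ball of radius
    \<open>6 * (\<kappa> * r)\<close>, costs at most half of the left-hand side.\<close>
  define c where "c = (1 / (2 * (1 + sqrt C3 * (6 * \<kappa>) ^ ?N)))\<^sup>2"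
  have cp: "0 < 1 + sqrt C3 * (6 * \<kappa>) ^ ?N" using C3 \<kappa> by (intro add_pos_nonneg) auto
  have c: "0 < c" using cp by (auto simp: c_def)
  have cs: "sqrt C3 * (sqrt c * (6 * \<kappa>) ^ ?N) \<le> 1 / 2"
    using cp by (simp add: c_def real_sqrt_divide real_sqrt_power field_simps)
  \<comment> \<open>From this level on, the term stemming from the bounded limit flux is at most a
    quarter of \<open>l * V\<close>.\<close>
  define l0 where "l0 = 1 + 4 * C2 * \<kappa> ^ ?N"
  have l0: "0 < l0" using C12 \<kappa> by (auto simp: l0_def intro!: add_pos_nonneg)
  have main: "l * measure lborel (ball x r) \<le> (LINT y|M. indicator (ball x (6 * (\<kappa> * r))) y *
          (2 * sqrt C3 * (sqrt l * (if c * l < (norm (wgrad \<Omega> (T k g) y))\<^sup>2 then norm (wgrad \<Omega> (T k g) y) else 0))))"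
    if r: "0 < r" and sub: "ball x (6 * (\<kappa> * r)) \<subseteq> \<Omega>" and l: "l0 \<le> l"
      and h1: "l * measure lborel (ball x r) \<le> (LINT y|M. indicator (ball x r) y * (norm (wgrad \<Omega> (T k g) y))\<^sup>2)"
      and h2: "(LINT y|M. indicator (ball x (2 * (\<kappa> * r))) y * (norm (wgrad \<Omega> (T k g) y))\<^sup>2)
          \<le> l * measure lborel (ball x (2 * (\<kappa> * r)))" for k x r l
  proof -
    have lp: "0 < l" using l l0 by linarith
    have \<kappa>r: "0 < \<kappa> * r" using \<kappa> r by simp
    define du where "du = wgrad \<Omega> (T k g)"
    let ?B = "ball x (6 * (\<kappa> * r))" and ?high = "\<lambda>y. if c * l < (norm (du y))\<^sup>2 then norm (du y) else 0"
    have dus: "du \<in> sq_int M" unfolding du_def by (rule H10_sq_int(2)[OF T(1)[OF g]])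
    define V where "V = measure lborel (ball x r)"
    have V: "0 < V" using r by (simp add: V_def content_ball_pos)
    have Vs: "measure lborel (ball x (t * r)) = t ^ ?N * V" if "0 \<le> t" for t
      unfolding V_def using that r by (intro measure_ball_scale) auto
    define J where "J = (LINT y|M. indicator (?B) y * norm (du y))"
    define J' where "J' = (LINT y|M. indicator (?B) y * ?high y)"
    define I where "I = (LINT y|M. indicator (ball x (2 * (\<kappa> * r))) y * (norm (du y))\<^sup>2)"
    have sub1: "ball x (\<kappa> * r) \<subseteq> \<Omega>" using sub subset_ball[of "\<kappa> * r" "6 * (\<kappa> * r)" x] \<kappa>r by auto
    obtain m where m: "(LINT y|M. indicator (ball x (\<kappa> * r)) y * (T k g y - m)\<^sup>2)
      \<le> 2 * d\<^sup>2 * (\<kappa> * r)\<^sup>2 * I + Ehrling_const d * (\<kappa> * r)\<^sup>2 / measure lborel (ball x (\<kappa> * r)) * J\<^sup>2"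
      using Ehrling_H10[OF H10_gradient[OF T(1)[OF g]] \<kappa>r d sub] unfolding I_def J_def du_def by blast
    \<comment> \<open>Caccioppoli's inequality with the constant \<open>m\<close> supplied by
      Ehrling's inequality on the ball of radius \<open>\<kappa> * r\<close>.\<close>
    have "l * V \<le> 4 / a1 * ((2 * a2 + 1) * (C0 / r)\<^sup>2 * (LINT y|M. indicator (ball x (\<kappa> * r)) y * (T k g y - m)\<^sup>2)
      + (1 + 1 / a1) * s\<^sup>2 * measure lborel (ball x (\<kappa> * r)))"
      using h1 Caccioppoli[OF g w s r sub1[unfolded \<kappa>_def] C0(1) C0(2)[OF r], of k m] unfolding \<kappa>_def V_def by linarith
    also have "\<dots> \<le> 4 / a1 * ((2 * a2 + 1) * (C0 / r)\<^sup>2 * (2 * d\<^sup>2 * (\<kappa> * r)\<^sup>2 * I + Ehrling_const d * (\<kappa> * r)\<^sup>2 / (\<kappa> ^ ?N * V) * J\<^sup>2)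
      + (1 + 1 / a1) * s\<^sup>2 * (\<kappa> ^ ?N * V))"
      using m Vs[of \<kappa>] \<kappa> a1_pos a2_pos by (intro mult_left_mono add_mono) auto
    also have "\<dots> = C1 * (2 * \<kappa>\<^sup>2) * d\<^sup>2 * I + C3 / 2 * J\<^sup>2 / V + C2 * \<kappa> ^ ?N * V"
      using r V \<kappa> a1_pos by (simp add: C1_def C2_def C3_def field_simps)
    also have "C1 * (2 * \<kappa>\<^sup>2) * d\<^sup>2 * I \<le> C1 * (2 * \<kappa>\<^sup>2) * d\<^sup>2 * (l * ((2 * \<kappa>) ^ ?N * V))"
    proof (intro mult_left_mono)
      show "I \<le> l * ((2 * \<kappa>) ^ ?N * V)"
        using h2 Vs[of "2 * \<kappa>"] \<kappa> by (simp add: I_def du_def mult.assoc)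
    qed (use C12 in auto)
    also have "\<dots> = q * d\<^sup>2 * (l * V)" by (simp add: q_def)
    also have "\<dots> \<le> 1 / 4 * (l * V)" using dq lp V by (intro mult_right_mono) auto
    also have "C2 * \<kappa> ^ ?N * V \<le> 1 / 4 * (l * V)"
    proof -
      have "C2 * \<kappa> ^ ?N \<le> 1 / 4 * l" using l by (simp add: l0_def)
      then show ?thesis using V by (simp add: mult_right_mono)
    qed
    \<comment> \<open>Two quarters of \<open>l * V\<close> are absorbed, which doubles the
      coefficient \<open>C3 / 2\<close>.\<close>
    finally have "l * V \<le> C3 * J\<^sup>2 / V" using V by (simp add: field_simps)
    then have lV2: "l * V\<^sup>2 \<le> C3 * J\<^sup>2" using V by (simp add: field_simps power2_eq_square)
    have J0: "0 \<le> J" unfolding J_def by (rule Bochner_Integration.integral_nonneg) simp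
    have lV: "sqrt l * V \<le> sqrt C3 * J"
      using real_sqrt_le_mono[OF lV2] V J0 by (simp add: real_sqrt_mult)
    have i0: "integrable M (\<lambda>y. indicator (?B) y * norm (du y))"
      using sq_int_mult_integrable[OF sq_int_indicator[of "?B"] dus] by simp
    have i1: "integrable M (indicator (?B) :: _ \<Rightarrow> real)"
      using sq_int_integrable[OF sq_int_indicator[of "?B"]] by (simp add: indicator_power2)
    have i2: "integrable M (\<lambda>y. indicator (?B) y * ?high y)"
    proof (rule Bochner_Integration.integrable_bound[OF i0])
      have [measurable]: "du \<in> borel_measurable M" by (rule sq_int_measurable[OF dus])
      have [measurable]: "(indicator (?B) :: _ \<Rightarrow> real) \<in> borel_measurable M"
        by (rule borel_measurable_integrable[OF i1])
      show "(\<lambda>y. indicator (?B) y * ?high y) \<in> borel_measurable M"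
        by measurable
    qed (auto simp: indicator_def)
    have "J \<le> (LINT y|M. sqrt (c * l) * indicator (?B) y
        + indicator (?B) y * ?high y)"
      unfolding J_def
    proof (rule integral_mono[OF i0 Bochner_Integration.integrable_add[OF integrable_mult_right[OF i1] i2]])
      fix y
      have "norm (du y) \<le> sqrt (c * l)" if "\<not> c * l < (norm (du y))\<^sup>2"
        using that by (intro real_le_rsqrt) simp
      moreover have "0 \<le> sqrt (c * l)" using c lp by simp
      ultimately show "indicator (?B) y * norm (du y) \<le> sqrt (c * l) * indicator (?B) y
        + indicator (?B) y * ?high y"
        by (auto simp: indicator_def)
    qed
    also have "\<dots> = sqrt (c * l) * (LINT y|M. indicator (?B) y) + J'"
      unfolding J'_def using i1 i2 by simp
    also have "(LINT y|M. indicator (?B) y) = (LINT y|lborel. indicator (?B) y :: real)"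
      using sub by (intro integral_lebesgue_on_eq_lborel) (auto simp: indicator_def intro!: borel_measurable_indicator)
    also have "\<dots> = (6 * \<kappa>) ^ ?N * V" using Vs[of "6 * \<kappa>"] \<kappa> by (simp add: mult.assoc)
    finally have "sqrt C3 * J \<le> sqrt C3 * (sqrt (c * l) * ((6 * \<kappa>) ^ ?N * V) + J')"
      using C3 by (intro mult_left_mono) auto
    also have "\<dots> = sqrt C3 * (sqrt c * (6 * \<kappa>) ^ ?N) * (sqrt l * V) + sqrt C3 * J'"
      by (simp add: real_sqrt_mult algebra_simps)
    also have "sqrt C3 * (sqrt c * (6 * \<kappa>) ^ ?N) * (sqrt l * V) \<le> 1 / 2 * (sqrt l * V)"
      using cs V lp by (intro mult_right_mono) auto
    finally have "sqrt l * V \<le> 2 * sqrt C3 * J'" using lV by simp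
    \<comment> \<open>Restoring a factor \<open>sqrt l\<close> keeps the estimate linear in the
      truncated gradient norm, the form needed for summing over levels.\<close>
    then have "sqrt l * (sqrt l * V) \<le> sqrt l * (2 * sqrt C3 * J')" using lp by (intro mult_left_mono) auto
    also have "sqrt l * (sqrt l * V) = l * V" using lp by simp
    also have "sqrt l * (2 * sqrt C3 * J') = (LINT y|M. indicator (?B) y *
          (2 * sqrt C3 * (sqrt l * ?high y)))"
      unfolding J'_def by (simp only: integral_mult_right_zero[symmetric] mult_ac)
    finally show ?thesis unfolding V_def du_def .
  qed
  show ?thesis
    by (rule that[of l0 c "2 * sqrt C3"]) (use l0 c C3 in \<open>simp_all add: main[unfolded \<kappa>_def]\<close>)
qed

text \<open>\<open>L\<close> can be chosen independently of \<open>k\<close> because the total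
  energies are bounded by one \<open>Q0\<close>. The starting level \<open>l1\<close> is so high
  that energy \<open>Q0\<close> cannot give a ball of radius \<open>R / (5 * K)\<close> the mean
  \<open>l1\<close>, and the energy above \<open>l1 * 4 ^ m\<close> is at most
  \<open>Q / m\<close>.\<close>

theorem corrector_equi_integrable:
  assumes g: "g \<in> H10 \<Omega>" and w: "weakly_H10 (\<lambda>k. T k g) w"
    and s: "AE x in M. norm (Astar x *v wgrad \<Omega> w x) \<le> s" "0 \<le> s"
    and S: "S \<in> sets lebesgue" and R: "0 < R" "\<And>x. x \<in> S \<Longrightarrow> ball x R \<subseteq> \<Omega>" and e: "0 < e"
  shows "\<exists>L. \<forall>k. (LINT x|M. indicator (S \<inter> {x. L < indicator \<Omega> x * (norm (wgrad \<Omega> (T k g) x))\<^sup>2}) x * (norm (wgrad \<Omega> (T k g) x))\<^sup>2) \<le> e"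
proof -
  define \<kappa> where "\<kappa> = ratio TYPE('n)"
  have \<kappa>: "4 \<le> \<kappa>" unfolding \<kappa>_def by (rule ratio_ge)
  obtain l0 c D where l0: "0 < l0" "0 < c" "0 \<le> D" and RH: "\<forall>k x r l. 0 < r \<longrightarrow> ball x (6 * (\<kappa> * r)) \<subseteq> \<Omega> \<longrightarrow> l0 \<le> l
    \<longrightarrow> l * measure lborel (ball x r) \<le> (LINT y|M. indicator (ball x r) y * (norm (wgrad \<Omega> (T k g) y))\<^sup>2)
    \<longrightarrow> (LINT y|M. indicator (ball x (2 * (\<kappa> * r))) y * (norm (wgrad \<Omega> (T k g) y))\<^sup>2)
          \<le> l * measure lborel (ball x (2 * (\<kappa> * r)))
    \<longrightarrow> l * measure lborel (ball x r) \<le> (LINT y|M. indicator (ball x (6 * (\<kappa> * r))) y *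
          (D * (sqrt l * (if c * l < (norm (wgrad \<Omega> (T k g) y))\<^sup>2 then norm (wgrad \<Omega> (T k g) y) else 0))))"
    by (rule reverse_Hoelder[OF g w s, folded \<kappa>_def])
  \<comment> \<open>The reverse Hoelder inequality integrates over the ball of radius
    \<open>6 * (\<kappa> * r)\<close>.\<close>
  define K where "K = 6 * \<kappa>"
  have K: "1 \<le> K" using \<kappa> by (simp add: K_def)
  define V0 where "V0 = measure lborel (ball (0::real^'n) (R / (5 * K)))"
  have V0: "0 < V0" unfolding V0_def using R K by (intro content_ball_pos) auto
  define Q0 where "Q0 = (1 / a1 * l2 M (wgrad \<Omega> g))\<^sup>2"
  have Q0: "0 \<le> Q0" by (simp add: Q0_def)
  define l1 where "l1 = l0 + (Q0 + 1) / V0"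
  have l1: "l0 \<le> l1" "0 < l1" "Q0 < l1 * V0"
  proof -
    have "0 < (Q0 + 1) / V0" using Q0 V0 by simp
    then show "l0 \<le> l1" "0 < l1" using l0 by (auto simp: l1_def)
    have "l1 * V0 = l0 * V0 + (Q0 + 1)" using V0 by (simp add: l1_def field_simps)
    moreover have "0 < l0 * V0" using l0 V0 by simp
    ultimately show "Q0 < l1 * V0" by linarith
  qed
  define D' where "D' = (5 * K) ^ CARD('n) * D"
  have D': "0 \<le> D'" using K l0 by (simp add: D'_def)
  define Q where "Q = 2 * D' / sqrt c * Q0"
  have Q: "0 \<le> Q" using D' l0 Q0 by (simp add: Q_def)
  \<comment> \<open>The number of levels after which \<open>Q / m\<close> falls below
    \<open>e\<close>.\<close>
  obtain m :: nat where m: "Q / e < real m" using reals_Archimedean2 by blast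
  then have m0: "0 < real m" using Q e by (meson divide_nonneg_pos le_less_trans)
  show ?thesis
  proof (intro exI[of _ "l1 * 4 ^ m"] allI)
    fix k
    define du where "du = wgrad \<Omega> (T k g)"
    have dus: "du \<in> sq_int M" unfolding du_def by (rule H10_sq_int(2)[OF T(1)[OF g]])
    have [measurable]: "du \<in> borel_measurable M" by (rule sq_int_measurable[OF dus])
    define f where "f x = indicator \<Omega> x * (norm (du x))\<^sup>2" for x
    have nn: "(\<integral>\<^sup>+x\<in>A. ennreal (f x) \<partial>lebesgue) = ennreal (LINT x|M. indicator A x * (norm (du x))\<^sup>2)"
      if "A \<in> sets lebesgue" for A
      unfolding f_def by (rule set_nn_integral_extended[OF sq_int_integrable[OF dus] _ that]) simp
    have total: "(\<integral>\<^sup>+x. ennreal (f x) \<partial>lebesgue) \<le> ennreal Q0"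
    proof -
      have "(\<integral>\<^sup>+x. ennreal (f x) \<partial>lebesgue) = ennreal ((l2 M du)\<^sup>2)"
        using nn[of UNIV] by (simp add: l2_power2)
      also have "(l2 M du)\<^sup>2 \<le> Q0" unfolding Q0_def du_def by (intro power_mono T_bound g) auto
      finally show ?thesis by (simp add: ennreal_leI)
    qed
    interpret integrable_density f
    proof
      show "f \<in> borel_measurable lebesgue"
        unfolding f_def[abs_def] by (intro indicator_extension_measurable) measurable
      show "0 \<le> f x" for x by (simp add: f_def)
      show "(\<integral>\<^sup>+x. ennreal (f x) \<partial>lebesgue) < top" using total by (rule le_less_trans) simp
    qed
    have mass_eq: "mass A = ennreal (LINT x|M. indicator A x * (norm (du x))\<^sup>2)" if "A \<in> sets lebesgue" for A
      unfolding mass_def by (rule nn[OF that])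
    have mass_UNIV: "mass UNIV \<le> ennreal Q0" using total by (simp add: mass_def)
    have i0: "0 \<le> (LINT x|M. indicator A x * (norm (du x))\<^sup>2)" for A :: "(real^'n) set"
      by (rule Bochner_Integration.integral_nonneg) simp
    have level: "mass (S \<inter> {x. l1 * 4 ^ j < f x})
      \<le> (\<integral>\<^sup>+y. ennreal (D' * (sqrt (l1 * 4 ^ j) * (if c * (l1 * 4 ^ j) < f y then sqrt (f y) else 0))) \<partial>lebesgue)" for j
    proof -
      define l where "l = l1 * 4 ^ j"
      have "l1 * 1 \<le> l" unfolding l_def using l1 by (intro mult_left_mono) auto
      then have l: "l1 \<le> l" "0 < l" "l0 \<le> l" using l1 by auto
      let ?h = "\<lambda>y. D * (sqrt l * (if c * l < f y then sqrt (f y) else 0))"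
      let ?p = "\<lambda>y. D * (sqrt l * (if c * l < (norm (du y))\<^sup>2 then norm (du y) else 0))"
      have hp: "?h y = indicator \<Omega> y * ?p y" for y
        using l(2) l0(2) by (auto simp: f_def indicator_def not_less)
      have p0: "0 \<le> ?p y" for y using l0 l by simp
      have ip: "integrable M ?p"
      proof (intro integrable_mult_right)
        show "integrable M (\<lambda>y. if c * l < (norm (du y))\<^sup>2 then norm (du y) else 0)"
          by (rule Bochner_Integration.integrable_bound[OF sq_int_mult_integrable[OF sq_int_const[of "1::real"] dus]])
            auto
      qed
      have "mass (S \<inter> {x. l < f x}) \<le> ennreal ((5 * K) ^ CARD('n)) * (\<integral>\<^sup>+y. ennreal (?h y) \<partial>lebesgue)"
      proof (rule level_set_estimate[OF S l(2) R(1) K])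
        show "(\<lambda>y. ennreal (?h y)) \<in> borel_measurable lebesgue" by measurable
        have "mass UNIV \<le> ennreal Q0" by (rule mass_UNIV)
        also have "\<dots> < ennreal (l1 * V0)" using l1(3) Q0 by (intro ennreal_lessI) auto
        also have "\<dots> \<le> ennreal (l * V0)" using l V0 by (intro ennreal_leI mult_right_mono) auto
        finally show "mass UNIV < ennreal (l * measure lborel (ball (0::real^'n) (R / (5 * K))))" by (simp add: V0_def)
      next
        fix x r assume x: "x \<in> S" and r: "0 < r" "5 * K * r \<le> R"
          and h1: "ennreal (l * measure lborel (ball x r)) \<le> mass (ball x r)"
          and h2: "\<And>s. 2 * r \<le> s \<Longrightarrow> s \<le> R \<Longrightarrow> mass (ball x s) \<le> ennreal (l * measure lborel (ball x s))"
        have \<kappa>r: "4 * r \<le> \<kappa> * r" using \<kappa> r by simp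
        have rR: "6 * (\<kappa> * r) \<le> R" "2 * r \<le> 2 * (\<kappa> * r)" "2 * (\<kappa> * r) \<le> R" using r \<kappa>r by (simp_all add: K_def mult.assoc) (use r(1) \<kappa>r in linarith)+
        have sub: "ball x (6 * (\<kappa> * r)) \<subseteq> \<Omega>" using subset_ball[OF rR(1), of x] R(2)[OF x] by blast
        have a: "l * measure lborel (ball x r) \<le> (LINT y|M. indicator (ball x r) y * (norm (du y))\<^sup>2)"
          using h1 i0 by (simp add: mass_eq)
        have b: "(LINT y|M. indicator (ball x (2 * (\<kappa> * r))) y * (norm (du y))\<^sup>2) \<le> l * measure lborel (ball x (2 * (\<kappa> * r)))"
          using h2[OF rR(2,3)] l(2) by (simp add: mass_eq)
        have "l * measure lborel (ball x r) \<le> (LINT y|M. indicator (ball x (6 * (\<kappa> * r))) y * ?p y)"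
          using RH[rule_format, OF r(1) sub l(3) a[unfolded du_def] b[unfolded du_def]] by (simp only: du_def)
        then have "ennreal (l * measure lborel (ball x r)) \<le> ennreal (LINT y|M. indicator (ball x (6 * (\<kappa> * r))) y * ?p y)"
          by (rule ennreal_leI)
        also have "\<dots> = (\<integral>\<^sup>+y\<in>ball x (6 * (\<kappa> * r)). ennreal (indicator \<Omega> y * ?p y) \<partial>lebesgue)"
          by (rule set_nn_integral_extended[OF ip p0, symmetric]) simp
        finally show "ennreal (l * measure lborel (ball x r)) \<le> (\<integral>\<^sup>+y\<in>ball x (K * r). ennreal (?h y) \<partial>lebesgue)"
          unfolding hp by (simp add: K_def mult.assoc)
      qed
      also have "\<dots> = (\<integral>\<^sup>+y. ennreal ((5 * K) ^ CARD('n)) * ennreal (?h y) \<partial>lebesgue)"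
        by (rule nn_integral_cmult[symmetric]) measurable
      also have "\<dots> = (\<integral>\<^sup>+y. ennreal (D' * (sqrt l * (if c * l < f y then sqrt (f y) else 0))) \<partial>lebesgue)"
      proof (rule nn_integral_cong)
        fix y
        have "0 \<le> ?h y" using p0[of y] by (simp only: hp) simp
        then show "ennreal ((5 * K) ^ CARD('n)) * ennreal (?h y) = ennreal (D' * (sqrt l * (if c * l < f y then sqrt (f y) else 0)))"
          using K by (simp add: ennreal_mult[symmetric] D'_def mult.assoc)
      qed
      finally show ?thesis by (simp only: l_def)
    qed
    define A where "A = S \<inter> {x. l1 * 4 ^ m < f x}"
    have A: "A \<in> sets lebesgue"
    proof -
      have "{x. l1 * 4 ^ m < f x} \<in> sets lebesgue" using borel_measurable_less[of "\<lambda>x. l1 * 4 ^ m" lebesgue f] by simp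
      with S show ?thesis by (simp add: A_def)
    qed
    have "of_nat m * mass A \<le> ennreal (2 * D' / sqrt c) * mass UNIV"
      unfolding A_def by (rule high_level_mass_bound[OF l1(2) l0(2) D' level])
    also have "\<dots> \<le> ennreal (2 * D' / sqrt c) * ennreal Q0" by (intro mult_left_mono mass_UNIV) simp
    also have "\<dots> = ennreal Q" using D' l0 Q0 by (simp add: Q_def ennreal_mult[symmetric])
    finally have "ennreal (real m * (LINT x|M. indicator A x * (norm (du x))\<^sup>2)) \<le> ennreal Q"
      using i0[of A] by (simp add: mass_eq[OF A] ennreal_mult ennreal_of_nat_eq_real_of_nat)
    then have "real m * (LINT x|M. indicator A x * (norm (du x))\<^sup>2) \<le> Q" using Q by simp
    also have "Q \<le> real m * e" using m e by (simp add: field_simps)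
    finally have "(LINT x|M. indicator A x * (norm (du x))\<^sup>2) \<le> e" using m0 by simp
    then show "(LINT x|M. indicator (S \<inter> {x. l1 * 4 ^ m < indicator \<Omega> x * (norm (wgrad \<Omega> (T k g) x))\<^sup>2}) x
        * (norm (wgrad \<Omega> (T k g) x))\<^sup>2) \<le> e"
      by (simp only: A_def f_def du_def)
  qed
qed

end

section \<open>Limit of the energies weighted by a bounded measurable function\<close>

lemma tendsto_of_uniform_approximation:
  fixes X :: "nat \<Rightarrow> real"
  assumes "\<And>e. 0 < e \<Longrightarrow> \<exists>Z z. Z \<longlonglongrightarrow> z \<and> \<bar>z - l\<bar> \<le> e \<and> (\<forall>k. \<bar>Z k - X k\<bar> \<le> e)"
  shows "X \<longlonglongrightarrow> l"
proof (rule LIMSEQ_I)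
  fix e :: real assume e: "0 < e"
  obtain Z z where Z: "Z \<longlonglongrightarrow> z" "\<bar>z - l\<bar> \<le> e / 4" "\<forall>k. \<bar>Z k - X k\<bar> \<le> e / 4"
    using assms[of "e / 4"] e by auto
  obtain n where n: "\<forall>k\<ge>n. norm (Z k - z) < e / 4" using LIMSEQ_D[OF Z(1), of "e / 4"] e by auto
  have "norm (X k - l) < e" if "n \<le> k" for k
    using n[rule_format, OF that] Z(2) Z(3)[rule_format, of k] e unfolding real_norm_def by linarith
  then show "\<exists>n. \<forall>k\<ge>n. norm (X k - l) < e" by blast
qed

context h_convergent
begin

text \<open>With \<open>p j\<close> in place of \<open>b\<close>, the weight
  \<open>\<phi> * p j\<close> is a test function and the div-curl lemma applies with both sequences
  equal. The error is uniform in \<open>k\<close>: where the density exceeds \<open>L\<close> it is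
  small by equi-integrability, elsewhere it is controlled by the \<open>L1\<close> distance of
  \<open>p j\<close> and \<open>b\<close> on \<open>K\<close>.\<close>

lemma energy_limit:
  assumes g: "g \<in> H10 \<Omega>" and w: "weakly_H10 (\<lambda>k. T k g) w"
    and s: "AE x in M. norm (Astar x *v wgrad \<Omega> w x) \<le> s" "0 \<le> s"
    and b: "b \<in> borel_measurable M" "AE x in M. \<bar>b x\<bar> \<le> C" and \<phi>: "\<phi> \<in> test_functions \<Omega>"
  shows "(\<lambda>k. LINT x|M. \<phi> x * b x * (a k x * (norm (wgrad \<Omega> (T k g) x))\<^sup>2))
    \<longlonglongrightarrow> (LINT x|M. \<phi> x * b x * ((Astar x *v wgrad \<Omega> w x) \<bullet> wgrad \<Omega> w x))"
proof -
  define B where "B = \<bar>C\<bar>"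
  \<comment> \<open>A version of \<open>b\<close> that is bounded everywhere and measurable on the
    whole space.\<close>
  define b' where "b' x = indicator \<Omega> x * max (- B) (min B (b x))" for x
  have bb': "AE x in M. b x = b' x"
    using b(2) AE_space by eventually_elim (auto simp: b'_def B_def space_restrict_space)
  have [measurable]: "b \<in> borel_measurable M" "a k \<in> borel_measurable M" for k by (rule b(1) a_measurable)+
  have b'm: "b' \<in> borel_measurable lebesgue"
    unfolding b'_def[abs_def] by (intro indicator_extension_measurable) measurable
  have b'B: "\<bar>b' x\<bar> \<le> B" for x by (auto simp: b'_def B_def indicator_def)
  have [measurable]: "b' \<in> borel_measurable M"
    using b'm by (rule measurable_restrict_space1)
  obtain K where K: "compact K" "K \<subseteq> \<Omega>" "\<forall>x. x \<notin> K \<longrightarrow> \<phi> x = 0"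
    using \<phi> by (rule test_functionE)
  have Kb: "K \<in> sets borel" using K(1) by (intro borel_closed compact_imp_closed)
  have [measurable]: "(indicator K :: _ \<Rightarrow> real) \<in> borel_measurable M"
    using sq_int_measurable[OF sq_int_indicator[OF Kb]] .
  \<comment> \<open>A uniform margin around \<open>K\<close>, which the stopping balls
    require.\<close>
  obtain R where R: "0 < R" "(\<Union>x\<in>K. ball x R) \<subseteq> \<Omega>"
    using compact_subset_open_imp_ball_epsilon_subset[OF K(1) open_domain K(2)] by blast
  obtain p where p: "\<And>j::nat. real_polynomial_function (p j)" "\<And>j x. x \<in> K \<Longrightarrow> \<bar>p j x\<bar> \<le> B + 1"
    "AE x in lebesgue. x \<in> K \<longrightarrow> (\<lambda>j. p j x) \<longlonglongrightarrow> b' x"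
    using bounded_measurable_polynomial_approximation[OF b'm b'B K(1)] by blast
  have pc: "AE x in M. x \<in> K \<longrightarrow> (\<lambda>j. p j x) \<longlonglongrightarrow> b' x"
    unfolding AE_lebesgue_on_iff[OF domain_sets] using p(3) by eventually_elim simp
  have \<phi>p: "(\<lambda>x. \<phi> x * p j x) \<in> test_functions \<Omega>" for j
    by (intro test_function_mult_smooth \<phi> smooth_real_polynomial_function p)
  have [measurable]: "\<phi> \<in> borel_measurable M" "p j \<in> borel_measurable M" for j
    by (rule test_function_measurable[OF \<phi>], rule borel_imp_lebesgue_on[OF smooth_borel[OF smooth_real_polynomial_function[OF p(1)]]])
  obtain F where F: "0 \<le> F" "\<And>x. \<bar>\<phi> x\<bar> \<le> F" using test_function_bounded[OF \<phi>] by auto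
  let ?du = "\<lambda>k. wgrad \<Omega> (T k g)" and ?n = "\<lambda>k x. (norm (wgrad \<Omega> (T k g) x))\<^sup>2"
  let ?P = "\<lambda>j k x. \<phi> x * p j x * (a k x * ?n k x)" and ?Q = "\<lambda>k x. \<phi> x * b x * (a k x * ?n k x)"
  note dus = H10_sq_int(2)[OF T(1)[OF g]]
  have wH: "w \<in> H10 \<Omega>" using w by (simp add: weakly_H10_def)
  have [measurable]: "?du k \<in> borel_measurable M" for k by (rule sq_int_measurable[OF dus])
  define \<rho> where "\<rho> x = (Astar x *v wgrad \<Omega> w x) \<bullet> wgrad \<Omega> w x" for x
  have i\<rho>: "integrable M \<rho>"
    unfolding \<rho>_def by (rule sq_int_inner_integrable[OF T_flux_id(1)[OF g w] H10_sq_int(2)[OF wH]])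
  have m\<rho> [measurable]: "\<rho> \<in> borel_measurable M" by (rule borel_measurable_integrable[OF i\<rho>])
  have Y: "(\<lambda>j. LINT x|M. \<phi> x * p j x * \<rho> x) \<longlonglongrightarrow> (LINT x|M. \<phi> x * b x * \<rho> x)"
  proof (rule integral_dominated_convergence[where w = "\<lambda>x. F * (B + 1) * \<bar>\<rho> x\<bar>"])
    show "AE x in M. (\<lambda>j. \<phi> x * p j x * \<rho> x) \<longlonglongrightarrow> \<phi> x * b x * \<rho> x"
      using pc bb'
    proof eventually_elim
      fix x assume x: "x \<in> K \<longrightarrow> (\<lambda>j. p j x) \<longlonglongrightarrow> b' x" "b x = b' x"
      show "(\<lambda>j. \<phi> x * p j x * \<rho> x) \<longlonglongrightarrow> \<phi> x * b x * \<rho> x"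
        using x K(3) by (cases "x \<in> K") (auto intro!: tendsto_intros)
    qed
    show "AE x in M. norm (\<phi> x * p j x * \<rho> x) \<le> F * (B + 1) * \<bar>\<rho> x\<bar>" for j
    proof (rule AE_I2)
      fix x show "norm (\<phi> x * p j x * \<rho> x) \<le> F * (B + 1) * \<bar>\<rho> x\<bar>"
        using F p(2)[of x j] K(3) by (cases "x \<in> K") (auto simp: abs_mult B_def intro!: mult_mono)
    qed
  qed (use i\<rho> in auto)
  have \<delta>: "(\<lambda>j. LINT x|M. indicator K x * \<bar>p j x - b' x\<bar>) \<longlonglongrightarrow> (LINT x|M. 0)"
  proof (rule integral_dominated_convergence[where w = "\<lambda>x. 2 * B + 1"])
    show "AE x in M. (\<lambda>j. indicator K x * \<bar>p j x - b' x\<bar>) \<longlonglongrightarrow> 0"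
      using pc
    proof eventually_elim
      fix x assume x: "x \<in> K \<longrightarrow> (\<lambda>j. p j x) \<longlonglongrightarrow> b' x"
      show "(\<lambda>j. indicator K x * \<bar>p j x - b' x\<bar>) \<longlonglongrightarrow> 0"
      proof (cases "x \<in> K")
        case True
        with x have "(\<lambda>j. \<bar>p j x - b' x\<bar>) \<longlonglongrightarrow> \<bar>b' x - b' x\<bar>" by (intro tendsto_intros) auto
        with True show ?thesis by simp
      qed simp
    qed
    show "AE x in M. norm (indicator K x * \<bar>p j x - b' x\<bar>) \<le> 2 * B + 1" for j
    proof (rule AE_I2)
      fix x show "norm (indicator K x * \<bar>p j x - b' x\<bar>) \<le> 2 * B + 1"
        using p(2)[of x j] b'B[of x] by (cases "x \<in> K") auto
    qed
    show "integrable M (\<lambda>x. 2 * B + 1)" using finite_measure.integrable_const[OF finite_measure_domain] .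
  qed auto
  show ?thesis
  proof (rule tendsto_of_uniform_approximation)
    fix e :: real assume e: "0 < e"
    have B: "0 \<le> B" by (simp add: B_def)
    have Fa: "0 \<le> F * a2" using F(1) a2_pos by simp
    \<comment> \<open>Each of the two error terms receives half of \<open>e\<close>. The level
      \<open>L\<close> is fixed by \<open>e1\<close>, and only then is \<open>j\<close> chosen,
      depending on \<open>L\<close>.\<close>
    define e1 where "e1 = e / (2 * (F * a2 * (2 * B + 1) + 1))"
    have e1: "0 < e1" "F * a2 * ((2 * B + 1) * e1) \<le> e / 2"
    proof -
      define t where "t = F * a2 * (2 * B + 1)"
      have t: "0 \<le> t" unfolding t_def using Fa B by simp
      show "0 < e1" unfolding e1_def t_def[symmetric] using t e by simp
      have "t * e1 \<le> e / 2" unfolding e1_def t_def[symmetric] using t e by (simp add: field_simps)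
      then show "F * a2 * ((2 * B + 1) * e1) \<le> e / 2" by (simp add: t_def mult.assoc)
    qed
    define A where "A L k = K \<inter> {x. L < indicator \<Omega> x * ?n k x}" for L k
    have KR: "\<And>x. x \<in> K \<Longrightarrow> ball x R \<subseteq> \<Omega>" using R(2) by blast
    have "K \<in> sets lebesgue" using Kb by simp
    from corrector_equi_integrable[OF g w s this R(1) KR e1(1)]
    obtain L where L: "\<forall>k. (LINT x|M. indicator (A L k) x * ?n k x) \<le> e1"
      unfolding A_def by auto
    define t where "t = F * a2 * \<bar>L\<bar>"
    have t: "0 \<le> t" unfolding t_def using Fa by simp
    have "0 < e / (2 * (t + 1))" using e t by simp
    from LIMSEQ_D[OF \<delta> this] LIMSEQ_D[OF Y e]
    obtain j where j: "\<bar>LINT x|M. indicator K x * \<bar>p j x - b' x\<bar>\<bar> < e / (2 * (t + 1))"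
      "\<bar>(LINT x|M. \<phi> x * p j x * \<rho> x) - (LINT x|M. \<phi> x * b x * \<rho> x)\<bar> < e"
      by (auto simp: real_norm_def) (meson nle_le)
    have tj: "t * (LINT x|M. indicator K x * \<bar>p j x - b' x\<bar>) \<le> e / 2"
    proof -
      have "t * (LINT x|M. indicator K x * \<bar>p j x - b' x\<bar>) \<le> t * (e / (2 * (t + 1)))"
        using j(1) t by (intro mult_left_mono) auto
      also have "\<dots> \<le> e / 2" using t e by (simp add: field_simps)
      finally show ?thesis .
    qed
    have iK: "integrable M (\<lambda>x. indicator K x * \<bar>p j x - b' x\<bar>)"
    proof (rule Bochner_Integration.integrable_bound[OF finite_measure.integrable_const[OF finite_measure_domain, of "2 * B + 1"]])
      show "AE x in M. norm (indicator K x * \<bar>p j x - b' x\<bar>) \<le> norm (2 * B + 1)"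
      proof (rule AE_I2)
        fix x show "norm (indicator K x * \<bar>p j x - b' x\<bar>) \<le> norm (2 * B + 1)"
          using p(2)[of x j] b'B[of x] B by (cases "x \<in> K") auto
      qed
    qed measurable
    have close: "\<bar>(LINT x|M. ?P j k x) - (LINT x|M. ?Q k x)\<bar> \<le> e" for k
    proof -
      have du2: "integrable M (\<lambda>x. ?n k x)" by (rule sq_int_integrable[OF dus])
      have Am [measurable]: "(indicator (A L k) :: _ \<Rightarrow> real) \<in> borel_measurable M"
      proof -
        have [measurable]: "(\<lambda>x. indicator \<Omega> x * ?n k x) \<in> borel_measurable lebesgue"
          by (rule indicator_extension_measurable) measurable
        have "{x \<in> space lebesgue. L < indicator \<Omega> x * ?n k x} \<in> sets lebesgue" by measurable
        then have "A L k \<in> sets lebesgue" using Kb by (auto simp: A_def)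
        then show ?thesis by (intro measurable_restrict_space1 borel_measurable_indicator)
      qed
      have i0: "integrable M (\<lambda>x. q x * (a k x * ?n k x))"
        if "q \<in> borel_measurable M" "AE x in M. \<bar>q x\<bar> \<le> F * (B + 1)" for q
        using bounded_inner_integrable[OF that flux_sq_int[OF dus, of k k] dus] by (simp add: power2_norm_eq_inner)
      have i1: "integrable M (\<lambda>x. ?P j k x)"
      proof (rule i0)
        show "AE x in M. \<bar>\<phi> x * p j x\<bar> \<le> F * (B + 1)"
        proof (rule AE_I2)
          fix x show "\<bar>\<phi> x * p j x\<bar> \<le> F * (B + 1)"
            using F p(2)[of x j] K(3) B by (cases "x \<in> K") (auto simp: abs_mult intro!: mult_mono)
        qed
      qed measurable
      have i2: "integrable M (\<lambda>x. ?Q k x)"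
      proof (rule i0)
        show "AE x in M. \<bar>\<phi> x * b x\<bar> \<le> F * (B + 1)"
          using bb'
        proof eventually_elim
          fix x assume "b x = b' x"
          then have "\<bar>b x\<bar> \<le> B + 1" using b'B[of x] by simp
          then show "\<bar>\<phi> x * b x\<bar> \<le> F * (B + 1)" using F B by (auto simp: abs_mult intro!: mult_mono)
        qed
      qed measurable
      have iA: "integrable M (\<lambda>x. indicator (A L k) x * ?n k x)"
        by (rule Bochner_Integration.integrable_bound[OF du2], measurable) (auto simp: indicator_def)
      let ?bound = "\<lambda>k x. F * a2 * (2 * B + 1) * (indicator (A L k) x * ?n k x) + t * (indicator K x * \<bar>p j x - b' x\<bar>)"
      have "\<bar>(LINT x|M. ?P j k x) - (LINT x|M. ?Q k x)\<bar> = \<bar>LINT x|M. ?P j k x - ?Q k x\<bar>"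
        using i1 i2 by simp
      also have "\<dots> \<le> (LINT x|M. \<bar>?P j k x - ?Q k x\<bar>)"
        by (rule integral_abs_bound)
      also have "\<dots> \<le> (LINT x|M. ?bound k x)"
      proof (rule integral_mono_AE)
        show "AE x in M. \<bar>?P j k x - ?Q k x\<bar> \<le> ?bound k x"
          using bb'
        proof eventually_elim
          fix x assume bx: "b x = b' x"
          define n where "n = ?n k x"
          define c where "c = \<bar>p j x - b' x\<bar>"
          have n: "0 \<le> n" and c: "0 \<le> c" by (auto simp: n_def c_def)
          have "\<phi> x * p j x * (a k x * n) - \<phi> x * b x * (a k x * n) = \<phi> x * (p j x - b' x) * (a k x * n)"
            by (simp add: bx algebra_simps)
          then have eq: "\<bar>\<phi> x * p j x * (a k x * n) - \<phi> x * b x * (a k x * n)\<bar> = \<bar>\<phi> x\<bar> * c * (a k x * n)"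
            using a_bounds(1)[of k x] a1_pos n by (simp add: abs_mult c_def)
          have le: "\<bar>\<phi> x\<bar> * c * (a k x * n) \<le> F * c * (a2 * n)"
            using a_bounds[of k x] a1_pos a2_pos F c n by (intro mult_mono) auto
          show "\<bar>?P j k x - ?Q k x\<bar> \<le> ?bound k x"
            unfolding n_def[symmetric] c_def[symmetric] eq
          proof (cases "x \<in> K")
            case False
            then show "\<bar>\<phi> x\<bar> * c * (a k x * n) \<le> F * a2 * (2 * B + 1) * (indicator (A L k) x * n) + t * (indicator K x * c)"
              using K(3) by (simp add: A_def)
          next
            case True
            then have xO: "x \<in> \<Omega>" using K(2) by auto
            show "\<bar>\<phi> x\<bar> * c * (a k x * n) \<le> F * a2 * (2 * B + 1) * (indicator (A L k) x * n) + t * (indicator K x * c)"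
            proof (cases "L < n")
              case LT: True
              have "c \<le> 2 * B + 1" using p(2)[OF True, of j] b'B[of x] by (auto simp: c_def)
              then have "F * c * (a2 * n) \<le> F * (2 * B + 1) * (a2 * n)"
                using F n a2_pos by (intro mult_right_mono mult_left_mono) auto
              moreover have "0 \<le> t * c" using t c by simp
              moreover have "x \<in> A L k" using True LT xO by (simp add: A_def n_def)
              ultimately show ?thesis using le True by (simp add: mult_ac)
            next
              case LT: False
              then have "n \<le> \<bar>L\<bar>" by simp
              then have "F * c * (a2 * n) \<le> F * c * (a2 * \<bar>L\<bar>)"
                using F c a2_pos by (intro mult_left_mono) auto
              moreover have "x \<notin> A L k" using LT xO by (simp add: A_def n_def)
              ultimately show ?thesis using le True by (simp add: t_def mult_ac)
            qed
          qed
        qed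
      qed (use i1 i2 iA iK in auto)
      also have "\<dots> = F * a2 * (2 * B + 1) * (LINT x|M. indicator (A L k) x * ?n k x) + t * (LINT x|M. indicator K x * \<bar>p j x - b' x\<bar>)"
        using iA iK by simp
      also have "\<dots> \<le> F * a2 * (2 * B + 1) * e1 + e / 2"
        using L tj Fa B by (intro add_mono mult_left_mono) auto
      also have "\<dots> \<le> e" using e1(2) by (simp add: mult.assoc)
      finally show ?thesis .
    qed
    have "(\<lambda>k. LINT x|M. ?P j k x) \<longlonglongrightarrow> (LINT x|M. \<phi> x * p j x * \<rho> x)"
      using div_curl[OF g w w \<phi>p] by (simp add: \<rho>_def power2_norm_eq_inner)
    moreover have "\<bar>(LINT x|M. \<phi> x * p j x * \<rho> x) - (LINT x|M. \<phi> x * b x * ((Astar x *v wgrad \<Omega> w x) \<bullet> wgrad \<Omega> w x))\<bar> \<le> e"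
      using j(2) by (simp add: \<rho>_def)
    ultimately show "\<exists>Z z. Z \<longlonglongrightarrow> z \<and> \<bar>z - (LINT x|M. \<phi> x * b x * ((Astar x *v wgrad \<Omega> w x) \<bullet> wgrad \<Omega> w x))\<bar> \<le> e
      \<and> (\<forall>k. \<bar>Z k - (LINT x|M. \<phi> x * b x * (a k x * (norm (?du k x))\<^sup>2))\<bar> \<le> e)"
      using close by (intro exI conjI) auto
  qed
qed

end

section \<open>The trace inequality\<close>

lemma trace_eq_sum_inner:
  fixes X :: "real^'n::finite^'n"
  shows "trace X = (\<Sum>i\<in>UNIV. (X *v axis i 1) \<bullet> axis i 1)"
  by (simp add: trace_def inner_axis matrix_vector_mult_basis column_def)

text \<open>If the matrix to be inverted is singular, \<open>matrix_inv\<close> is a junk value, but then the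
  quadratic inequality forces \<open>A = a *\<^sub>R mat 1\<close> and the left-hand side vanishes.\<close>

lemma trace_bound:
  fixes A B :: "real^'n::finite^'n"
  assumes b: "0 < b"
    and sym: "\<And>\<xi> \<eta>. (A *v \<xi>) \<bullet> \<eta> = (A *v \<eta>) \<bullet> \<xi>"
    and quad: "\<And>\<xi> \<eta>. 0 \<le> b * ((A *v \<xi>) \<bullet> \<xi>) - a * ((B *v \<xi>) \<bullet> \<xi>) - 2 * b * ((A *v \<xi> - a *\<^sub>R \<xi>) \<bullet> \<eta>) + b * c * (\<eta> \<bullet> \<eta>)"
    and sing: "\<And>\<xi>. \<xi> \<noteq> 0 \<Longrightarrow> A *v \<xi> = a *\<^sub>R \<xi> \<Longrightarrow> c = 0"
  shows "trace (b *\<^sub>R ((A - a *\<^sub>R mat 1) ** matrix_inv (b *\<^sub>R A - a *\<^sub>R B) ** (A - a *\<^sub>R mat 1))) \<le> real CARD('n) * c"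
proof -
  define P where "P = A - a *\<^sub>R mat 1"
  define M where "M = b *\<^sub>R A - a *\<^sub>R B"
  have P: "P *v \<xi> = A *v \<xi> - a *\<^sub>R \<xi>" for \<xi>
    by (simp add: P_def matrix_vector_mult_diff_rdistrib scaleR_mat_1_mult_vec)
  have quad': "0 \<le> (M *v \<xi>) \<bullet> \<xi> - 2 * b * ((P *v \<xi>) \<bullet> \<eta>) + b * c * (\<eta> \<bullet> \<eta>)" for \<xi> \<eta>
    using quad[of \<xi> \<eta>] by (simp add: P M_def matrix_vector_mult_diff_rdistrib scaleR_matrix_vector_assoc[symmetric] inner_diff_left)
  have Psym: "(P *v \<xi>) \<bullet> \<eta> = (P *v \<eta>) \<bullet> \<xi>" for \<xi> \<eta>
    using sym[of \<xi> \<eta>] inner_commute[of \<xi> \<eta>] by (simp add: P inner_diff_left)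
  show ?thesis
  proof (cases "invertible M")
    case True
    then have MI: "M ** matrix_inv M = mat 1"
      unfolding invertible_def matrix_inv_def by (rule someI2_ex) simp
    have "((b *\<^sub>R (P ** matrix_inv M ** P)) *v axis i 1) \<bullet> axis i 1 \<le> c" for i
    proof -
      define \<eta> :: "real^'n" where "\<eta> = axis i 1"
      \<comment> \<open>For symmetric \<open>M\<close> the minimiser in \<open>\<xi>\<close> would
        be \<open>b *\<^sub>R \<zeta>\<close>. Symmetry of \<open>M\<close> is not known, but
        inserting this vector uses only \<open>M *v \<zeta> = P *v \<eta>\<close> and the symmetry
        of \<open>P\<close>.\<close>
      define \<zeta> where "\<zeta> = matrix_inv M *v (P *v \<eta>)"
      have "M *v \<zeta> = P *v \<eta>" unfolding \<zeta>_def by (metis MI matrix_vector_mul_assoc matrix_vector_mul_lid)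
      then have "0 \<le> b * (b * ((P *v \<eta>) \<bullet> \<zeta>)) - 2 * b * (b * ((P *v \<eta>) \<bullet> \<zeta>)) + b * c * (\<eta> \<bullet> \<eta>)"
        using quad'[of "b *\<^sub>R \<zeta>" \<eta>] Psym[of \<zeta> \<eta>] by (simp add: matrix_vector_mult_scaleR)
      then have "b * (b * ((P *v \<eta>) \<bullet> \<zeta>)) \<le> b * c"
        by (simp add: \<eta>_def inner_axis_axis)
      then have "b * ((P *v \<eta>) \<bullet> \<zeta>) \<le> c" using b by simp
      moreover have "(b *\<^sub>R (P ** matrix_inv M ** P)) *v \<eta> = b *\<^sub>R (P *v \<zeta>)"
        by (simp add: scaleR_matrix_vector_assoc[symmetric] \<zeta>_def matrix_vector_mul_assoc matrix_mul_assoc)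
      ultimately show ?thesis using Psym[of \<zeta> \<eta>] by (simp add: \<eta>_def)
    qed
    then have "trace (b *\<^sub>R (P ** matrix_inv M ** P)) \<le> real CARD('n) * c"
      unfolding trace_eq_sum_inner by (rule sum_bounded_above)
    then show ?thesis by (simp add: P_def M_def)
  next
    case False
    then obtain \<xi> where \<xi>: "\<xi> \<noteq> 0" "M *v \<xi> = 0"
      unfolding invertible_left_inverse matrix_left_invertible_ker by blast
    \<comment> \<open>Along the kernel vector, at \<open>t *\<^sub>R \<xi>\<close>, the quadratic
      inequality is affine in \<open>t\<close>, so its slope vanishes.\<close>
    have "(- (b * ((P *v \<xi>) \<bullet> (P *v \<xi>))))\<^sup>2 \<le> 0 * (b * c * ((P *v \<xi>) \<bullet> (P *v \<xi>)))"
      by (rule quadratic_nonneg_discriminant)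
        (use quad'[of "t *\<^sub>R \<xi>" "P *v \<xi>" for t] \<xi>(2) in \<open>simp add: matrix_vector_mult_scaleR algebra_simps\<close>)
    then have "P *v \<xi> = 0" using b by simp
    then have c: "c = 0" using sing[OF \<xi>(1)] by (simp add: P)
    have "P *v \<xi> = 0" for \<xi>
    proof -
      \<comment> \<open>With \<open>c = 0\<close> the inequality is affine in \<open>\<eta>\<close>,
        for every \<open>\<xi>\<close>.\<close>
      have "(- (b * ((P *v \<xi>) \<bullet> (P *v \<xi>))))\<^sup>2 \<le> 0 * ((M *v \<xi>) \<bullet> \<xi>)"
        by (rule quadratic_nonneg_discriminant)
          (use quad'[of \<xi> "t *\<^sub>R (P *v \<xi>)" for t] c in \<open>simp add: algebra_simps\<close>)
      then show ?thesis using b by simp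
    qed
    then have "P = 0" by (simp add: matrix_eq)
    then show ?thesis by (simp add: P_def[symmetric] c trace_def)
  qed
qed

text \<open>Exhaustion of \<open>\<Omega>\<close> by compact sets. \<open>Bsharp\<close> comes
  without measurability; its quadratic expressions acquire it through
  \<open>in_distributions\<close>.\<close>

lemma locally_integrable_measurable:
  assumes f: "locally_integrable \<Omega> f" and \<Omega>: "open \<Omega>"
  shows "f \<in> borel_measurable (lebesgue_on \<Omega>)"
proof (rule measurableI)
  obtain C where C: "\<And>n::nat. compact (C n)" "\<And>n. C n \<subseteq> \<Omega>" "\<Union>(range C) = \<Omega>"
    using open_Union_compact_subsets[OF \<Omega>] by metis
  have Cl: "C n \<in> sets lebesgue" for n using C(1)[of n] by (simp add: borel_compact)
  fix S :: "real set" assume S: "S \<in> sets borel"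
  have "f -` S \<inter> C n \<in> sets lebesgue" for n
  proof -
    have "f \<in> borel_measurable (lebesgue_on (C n))"
      using f C(1,2) by (auto simp: locally_integrable_def intro: borel_measurable_integrable)
    from measurable_sets[OF this S] show ?thesis by (simp add: sets_restrict_space_iff Cl space_restrict_space)
  qed
  moreover have "f -` S \<inter> \<Omega> = (\<Union>n. f -` S \<inter> C n)" using C(3) by auto
  ultimately have "f -` S \<inter> \<Omega> \<in> sets lebesgue" by (simp only:) blast
  then show "f -` S \<inter> space (lebesgue_on \<Omega>) \<in> sets (lebesgue_on \<Omega>)"
    using \<Omega> by (simp add: sets_restrict_space_iff space_restrict_space)
qed simp

lemma locally_integrable_test_function:
  assumes f: "locally_integrable \<Omega> f" and \<Omega>: "open \<Omega>" and \<phi>: "\<phi> \<in> test_functions \<Omega>"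
  shows "integrable (lebesgue_on \<Omega>) (\<lambda>x. f x * \<phi> x)"
proof -
  obtain K where K: "smooth \<phi>" "compact K" "K \<subseteq> \<Omega>" "\<forall>x. x \<notin> K \<longrightarrow> \<phi> x = 0"
    using \<phi> by (rule test_functionE)
  obtain F where F: "\<And>x. \<bar>\<phi> x\<bar> \<le> F" using test_function_bounded[OF \<phi>] by auto
  have sets: "K \<in> sets lebesgue" "\<Omega> \<in> sets lebesgue" using K(2) \<Omega> by (auto simp: borel_compact)
  have "integrable (lebesgue_on K) f" using f K by (auto simp: locally_integrable_def)
  then have "integrable lebesgue (\<lambda>x. indicator K x *\<^sub>R f x)"
    using sets by (subst (asm) integrable_restrict_space) auto
  from integrable_mult_indicator[OF sets(2) this] have i: "integrable (lebesgue_on \<Omega>) (\<lambda>x. indicator K x * f x)"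
    using sets by (subst integrable_restrict_space) auto
  show ?thesis
  proof (rule Bochner_Integration.integrable_bound[OF integrable_mult_right[OF i, of F]])
    show "(\<lambda>x. f x * \<phi> x) \<in> borel_measurable (lebesgue_on \<Omega>)"
      using locally_integrable_measurable[OF f \<Omega>] borel_imp_lebesgue_on[OF smooth_borel[OF K(1)]] by measurable
    show "AE x in lebesgue_on \<Omega>. norm (f x * \<phi> x) \<le> norm (F * (indicator K x * f x))"
    proof (rule AE_I2)
      fix x
      have "\<bar>\<phi> x\<bar> * \<bar>f x\<bar> \<le> F * \<bar>f x\<bar>" using F by (intro mult_right_mono) auto
      also have "\<dots> \<le> \<bar>F\<bar> * \<bar>f x\<bar>" by (intro mult_right_mono) auto
      finally show "norm (f x * \<phi> x) \<le> norm (F * (indicator K x * f x))"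
        using K(4) by (cases "x \<in> K") (auto simp: abs_mult mult.commute)
    qed
  qed
qed

section \<open>Pointwise inequalities for the two-phase problem\<close>

locale two_phase = h_convergent \<Omega> a a1 a2 Astar
  for \<Omega> :: "(real^'n::finite) set" and a :: "nat \<Rightarrow> real^'n \<Rightarrow> real" and a1 a2 Astar +
  fixes \<iota> :: "nat \<Rightarrow> real^'n \<Rightarrow> real" and \<theta> b :: "real^'n \<Rightarrow> real" and b1 b2 :: real and Bsharp :: "real^'n \<Rightarrow> real^'n^'n"
  assumes a_eq: "\<And>k x. a k x = a1 * \<iota> k x + a2 * (1 - \<iota> k x)" and \<iota>_cases: "\<And>k x. \<iota> k x = 0 \<or> \<iota> k x = 1"
    and a12: "a1 < a2"
    and \<theta>_bounds: "AE x in M. 0 \<le> \<theta> x \<and> \<theta> x \<le> 1"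
    and \<iota>_limit: "weakly_star_in_Linfty \<Omega> \<iota> \<theta>"
    and b_measurable: "b \<in> borel_measurable M" and b1_pos: "0 < b1" and b_bounds: "AE x in M. b1 \<le> b x \<and> b x \<le> b2"
    and B_limit: "relatively_converges \<Omega> (\<lambda>k x. a k x *\<^sub>R mat 1) (\<lambda>k x. b x *\<^sub>R mat 1) Bsharp"
begin

lemma \<iota>_measurable [measurable]: "\<iota> k \<in> borel_measurable M" "\<theta> \<in> borel_measurable M"
  using \<iota>_limit by (auto simp: weakly_star_in_Linfty_def Linfty_def)

lemma \<iota>_abs: "\<bar>\<iota> k x\<bar> \<le> 1"
  using \<iota>_cases[of k x] by auto

lemma \<theta>_abs: "AE x in M. \<bar>\<theta> x\<bar> \<le> 1"
  using \<theta>_bounds by eventually_elim auto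

lemma affine_limit:
  assumes h: "integrable M h"
  shows "(\<lambda>k. LINT x|M. (p * \<iota> k x + q * (1 - \<iota> k x)) * h x) \<longlonglongrightarrow> (LINT x|M. (p * \<theta> x + q * (1 - \<theta> x)) * h x)"
proof -
  have i: "integrable M (\<lambda>x. \<iota> k x * h x)" for k
    by (rule bounded_mult_integrable[OF h _ AE_I2[OF \<iota>_abs]]) simp
  have j: "integrable M (\<lambda>x. \<theta> x * h x)"
    by (rule bounded_mult_integrable[OF h _ \<theta>_abs]) simp
  have e: "(p * t + q * (1 - t)) * y = (p - q) * (t * y) + q * y" for t y :: real by (simp add: algebra_simps)
  have "(\<lambda>k. (p - q) * (LINT x|M. \<iota> k x * h x) + q * (LINT x|M. h x))
      \<longlonglongrightarrow> (p - q) * (LINT x|M. \<theta> x * h x) + q * (LINT x|M. h x)"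
    using \<iota>_limit h unfolding weakly_star_in_Linfty_def by (intro tendsto_intros) auto
  then show ?thesis unfolding e using i j h by simp
qed

text \<open>Limit of the nonnegative expression
  \<open>\<bar>a k x *\<^sub>R \<xi> - \<tau>\<bar>\<^sup>2 / a k x\<close>. Its constant term
  passes to the limit because \<open>\<iota>\<close> takes only the values 0 and 1, so that
  \<open>1 / a k\<close> is affine in \<open>\<iota>\<close>. This harmonic mean bound serves the
  degenerate case of the trace inequality.\<close>

lemma compliance_bound:
  assumes w: "w \<in> H10 \<Omega>"
  shows "AE x in M. 0 \<le> (Astar x *v wgrad \<Omega> w x) \<bullet> wgrad \<Omega> w x - 2 * (wgrad \<Omega> w x \<bullet> \<tau>)
    + (\<theta> x / a1 + (1 - \<theta> x) / a2) * (\<tau> \<bullet> \<tau>)"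
proof -
  define q where "q t = 1 / a1 * t + 1 / a2 * (1 - t)" for t
  have q_abs: "\<bar>q t * (\<tau> \<bullet> \<tau>)\<bar> \<le> (1 / a1 + 1 / a2) * (\<tau> \<bullet> \<tau>)" if "0 \<le> t \<and> t \<le> 1" for t
  proof -
    have "0 \<le> t / a1" "0 \<le> (1 - t) / a2" "t / a1 \<le> 1 / a1" "(1 - t) / a2 \<le> 1 / a2"
      using a1_pos a2_pos that by (auto intro: divide_right_mono)
    then show ?thesis by (simp add: q_def abs_mult mult_right_mono)
  qed
  have [measurable]: "q \<in> borel_measurable borel" unfolding q_def[abs_def] by measurable
  have "AE x in M. 0 \<le> (Astar x *v wgrad \<Omega> w x) \<bullet> wgrad \<Omega> w x - 2 * ((Astar x *v wgrad \<Omega> w x) \<bullet> 0)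
    - 2 * (wgrad \<Omega> w x \<bullet> \<tau>) + q (\<theta> x) * (\<tau> \<bullet> \<tau>)"
  proof (rule quadratic_limit_nonneg[OF w])
    show "\<bar>q (\<iota> k x) * (\<tau> \<bullet> \<tau>)\<bar> \<le> (1 / a1 + 1 / a2) * (\<tau> \<bullet> \<tau>)" for k x
      using \<iota>_cases[of k x] by (intro q_abs) auto
    show "AE x in M. \<bar>q (\<theta> x) * (\<tau> \<bullet> \<tau>)\<bar> \<le> (1 / a1 + 1 / a2) * (\<tau> \<bullet> \<tau>)"
      using \<theta>_bounds by eventually_elim (rule q_abs)
    show "(\<lambda>k. LINT x|M. q (\<iota> k x) * (\<tau> \<bullet> \<tau>) * h x) \<longlonglongrightarrow> (LINT x|M. q (\<theta> x) * (\<tau> \<bullet> \<tau>) * h x)"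
      if "integrable M h" for h
      using affine_limit[OF integrable_mult_right[OF that, of "\<tau> \<bullet> \<tau>"], of "1 / a1" "1 / a2"] by (simp add: q_def mult.assoc)
    fix k x \<xi>
    have ap: "0 < a k x" using a_bounds(1)[of k x] a1_pos by linarith
    have "0 \<le> 1 / a k x * ((a k x *\<^sub>R \<xi> - \<tau>) \<bullet> (a k x *\<^sub>R \<xi> - \<tau>))" using ap by simp
    also have "\<dots> = a k x * (\<xi> \<bullet> \<xi>) - 2 * (\<xi> \<bullet> \<tau>) + 1 / a k x * (\<tau> \<bullet> \<tau>)"
      using ap by (simp add: inner_diff inner_commute field_simps)
    also have "1 / a k x = q (\<iota> k x)" using \<iota>_cases[of k x] by (auto simp: a_eq q_def)
    finally show "0 \<le> a k x * (\<xi> \<bullet> \<xi>) - 2 * (a k x * (\<xi> \<bullet> 0)) - 2 * (\<xi> \<bullet> \<tau>) + q (\<iota> k x) * (\<tau> \<bullet> \<tau>)" by simp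
  qed measurable
  then show ?thesis by eventually_elim (simp add: q_def)
qed

text \<open>The limit of \<open>\<integral> \<phi> * b * (a k - a1) * (norm (wgrad u\<^sub>k - \<eta>))\<^sup>2 \<ge> 0\<close>.\<close>

lemma relative_bound:
  assumes w: "w \<in> H10 \<Omega>" and s: "AE x in M. norm (Astar x *v wgrad \<Omega> w x) \<le> s" "0 \<le> s"
  shows "AE x in M. 0 \<le> b x * ((Astar x *v wgrad \<Omega> w x) \<bullet> wgrad \<Omega> w x) - a1 * ((Bsharp x *v wgrad \<Omega> w x) \<bullet> wgrad \<Omega> w x)
    - 2 * b x * ((Astar x *v wgrad \<Omega> w x - a1 *\<^sub>R wgrad \<Omega> w x) \<bullet> \<eta>)
    + b x * ((1 - \<theta> x) * (a2 - a1)) * (\<eta> \<bullet> \<eta>)"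
proof -
  obtain g where g: "g \<in> H10 \<Omega>" "weakly_H10 (\<lambda>k. T k g) w" by (rule exists_corrector[OF w])
  let ?s = "\<lambda>x. Astar x *v wgrad \<Omega> w x" and ?dw = "wgrad \<Omega> w" and ?du = "\<lambda>k. wgrad \<Omega> (T k g)"
    and ?\<beta> = "\<lambda>x. (Bsharp x *v wgrad \<Omega> w x) \<bullet> wgrad \<Omega> w x"
  note flux = T_flux_id[OF g] and du = H10_sq_int(2)[OF T(1)[OF g(1)]] and dw = H10_sq_int(2)[OF w]
  have [measurable]: "b \<in> borel_measurable M" "a k \<in> borel_measurable M" for k by (rule b_measurable a_measurable)+
  have [measurable]: "?s \<in> borel_measurable M" "?dw \<in> borel_measurable M" by (rule sq_int_measurable flux dw)+
  have babs: "AE x in M. \<bar>b x\<bar> \<le> b2" using b_bounds b1_pos by (elim eventually_mono) auto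
  \<comment> \<open>Here \<open>r = id\<close>: the corrector converges along the full sequence and
    is a test sequence for the given coefficients.\<close>
  have rel: "in_distributions \<Omega> (\<lambda>k x. b x * (?du k x \<bullet> ?du k x)) ?\<beta>"
    using B_limit T_test_sequence[of g id w] g
    unfolding relatively_converges_def by (simp add: comp_def scaleR_mat_1_mult_vec)
  then have \<beta>l: "locally_integrable \<Omega> ?\<beta>" by (simp add: in_distributions_def)
  note \<beta>i = locally_integrable_test_function[OF \<beta>l open_domain]
  have [measurable]: "?\<beta> \<in> borel_measurable M" by (rule locally_integrable_measurable[OF \<beta>l open_domain])
  let ?h = "\<lambda>x. b x * (?s x \<bullet> ?dw x) - a1 * ?\<beta> x - 2 * b x * ((?s x - a1 *\<^sub>R ?dw x) \<bullet> \<eta>)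
    + b x * ((1 - \<theta> x) * (a2 - a1)) * (\<eta> \<bullet> \<eta>)"
  show ?thesis
  proof (rule fundamental_lemma_nonneg[OF open_domain])
    show "?h \<in> borel_measurable M" by measurable
  next
    fix \<phi> assume \<phi>: "\<phi> \<in> test_functions \<Omega>"
    have [measurable]: "\<phi> \<in> borel_measurable M" by (rule test_function_measurable[OF \<phi>])
    obtain F where F: "\<And>x. \<bar>\<phi> x\<bar> \<le> F" using test_function_bounded[OF \<phi>] by auto
    have \<phi>b: "AE x in M. \<bar>\<phi> x * b x\<bar> \<le> F * b2"
      using babs
    proof eventually_elim
      fix x assume "\<bar>b x\<bar> \<le> b2"
      with F[of x] show "\<bar>\<phi> x * b x\<bar> \<le> F * b2" unfolding abs_mult by (intro mult_mono) auto
    qed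
    have t\<phi>: "(\<lambda>x. (\<phi> x * b x) *\<^sub>R \<eta>) \<in> sq_int M"
      by (rule sq_int_bounded_scaleR[OF sq_int_const _ \<phi>b]) measurable
    have h: "integrable M (\<lambda>x. \<phi> x * b x * (\<eta> \<bullet> \<eta>))"
      using sq_int_inner_integrable[OF t\<phi> sq_int_const[of \<eta>]] by simp
    \<comment> \<open>The expanded integrand, with slots for the energy, the relative energy, the
      flux, the gradient and the coefficient of \<open>\<eta> \<bullet> \<eta>\<close>; it is shared
      by the sequence and the limit.\<close>
    let ?j = "\<lambda>e \<beta> s d c x. e x - a1 * (\<beta> x * \<phi> x) - 2 * (s x \<bullet> ((\<phi> x * b x) *\<^sub>R \<eta>))
        + 2 * a1 * (((\<phi> x * b x) *\<^sub>R \<eta>) \<bullet> d x) + c x * (\<phi> x * b x * (\<eta> \<bullet> \<eta>))"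
    have ji: "integrable M (?j e \<beta> s d c)"
      and je: "(LINT x|M. ?j e \<beta> s d c x) = (LINT x|M. e x) - a1 * (LINT x|M. \<beta> x * \<phi> x) - 2 * (LINT x|M. s x \<bullet> ((\<phi> x * b x) *\<^sub>R \<eta>))
        + 2 * a1 * (LINT x|M. ((\<phi> x * b x) *\<^sub>R \<eta>) \<bullet> d x) + (LINT x|M. c x * (\<phi> x * b x * (\<eta> \<bullet> \<eta>)))"
      if "integrable M e" "integrable M (\<lambda>x. \<beta> x * \<phi> x)" "s \<in> sq_int M" "d \<in> sq_int M"
        "c \<in> borel_measurable M" "AE x in M. \<bar>c x\<bar> \<le> a2" for e \<beta> s d c
    proof -
      note i = that(1,2) sq_int_inner_integrable[OF that(3) t\<phi>] sq_int_inner_integrable[OF t\<phi> that(4)]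
        bounded_mult_integrable[OF h that(5,6)]
      then show "integrable M (?j e \<beta> s d c)"
        by (intro Bochner_Integration.integrable_add Bochner_Integration.integrable_diff integrable_mult_right)
      show "(LINT x|M. ?j e \<beta> s d c x) = (LINT x|M. e x) - a1 * (LINT x|M. \<beta> x * \<phi> x) - 2 * (LINT x|M. s x \<bullet> ((\<phi> x * b x) *\<^sub>R \<eta>))
        + 2 * a1 * (LINT x|M. ((\<phi> x * b x) *\<^sub>R \<eta>) \<bullet> d x) + (LINT x|M. c x * (\<phi> x * b x * (\<eta> \<bullet> \<eta>)))"
        using i by (simp only: Bochner_Integration.integral_add Bochner_Integration.integral_diff integrable_mult_right
            Bochner_Integration.integrable_diff Bochner_Integration.integrable_add integral_mult_right_zero)
    qed
    \<comment> \<open>\<open>a k - a1\<close> in the shape required by \<open>affine_limit\<close>;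
      the factor 0 is its value in the first phase.\<close>
    let ?c = "\<lambda>k x. 0 * \<iota> k x + (a2 - a1) * (1 - \<iota> k x)" and ?\<gamma> = "\<lambda>x. 0 * \<theta> x + (a2 - a1) * (1 - \<theta> x)"
    have ca: "?c k x = a k x - a1" for k x by (simp add: a_eq algebra_simps)
    have e0: "integrable M (\<lambda>x. \<phi> x * b x * (?s x \<bullet> ?dw x))"
      by (rule bounded_inner_integrable[OF _ \<phi>b flux(1) dw]) measurable
    have c0: "AE x in M. \<bar>?\<gamma> x\<bar> \<le> a2"
      using \<theta>_bounds
    proof eventually_elim
      fix x assume "0 \<le> \<theta> x \<and> \<theta> x \<le> 1"
      then have "0 \<le> (a2 - a1) * (1 - \<theta> x)" "(a2 - a1) * (1 - \<theta> x) \<le> a2 - a1" using a12 by (auto simp: mult_left_le)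
      then show "\<bar>?\<gamma> x\<bar> \<le> a2" using a1_pos by simp
    qed
    have he: "?h x * \<phi> x = ?j (\<lambda>x. \<phi> x * b x * (?s x \<bullet> ?dw x)) ?\<beta> ?s ?dw ?\<gamma> x" for x
      by (simp add: inner_diff_left inner_commute algebra_simps)
    show "integrable M (\<lambda>x. ?h x * \<phi> x)"
      unfolding he by (rule ji[OF e0 \<beta>i[OF \<phi>] flux(1) dw _ c0]) measurable
    assume \<phi>0: "\<And>x. 0 \<le> \<phi> x"
    let ?e = "\<lambda>k x. \<phi> x * b x * (a k x * (norm (?du k x))\<^sup>2)"
    let ?jk = "\<lambda>k. ?j (?e k) (\<lambda>x. b x * (?du k x \<bullet> ?du k x)) (\<lambda>x. a k x *\<^sub>R ?du k x) (?du k) (?c k)"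
    have ek: "integrable M (?e k)" for k
      using bounded_inner_integrable[OF _ \<phi>b flux_sq_int[OF du, of k k] du] by (simp add: power2_norm_eq_inner)
    have \<beta>k: "integrable M (\<lambda>x. b x * (?du k x \<bullet> ?du k x) * \<phi> x)" for k
      using bounded_inner_integrable[OF _ \<phi>b du du, of k k] by (simp add: mult_ac)
    have ck: "AE x in M. \<bar>?c k x\<bar> \<le> a2" for k
      unfolding ca
    proof (rule AE_I2)
      show "\<bar>a k x - a1\<bar> \<le> a2" for x using a_bounds[of k x] a1_pos by linarith
    qed
    have mk: "?c k \<in> borel_measurable M" "?\<gamma> \<in> borel_measurable M" for k by measurable
    have "(\<lambda>k. LINT x|M. ?jk k x) \<longlonglongrightarrow> (LINT x|M. ?h x * \<phi> x)"
      unfolding he je[OF ek \<beta>k flux_sq_int[OF du] du mk(1) ck] je[OF e0 \<beta>i[OF \<phi>] flux(1) dw mk(2) c0]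
      using rel \<phi> unfolding in_distributions_def
      by (intro tendsto_add tendsto_diff tendsto_mult_left energy_limit[OF g s b_measurable babs \<phi>] flux(2)[OF t\<phi>]
          weakly_H10_gradient_functional[OF g(2) t\<phi>] affine_limit[OF h]) auto
    moreover have "0 \<le> (LINT x|M. ?jk k x)" for k
    proof (rule integral_nonneg_AE)
      show "AE x in M. 0 \<le> ?jk k x"
        using b_bounds
      proof eventually_elim
        fix x assume "b1 \<le> b x \<and> b x \<le> b2"
        then have "0 \<le> \<phi> x * b x * (a k x - a1) * ((?du k x - \<eta>) \<bullet> (?du k x - \<eta>))"
          using b1_pos \<phi>0[of x] a_bounds(1)[of k x] by (intro mult_nonneg_nonneg) auto
        also have "\<dots> = ?jk k x"
          unfolding ca power2_norm_eq_inner by (simp add: inner_diff inner_commute algebra_simps)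
        finally show "0 \<le> ?jk k x" .
      qed
    qed
    ultimately show "0 \<le> (LINT x|M. ?h x * \<phi> x)" by (intro LIMSEQ_le_const) auto
  qed
qed

text \<open>Near a point, cut-off affine functions turn relations between gradients into relations
  between constant vectors. Each holds almost everywhere for fixed vectors; collecting the two
  vectors in a pair \<open>p\<close> allows one exchange of quantifiers for both.\<close>

lemma pointwise_relations:
  "AE x in M. (\<forall>p. (Astar x *v fst p) \<bullet> snd p = (Astar x *v snd p) \<bullet> fst p)
    \<and> (\<forall>p. 0 \<le> (Astar x *v fst p) \<bullet> fst p - 2 * (fst p \<bullet> snd p) + (\<theta> x / a1 + (1 - \<theta> x) / a2) * (snd p \<bullet> snd p))
    \<and> (\<forall>p. 0 \<le> b x * ((Astar x *v fst p) \<bullet> fst p) - a1 * ((Bsharp x *v fst p) \<bullet> fst p)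
        - 2 * b x * ((Astar x *v fst p - a1 *\<^sub>R fst p) \<bullet> snd p) + b x * ((1 - \<theta> x) * (a2 - a1)) * (snd p \<bullet> snd p))"
  (is "AE x in M. (\<forall>p. ?S x p) \<and> (\<forall>p. 0 \<le> ?C x p) \<and> (\<forall>p. 0 \<le> ?R x p)")
proof (rule AE_lebesgue_on_locally[OF domain_sets])
  fix x0 assume "x0 \<in> \<Omega>"
  from local_affine_functions[OF this] obtain r where r: "0 < r" "ball x0 r \<subseteq> \<Omega>"
    "\<forall>\<xi>. \<exists>w\<in>test_functions \<Omega>. \<forall>x\<in>ball x0 r. grad w x = \<xi>" by auto
  have affine: "\<exists>w s. w \<in> H10 \<Omega> \<and> (AE x in M. x \<in> ball x0 r \<longrightarrow> wgrad \<Omega> w x = \<xi>)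
      \<and> (AE x in M. norm (Astar x *v wgrad \<Omega> w x) \<le> s) \<and> 0 \<le> s" for \<xi>
  proof -
    obtain w where w: "w \<in> test_functions \<Omega>" "\<forall>x\<in>ball x0 r. grad w x = \<xi>" using r(3) by blast
    obtain D where D: "0 \<le> D" "\<And>x. norm (grad w x) \<le> D" using test_function_grad_bounded[OF w(1)] by auto
    have wH: "w \<in> H10 \<Omega>" by (rule test_function_H10[OF w(1) open_domain])
    have "AE x in M. norm (Astar x *v wgrad \<Omega> w x) \<le> a2 * D"
      using flux_bound[OF wH] wgrad_test[OF w(1)]
    proof eventually_elim
      fix x assume "norm (Astar x *v wgrad \<Omega> w x) \<le> a2 * norm (wgrad \<Omega> w x)" "wgrad \<Omega> w x = grad w x"
      then have "norm (Astar x *v wgrad \<Omega> w x) \<le> a2 * norm (grad w x)" by simp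
      also have "\<dots> \<le> a2 * D" using D(2) a2_pos by (intro mult_left_mono) auto
      finally show "norm (Astar x *v wgrad \<Omega> w x) \<le> a2 * D" .
    qed
    moreover have "AE x in M. x \<in> ball x0 r \<longrightarrow> wgrad \<Omega> w x = \<xi>"
      using wgrad_test[OF w(1)] by eventually_elim (use w(2) in auto)
    ultimately show ?thesis using wH D(1) a2_pos by (intro exI[of _ w] exI[of _ "a2 * D"]) auto
  qed
  \<comment> \<open>Symmetry is put in the form of an inequality by a negated absolute value, and
    localised by the indicator of the ball, so that \<open>AE_nonneg_all\<close> applies.\<close>
  have S: "AE x in M. \<forall>p. 0 \<le> indicator (ball x0 r) x * - \<bar>(Astar x *v fst p) \<bullet> snd p - (Astar x *v snd p) \<bullet> fst p\<bar>"
  proof (rule AE_nonneg_all)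
    fix p :: "(real^'n) \<times> (real^'n)"
    obtain w s where w: "w \<in> H10 \<Omega>" "AE x in M. x \<in> ball x0 r \<longrightarrow> wgrad \<Omega> w x = fst p" using affine by blast
    obtain w' s where w': "w' \<in> H10 \<Omega>" "AE x in M. x \<in> ball x0 r \<longrightarrow> wgrad \<Omega> w' x = snd p" using affine by blast
    show "AE x in M. 0 \<le> indicator (ball x0 r) x * - \<bar>(Astar x *v fst p) \<bullet> snd p - (Astar x *v snd p) \<bullet> fst p\<bar>"
      using w(2) w'(2) flux_symmetric[OF w(1) w'(1)] by eventually_elim (auto simp: indicator_def)
  qed (intro continuous_intros)
  have C: "AE x in M. \<forall>p. 0 \<le> indicator (ball x0 r) x * ?C x p"
  proof (rule AE_nonneg_all)
    fix p :: "(real^'n) \<times> (real^'n)"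
    obtain w where w: "w \<in> H10 \<Omega>" "AE x in M. x \<in> ball x0 r \<longrightarrow> wgrad \<Omega> w x = fst p" using affine by blast
    show "AE x in M. 0 \<le> indicator (ball x0 r) x * ?C x p"
      using w(2) compliance_bound[OF w(1), of "snd p"] by eventually_elim (auto simp: indicator_def)
  qed (intro continuous_intros)
  have R: "AE x in M. \<forall>p. 0 \<le> indicator (ball x0 r) x * ?R x p"
  proof (rule AE_nonneg_all)
    fix p :: "(real^'n) \<times> (real^'n)"
    obtain w s where w: "w \<in> H10 \<Omega>" "AE x in M. x \<in> ball x0 r \<longrightarrow> wgrad \<Omega> w x = fst p"
      "AE x in M. norm (Astar x *v wgrad \<Omega> w x) \<le> s" "0 \<le> s" using affine by blast
    show "AE x in M. 0 \<le> indicator (ball x0 r) x * ?R x p"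
      using w(2) relative_bound[OF w(1,3,4), of "snd p"] by eventually_elim (auto simp: indicator_def)
  qed (intro continuous_intros)
  have "AE x in M. x \<in> ball x0 r \<longrightarrow> (\<forall>p. ?S x p) \<and> (\<forall>p. 0 \<le> ?C x p) \<and> (\<forall>p. 0 \<le> ?R x p)"
    using S C R
  proof (eventually_elim, intro impI conjI allI)
    fix x p assume x: "x \<in> ball x0 r"
    assume "\<forall>p. 0 \<le> indicator (ball x0 r) x * - \<bar>(Astar x *v fst p) \<bullet> snd p - (Astar x *v snd p) \<bullet> fst p\<bar>"
    from this[rule_format, of p] x show "?S x p" by simp
  next
    fix x p assume x: "x \<in> ball x0 r"
    assume "\<forall>p. 0 \<le> indicator (ball x0 r) x * ?C x p"
    from this[rule_format, of p] x show "0 \<le> ?C x p" by simp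
  next
    fix x p assume x: "x \<in> ball x0 r"
    assume "\<forall>p. 0 \<le> indicator (ball x0 r) x * ?R x p"
    from this[rule_format, of p] x show "0 \<le> ?R x p" by simp
  qed
  then show "\<exists>U. open U \<and> x0 \<in> U \<and> (AE x in M. x \<in> U \<longrightarrow> (\<forall>p. ?S x p) \<and> (\<forall>p. 0 \<le> ?C x p) \<and> (\<forall>p. 0 \<le> ?R x p))"
    using r(1) by (intro exI[of _ "ball x0 r"]) auto
qed

theorem trace_inequality:
  "AE x in M. trace (b x *\<^sub>R ((Astar x - a1 *\<^sub>R mat 1) ** matrix_inv (b x *\<^sub>R Astar x - a1 *\<^sub>R Bsharp x) **
      (Astar x - a1 *\<^sub>R mat 1))) \<le> real CARD('n) * ((1 - \<theta> x) * (a2 - a1))"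
  using pointwise_relations \<theta>_bounds b_bounds
proof eventually_elim
  fix x
  assume rel: "(\<forall>p. (Astar x *v fst p) \<bullet> snd p = (Astar x *v snd p) \<bullet> fst p)
    \<and> (\<forall>p. 0 \<le> (Astar x *v fst p) \<bullet> fst p - 2 * (fst p \<bullet> snd p) + (\<theta> x / a1 + (1 - \<theta> x) / a2) * (snd p \<bullet> snd p))
    \<and> (\<forall>p. 0 \<le> b x * ((Astar x *v fst p) \<bullet> fst p) - a1 * ((Bsharp x *v fst p) \<bullet> fst p)
        - 2 * b x * ((Astar x *v fst p - a1 *\<^sub>R fst p) \<bullet> snd p) + b x * ((1 - \<theta> x) * (a2 - a1)) * (snd p \<bullet> snd p))"
    and \<theta>: "0 \<le> \<theta> x \<and> \<theta> x \<le> 1" and b: "b1 \<le> b x \<and> b x \<le> b2"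
  show "trace (b x *\<^sub>R ((Astar x - a1 *\<^sub>R mat 1) ** matrix_inv (b x *\<^sub>R Astar x - a1 *\<^sub>R Bsharp x) **
      (Astar x - a1 *\<^sub>R mat 1))) \<le> real CARD('n) * ((1 - \<theta> x) * (a2 - a1))"
  proof (rule trace_bound)
    show "0 < b x" using b b1_pos by simp
    show "(Astar x *v \<xi>) \<bullet> \<eta> = (Astar x *v \<eta>) \<bullet> \<xi>" for \<xi> \<eta>
      using rel[THEN conjunct1, rule_format, of "(\<xi>, \<eta>)"] by simp
    show "0 \<le> b x * ((Astar x *v \<xi>) \<bullet> \<xi>) - a1 * ((Bsharp x *v \<xi>) \<bullet> \<xi>) - 2 * b x * ((Astar x *v \<xi> - a1 *\<^sub>R \<xi>) \<bullet> \<eta>)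
        + b x * ((1 - \<theta> x) * (a2 - a1)) * (\<eta> \<bullet> \<eta>)" for \<xi> \<eta>
      using rel[THEN conjunct2, THEN conjunct2, rule_format, of "(\<xi>, \<eta>)"] by simp
    fix \<xi> :: "real^'n" assume \<xi>: "\<xi> \<noteq> 0" "Astar x *v \<xi> = a1 *\<^sub>R \<xi>"
    \<comment> \<open>The harmonic mean bound at \<open>\<tau> = a1 *\<^sub>R \<xi>\<close>: a
      nonzero vector on which \<open>Astar x\<close> acts as \<open>a1\<close> forces the second
      phase to have density zero.\<close>
    have "0 \<le> a1 * (\<xi> \<bullet> \<xi>) - 2 * a1 * (\<xi> \<bullet> \<xi>) + (\<theta> x / a1 + (1 - \<theta> x) / a2) * (a1 * (a1 * (\<xi> \<bullet> \<xi>)))"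
      using rel[THEN conjunct2, THEN conjunct1, rule_format, of "(\<xi>, a1 *\<^sub>R \<xi>)"] by (simp add: \<xi>(2))
    also have "\<dots> = - (a1 * (\<xi> \<bullet> \<xi>) / a2) * ((1 - \<theta> x) * (a2 - a1))"
      using a1_pos a2_pos by (simp add: field_simps)
    finally have "(a1 * (\<xi> \<bullet> \<xi>) / a2) * ((1 - \<theta> x) * (a2 - a1)) \<le> 0" by simp
    moreover have "0 < a1 * (\<xi> \<bullet> \<xi>) / a2" using \<xi>(1) a1_pos a2_pos by simp
    ultimately have "(1 - \<theta> x) * (a2 - a1) \<le> 0" by (meson mult_le_0_iff not_less)
    moreover have "0 \<le> (1 - \<theta> x) * (a2 - a1)" using \<theta> a12 by simp
    ultimately show "(1 - \<theta> x) * (a2 - a1) = 0" by simp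
  qed
qed

end

theorem mainTheorem3:
  fixes \<Omega> :: "(real^'n::finite) set"
    and a1 a2 b1 b2 :: real
    and \<omega> :: "nat \<Rightarrow> (real^'n) set"
    and \<theta> b :: "real^'n \<Rightarrow> real"
    and A B :: "nat \<Rightarrow> real^'n \<Rightarrow> real^'n^'n"
    and Astar Bsharp :: "real^'n \<Rightarrow> real^'n^'n"
  assumes "open \<Omega>" and "bounded \<Omega>"
    and "0 < a1" and "a1 < a2"
    and "0 < b1" and "b1 \<le> b2"
    and "\<And>k. \<omega> k \<in> sets lebesgue" and "\<And>k. \<omega> k \<subseteq> \<Omega>"
    and "AE x in lebesgue_on \<Omega>. 0 \<le> \<theta> x \<and> \<theta> x \<le> 1"
    and "\<And>k x. A k x = (a1 * indicator (\<omega> k) x + a2 * (1 - indicator (\<omega> k) x)) *\<^sub>R mat 1"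
    and "weakly_star_in_Linfty \<Omega> (\<lambda>k. indicator (\<omega> k)) \<theta>"
    and "H_converges \<Omega> A Astar"
    and "b \<in> Linfty \<Omega>"
    and "\<And>k x. B k x = b x *\<^sub>R mat 1"
    and "\<And>k. B k \<in> matrix_class b1 b2 \<Omega>"
    and "relatively_converges \<Omega> A B Bsharp"
  shows "AE x in lebesgue_on \<Omega>.
    trace (b x *\<^sub>R ((Astar x - a1 *\<^sub>R mat 1) ** matrix_inv (b x *\<^sub>R Astar x - a1 *\<^sub>R Bsharp x) **
                  (Astar x - a1 *\<^sub>R mat 1)))
      \<le> real CARD('n) * (1 - \<theta> x) * (a2 - a1)"
proof -
  let ?a = "\<lambda>k x. a1 * indicator (\<omega> k) x + a2 * (1 - indicator (\<omega> k) x) :: real"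
  have A: "A = (\<lambda>k x. ?a k x *\<^sub>R mat 1)" and B: "B = (\<lambda>k x. b x *\<^sub>R mat 1)" by (simp_all add: fun_eq_iff assms)
  interpret two_phase \<Omega> ?a a1 a2 Astar "\<lambda>k. indicator (\<omega> k)" \<theta> b b1 b2 Bsharp
  proof
    show "?a k \<in> borel_measurable (lebesgue_on \<Omega>)" for k
    proof (rule measurable_restrict_space1)
      have [measurable]: "\<omega> k \<in> sets lebesgue" by (rule assms(7))
      show "?a k \<in> borel_measurable lebesgue" by measurable
    qed
    show "a1 \<le> ?a k x" "?a k x \<le> a2" for k x using assms(4) by (auto simp: indicator_def)
    show "AE x in lebesgue_on \<Omega>. b1 \<le> b x \<and> b x \<le> b2"
    proof -
      have "AE x in lebesgue_on \<Omega>. \<forall>\<xi>. b1 * (norm \<xi>)\<^sup>2 \<le> ((b x *\<^sub>R mat 1) *v \<xi>) \<bullet> \<xi>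
          \<and> norm ((b x *\<^sub>R mat 1 :: real^'n^'n) *v \<xi>) \<le> b2 * norm \<xi>"
        using assms(15)[of 0] unfolding B matrix_class_def by (auto elim: eventually_mono)
      then show ?thesis
      proof eventually_elim
        fix x assume x: "\<forall>\<xi>. b1 * (norm \<xi>)\<^sup>2 \<le> ((b x *\<^sub>R mat 1) *v \<xi>) \<bullet> \<xi>
          \<and> norm ((b x *\<^sub>R mat 1 :: real^'n^'n) *v \<xi>) \<le> b2 * norm \<xi>"
        \<comment> \<open>Any unit vector extracts the scalar bounds on \<open>b x\<close> from the
          matrix bounds.\<close>
        obtain i :: 'n where True by simp
        from x[rule_format, of "axis i 1"] show "b1 \<le> b x \<and> b x \<le> b2"
          by (auto simp: scaleR_mat_1_mult_vec inner_axis_axis norm_axis_1)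
      qed
    qed
  qed (use assms A B in \<open>auto simp: Linfty_def indicator_def\<close>)
  show ?thesis using trace_inequality by (simp only: mult.assoc)
qed

end
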